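(* Let $a,b$ be positive integers with $\mu^2(ab)=1$ (so $a,b$ are squarefree and coprime) and $a\equiv b\equiv 1\pmod 4$. Let $$N(B)=\tfrac12\#\{(x,y)\in\mathbb{Z}^2: \gcd(x,y)=1,\ |x|,|y|\le B,\ ax^2+by^2\text{ squareful}\}.$$ Then for any $\epsilon>0$, $$N(B)=cB+O(B^{85/86+\epsilon}),$$ where the implied constant depends only on $a,b,\epsilon$, and $$c=\frac{2\sigma_\infty}{\pi^2}\sum_{\substack{v\ge1\\ v\equiv1\ (\mathrm{mod}\ 4)}}\frac{\mu^2(abv)\gamma(abv)\rho(a,b,v)}{v^{3/2}},\qquad \sigma_\infty=2\left(\frac{\sinh^{-1}(\sqrt{a/b})}{\sqrt a}+\frac{\sinh^{-1}(\sqrt{b/a})}{\sqrt b}\right).$$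
   Context: A nonzero integer $z$ is squareful if $p\mid z$ implies $p^2\mid z$ for every prime $p$. $\mu$ is the Möbius function. For a positive integer $d$, $\gamma(d)=\prod_{p\mid d,\,p>2}(1+1/p)^{-1}$. For positive integers $a,b,v$, $\rho(a,b,v)=\prod_{p\mid a,\,p>2}\bigl(1+\bigl(\tfrac{bv}{p}\bigr)\bigr)\prod_{p\mid b,\,p>2}\bigl(1+\bigl(\tfrac{av}{p}\bigr)\bigr)\prod_{p\mid v,\,p>2}\bigl(1+\bigl(\tfrac{-ab}{p}\bigr)\bigr)$, with Legendre symbols. *)

theory Defs
  imports "HOL-Analysis.Analysis" "HOL-Number_Theory.Number_Theory"
    "HOL-Computational_Algebra.Squarefree"
begin

definition squareful :: "int \<Rightarrow> bool" where
  "squareful z \<longleftrightarrow> z \<noteq> 0 \<and> (\<forall>p. prime p \<longrightarrow> p dvd z \<longrightarrow> p\<^sup>2 dvd z)"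

definition moebius :: "nat \<Rightarrow> int" where
  "moebius n = (if squarefree n then (-1) ^ card (prime_factors n) else 0)"

definition odd_prime_factors :: "nat \<Rightarrow> nat set" where
  "odd_prime_factors n = {p \<in> prime_factors n. p > 2}"

definition gamma_fn :: "nat \<Rightarrow> real" where
  "gamma_fn d = (\<Prod>p\<in>odd_prime_factors d. inverse (1 + 1 / real p))"

definition rho :: "nat \<Rightarrow> nat \<Rightarrow> nat \<Rightarrow> int" where
  "rho a b v =
     (\<Prod>p\<in>odd_prime_factors a. 1 + Legendre (int (b * v)) (int p)) *
     (\<Prod>p\<in>odd_prime_factors b. 1 + Legendre (int (a * v)) (int p)) *
     (\<Prod>p\<in>odd_prime_factors v. 1 + Legendre (- int (a * b)) (int p))"

definition squareful_points :: "nat \<Rightarrow> nat \<Rightarrow> real \<Rightarrow> (int \<times> int) set" where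
  "squareful_points a b B =
     {(x, y). gcd x y = 1 \<and> \<bar>real_of_int x\<bar> \<le> B \<and> \<bar>real_of_int y\<bar> \<le> B \<and>
              squareful (int a * x\<^sup>2 + int b * y\<^sup>2)}"

definition squareful_count :: "nat \<Rightarrow> nat \<Rightarrow> real \<Rightarrow> real" where
  "squareful_count a b B = real (card (squareful_points a b B)) / 2"

definition sigma_infty :: "nat \<Rightarrow> nat \<Rightarrow> real" where
  "sigma_infty a b =
     2 * (arsinh (sqrt (real a / real b)) / sqrt (real a) +
          arsinh (sqrt (real b / real a)) / sqrt (real b))"

definition leading_term :: "nat \<Rightarrow> nat \<Rightarrow> nat \<Rightarrow> real" where
  "leading_term a b v =
     of_int ((moebius (a * b * v))\<^sup>2) * gamma_fn (a * b * v) * of_int (rho a b v) /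
     real v powr (3 / 2)"

definition leading_constant :: "nat \<Rightarrow> nat \<Rightarrow> real" where
  "leading_constant a b =
     2 * sigma_infty a b / pi\<^sup>2 *
     (\<Sum>\<^sub>\<infinity>v\<in>{v. v \<ge> 1 \<and> [v = 1] (mod 4)}. leading_term a b v)"

text \<open>Finiteness of the counted set and convergence of the series show that \<open>card\<close> and
  \<open>infsum\<close> do not take their default value \<open>0\<close> above.\<close>

lemma finite_squareful_points: "finite (squareful_points a b B)"
proof (rule finite_subset)
  show "squareful_points a b B \<subseteq> {-\<lfloor>B\<rfloor>..\<lfloor>B\<rfloor>} \<times> {-\<lfloor>B\<rfloor>..\<lfloor>B\<rfloor>}"
  proof (clarsimp simp: squareful_points_def)
    fix x y :: int
    assume "\<bar>real_of_int x\<bar> \<le> B" "\<bar>real_of_int y\<bar> \<le> B"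
    then have "\<bar>x\<bar> \<le> \<lfloor>B\<rfloor>" "\<bar>y\<bar> \<le> \<lfloor>B\<rfloor>" by (simp_all add: le_floor_iff)
    then show "- \<lfloor>B\<rfloor> \<le> x \<and> x \<le> \<lfloor>B\<rfloor> \<and> - \<lfloor>B\<rfloor> \<le> y \<and> y \<le> \<lfloor>B\<rfloor>" by linarith
  qed
qed auto

lemma finite_odd_prime_factors [simp]: "finite (odd_prime_factors n)"
  by (simp add: odd_prime_factors_def)

lemma abs_prod_Legendre_le:
  "\<bar>\<Prod>p\<in>odd_prime_factors n. 1 + Legendre c (int p)\<bar> \<le> 2 ^ card (odd_prime_factors n)"
proof -
  have "(\<Prod>p\<in>odd_prime_factors n. \<bar>1 + Legendre c (int p)\<bar>) \<le> (\<Prod>p\<in>odd_prime_factors n. 2)"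
    by (rule prod_mono) (auto simp: Legendre_def)
  then show ?thesis by (simp add: abs_prod)
qed

lemma two_pow_odd_prime_factors_le:
  assumes "v > 0"
  shows "(2::real) ^ card (odd_prime_factors v) \<le> 2 ^ 16 * real v powr (1 / 4)"
proof -
  let ?P = "odd_prime_factors v"
  define g where "g p = (if p < (16::nat) then 2 else (1::real))" for p
  have step: "2 \<le> g p * real p powr (1 / 4)" if "p \<in> ?P" for p
  proof (cases "p < 16")
    case True
    have "1 \<le> real p powr (1 / 4)"
      using that by (intro ge_one_powr_ge_zero) (auto simp: odd_prime_factors_def)
    then show ?thesis using True by (simp add: g_def)
  next
    case False
    have "(2::real) = (2 ^ 4) powr (1 / 4)" by (subst powr_realpow [symmetric]) (simp_all add: powr_powr)
    also have "\<dots> \<le> real p powr (1 / 4)" using False by (intro powr_mono2) auto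
    finally show ?thesis using False by (simp add: g_def)
  qed
  have "(2::real) ^ card ?P = (\<Prod>p\<in>?P. 2)" by simp
  also have "\<dots> \<le> (\<Prod>p\<in>?P. g p * real p powr (1 / 4))"
    by (rule prod_mono) (use step in auto)
  also have "\<dots> = (\<Prod>p\<in>?P. g p) * (\<Prod>p\<in>?P. real p powr (1 / 4))"
    by (rule prod.distrib)
  also have "(\<Prod>p\<in>?P. g p) = 2 ^ card {p \<in> ?P. p < 16}"
    unfolding g_def by (subst prod.inter_filter [symmetric]) simp_all
  also have "(\<Prod>p\<in>?P. real p powr (1 / 4)) = real (\<Prod>?P) powr (1 / 4)"
    by (simp add: prod_powr_distrib)
  finally have *: "(2::real) ^ card ?P \<le>
    2 ^ card {p \<in> ?P. p < 16} * real (\<Prod>?P) powr (1 / 4)" .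
  have "card {p \<in> ?P. p < 16} \<le> card {..<16::nat}" by (rule card_mono) auto
  then have c: "(2::real) ^ card {p \<in> ?P. p < 16} \<le> 2 ^ 16"
    by (intro power_increasing) auto
  have "\<Prod>?P dvd \<Prod>(prime_factors v)"
    by (rule prod_dvd_prod_subset) (auto simp: odd_prime_factors_def)
  also have "\<Prod>(prime_factors v) dvd (\<Prod>p\<in>prime_factors v. p ^ multiplicity p v)"
    by (rule prod_dvd_prod) (auto simp: prime_factors_multiplicity)
  also have "\<dots> = v" using assms by (simp add: prime_factorization_nat [symmetric])
  finally have "\<Prod>?P \<le> v" using assms by (rule dvd_imp_le)
  then have "real (\<Prod>?P) powr (1 / 4) \<le> real v powr (1 / 4)"
    by (intro powr_mono2) (simp_all del: of_nat_prod)
  with c have "2 ^ card {p \<in> ?P. p < 16} * real (\<Prod>?P) powr (1 / 4)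
      \<le> 2 ^ 16 * real v powr (1 / 4)"
    by (intro mult_mono) auto
  with * show ?thesis by linarith
qed

lemma leading_term_summable:
  "leading_term a b summable_on {v. v \<ge> 1 \<and> [v = 1] (mod 4)}"
proof -
  define K :: real where
    "K = 2 ^ card (odd_prime_factors a) * 2 ^ card (odd_prime_factors b) * 2 ^ 16"
  have bound: "norm (leading_term a b v) \<le> K * real v powr (- 5 / 4)" for v
  proof (cases "v = 0")
    case False
    have mu: "\<bar>real_of_int ((moebius (a * b * v))\<^sup>2)\<bar> \<le> 1"
      by (auto simp: moebius_def power_mult [symmetric])
    have "0 \<le> gamma_fn (a * b * v)" "gamma_fn (a * b * v) \<le> 1"
      unfolding gamma_fn_def
      by (auto intro!: prod_nonneg prod_le_1 inverse_le_1_iff [THEN iffD2] simp: add_nonneg_nonneg)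
    then have ga: "\<bar>gamma_fn (a * b * v)\<bar> \<le> 1" by simp
    have "\<bar>rho a b v\<bar> \<le> 2 ^ card (odd_prime_factors a) * 2 ^ card (odd_prime_factors b) *
        2 ^ card (odd_prime_factors v)"
      unfolding rho_def abs_mult by (intro mult_mono abs_prod_Legendre_le) auto
    then have "real_of_int \<bar>rho a b v\<bar> \<le> real_of_int (2 ^ card (odd_prime_factors a) *
        2 ^ card (odd_prime_factors b) * 2 ^ card (odd_prime_factors v))"
      by (simp only: of_int_le_iff)
    also have "\<dots> \<le> 2 ^ card (odd_prime_factors a) * 2 ^ card (odd_prime_factors b) *
        (2 ^ 16 * real v powr (1 / 4))"
      unfolding of_int_mult of_int_power of_int_numeral
      using False by (intro mult_left_mono two_pow_odd_prime_factors_le) auto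
    finally have rho: "\<bar>real_of_int (rho a b v)\<bar> \<le> K * real v powr (1 / 4)"
      by (simp add: K_def mult_ac)
    have "\<bar>real_of_int ((moebius (a * b * v))\<^sup>2)\<bar> * \<bar>gamma_fn (a * b * v)\<bar> *
        \<bar>real_of_int (rho a b v)\<bar> \<le> 1 * 1 * (K * real v powr (1 / 4))"
      by (intro mult_mono mu ga rho) auto
    then have "norm (leading_term a b v) \<le> K * real v powr (1 / 4) / real v powr (3 / 2)"
      unfolding leading_term_def real_norm_def abs_divide abs_mult
      by (simp add: divide_right_mono)
    also have "\<dots> = K * real v powr (- 5 / 4)"
      using powr_diff [of "real v" "1 / 4" "3 / 2"] by simp
    finally show ?thesis .
  qed (simp add: leading_term_def)
  have "summable (\<lambda>v. K * real v powr (- 5 / 4))"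
    by (intro summable_mult) (simp add: summable_real_powr_iff)
  then have "summable (\<lambda>v. norm (leading_term a b v))"
    by (rule summable_comparison_test') (use bound in auto)
  then have "leading_term a b summable_on UNIV"
    by (rule norm_summable_imp_summable_on)
  then show ?thesis
    by (rule summable_on_subset_banach) simp
qed

end

theory Submission
  imports Defs
begin

text \<open>
  A squareful value that occurs is odd, hence of the form $u^2 v^3$ with $v$ squarefree and
  $v \equiv 1 \pmod 4$; the points are sorted by $v$ and the sum is cut at $v = B^{1/43}$.

  For small $v$, each root $r$ of $a + b r^2 \equiv 0 \pmod{v^3}$ yields a lattice on which the form
  divided by $v^3$ is integral and, by a pigeonhole argument in the style of Legendre, represents a
  nonzero square. Choosing a basis adapted to such a point, the primitive solutions of
  $f = \mbox{square}$ are parametrised two-to-one by primitive pairs $(s, t)$ up to the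
  common divisor $\gcd(s, 2ab)$. Comparing areas and sieving by the Moebius function counts these pairs
  in the region $\max(|x|, |y|) \le B$; its area produces $\sigma_\infty$ and the number of roots
  produces $\rho$.

  For large $v$, a number $n$ prime to $2ab$ has at most $9 \cdot 2^{\omega(n)}$ primitive
  representations by $a x^2 + b y^2$, which bounds the tail by $B^{1 + \epsilon} \sum v^{-3/2}$.
\<close>

section \<open>Moebius inversion\<close>

text \<open>The obstacle is uniformity in v. For fixed v the count is a lattice point problem with
  error O(sqrt(B) log B), but the lattice depends on v and on the root, so its basis must be bounded
  by a power of v; hence the explicit sizes attached to the represented square and to the completed
  basis. The outcome is an error v^18 B^(17/32) for each v. Summed up to V it gives V^19 B^(17/32),
  the tail costs about B V^(-1/2), and V = B^(1/43) makes the tail B^(85/86), which dominates.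

  The factors of \<open>rho\<close> arise in two ways. For p | v they count roots modulo p, hence
  modulo v^3. For p | ab each factor is 0 or 2: a zero means that there is a local obstruction and
  no point, and otherwise the product is 2^omega(ab), half the number of divisors of 2ab. These
  divisors are the possible common factors of the parametrised coordinates, and each contributes the
  same main term.

  Complex squares encode the height: with z^2 = sqrt(a) x + i sqrt(b) y, the box |x|, |y| <= T
  becomes a region in z whose area is linear in T, and the parametrisation becomes squaring on a
  lattice.\<close>

lemma moebius_1 [simp]: "moebius (Suc 0) = 1"
  by (simp add: moebius_def)

lemma abs_moebius_le_1: "\<bar>moebius n\<bar> \<le> 1"
  by (simp add: moebius_def power_abs)

lemma squarefree_prime_mult_iff:
  fixes p n :: nat
  assumes "prime p" "\<not> p dvd n"
  shows "squarefree (p * n) \<longleftrightarrow> squarefree n"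
proof -
  have "coprime p n" using assms by (simp add: prime_imp_coprime)
  moreover have "squarefree p" using assms squarefree_prime by blast
  ultimately show ?thesis
    using squarefree_mult_coprime[of p n] squarefree_multD(2)[of p n] by blast
qed

lemma squarefree_prime_mult_not_dvd:
  fixes p n :: nat
  assumes "prime p" "squarefree (p * n)"
  shows "\<not> p dvd n"
proof
  assume "p dvd n"
  then have "p\<^sup>2 dvd p * n" by (simp add: power2_eq_square mult_dvd_mono)
  then have "is_unit p" using assms(2) by (rule squarefreeD[rotated])
  then show False using assms(1) not_prime_unit by blast
qed

lemma prime_factors_prime_mult:
  fixes p n :: nat
  assumes "prime p" "\<not> p dvd n"
  shows "prime_factors (p * n) = insert p (prime_factors n)" "p \<notin> prime_factors n"
proof -
  have "n \<noteq> 0" "p \<noteq> 0" using assms by (auto intro!: gr0I)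
  then show "prime_factors (p * n) = insert p (prime_factors n)"
    using assms by (simp add: prime_factors_product prime_prime_factors)
  show "p \<notin> prime_factors n" using assms by auto
qed

lemma moebius_prime_mult:
  assumes "prime p" "\<not> p dvd n"
  shows "moebius (p * n) = - moebius n"
  using assms by (simp add: moebius_def squarefree_prime_mult_iff prime_factors_prime_mult)

lemma moebius_prime_mult_dvd:
  assumes "prime p" "p dvd n"
  shows "moebius (p * n) = 0"
proof -
  have "p\<^sup>2 dvd p * n" using assms by (simp add: power2_eq_square mult_dvd_mono)
  then have "\<not> squarefree (p * n)" using assms(1) not_squarefreeI not_prime_unit by blast
  then show ?thesis by (simp add: moebius_def)
qed

text \<open>The squarefree divisors pair off as d and p d for a fixed prime p of n, with opposite
  signs.\<close>

lemma moebius_divisor_sum: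
  assumes "n > 0"
  shows "(\<Sum>d | d dvd n. moebius d) = (if n = 1 then 1 else 0)"
proof (cases "n = 1")
  case False
  then obtain p where p: "prime p" "p dvd n" using prime_factor_nat by blast
  define S where "S = {d. d dvd n \<and> squarefree d}"
  have fin: "finite S" unfolding S_def using assms by (intro finite_subset[OF _ finite_divisors_nat]) auto
  have "(\<Sum>d | d dvd n. moebius d) = (\<Sum>d\<in>S. moebius d)"
    unfolding S_def using assms by (intro sum.mono_neutral_right) (auto simp: moebius_def)
  also have "\<dots> = (\<Sum>d\<in>{d\<in>S. \<not> p dvd d}. moebius d) + (\<Sum>d\<in>{d\<in>S. p dvd d}. moebius d)"
    using fin by (subst sum.union_disjoint[symmetric]) (auto intro!: sum.cong)
  also have "(\<Sum>d\<in>{d\<in>S. p dvd d}. moebius d) = (\<Sum>d\<in>{d\<in>S. \<not> p dvd d}. moebius (p * d))"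
  proof (rule sum.reindex_bij_witness[where i = "\<lambda>d. p * d" and j = "\<lambda>d. d div p"])
    fix d assume "d \<in> {d\<in>S. p dvd d}"
    then have d: "d dvd n" "squarefree d" "p dvd d" by (auto simp: S_def)
    then obtain e where e: "d = p * e" by blast
    have "\<not> p dvd e" using squarefree_prime_mult_not_dvd[OF p(1)] d(2) e by blast
    moreover have "squarefree e" "e dvd n" using d e squarefree_multD(2) dvd_mult_right by blast+
    moreover have "d div p = e" using e p(1) by simp
    ultimately show "d div p \<in> {d\<in>S. \<not> p dvd d}" by (simp add: S_def)
  next
    fix d assume "d \<in> {d\<in>S. \<not> p dvd d}"
    then show "p * d \<in> {d\<in>S. p dvd d}"
      using p prime_imp_coprime[OF p(1), of d] divides_mult[of p n d]
      by (simp add: S_def squarefree_prime_mult_iff)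
  qed (use p in auto)
  also have "\<dots> = - (\<Sum>d\<in>{d\<in>S. \<not> p dvd d}. moebius d)"
    using p by (simp add: moebius_prime_mult sum_negf)
  finally show ?thesis using False by simp
qed auto

text \<open>With a cut K that does not depend on G, the sum over k can later be interchanged with
  the sum over lattice points.\<close>

lemma moebius_sum_atMost:
  assumes "G > 0" "G \<le> K"
  shows "(\<Sum>k=1..K. if k dvd G then moebius k else 0) = (if G = 1 then 1 else 0)"
proof -
  have "(\<Sum>k=1..K. if k dvd G then moebius k else 0) = (\<Sum>k | k dvd G. moebius k)"
  proof -
    have "{k \<in> {1..K}. k dvd G} = {k. k dvd G}"
      using assms by (auto dest: dvd_imp_le intro: Suc_leI gr0I)
    then show ?thesis by (simp add: sum.inter_filter[symmetric])
  qed
  then show ?thesis using moebius_divisor_sum assms by simp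
qed

section \<open>Density of the coprimality condition\<close>

definition density_term :: "nat \<Rightarrow> nat \<Rightarrow> real" where
  "density_term q k = of_int (moebius k) * real (gcd k q) / (real k)\<^sup>2"

text \<open>For coprime d1, d2 with q = d1 d2, this is the proportion of integer pairs (s, t) for
  which d1 s and d2 t are coprime: k divides both exactly on a sublattice of index k^2 / gcd(k,
  q).\<close>

definition coprime_density :: "nat \<Rightarrow> real" where
  "coprime_density q = (\<Sum>\<^sub>\<infinity>k. density_term q k)"

lemma abs_density_term_le:
  assumes "q > 0"
  shows "\<bar>density_term q k\<bar> \<le> real q / (real k)\<^sup>2"
proof -
  have "real (gcd k q) \<le> real q" using assms by (simp add: dvd_imp_le)
  moreover have "\<bar>real_of_int (moebius k)\<bar> \<le> 1" using abs_moebius_le_1[of k] by linarith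
  ultimately have "\<bar>real_of_int (moebius k)\<bar> * real (gcd k q) \<le> 1 * real q"
    by (intro mult_mono) auto
  then show ?thesis by (simp add: density_term_def abs_mult divide_right_mono)
qed

lemma inverse_squares_summable: "(\<lambda>k::nat. 1 / (real k)\<^sup>2) summable_on UNIV"
  by (rule norm_summable_imp_summable_on) (use inverse_power_summable[of 2] in \<open>simp add: field_simps\<close>)

lemma density_term_summable:
  assumes "q > 0"
  shows "density_term q summable_on A"
proof -
  have "(\<lambda>k. real q * (1 / (real k)\<^sup>2)) summable_on UNIV"
    by (intro summable_on_cmult_right inverse_squares_summable)
  then have "(\<lambda>k. norm (density_term q k)) summable_on UNIV"
    by (rule Infinite_Sum.abs_summable_on_comparison_test') (use abs_density_term_le[OF assms] in auto)
  then show ?thesis using abs_summable_summable summable_on_subset_banach by blast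
qed

text \<open>The terms with k prime to p have the same sum E for q and p q. Those with k = p k'
  survive only for k' prime to p; they contribute -E/p^2 for q, but -E/p for p q, because the gcd
  gains a factor p. The quotient (1 - 1/p) / (1 - 1/p^2) is 1 / (1 + 1/p).\<close>

lemma coprime_density_prime_mult:
  assumes "prime p" "\<not> p dvd q" "q > 0"
  shows "coprime_density (p * q) = coprime_density q / (1 + 1 / real p)"
proof -
  define E where "E = (\<Sum>\<^sub>\<infinity>k\<in>{k. \<not> p dvd k}. density_term q k)"
  have p0: "p > 0" using assms prime_gt_0_nat by blast
  have split: "coprime_density r = (\<Sum>\<^sub>\<infinity>k\<in>{k. \<not> p dvd k}. density_term r k) + (\<Sum>\<^sub>\<infinity>k\<in>{k. p dvd k}. density_term r k)"
    if "r > 0" for r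
  proof -
    have "(UNIV :: nat set) = {k. \<not> p dvd k} \<union> {k. p dvd k}" by auto
    then show ?thesis unfolding coprime_density_def
      using infsum_Un_disjoint[of "density_term r" "{k. \<not> p dvd k}" "{k. p dvd k}"]
        density_term_summable[OF that] by auto
  qed
  have mult: "(\<Sum>\<^sub>\<infinity>k\<in>{k. p dvd k}. density_term r k) = (\<Sum>\<^sub>\<infinity>k. density_term r (p * k))" for r
  proof -
    have "bij_betw (\<lambda>k. p * k) UNIV {k. p dvd k}"
      using p0 by (auto simp: bij_betw_def inj_on_def elim: dvdE)
    then show ?thesis by (rule infsum_reindex_bij_betw[symmetric])
  qed
  have drop: "(\<Sum>\<^sub>\<infinity>k. density_term r (p * k)) = (\<Sum>\<^sub>\<infinity>k\<in>{k. \<not> p dvd k}. density_term r (p * k))" for r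
    by (rule infsum_cong_neutral) (auto simp: density_term_def moebius_prime_mult_dvd assms)
  have t1: "density_term q (p * k) = (- 1 / (real p)\<^sup>2) * density_term q k" if "\<not> p dvd k" for k
  proof -
    have "gcd (p * k) q = gcd k q"
      using assms prime_imp_coprime[of p q] by (intro gcd_mult_left_left_cancel) (simp add: coprime_commute)
    then show ?thesis unfolding density_term_def moebius_prime_mult[OF assms(1) that]
      by (simp add: power_mult_distrib field_simps)
  qed
  have t2: "density_term (p * q) (p * k) = (- 1 / real p) * density_term q k" if "\<not> p dvd k" for k
    unfolding density_term_def moebius_prime_mult[OF assms(1) that] gcd_mult_distrib_nat[symmetric]
    using p0 by (simp add: power2_eq_square field_simps)
  have t3: "density_term (p * q) k = density_term q k" if "\<not> p dvd k" for k
  proof -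
    have "coprime p k" using that assms by (simp add: prime_imp_coprime)
    then have "coprime k p" by (simp add: coprime_commute)
    then have "gcd k (p * q) = gcd k q" by (simp add: gcd_mult_right_left_cancel)
    then show ?thesis by (simp add: density_term_def)
  qed
  have "coprime_density q = E + (- 1 / (real p)\<^sup>2) * E"
    unfolding split[OF assms(3)] mult drop E_def
    by (subst infsum_cmult_right'[symmetric]) (intro arg_cong2[where f = "(+)"] infsum_cong refl, use t1 in auto)
  moreover have "coprime_density (p * q) = E + (- 1 / real p) * E"
    unfolding split[of "p * q", simplified, OF conjI[OF p0 assms(3)]] mult drop E_def
    by (subst infsum_cmult_right'[symmetric]) (intro arg_cong2[where f = "(+)"] infsum_cong refl, use t2 t3 in auto)
  moreover have "real p > 0" using p0 by simp
  ultimately have "coprime_density (p * q) = E * (1 - 1 / real p)" "real p > 0"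
      "coprime_density q = E * ((1 - 1 / real p) * (1 + 1 / real p))"
    by (simp_all add: algebra_simps power2_eq_square)
  moreover have "1 + 1 / real p > 0" using \<open>real p > 0\<close> by (simp add: add_pos_nonneg)
  ultimately show ?thesis by simp
qed

text \<open>Multiplying by the sum of 1/m^2, which is pi^2/6, and regrouping the absolutely
  convergent double sum by n = k m leaves only the term n = 1.\<close>

lemma coprime_density_1: "coprime_density 1 = 6 / pi\<^sup>2"
proof -
  define f where "f k = of_int (moebius k) / (real k)\<^sup>2" for k
  define g where "g m = 1 / (real m)\<^sup>2" for m :: nat
  let ?N = "{k::nat. k > 0}"
  have f1: "density_term 1 k = f k" for k by (simp add: density_term_def f_def)
  have fs: "(\<lambda>k. norm (f k)) summable_on ?N"
  proof -
    have "\<bar>f k\<bar> \<le> 1 / (real k)\<^sup>2" for k using abs_density_term_le[of 1 k] f1 by simp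
    then show ?thesis
      using Infinite_Sum.abs_summable_on_comparison_test'[OF summable_on_subset_banach[OF inverse_squares_summable subset_UNIV, of ?N], of f]
      by auto
  qed
  have gs: "(\<lambda>k. norm (g k)) summable_on ?N"
    using summable_on_subset_banach[OF inverse_squares_summable subset_UNIV, of ?N] by (simp add: g_def)
  have ginf: "infsum g ?N = pi\<^sup>2 / 6"
  proof -
    have "((\<lambda>n::nat. 1 / (real n + 1)\<^sup>2) has_sum pi\<^sup>2 / 6) UNIV"
      using inverse_squares_sums by (intro sums_nonneg_imp_has_sum) (auto simp: add_ac)
    moreover have "bij_betw Suc UNIV ?N" by (auto simp: bij_betw_def gr0_conv_Suc)
    ultimately have "(g has_sum pi\<^sup>2 / 6) ?N"
      using has_sum_reindex_bij_betw[of Suc UNIV ?N g "pi\<^sup>2 / 6"] by (simp add: g_def add_ac)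
    then show ?thesis by (rule infsumI)
  qed
  have finf: "infsum f ?N = coprime_density 1"
    unfolding coprime_density_def f1[symmetric]
    by (rule infsum_cong_neutral) (auto simp: density_term_def)
  have prod_sum: "(\<lambda>x. norm ((\<lambda>(k, m). f k * g m) x)) summable_on ?N \<times> ?N"
    
    unfolding Infinite_Sum.abs_summable_on_Sigma_iff
  proof (intro conjI ballI)
    fix k
    show "(\<lambda>m. norm (case (k, m) of (k, m) \<Rightarrow> f k * g m)) summable_on ?N"
      using summable_on_cmult_right[OF gs, of "norm (f k)"] by (simp add: norm_mult abs_mult)
  next
    have "(\<Sum>\<^sub>\<infinity>m\<in>?N. norm (case (k, m) of (k, m) \<Rightarrow> f k * g m)) = norm (f k) * (\<Sum>\<^sub>\<infinity>m\<in>?N. norm (g m))" for k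
      by (simp add: norm_mult infsum_cmult_right' del: real_norm_def)
    moreover have "(\<lambda>k. norm (norm (f k) * (\<Sum>\<^sub>\<infinity>m\<in>?N. norm (g m)))) summable_on ?N"
      using summable_on_cmult_left[OF fs, of "norm (\<Sum>\<^sub>\<infinity>m\<in>?N. norm (g m))"] by (simp add: norm_mult del: real_norm_def) simp
    ultimately show "(\<lambda>k. norm (\<Sum>\<^sub>\<infinity>m\<in>?N. norm (case (k, m) of (k, m) \<Rightarrow> f k * g m))) summable_on ?N"
      by simp
  qed
  have "infsum f ?N * infsum g ?N = (\<Sum>\<^sub>\<infinity>(k, m)\<in>?N \<times> ?N. f k * g m)"
  proof -
    have "(\<Sum>\<^sub>\<infinity>(k, m)\<in>?N \<times> ?N. f k * g m) = (\<Sum>\<^sub>\<infinity>k\<in>?N. \<Sum>\<^sub>\<infinity>m\<in>?N. f k * g m)"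
      using infsum_Sigma'_banach[of "\<lambda>k m. f k * g m" ?N "\<lambda>_. ?N"] abs_summable_summable[OF prod_sum] by simp
    also have "\<dots> = (\<Sum>\<^sub>\<infinity>k\<in>?N. f k * infsum g ?N)"
      by (simp add: infsum_cmult_right')
    also have "\<dots> = infsum f ?N * infsum g ?N" by (rule infsum_cmult_left')
    finally show ?thesis by simp
  qed
  also have "\<dots> = (\<Sum>\<^sub>\<infinity>(n, k)\<in>Sigma ?N (\<lambda>n. {k. k dvd n}). f k * g (n div k))"
    by (rule infsum_reindex_bij_witness[where i = "\<lambda>(n, k). (k, n div k)" and j = "\<lambda>(k, m). (k * m, k)"])
       (auto elim!: dvdE)
  also have "\<dots> = (\<Sum>\<^sub>\<infinity>n\<in>?N. \<Sum>\<^sub>\<infinity>k\<in>{k. k dvd n}. f k * g (n div k))"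
  proof (rule infsum_Sigma'_banach[symmetric])
    have "(\<lambda>(n, k). f k * g (n div k)) summable_on Sigma ?N (\<lambda>n. {k. k dvd n}) \<longleftrightarrow>
      (\<lambda>(k, m). f k * g m) summable_on ?N \<times> ?N"
      by (rule summable_on_reindex_bij_witness[where j = "\<lambda>(n, k). (k, n div k)" and i = "\<lambda>(k, m). (k * m, k)"])
       (auto elim!: dvdE)
    then show "(\<lambda>(n, k). f k * g (n div k)) summable_on Sigma ?N (\<lambda>n. {k. k dvd n})"
      using abs_summable_summable[OF prod_sum] by simp
  qed
  also have "\<dots> = (\<Sum>\<^sub>\<infinity>n\<in>?N. if n = 1 then 1 else 0)"
  proof (rule infsum_cong)
    fix n :: nat assume n: "n \<in> ?N"
    have "(\<Sum>\<^sub>\<infinity>k\<in>{k. k dvd n}. f k * g (n div k)) = (\<Sum>k | k dvd n. of_int (moebius k) / (real n)\<^sup>2)"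
      using n by (simp add: infsum_finite, intro sum.cong)
        (auto simp: f_def g_def power_mult_distrib elim!: dvdE)
    also have "\<dots> = of_int (\<Sum>k | k dvd n. moebius k) / (real n)\<^sup>2"
      by (simp add: sum_divide_distrib)
    also have "\<dots> = (if n = 1 then 1 else 0)" using n by (simp add: moebius_divisor_sum)
    finally show "(\<Sum>\<^sub>\<infinity>k\<in>{k. k dvd n}. f k * g (n div k)) = (if n = 1 then 1 else 0)" .
  qed
  also have "\<dots> = (\<Sum>\<^sub>\<infinity>n\<in>{1::nat}. 1)" by (rule infsum_cong_neutral) auto
  also have "\<dots> = 1" by simp
  finally show ?thesis by (simp add: finf ginf field_simps)
qed

lemma squarefree_nat_induct [consumes 1, case_names one mult]:
  fixes q :: nat
  assumes "squarefree q" "P 1"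
    and "\<And>p q. prime p \<Longrightarrow> \<not> p dvd q \<Longrightarrow> squarefree q \<Longrightarrow> P q \<Longrightarrow> P (p * q)"
  shows "P q"
  using assms(1)
proof (induction q rule: less_induct)
  case (less q)
  show ?case
  proof (cases "q = 1")
    case False
    then obtain p where p: "prime p" "p dvd q" using prime_factor_nat by blast
    then obtain e where e: "q = p * e" by blast
    have "\<not> p dvd e" using squarefree_prime_mult_not_dvd[OF p(1)] less.prems e by blast
    moreover have "squarefree e" using less.prems e squarefree_multD by blast
    moreover have "e > 0" using \<open>squarefree e\<close> by (auto intro!: gr0I)
    then have "e < q" using e prime_gt_1_nat[OF p(1)] by simp
    ultimately show ?thesis using assms(3)[OF p(1)] less.IH e by blast
  qed (use assms(2) in simp)
qed

lemma coprime_density_squarefree: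
  assumes "squarefree q"
  shows "coprime_density q = 6 / pi\<^sup>2 * (\<Prod>p\<in>prime_factors q. inverse (1 + 1 / real p))"
  using assms
proof (induction q rule: squarefree_nat_induct)
  case (mult p q)
  then have "q > 0" by (auto intro: gr0I)
  then show ?case using mult
    by (simp add: coprime_density_prime_mult prime_factors_prime_mult divide_inverse)
qed (simp add: coprime_density_1[simplified])

lemma card_divisors_squarefree:
  fixes n :: nat
  assumes "squarefree n"
  shows "card {d. d dvd n} = 2 ^ card (prime_factors n)"
  using assms
proof (induction n rule: squarefree_nat_induct)
  case (mult p n)
  have n0: "n > 0" using mult by (auto intro: gr0I)
  have p0: "p > 0" using mult prime_gt_0_nat by blast
  have "{d. d dvd p * n} = {d. d dvd n} \<union> (\<lambda>d. p * d) ` {d. d dvd n}"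
  proof (intro equalityI subsetI)
    fix d assume d: "d \<in> {d. d dvd p * n}"
    show "d \<in> {d. d dvd n} \<union> (\<lambda>d. p * d) ` {d. d dvd n}"
    proof (cases "p dvd d")
      case True
      then show ?thesis using d p0 by (auto elim!: dvdE)
    next
      case False
      then have "coprime p d" using mult by (simp add: prime_imp_coprime)
      then have "coprime d p" by (simp add: coprime_commute)
      then show ?thesis using d by (simp add: coprime_dvd_mult_right_iff)
    qed
  qed auto
  moreover have "{d. d dvd n} \<inter> (\<lambda>d. p * d) ` {d. d dvd n} = {}"
    using mult by (auto dest: dvd_mult_left)
  moreover have "card ((\<lambda>d. p * d) ` {d. d dvd n}) = card {d. d dvd n}"
    using p0 by (intro card_image) (auto simp: inj_on_def)
  ultimately have "card {d. d dvd p * n} = 2 * card {d. d dvd n}"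
    using n0 by (simp add: card_Un_disjoint)
  then show ?case using mult by (simp add: prime_factors_prime_mult)
qed auto

section \<open>Lattice points in planar regions\<close>

text \<open>If z^2 = sqrt(a) x + i sqrt(b) y, this is max(|x|, |y|). The parametrised points occur
  as such squares, so counting them in a box means counting z in a region.\<close>

definition hgt :: "real \<Rightarrow> real \<Rightarrow> complex \<Rightarrow> real" where
  "hgt a b z = max (\<bar>Re (z\<^sup>2)\<bar> / sqrt a) (\<bar>Im (z\<^sup>2)\<bar> / sqrt b)"

lemma hgt_scale: "hgt a b (of_real r * z) = r\<^sup>2 * hgt a b z"
proof -
  have "(of_real r * z)\<^sup>2 = of_real (r\<^sup>2) * z\<^sup>2" by (simp add: power_mult_distrib)
  then have "hgt a b (of_real r * z) = max (r\<^sup>2 * (\<bar>Re (z\<^sup>2)\<bar> / sqrt a)) (r\<^sup>2 * (\<bar>Im (z\<^sup>2)\<bar> / sqrt b))"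
    unfolding hgt_def by (simp only: Re_complex_of_real Im_complex_of_real times_complex.sel mult_zero_left diff_zero add_0_right abs_mult abs_power2 times_divide_eq_right)
  then show ?thesis by (simp add: hgt_def max_mult_distrib_left)
qed

lemma hgt_le_iff:
  assumes "a > 0" "b > 0"
  shows "hgt a b z \<le> T \<longleftrightarrow> \<bar>Re (z\<^sup>2)\<bar> \<le> T * sqrt a \<and> \<bar>Im (z\<^sup>2)\<bar> \<le> T * sqrt b"
  using assms by (simp add: hgt_def pos_divide_le_eq)

lemma norm_le_hgt:
  assumes "a \<ge> 1" "b \<ge> 1" "hgt a b z \<le> B"
  shows "norm z \<le> sqrt (a + b) * sqrt B"
proof -
  have h: "\<bar>Re (z\<^sup>2)\<bar> \<le> B * sqrt a" "\<bar>Im (z\<^sup>2)\<bar> \<le> B * sqrt b"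
    using assms hgt_le_iff[of a b z B] by auto
  have "0 \<le> B * sqrt a" using h(1) abs_ge_zero order_trans by blast
  then have B: "B \<ge> 0" using assms by (simp add: zero_le_mult_iff)
  have "(norm z) ^ 4 = (norm (z\<^sup>2))\<^sup>2" by (simp add: norm_power)
  also have "\<dots> = \<bar>Re (z\<^sup>2)\<bar>\<^sup>2 + \<bar>Im (z\<^sup>2)\<bar>\<^sup>2" by (simp add: cmod_power2)
  also have "\<dots> \<le> (B * sqrt a)\<^sup>2 + (B * sqrt b)\<^sup>2"
    using h by (intro add_mono power_mono) auto
  also have "\<dots> = (a + b) * B\<^sup>2" using assms by (simp add: power_mult_distrib algebra_simps)
  \<comment> \<open>The factor a + b is enlarged to its square, so that the fourth root is simply
    sqrt(a + b) sqrt(B).\<close>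
  also have "\<dots> \<le> (a + b)\<^sup>2 * B\<^sup>2"
    using assms by (intro mult_right_mono) (auto simp: power2_eq_square intro!: mult_left_le_imp_le)
  also have "\<dots> = (sqrt (a + b) * sqrt B) ^ 4"
  proof -
    have four: "sqrt x ^ 4 = x\<^sup>2" if "x \<ge> 0" for x
    proof -
      have "sqrt x ^ 4 = ((sqrt x)\<^sup>2)\<^sup>2" by (simp flip: power_mult)
      then show ?thesis using that by simp
    qed
    have "sqrt (a + b) ^ 4 = (a + b)\<^sup>2" "sqrt B ^ 4 = B\<^sup>2"
      by (rule four, use assms B in linarith)+
    then show ?thesis by (simp only: power_mult_distrib)
  qed
  finally have "norm z ^ 4 \<le> (sqrt (a + b) * sqrt B) ^ 4" .
  moreover have "0 \<le> sqrt (a + b) * sqrt B" using assms B by (intro mult_nonneg_nonneg) auto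
  ultimately show ?thesis
    using power_mono_iff[of "norm z" "sqrt (a + b) * sqrt B" 4] by (simp only: norm_ge_zero)
qed

text \<open>Adding w changes z^2 by 2 z w + w^2, and since a and b are at least 1, dividing by their
  square roots does not enlarge this change.\<close>

lemma hgt_add_le:
  assumes "a \<ge> 1" "b \<ge> 1"
  shows "hgt a b (z + w) \<le> hgt a b z + 2 * norm z * norm w + (norm w)\<^sup>2"
proof -
  define e where "e = 2 * z * w + w\<^sup>2"
  have eq: "(z + w)\<^sup>2 = z\<^sup>2 + e" by (simp add: e_def power2_eq_square algebra_simps)
  have e: "norm e \<le> 2 * norm z * norm w + (norm w)\<^sup>2"
    unfolding e_def by (rule order_trans[OF norm_triangle_ineq]) (simp add: norm_mult norm_power)
  have aux: "\<bar>x + y\<bar> / s \<le> \<bar>x\<bar> / s + n" if "\<bar>y\<bar> \<le> n" "s \<ge> 1" for x y s n :: real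
  proof -
    have "n \<le> n * s" using that by (simp add: mult_le_cancel_left1)
    then have "\<bar>x + y\<bar> \<le> \<bar>x\<bar> + n * s" using that by linarith
    then have "\<bar>x + y\<bar> / s \<le> (\<bar>x\<bar> + n * s) / s" using that by (intro divide_right_mono) auto
    then show ?thesis using that by (simp add: add_divide_distrib)
  qed
  have "\<bar>Re ((z + w)\<^sup>2)\<bar> / sqrt a \<le> \<bar>Re (z\<^sup>2)\<bar> / sqrt a + norm e"
    unfolding eq plus_complex.sel using assms abs_Re_le_cmod by (intro aux) auto
  moreover have "\<bar>Im ((z + w)\<^sup>2)\<bar> / sqrt b \<le> \<bar>Im (z\<^sup>2)\<bar> / sqrt b + norm e"
    unfolding eq plus_complex.sel using assms abs_Im_le_cmod by (intro aux) auto
  ultimately have "hgt a b (z + w) \<le> hgt a b z + norm e"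
    unfolding hgt_def by linarith
  then show ?thesis using e by linarith
qed

definition lin :: "complex \<Rightarrow> complex \<Rightarrow> real \<times> real \<Rightarrow> complex" where
  "lin \<xi> \<eta> p = of_real (fst p) * \<xi> + of_real (snd p) * \<eta>"

definition region :: "real \<Rightarrow> real \<Rightarrow> complex \<Rightarrow> complex \<Rightarrow> real \<Rightarrow> (real \<times> real) set" where
  "region a b \<xi> \<eta> B = {p. hgt a b (lin \<xi> \<eta> p) \<le> B}"

lemma continuous_lin [continuous_intros]: "continuous_on A (lin \<xi> \<eta>)"
  unfolding lin_def by (intro continuous_intros)

lemma closed_region: 
  assumes "a > 0" "b > 0"
  shows "closed (region a b \<xi> \<eta> B)"
proof -
  have "region a b \<xi> \<eta> B = {p. \<bar>Re ((lin \<xi> \<eta> p)\<^sup>2)\<bar> \<le> B * sqrt a} \<inter> {p. \<bar>Im ((lin \<xi> \<eta> p)\<^sup>2)\<bar> \<le> B * sqrt b}"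
    using assms by (auto simp: region_def hgt_le_iff)
  moreover have "closed {p. \<bar>Re ((lin \<xi> \<eta> p)\<^sup>2)\<bar> \<le> B * sqrt a}" "closed {p. \<bar>Im ((lin \<xi> \<eta> p)\<^sup>2)\<bar> \<le> B * sqrt b}"
    by (intro closed_Collect_le continuous_intros)+
  ultimately show ?thesis by auto
qed

text \<open>Cramer's rule: pairing with the conjugate of one basis vector isolates the coordinate of
  the other, and Im(cnj \<open>\<xi>\<close> \<open>\<eta>\<close>) is the determinant of the
  basis.\<close>

lemma lin_coord_bound:
  assumes "Im (cnj \<xi> * \<eta>) \<noteq> 0"
  shows "\<bar>fst p\<bar> * \<bar>Im (cnj \<xi> * \<eta>)\<bar> \<le> norm \<eta> * norm (lin \<xi> \<eta> p)"
    and "\<bar>snd p\<bar> * \<bar>Im (cnj \<xi> * \<eta>)\<bar> \<le> norm \<xi> * norm (lin \<xi> \<eta> p)"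
proof -
  have "Im (cnj \<eta> * lin \<xi> \<eta> p) = - fst p * Im (cnj \<xi> * \<eta>)"
    by (simp add: lin_def algebra_simps)
  then have "\<bar>fst p\<bar> * \<bar>Im (cnj \<xi> * \<eta>)\<bar> = \<bar>Im (cnj \<eta> * lin \<xi> \<eta> p)\<bar>"
    by (simp only: abs_mult abs_minus_cancel)
  also have "\<dots> \<le> norm (cnj \<eta> * lin \<xi> \<eta> p)" by (rule abs_Im_le_cmod)
  finally show "\<bar>fst p\<bar> * \<bar>Im (cnj \<xi> * \<eta>)\<bar> \<le> norm \<eta> * norm (lin \<xi> \<eta> p)" by (simp add: norm_mult)
  have "Im (cnj \<xi> * lin \<xi> \<eta> p) = snd p * Im (cnj \<xi> * \<eta>)"
    by (simp add: lin_def algebra_simps)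
  then have "\<bar>snd p\<bar> * \<bar>Im (cnj \<xi> * \<eta>)\<bar> = \<bar>Im (cnj \<xi> * lin \<xi> \<eta> p)\<bar>"
    by (simp only: abs_mult)
  also have "\<dots> \<le> norm (cnj \<xi> * lin \<xi> \<eta> p)" by (rule abs_Im_le_cmod)
  finally show "\<bar>snd p\<bar> * \<bar>Im (cnj \<xi> * \<eta>)\<bar> \<le> norm \<xi> * norm (lin \<xi> \<eta> p)" by (simp add: norm_mult)
qed

lemma bounded_region:
  assumes "a \<ge> 1" "b \<ge> 1" "Im (cnj \<xi> * \<eta>) \<noteq> 0"
  shows "bounded (region a b \<xi> \<eta> B)"
proof -
  let ?D = "\<bar>Im (cnj \<xi> * \<eta>)\<bar>" and ?N = "sqrt (a + b) * sqrt B"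
  have "norm p \<le> norm \<eta> * ?N / ?D + norm \<xi> * ?N / ?D" if "p \<in> region a b \<xi> \<eta> B" for p
  proof -
    have n: "norm (lin \<xi> \<eta> p) \<le> ?N" using that assms by (intro norm_le_hgt) (auto simp: region_def)
    have "\<bar>fst p\<bar> * ?D \<le> norm \<eta> * ?N" "\<bar>snd p\<bar> * ?D \<le> norm \<xi> * ?N"
      using lin_coord_bound[OF assms(3), of p] mult_left_mono[OF n, of "norm \<eta>"] mult_left_mono[OF n, of "norm \<xi>"]
      by simp_all
    then have "\<bar>fst p\<bar> \<le> norm \<eta> * ?N / ?D" "\<bar>snd p\<bar> \<le> norm \<xi> * ?N / ?D"
      using assms(3) by (simp_all add: pos_le_divide_eq)
    then show ?thesis using norm_Pair_le[of "fst p" "snd p"] by simp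
  qed
  then show ?thesis unfolding bounded_iff by blast
qed

lemma region_fmeasurable:
  assumes "a \<ge> 1" "b \<ge> 1" "Im (cnj \<xi> * \<eta>) \<noteq> 0"
  shows "region a b \<xi> \<eta> B \<in> fmeasurable lborel"
  using closed_region[of a b] bounded_region[OF assms] assms
  by (intro fmeasurable_compact) (auto simp: compact_eq_bounded_closed)

text \<open>The height is homogeneous of degree 2, so B corresponds to a dilation by sqrt(B) in the
  plane, hence to a factor B in area.\<close>

lemma measure_region_scale:
  assumes "a \<ge> 1" "b \<ge> 1" "Im (cnj \<xi> * \<eta>) \<noteq> 0" "B > 0"
  shows "measure lborel (region a b \<xi> \<eta> B) = B * measure lborel (region a b \<xi> \<eta> 1)"
proof -
  have "region a b \<xi> \<eta> B = (\<lambda>p. sqrt B *\<^sub>R p + 0) ` region a b \<xi> \<eta> 1"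
  proof (intro equalityI subsetI)
    fix p assume p: "p \<in> region a b \<xi> \<eta> B"
    have "lin \<xi> \<eta> p = of_real (sqrt B) * lin \<xi> \<eta> ((1 / sqrt B) *\<^sub>R p)"
      using assms by (simp add: lin_def algebra_simps flip: of_real_mult of_real_divide)
    then have "hgt a b (lin \<xi> \<eta> p) = B * hgt a b (lin \<xi> \<eta> ((1 / sqrt B) *\<^sub>R p))"
      using assms hgt_scale[of a b "sqrt B"] by simp
    then have "(1 / sqrt B) *\<^sub>R p \<in> region a b \<xi> \<eta> 1" using p assms by (simp add: region_def)
    then show "p \<in> (\<lambda>p. sqrt B *\<^sub>R p + 0) ` region a b \<xi> \<eta> 1"
      using assms by (intro image_eqI[of _ _ "(1 / sqrt B) *\<^sub>R p"]) auto
  next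
    fix p assume "p \<in> (\<lambda>p. sqrt B *\<^sub>R p + 0) ` region a b \<xi> \<eta> 1"
    then obtain q where q: "q \<in> region a b \<xi> \<eta> 1" "p = sqrt B *\<^sub>R q" by auto
    have "lin \<xi> \<eta> p = of_real (sqrt B) * lin \<xi> \<eta> q" by (simp add: q lin_def algebra_simps)
    then have "hgt a b (lin \<xi> \<eta> p) = B * hgt a b (lin \<xi> \<eta> q)"
      using assms hgt_scale[of a b "sqrt B"] by simp
    then show "p \<in> region a b \<xi> \<eta> B" using q assms by (simp add: region_def)
  qed
  then have "measure lebesgue (region a b \<xi> \<eta> B) = B * measure lebesgue (region a b \<xi> \<eta> 1)"
    using assms by (simp only: measure_lebesgue_affine) simp
  moreover have "measure lebesgue (region a b \<xi> \<eta> B) = measure lborel (region a b \<xi> \<eta> B)" for B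
    using closed_region[of a b] assms by (intro measure_completion) auto
  ultimately show ?thesis by simp
qed

text \<open>Half-open, so that distinct cells are disjoint and the area of a union of cells is their
  number.\<close>

definition cell :: "int \<times> int \<Rightarrow> (real \<times> real) set" where
  "cell p = {of_int (fst p)..<of_int (fst p) + 1} \<times> {of_int (snd p)..<of_int (snd p) + 1}"

lemma emeasure_cell: "emeasure lborel (cell p) = 1"
  unfolding cell_def lborel_prod[symmetric] by (subst lborel.emeasure_pair_measure_Times) auto

lemma cell_borel [measurable, simp]: "cell p \<in> sets borel"
  unfolding cell_def by (simp add: borel_Times)

lemma mem_cell_iff: "x \<in> cell p \<longleftrightarrow> \<lfloor>fst x\<rfloor> = fst p \<and> \<lfloor>snd x\<rfloor> = snd p"
  by (cases x, cases p) (auto simp: cell_def floor_eq_iff)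

definition ipt :: "int \<times> int \<Rightarrow> real \<times> real" where
  "ipt p = (of_int (fst p), of_int (snd p))"

definition lattice_points :: "real \<Rightarrow> real \<Rightarrow> complex \<Rightarrow> complex \<Rightarrow> real \<Rightarrow> (int \<times> int) set" where
  "lattice_points a b \<xi> \<eta> B = {p. hgt a b (lin \<xi> \<eta> (ipt p)) \<le> B}"

lemma lattice_point_bound:
  assumes "a \<ge> 1" "b \<ge> 1" "Im (cnj \<xi> * \<eta>) \<noteq> 0" "p \<in> lattice_points a b \<xi> \<eta> B"
  shows "\<bar>real_of_int (fst p)\<bar> * \<bar>Im (cnj \<xi> * \<eta>)\<bar> \<le> norm \<eta> * (sqrt (a + b) * sqrt B)"
    and "\<bar>real_of_int (snd p)\<bar> * \<bar>Im (cnj \<xi> * \<eta>)\<bar> \<le> norm \<xi> * (sqrt (a + b) * sqrt B)"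
proof -
  have n: "norm (lin \<xi> \<eta> (ipt p)) \<le> sqrt (a + b) * sqrt B"
    using assms by (intro norm_le_hgt) (auto simp: lattice_points_def)
  show "\<bar>real_of_int (fst p)\<bar> * \<bar>Im (cnj \<xi> * \<eta>)\<bar> \<le> norm \<eta> * (sqrt (a + b) * sqrt B)"
    using lin_coord_bound(1)[OF assms(3), of "ipt p"] mult_left_mono[OF n, of "norm \<eta>"]
    by (simp add: ipt_def)
  show "\<bar>real_of_int (snd p)\<bar> * \<bar>Im (cnj \<xi> * \<eta>)\<bar> \<le> norm \<xi> * (sqrt (a + b) * sqrt B)"
    using lin_coord_bound(2)[OF assms(3), of "ipt p"] mult_left_mono[OF n, of "norm \<xi>"]
    by (simp add: ipt_def)
qed

lemma finite_lattice_points: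
  assumes "a \<ge> 1" "b \<ge> 1" "Im (cnj \<xi> * \<eta>) \<noteq> 0"
  shows "finite (lattice_points a b \<xi> \<eta> B)"
proof (rule finite_subset)
  let ?D = "\<bar>Im (cnj \<xi> * \<eta>)\<bar>" and ?N = "sqrt (a + b) * sqrt B"
  let ?X = "\<lfloor>norm \<eta> * ?N / ?D\<rfloor>" and ?Y = "\<lfloor>norm \<xi> * ?N / ?D\<rfloor>"
  show "lattice_points a b \<xi> \<eta> B \<subseteq> {-?X..?X} \<times> {-?Y..?Y}"
  proof
    fix p assume p: "p \<in> lattice_points a b \<xi> \<eta> B"
    have "\<bar>real_of_int (fst p)\<bar> \<le> norm \<eta> * ?N / ?D" "\<bar>real_of_int (snd p)\<bar> \<le> norm \<xi> * ?N / ?D"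
      using lattice_point_bound[OF assms p] assms(3) by (simp_all add: pos_le_divide_eq)
    then have "\<bar>fst p\<bar> \<le> ?X" "\<bar>snd p\<bar> \<le> ?Y" by (simp_all add: le_floor_iff)
    then show "p \<in> {-?X..?X} \<times> {-?Y..?Y}" by (cases p) auto
  qed
qed auto

lemma lin_add: "lin \<xi> \<eta> (p + q) = lin \<xi> \<eta> p + lin \<xi> \<eta> q"
  by (simp add: lin_def algebra_simps)

text \<open>Moving inside a unit cell changes the height by at most \<open>\<delta>\<close>, so the
  union of the cells at the counted points lies between the regions of heights B -
  \<open>\<delta>\<close> and B + \<open>\<delta>\<close>. Area is linear in the height; the error
  is therefore A \<open>\<delta>\<close>, of order sqrt(B), without any estimate of the boundary
  curve.\<close>

lemma card_lattice_points:
  assumes ab: "a \<ge> 1" "b \<ge> 1" and D: "Im (cnj \<xi> * \<eta>) \<noteq> 0" and B: "B > 0"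
  defines "A \<equiv> measure lborel (region a b \<xi> \<eta> 1)"
    and "\<delta> \<equiv> 2 * (sqrt (a + b) * sqrt B) * (norm \<xi> + norm \<eta>) + (norm \<xi> + norm \<eta>)\<^sup>2"
  shows "\<bar>real (card (lattice_points a b \<xi> \<eta> B)) - A * B\<bar> \<le> A * \<delta>"
proof -
  define w where "w = norm \<xi> + norm \<eta>"
  define N where "N = sqrt (a + b) * sqrt B"
  let ?F = "lattice_points a b \<xi> \<eta> B"
  let ?U = "\<Union>p\<in>?F. cell p"
  have N: "N \<ge> 0" and w: "w \<ge> 0" using assms by (auto simp: N_def w_def)
  have d: "\<delta> = 2 * N * w + w\<^sup>2" by (simp add: \<delta>_def N_def w_def)
  have d0: "\<delta> \<ge> 0" using N w by (simp add: d)
  have A0: "A \<ge> 0" by (simp add: A_def)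
  have fin: "finite ?F" by (rule finite_lattice_points[OF ab D])
  have U: "measure lborel ?U = real (card ?F)"
  proof -
    have "measure lborel ?U = (\<Sum>p\<in>?F. measure lborel (cell p))"
      using fin by (intro measure_finite_Union)
        (auto simp: disjoint_family_on_def emeasure_cell set_eq_iff mem_cell_iff prod_eq_iff)
    then show ?thesis by (simp add: measure_def emeasure_cell)
  qed
  have Usets: "?U \<in> sets lborel" using fin by auto
  have Ufm: "?U \<in> fmeasurable lborel"
    using fin by (intro fmeasurable.finite_UN) (auto simp: fmeasurable_def emeasure_cell)
  have diff: "norm (lin \<xi> \<eta> (x - ipt p)) \<le> w" "norm (lin \<xi> \<eta> (ipt p - x)) \<le> w" if "x \<in> cell p" for x p
  proof -
    have *: "\<bar>fst x - of_int (fst p)\<bar> \<le> 1" "\<bar>snd x - of_int (snd p)\<bar> \<le> 1"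
      using that unfolding mem_cell_iff by linarith+
    have "norm (lin \<xi> \<eta> y) \<le> w" if "\<bar>fst y\<bar> \<le> 1" "\<bar>snd y\<bar> \<le> 1" for y
    proof -
      have "norm (lin \<xi> \<eta> y) \<le> \<bar>fst y\<bar> * norm \<xi> + \<bar>snd y\<bar> * norm \<eta>"
        unfolding lin_def by (rule order_trans[OF norm_triangle_ineq]) (simp add: norm_mult)
      also have "\<dots> \<le> 1 * norm \<xi> + 1 * norm \<eta>"
        using that by (intro add_mono mult_right_mono) auto
      finally show ?thesis by (simp add: w_def)
    qed
    from this[of "x - ipt p"] this[of "ipt p - x"] *
    show "norm (lin \<xi> \<eta> (x - ipt p)) \<le> w" "norm (lin \<xi> \<eta> (ipt p - x)) \<le> w"
      by (simp_all add: ipt_def abs_minus_commute)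
  qed
  have upper: "?U \<subseteq> region a b \<xi> \<eta> (B + \<delta>)"
  proof
    fix x assume "x \<in> ?U"
    then obtain p where p: "p \<in> ?F" "x \<in> cell p" by auto
    have h: "hgt a b (lin \<xi> \<eta> (ipt p)) \<le> B" using p by (simp add: lattice_points_def)
    have n: "norm (lin \<xi> \<eta> (ipt p)) \<le> N" unfolding N_def by (rule norm_le_hgt[OF ab h])
    let ?e = "lin \<xi> \<eta> (x - ipt p)"
    have "hgt a b (lin \<xi> \<eta> x) = hgt a b (lin \<xi> \<eta> (ipt p) + ?e)" by (simp flip: lin_add)
    also have "\<dots> \<le> hgt a b (lin \<xi> \<eta> (ipt p)) + 2 * norm (lin \<xi> \<eta> (ipt p)) * norm ?e + (norm ?e)\<^sup>2"
      by (rule hgt_add_le[OF ab])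
    also have "\<dots> \<le> B + 2 * N * w + w\<^sup>2"
      using h n diff(1)[OF p(2)] N w by (intro add_mono mult_mono power_mono) auto
    finally show "x \<in> region a b \<xi> \<eta> (B + \<delta>)" by (simp add: region_def d)
  qed
  have "real (card ?F) \<le> measure lborel (region a b \<xi> \<eta> (B + \<delta>))"
    unfolding U[symmetric] by (rule measure_mono_fmeasurable[OF upper Usets region_fmeasurable[OF ab D]])
  also have "\<dots> = (B + \<delta>) * A"
    unfolding A_def using B d0 by (intro measure_region_scale[OF ab D]) auto
  finally have up: "real (card ?F) - A * B \<le> A * \<delta>" by (simp add: algebra_simps)
  have low: "A * B - real (card ?F) \<le> A * \<delta>"
  proof (cases "\<delta> < B")
    case True
    have "region a b \<xi> \<eta> (B - \<delta>) \<subseteq> ?U"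
    proof
      fix x assume x: "x \<in> region a b \<xi> \<eta> (B - \<delta>)"
      define p where "p = (\<lfloor>fst x\<rfloor>, \<lfloor>snd x\<rfloor>)"
      have xp: "x \<in> cell p" by (simp add: mem_cell_iff p_def)
      have h: "hgt a b (lin \<xi> \<eta> x) \<le> B - \<delta>" using x by (simp add: region_def)
      have n: "norm (lin \<xi> \<eta> x) \<le> N" unfolding N_def using h d0 by (intro norm_le_hgt[OF ab]) auto
      let ?e = "lin \<xi> \<eta> (ipt p - x)"
      have "hgt a b (lin \<xi> \<eta> (ipt p)) = hgt a b (lin \<xi> \<eta> x + ?e)" by (simp flip: lin_add)
      also have "\<dots> \<le> hgt a b (lin \<xi> \<eta> x) + 2 * norm (lin \<xi> \<eta> x) * norm ?e + (norm ?e)\<^sup>2"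
        by (rule hgt_add_le[OF ab])
      also have "\<dots> \<le> (B - \<delta>) + 2 * N * w + w\<^sup>2"
        using h n diff(2)[OF xp] N w by (intro add_mono mult_mono power_mono) auto
      finally have "p \<in> ?F" by (simp add: lattice_points_def d)
      then show "x \<in> ?U" using xp by blast
    qed
    then have "measure lborel (region a b \<xi> \<eta> (B - \<delta>)) \<le> measure lborel ?U"
      using region_fmeasurable[OF ab D, of "B - \<delta>"] by (intro measure_mono_fmeasurable Ufm fmeasurableD)
    moreover have "measure lborel (region a b \<xi> \<eta> (B - \<delta>)) = (B - \<delta>) * A"
      unfolding A_def using True by (intro measure_region_scale[OF ab D]) auto
    ultimately show ?thesis using U by (simp add: algebra_simps)
  next
    case False
    \<comment> \<open>No inner region of positive height is available here, but the main term itself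
      does not exceed the permitted error.\<close>
    then have "A * B \<le> A * \<delta>" using A0 by (intro mult_left_mono) auto
    then show ?thesis by linarith
  qed
  from up low show ?thesis by linarith
qed

section \<open>Areas of hyperbolic sectors and linear changes of variables\<close>

definition vpair :: "real^2 \<Rightarrow> real \<times> real" where "vpair v = (v $ 1, v $ 2)"
definition pairv :: "real \<times> real \<Rightarrow> real^2" where "pairv p = vector [fst p, snd p]"

lemma vpair_pairv [simp]: "vpair (pairv p) = p" "pairv (vpair v) = v"
  by (auto simp: vpair_def pairv_def vec_eq_iff forall_2)

text \<open>Transfers areas between pairs of reals, where the regions live, and real^2, where
  determinants of linear maps act.\<close>

lemma lborel_vpair: "distr lborel borel vpair = lborel"
proof (rule lborel_eqI[symmetric])
  have meas: "vpair \<in> borel_measurable lborel"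
    unfolding vpair_def by (intro borel_measurable_Pair) simp_all
  have basis: "(Basis :: (real^2) set) = {axis 1 1, axis 2 1}" "axis 1 1 \<noteq> (axis 2 1 :: real^2)"
    by (auto simp: Basis_vec_def UNIV_2 axis_eq_axis)
  fix l u :: "real \<times> real" assume le: "\<And>b. b \<in> Basis \<Longrightarrow> l \<bullet> b \<le> u \<bullet> b"
  have lu: "fst l \<le> fst u" "snd l \<le> snd u"
    using le[of "(1, 0)"] le[of "(0, 1)"] by (auto simp: Basis_prod_def inner_prod_def)
  have "vpair -` box l u = box (pairv l) (pairv u)"
    by (auto simp: vpair_def pairv_def mem_box Basis_prod_def Basis_vec_def inner_axis forall_2 inner_prod_def UNIV_2)
  then have "emeasure (distr lborel borel vpair) (box l u) = emeasure lborel (box (pairv l) (pairv u))"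
    using meas by (simp add: emeasure_distr)
  also have "\<dots> = ennreal (\<Prod>b\<in>Basis. (pairv u - pairv l) \<bullet> b)"
    using lu by (intro emeasure_lborel_box) (auto simp: basis inner_axis pairv_def)
  also have "(\<Prod>b\<in>Basis. (pairv u - pairv l) \<bullet> b) = (fst u - fst l) * (snd u - snd l)"
    by (simp add: basis inner_axis pairv_def)
  also have "\<dots> = (\<Prod>b\<in>Basis. (u - l) \<bullet> b)"
    by (simp add: Basis_prod_def prod.union_disjoint inner_prod_def)
  finally show "emeasure (distr lborel borel vpair) (box l u) = ennreal (\<Prod>b\<in>Basis. (u - l) \<bullet> b)" .
qed simp

lemma closed_sector: "closed {(p, q). 0 \<le> p \<and> \<kappa>1 * p \<le> q \<and> q \<le> \<kappa>2 * p \<and> p * q \<le> (c::real)}"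
proof -
  have "{(p, q). 0 \<le> p \<and> \<kappa>1 * p \<le> q \<and> q \<le> \<kappa>2 * p \<and> p * q \<le> c} =
    {x. 0 \<le> fst x} \<inter> {x. \<kappa>1 * fst x \<le> snd x} \<inter> {x. snd x \<le> \<kappa>2 * fst x} \<inter> {x. fst x * snd x \<le> c}"
    by auto
  also have "closed \<dots>" by (intro closed_Int closed_Collect_le continuous_intros)
  finally show ?thesis .
qed

text \<open>Integration of the vertical slices. Up to \<open>p1\<close>, where the upper ray meets
  the hyperbola p q = c, a slice runs between the two rays; from there to \<open>p2\<close>, where
  the lower ray meets it, a slice runs from the lower ray to the hyperbola.\<close>

lemma emeasure_sector:
  fixes c :: real
  assumes "0 < \<kappa>1" "\<kappa>1 \<le> \<kappa>2" "c > 0"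
  shows "emeasure lborel {(p, q). 0 \<le> p \<and> \<kappa>1 * p \<le> q \<and> q \<le> \<kappa>2 * p \<and> p * q \<le> c} = ennreal (c / 2 * ln (\<kappa>2 / \<kappa>1))"
    (is "emeasure lborel ?S = _")
proof -
  define p1 where "p1 = sqrt (c / \<kappa>2)"
  define p2 where "p2 = sqrt (c / \<kappa>1)"
  have k: "\<kappa>2 > 0" using assms by simp
  have p1: "p1 > 0" "p1\<^sup>2 = c / \<kappa>2" using assms k by (auto simp: p1_def)
  have p2: "p2 > 0" "p2\<^sup>2 = c / \<kappa>1" using assms by (auto simp: p2_def)
  have p12: "p1 \<le> p2" unfolding p1_def p2_def using assms k by (intro real_sqrt_le_mono divide_left_mono) auto
  \<comment> \<open>At p = \<open>p1\<close> both indicators are 1 and the formula would count the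
    slice twice; a single point does not affect the integral.\<close>
  have slice: "emeasure lborel (Pair p -` ?S) =
      ennreal ((\<kappa>2 - \<kappa>1) * p) * indicator {0..p1} p + ennreal (c / p - \<kappa>1 * p) * indicator {p1..p2} p"
    if np: "p \<noteq> p1" for p
  proof -
    consider "p < 0" | "p = 0" | "0 < p" "p < p1" | "p1 < p" "p \<le> p2" | "p > p2" using np by linarith
    then show ?thesis
    proof cases
      case 1
      then have "Pair p -` ?S = {}" by auto
      then show ?thesis using 1 p1 by simp
    next
      case 2
      then have "Pair p -` ?S = {0}" using assms by auto
      then show ?thesis using 2 p1 by simp
    next
      case 3
      have "p\<^sup>2 < p1\<^sup>2" using 3 by (intro power_strict_mono) auto
      then have "\<kappa>2 * p\<^sup>2 < c" using p1 k by (simp add: field_simps)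
      then have "p * q \<le> c" if "q \<le> \<kappa>2 * p" for q
      proof -
        have "p * q \<le> p * (\<kappa>2 * p)" using that 3 by (intro mult_left_mono) auto
        also have "\<dots> = \<kappa>2 * p\<^sup>2" by (simp add: power2_eq_square)
        finally show ?thesis using \<open>\<kappa>2 * p\<^sup>2 < c\<close> by linarith
      qed
      then have "Pair p -` ?S = {\<kappa>1 * p..\<kappa>2 * p}" using 3 by auto
      moreover have "\<kappa>1 * p \<le> \<kappa>2 * p" using 3 assms by (intro mult_right_mono) auto
      ultimately show ?thesis using 3 by (simp add: algebra_simps)
    next
      case 4
      have "p1\<^sup>2 < p\<^sup>2" using 4 p1(1) by (intro power_strict_mono) auto
      moreover have "p\<^sup>2 \<le> p2\<^sup>2" using 4 p1(1) by (intro power_mono) auto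
      ultimately have c: "c < \<kappa>2 * p\<^sup>2" "\<kappa>1 * p\<^sup>2 \<le> c" using p1 p2 k assms by (simp_all add: field_simps)
      have p0: "p > 0" using 4 p1 by simp
      have "q \<le> \<kappa>2 * p" if "q \<le> c / p" for q
      proof -
        have "c / p < \<kappa>2 * p" using c(1) p0 by (simp add: pos_divide_less_eq power2_eq_square mult.assoc)
        then show ?thesis using that by linarith
      qed
      moreover have "p * q \<le> c \<longleftrightarrow> q \<le> c / p" for q
        using p0 by (simp add: pos_le_divide_eq mult.commute)
      ultimately have "Pair p -` ?S = {\<kappa>1 * p..c / p}" using p0 by auto
      moreover have "\<kappa>1 * p \<le> c / p" using c p0 by (simp add: field_simps power2_eq_square)
      ultimately show ?thesis using 4 by simp
    next
      case 5
      have p0: "p > 0" using 5 p2 by simp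
      have "p2\<^sup>2 < p\<^sup>2" using 5 p2 by (intro power_strict_mono) auto
      then have "c < \<kappa>1 * p\<^sup>2" using p2 assms by (simp add: field_simps)
      then have "p * q > c" if "\<kappa>1 * p \<le> q" for q
      proof -
        have "p * (\<kappa>1 * p) \<le> p * q" using that p0 by (intro mult_left_mono) auto
        moreover have "p * (\<kappa>1 * p) = \<kappa>1 * p\<^sup>2" by (simp add: power2_eq_square)
        ultimately show ?thesis using \<open>c < \<kappa>1 * p\<^sup>2\<close> by linarith
      qed
      then have e: "Pair p -` ?S = {}" by force
      show ?thesis unfolding e using 5 p12 by simp
    qed
  qed
  have "emeasure lborel ?S = (\<integral>\<^sup>+p. emeasure lborel (Pair p -` ?S) \<partial>lborel)"
    using closed_sector[of \<kappa>1 \<kappa>2 c] lborel.emeasure_pair_measure_alt[of ?S lborel]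
    unfolding lborel_prod by (simp add: borel_closed)
  also have "\<dots> = (\<integral>\<^sup>+p. ennreal ((\<kappa>2 - \<kappa>1) * p) * indicator {0..p1} p + ennreal (c / p - \<kappa>1 * p) * indicator {p1..p2} p \<partial>lborel)"
    by (intro nn_integral_cong_AE eventually_mono[OF AE_lborel_singleton[of p1]] slice)
  also have "\<dots> = (\<integral>\<^sup>+p. ennreal ((\<kappa>2 - \<kappa>1) * p) * indicator {0..p1} p \<partial>lborel)
      + (\<integral>\<^sup>+p. ennreal (c / p - \<kappa>1 * p) * indicator {p1..p2} p \<partial>lborel)"
    by (rule nn_integral_add) auto
  also have "(\<integral>\<^sup>+p. ennreal ((\<kappa>2 - \<kappa>1) * p) * indicator {0..p1} p \<partial>lborel)
      = ennreal ((\<kappa>2 - \<kappa>1) * p1\<^sup>2 / 2 - (\<kappa>2 - \<kappa>1) * 0\<^sup>2 / 2)"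
    using assms p1 by (intro nn_integral_FTC_Icc[where F = "\<lambda>p. (\<kappa>2 - \<kappa>1) * p\<^sup>2 / 2"])
      (auto intro!: derivative_eq_intros simp: mult_nonneg_nonneg)
  also have "(\<integral>\<^sup>+p. ennreal (c / p - \<kappa>1 * p) * indicator {p1..p2} p \<partial>lborel)
      = ennreal ((c * ln p2 - \<kappa>1 * p2\<^sup>2 / 2) - (c * ln p1 - \<kappa>1 * p1\<^sup>2 / 2))"
  proof (rule nn_integral_FTC_Icc[where F = "\<lambda>p. c * ln p - \<kappa>1 * p\<^sup>2 / 2"])
    fix p assume "p \<in> {p1..p2}"
    then have p: "p1 \<le> p" "p \<le> p2" by auto
    then have "p > 0" "p\<^sup>2 \<le> p2\<^sup>2" using p1(1) by (auto intro: power_mono)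
    then have "\<kappa>1 * p\<^sup>2 \<le> c" using p2(2) assms by (simp add: field_simps)
    then show "0 \<le> c / p - \<kappa>1 * p" using \<open>p > 0\<close> by (simp add: field_simps power2_eq_square)
    show "((\<lambda>p. c * ln p - \<kappa>1 * p\<^sup>2 / 2) has_real_derivative c / p - \<kappa>1 * p) (at p)"
      using \<open>p > 0\<close> by (auto intro!: derivative_eq_intros)
  qed (use p12 in auto)
  also have "ennreal ((\<kappa>2 - \<kappa>1) * p1\<^sup>2 / 2 - (\<kappa>2 - \<kappa>1) * 0\<^sup>2 / 2) + ennreal ((c * ln p2 - \<kappa>1 * p2\<^sup>2 / 2) - (c * ln p1 - \<kappa>1 * p1\<^sup>2 / 2))
      = ennreal (c / 2 * ln (\<kappa>2 / \<kappa>1))"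
  proof -
    have l1: "ln p1 = (ln c - ln \<kappa>2) / 2" "ln p2 = (ln c - ln \<kappa>1) / 2"
      unfolding p1_def p2_def using assms k by (simp_all add: ln_sqrt ln_div)
    have e: "\<kappa>1 * p2\<^sup>2 = c" "\<kappa>2 * p1\<^sup>2 = c" using p1 p2 assms k by auto
    have e2: "(c * ln p2 - \<kappa>1 * p2\<^sup>2 / 2) - (c * ln p1 - \<kappa>1 * p1\<^sup>2 / 2) =
        c / 2 * ln (\<kappa>2 / \<kappa>1) - (\<kappa>2 - \<kappa>1) * p1\<^sup>2 / 2"
    proof -
      have l2: "ln (\<kappa>2 / \<kappa>1) = ln \<kappa>2 - ln \<kappa>1" "(\<kappa>2 - \<kappa>1) * p1\<^sup>2 = c - \<kappa>1 * p1\<^sup>2"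
        using assms k e by (simp_all add: ln_div left_diff_distrib)
      show ?thesis unfolding l1 e l2 by (simp add: field_simps)
    qed
    \<comment> \<open>Two \<open>ennreal\<close> values may be added under the coercion only if both
      arguments are nonnegative. For this one it follows from ln x <= x - 1 at x = p1^2 /
      p2^2.\<close>
    have "0 \<le> (c * ln p2 - \<kappa>1 * p2\<^sup>2 / 2) - (c * ln p1 - \<kappa>1 * p1\<^sup>2 / 2)"
    proof -
      have "1 - p1\<^sup>2 / p2\<^sup>2 \<le> - ln (p1\<^sup>2 / p2\<^sup>2)" 
        using ln_le_minus_one[of "p1\<^sup>2 / p2\<^sup>2"] p1(1) p2(1) by simp
      also have "- ln (p1\<^sup>2 / p2\<^sup>2) = 2 * (ln p2 - ln p1)"
        using p1(1) p2(1) by (simp add: ln_div ln_realpow)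
      finally have "c * (1 - p1\<^sup>2 / p2\<^sup>2) \<le> c * (2 * (ln p2 - ln p1))"
        using assms by (intro mult_left_mono) auto
      moreover have "c * (1 - p1\<^sup>2 / p2\<^sup>2) = \<kappa>1 * p2\<^sup>2 - \<kappa>1 * p1\<^sup>2"
        using assms p2 by (simp add: field_simps)
      ultimately show ?thesis by (simp add: algebra_simps)
    qed
    moreover have "(\<kappa>2 - \<kappa>1) * p1\<^sup>2 / 2 \<ge> 0" using assms by simp
    ultimately show ?thesis unfolding e2 by (subst ennreal_plus[symmetric]) auto
  qed
  finally show ?thesis .
qed

text \<open>The preimage of S is the image of S under the inverse map, written as \<open>M\<close>
  on real^2, where the determinant 1 / e governs the area.\<close>

lemma measure_linear_preimage:
  fixes S :: "(real \<times> real) set" and \<alpha> \<beta> \<gamma> \<delta> :: real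
  defines "T \<equiv> \<lambda>(x, y). (\<alpha> * x + \<beta> * y, \<gamma> * x + \<delta> * y)"
  assumes det: "\<alpha> * \<delta> - \<beta> * \<gamma> \<noteq> 0" and S: "S \<in> fmeasurable lborel"
  shows "T -` S \<in> fmeasurable lborel"
    and "\<bar>\<alpha> * \<delta> - \<beta> * \<gamma>\<bar> * measure lborel (T -` S) = measure lborel S"
proof -
  define e where "e = \<alpha> * \<delta> - \<beta> * \<gamma>"
  define M :: "real^2 \<Rightarrow> real^2" where
    "M v = vector [(\<delta> * (v $ 1) - \<beta> * (v $ 2)) / e, (- \<gamma> * (v $ 1) + \<alpha> * (v $ 2)) / e]" for v
  have e: "e \<noteq> 0" using det by (simp add: e_def)
  have lin: "linear M"
    by (rule linearI) (auto simp: M_def vec_eq_iff forall_2 algebra_simps add_divide_distrib diff_divide_distrib)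
  have detM: "det (matrix M) = 1 / e"
  proof -
    have "det (matrix M) = \<delta> / e * (\<alpha> / e) - \<beta> / e * (\<gamma> / e)"
      by (simp add: det_2 matrix_def M_def axis_def)
    also have "\<dots> = (\<delta> * \<alpha> - \<beta> * \<gamma>) / (e * e)" by (simp add: diff_divide_distrib)
    also have "\<delta> * \<alpha> - \<beta> * \<gamma> = e" by (simp add: e_def)
    finally show ?thesis using e by simp
  qed
  have meas: "vpair \<in> borel_measurable borel"
    unfolding vpair_def by (intro borel_measurable_Pair) simp_all
  have vp: "emeasure lborel X = emeasure lborel (vpair -` X)" "vpair -` X \<in> sets borel" if "X \<in> sets borel" for X
  proof -
    show "emeasure lborel X = emeasure lborel (vpair -` X)"
      using that meas by (subst lborel_vpair[symmetric], subst emeasure_distr) auto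
    show "vpair -` X \<in> sets borel" by (rule measurable_sets_borel[OF meas that])
  qed
  have Sb: "S \<in> sets borel" using S by auto
  have Tm: "T \<in> borel_measurable borel"
    unfolding T_def case_prod_unfold by (intro borel_measurable_continuous_onI continuous_intros)
  have Tb: "T -` S \<in> sets borel" using Tm Sb by (rule measurable_sets_borel)
  have MT: "M (pairv (T p)) = pairv p" "T (vpair (M v)) = vpair v" for p v
  proof -
    have "(\<delta> * (\<alpha> * x + \<beta> * y) - \<beta> * (\<gamma> * x + \<delta> * y)) / e = x" "(- \<gamma> * (\<alpha> * x + \<beta> * y) + \<alpha> * (\<gamma> * x + \<delta> * y)) / e = y" for x y
    proof -
      have "\<delta> * (\<alpha> * x + \<beta> * y) - \<beta> * (\<gamma> * x + \<delta> * y) = e * x" "- \<gamma> * (\<alpha> * x + \<beta> * y) + \<alpha> * (\<gamma> * x + \<delta> * y) = e * y"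
        by (simp_all add: e_def algebra_simps)
      then show "(\<delta> * (\<alpha> * x + \<beta> * y) - \<beta> * (\<gamma> * x + \<delta> * y)) / e = x" "(- \<gamma> * (\<alpha> * x + \<beta> * y) + \<alpha> * (\<gamma> * x + \<delta> * y)) / e = y"
        using e by simp_all
    qed
    then show "M (pairv (T p)) = pairv p" by (cases p) (simp add: M_def pairv_def T_def)
    have "\<alpha> * ((\<delta> * x - \<beta> * y) / e) + \<beta> * ((- \<gamma> * x + \<alpha> * y) / e) = x" "\<gamma> * ((\<delta> * x - \<beta> * y) / e) + \<delta> * ((- \<gamma> * x + \<alpha> * y) / e) = y" for x y
    proof -
      have "\<alpha> * (\<delta> * x - \<beta> * y) + \<beta> * (- \<gamma> * x + \<alpha> * y) = e * x" "\<gamma> * (\<delta> * x - \<beta> * y) + \<delta> * (- \<gamma> * x + \<alpha> * y) = e * y"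
        by (simp_all add: e_def algebra_simps)
      then show "\<alpha> * ((\<delta> * x - \<beta> * y) / e) + \<beta> * ((- \<gamma> * x + \<alpha> * y) / e) = x" "\<gamma> * ((\<delta> * x - \<beta> * y) / e) + \<delta> * ((- \<gamma> * x + \<alpha> * y) / e) = y"
        using e unfolding times_divide_eq_right add_divide_distrib[symmetric] by simp_all
    qed
    then show "T (vpair (M v)) = vpair v" by (simp add: M_def vpair_def T_def)
  qed
  have im: "M ` (vpair -` S) = vpair -` (T -` S)"
  proof (intro equalityI subsetI)
    fix v assume "v \<in> M ` (vpair -` S)"
    then show "v \<in> vpair -` (T -` S)" using MT(2) by auto
  next
    fix v assume v: "v \<in> vpair -` (T -` S)"
    have "M (pairv (T (vpair v))) = v" by (simp add: MT)
    then show "v \<in> M ` (vpair -` S)" using v by (metis imageI vimageI2 vpair_pairv(1) vimageD)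
  qed
  have Sl: "vpair -` S \<in> lmeasurable"
    using S vp[OF Sb] by (auto simp: fmeasurable_def)
  have Ml: "vpair -` (T -` S) \<in> lmeasurable"
    using measurable_linear_image[OF lin Sl] im by simp
  then show Tf: "T -` S \<in> fmeasurable lborel"
    using vp[OF Tb] Tb by (auto simp: fmeasurable_def)
  have "measure lborel (T -` S) = measure lebesgue (vpair -` (T -` S))"
    using vp[OF Tb] by (simp add: measure_def)
  also have "\<dots> = \<bar>1 / e\<bar> * measure lebesgue (vpair -` S)"
    using measure_linear_image[OF lin Sl] im detM by simp
  also have "measure lebesgue (vpair -` S) = measure lborel S"
    using vp[OF Sb] by (simp add: measure_def)
  finally show "\<bar>\<alpha> * \<delta> - \<beta> * \<gamma>\<bar> * measure lborel (T -` S) = measure lborel S"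
    using e unfolding e_def[symmetric] by (simp add: abs_divide)
qed

section \<open>The region cut out by the two forms\<close>

text \<open>This is \<open>sigma_infty\<close> times sqrt(a b); the covolume of the lattices will
  supply the factor 1 / sqrt(a b).\<close>

definition area_const :: "real \<Rightarrow> real \<Rightarrow> real" where
  "area_const a b = 2 * sqrt a * arsinh (sqrt (b / a)) + 2 * sqrt b * arsinh (sqrt (a / b))"

lemma negligible_line: 
  assumes "u \<noteq> 0 \<or> w \<noteq> 0"
  shows "negligible {(x::real, y::real). u * x + w * y = 0}"
proof -
  have "{(x, y). u * x + w * y = 0} = {p. (u, w) \<bullet> p = 0}" by (auto simp: inner_prod_def)
  then show ?thesis using assms negligible_hyperplane[of "(u, w)" 0] by (auto simp: zero_prod_def)
qed

text \<open>The region is bounded by the hyperbolas x^2 - y^2 = +-sqrt(a) and 2 x y = +-sqrt(b). The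
  rays y = k x and x = k y cut its part in the first quadrant into three pieces, each bounded by two
  rays and a single hyperbola. In the coordinates x - y and x + y the form x^2 - y^2 becomes a
  product too, so \<open>emeasure_sector\<close> applies to every piece.\<close>

lemma measure_unit_region:
  assumes ab: "a \<ge> 1" "b \<ge> 1"
  shows "measure lborel (region a b 1 \<i> 1) = area_const a b"
proof -
  define \<alpha> where "\<alpha> = sqrt a"
  define \<beta> where "\<beta> = sqrt b"
  \<comment> \<open>Chosen so that the ray y = k x passes through the common point of x^2 - y^2 =
    \<open>\<alpha>\<close> and 2 x y = \<open>\<beta>\<close>, which is the relation
    \<open>keq\<close>. Then \<open>\<kappa>\<close> is the slope of this ray in the coordinates x -
    y and x + y.\<close>
  define k where "k = exp (- arsinh (\<alpha> / \<beta>))"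
  define \<kappa> where "\<kappa> = (1 + k) / (1 - k)"
  have pos: "\<alpha> > 0" "\<beta> > 0" using ab by (auto simp: \<alpha>_def \<beta>_def)
  have k0: "k > 0" by (simp add: k_def)
  have "arsinh (\<alpha> / \<beta>) > 0" using pos by simp
  then have k1: "k < 1" by (simp add: k_def)
  have lk: "ln (1 / k) = arsinh (\<alpha> / \<beta>)" by (simp add: k_def ln_div)
  have keq: "\<beta> * (1 - k\<^sup>2) = 2 * \<alpha> * k"
  proof -
    have "sinh (arsinh (\<alpha> / \<beta>)) = (1 / k - k) / 2"
      by (simp add: sinh_field_def k_def exp_minus inverse_eq_divide)
    then have "\<alpha> / \<beta> = (1 / k - k) / 2" by simp
    then show ?thesis using pos k0 by (simp add: field_simps power2_eq_square)
  qed
  have \<kappa>1: "\<kappa> \<ge> 1" using k0 k1 by (simp add: \<kappa>_def field_simps)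
  have l\<kappa>: "ln \<kappa> = arsinh (\<beta> / \<alpha>)"
  proof -
    have "sinh (ln \<kappa>) = (\<kappa> - 1 / \<kappa>) / 2"
      using \<kappa>1 by (simp add: sinh_field_def exp_minus inverse_eq_divide)
    also have "\<dots> = 2 * k / (1 - k\<^sup>2)"
    proof -
      have "1 - k \<noteq> 0" "1 + k \<noteq> 0" using k0 k1 by auto
      then have "\<kappa> - 1 / \<kappa> = ((1 + k)\<^sup>2 - (1 - k)\<^sup>2) / ((1 - k) * (1 + k))"
        by (simp add: \<kappa>_def diff_frac_eq power2_eq_square)
      also have "(1 + k)\<^sup>2 - (1 - k)\<^sup>2 = 4 * k" by (simp add: power2_eq_square algebra_simps)
      also have "(1 - k) * (1 + k) = 1 - k\<^sup>2" by (simp add: power2_eq_square algebra_simps)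
      finally have "\<kappa> - 1 / \<kappa> = 2 * (2 * k / (1 - k\<^sup>2))" by simp
      then show ?thesis by (simp only: nonzero_mult_div_cancel_left zero_neq_numeral not_False_eq_True)
    qed
    also have "\<dots> = \<beta> / \<alpha>"
    proof -
      have "1 - k\<^sup>2 > 0" using k0 k1 by (simp add: power_less_one_iff abs_square_less_1)
      then show ?thesis using keq pos by (simp add: field_simps)
    qed
    finally show ?thesis by (metis arsinh_sinh_real)
  qed
  define Sec where "Sec \<kappa>1 \<kappa>2 c = {(p, q). 0 \<le> p \<and> \<kappa>1 * p \<le> q \<and> q \<le> \<kappa>2 * p \<and> p * q \<le> c}" for \<kappa>1 \<kappa>2 c :: real
  have Sec: "Sec \<kappa>1 \<kappa>2 c \<in> fmeasurable lborel" "measure lborel (Sec \<kappa>1 \<kappa>2 c) = c / 2 * ln (\<kappa>2 / \<kappa>1)"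
    if "0 < \<kappa>1" "\<kappa>1 \<le> \<kappa>2" "c > 0" for \<kappa>1 \<kappa>2 c
  proof -
    have e: "emeasure lborel (Sec \<kappa>1 \<kappa>2 c) = ennreal (c / 2 * ln (\<kappa>2 / \<kappa>1))"
      unfolding Sec_def by (rule emeasure_sector[OF that])
    show "Sec \<kappa>1 \<kappa>2 c \<in> fmeasurable lborel"
      using e closed_sector[of \<kappa>1 \<kappa>2 c] by (auto simp: fmeasurable_def Sec_def borel_closed)
    have "0 \<le> c / 2 * ln (\<kappa>2 / \<kappa>1)" using that by (intro mult_nonneg_nonneg) auto
    then show "measure lborel (Sec \<kappa>1 \<kappa>2 c) = c / 2 * ln (\<kappa>2 / \<kappa>1)"
      using e by (simp add: measure_def)
  qed
  have leb: "S \<in> lmeasurable" "measure lebesgue S = measure lborel S" if "S \<in> fmeasurable lborel" for S :: "(real \<times> real) set"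
  proof -
    have "S \<in> sets lborel" "emeasure lborel S < \<infinity>" using that by (auto simp: fmeasurable_def)
    then show "S \<in> lmeasurable" "measure lebesgue S = measure lborel S"
      by (auto simp: fmeasurable_def)
  qed
  define Q1 where "Q1 = {(x::real, y::real). 0 \<le> y \<and> y \<le> k * x \<and> x\<^sup>2 - y\<^sup>2 \<le> \<alpha>}"
  define Q2 where "Q2 = Sec k (1 / k) (\<beta> / 2)"
  define Q3 where "Q3 = {(x::real, y::real). 0 \<le> x \<and> x \<le> k * y \<and> y\<^sup>2 - x\<^sup>2 \<le> \<alpha>}"
  define Q where "Q = {(x::real, y::real). 0 \<le> x \<and> 0 \<le> y \<and> \<bar>x\<^sup>2 - y\<^sup>2\<bar> \<le> \<alpha> \<and> \<bar>2 * x * y\<bar> \<le> \<beta>}"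
  have cone: "x - y \<ge> 0 \<and> x - y \<le> x + y \<and> x + y \<le> \<kappa> * (x - y) \<longleftrightarrow> 0 \<le> y \<and> y \<le> k * x" for x y
  proof -
    have "x + y \<le> \<kappa> * (x - y) \<longleftrightarrow> (x + y) * (1 - k) \<le> (1 + k) * (x - y)"
      using k1 by (simp add: \<kappa>_def pos_le_divide_eq)
    also have "\<dots> \<longleftrightarrow> y \<le> k * x" by (auto simp: algebra_simps)
    finally have *: "x + y \<le> \<kappa> * (x - y) \<longleftrightarrow> y \<le> k * x" .
    have "y \<le> x" if "0 \<le> y" "y \<le> k * x"
    proof -
      have "0 \<le> k * x" using that by linarith
      then have "x \<ge> 0" using k0 by (simp add: zero_le_mult_iff)
      then have "k * x \<le> x" using mult_right_mono[of k 1 x] k1 by simp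
      then show ?thesis using that by linarith
    qed
    then show ?thesis unfolding * by auto
  qed
  have QS: "(x, y) \<in> Q1 \<longleftrightarrow> (x - y, x + y) \<in> Sec 1 \<kappa> \<alpha>" for x y
  proof -
    have "(x - y, x + y) \<in> Sec 1 \<kappa> \<alpha> \<longleftrightarrow> (x - y \<ge> 0 \<and> x - y \<le> x + y \<and> x + y \<le> \<kappa> * (x - y)) \<and> (x - y) * (x + y) \<le> \<alpha>"
      by (auto simp: Sec_def)
    also have "(x - y) * (x + y) = x\<^sup>2 - y\<^sup>2" by (simp add: power2_eq_square algebra_simps)
    finally show ?thesis unfolding cone by (simp add: Q1_def)
  qed
  have Q1T: "Q1 = (\<lambda>(x, y). (1 * x + (- 1) * y, 1 * x + 1 * y)) -` Sec 1 \<kappa> \<alpha>"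
    using QS by auto
  have Q3T: "Q3 = (\<lambda>(x, y). ((- 1) * x + 1 * y, 1 * x + 1 * y)) -` Sec 1 \<kappa> \<alpha>"
  proof -
    have "(x, y) \<in> Q3 \<longleftrightarrow> (y, x) \<in> Q1" for x y by (auto simp: Q1_def Q3_def)
    then show ?thesis using QS by (auto simp: add.commute)
  qed
  have S1: "Sec 1 \<kappa> \<alpha> \<in> fmeasurable lborel" "measure lborel (Sec 1 \<kappa> \<alpha>) = \<alpha> / 2 * ln \<kappa>"
    using Sec[of 1 \<kappa> \<alpha>] \<kappa>1 pos by auto
  have mQ1: "Q1 \<in> fmeasurable lborel" "measure lborel Q1 = \<alpha> / 4 * ln \<kappa>"
    using measure_linear_preimage[of 1 1 "- 1" 1 "Sec 1 \<kappa> \<alpha>"] S1 unfolding Q1T by auto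
  have mQ3: "Q3 \<in> fmeasurable lborel" "measure lborel Q3 = \<alpha> / 4 * ln \<kappa>"
    using measure_linear_preimage[of "- 1" 1 1 1 "Sec 1 \<kappa> \<alpha>"] S1 unfolding Q3T by auto
  have kk: "k \<le> 1 / k" using k0 k1 mult_le_one[of k k] by (simp add: pos_le_divide_eq)
  have mQ2: "Q2 \<in> fmeasurable lborel" "measure lborel Q2 = \<beta> / 2 * ln (1 / k)"
    using Sec[of k "1 / k" "\<beta> / 2"] k0 kk pos by (auto simp: Q2_def ln_div ln_mult)
  \<comment> \<open>Below the ray the bound on x^2 - y^2 implies the one on 2 x y, and above it the
    implication is reversed (\<open>ineq2\<close>); on the ray the two agree by
    \<open>keq\<close>.\<close>
  have ineq: "2 * x * y * \<alpha> \<le> \<beta> * (x\<^sup>2 - y\<^sup>2)" if "0 \<le> y" "y \<le> k * x" for x y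
  proof -
    have "0 \<le> k * x" using that by linarith
    then have x: "x \<ge> 0" using k0 by (simp add: zero_le_mult_iff)
    have "2 * x * y * \<alpha> \<le> 2 * x * (k * x) * \<alpha>" using that x pos by (intro mult_right_mono mult_left_mono) auto
    also have "\<dots> = 2 * \<alpha> * k * x\<^sup>2" by (simp add: power2_eq_square)
    also have "\<dots> = \<beta> * (1 - k\<^sup>2) * x\<^sup>2" by (simp only: keq)
    also have "\<dots> = \<beta> * (x\<^sup>2 - (k * x)\<^sup>2)" by (simp add: algebra_simps power_mult_distrib)
    also have "\<dots> \<le> \<beta> * (x\<^sup>2 - y\<^sup>2)" using pos that by (intro mult_left_mono diff_left_mono power_mono) auto
    finally show ?thesis .
  qed
  have ineq2: "\<beta> * (x\<^sup>2 - y\<^sup>2) \<le> 2 * x * y * \<alpha>" if "0 \<le> x" "k * x \<le> y" for x y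
  proof -
    have "\<beta> * (x\<^sup>2 - y\<^sup>2) \<le> \<beta> * (x\<^sup>2 - (k * x)\<^sup>2)"
      using pos that k0 by (intro mult_left_mono diff_left_mono power_mono) auto
    also have "\<dots> = \<beta> * (1 - k\<^sup>2) * x\<^sup>2" by (simp add: algebra_simps power_mult_distrib)
    also have "\<dots> = 2 * \<alpha> * k * x\<^sup>2" by (simp only: keq)
    also have "\<dots> = 2 * x * (k * x) * \<alpha>" by (simp add: power2_eq_square)
    also have "\<dots> \<le> 2 * x * y * \<alpha>" using that pos by (intro mult_right_mono mult_left_mono) auto
    finally show ?thesis .
  qed
  have le_trans_div: "u \<le> \<beta>" if "u * \<alpha> \<le> \<beta> * w" "w \<le> \<alpha>" for u w
  proof -
    have "u * \<alpha> \<le> \<beta> * \<alpha>" using that pos mult_left_mono[of w \<alpha> \<beta>] by linarith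
    then show ?thesis using pos by simp
  qed
  have le_trans_div2: "w \<le> \<alpha>" if "\<beta> * w \<le> u * \<alpha>" "u \<le> \<beta>" for u w
  proof -
    have "\<beta> * w \<le> \<beta> * \<alpha>" using that pos mult_right_mono[of u \<beta> \<alpha>] by linarith
    then show ?thesis using pos by simp
  qed
  have Q: "Q1 \<union> Q2 \<union> Q3 = Q"
  proof -
    have "(x, y) \<in> Q1 \<union> Q2 \<union> Q3 \<longleftrightarrow> (x, y) \<in> Q" for x y
    proof
      assume "(x, y) \<in> Q1 \<union> Q2 \<union> Q3"
      then consider "(x, y) \<in> Q1" | "(x, y) \<in> Q2" | "(x, y) \<in> Q3" by auto
      then show "(x, y) \<in> Q"
      proof cases
        case 1
        then have h: "0 \<le> y" "y \<le> k * x" "x\<^sup>2 - y\<^sup>2 \<le> \<alpha>" by (auto simp: Q1_def)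
        then have "y \<le> x" using cone[of x y] by auto
        moreover have "y\<^sup>2 \<le> x\<^sup>2" using h \<open>y \<le> x\<close> by (intro power_mono) auto
        moreover have "2 * x * y \<le> \<beta>" using ineq[OF h(1,2)] h(3) by (rule le_trans_div)
        ultimately show ?thesis using h pos by (auto simp: Q_def)
      next
        case 2
        then have h: "0 \<le> x" "k * x \<le> y" "y \<le> 1 / k * x" "2 * x * y \<le> \<beta>" by (auto simp: Q2_def Sec_def)
        have "0 \<le> k * x" using h(1) k0 by simp
        then have y: "y \<ge> 0" using h(2) by linarith
        have xy: "k * y \<le> x" using h(3) k0 by (simp add: field_simps)
        have "x\<^sup>2 - y\<^sup>2 \<le> \<alpha>" using ineq2[OF h(1,2)] h(4) by (rule le_trans_div2)
        moreover have "y\<^sup>2 - x\<^sup>2 \<le> \<alpha>" using ineq2[OF y xy] h(4) by (intro le_trans_div2[of _ "2 * x * y"]) (simp_all add: mult_ac)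
        ultimately show ?thesis using h y by (auto simp: Q_def)
      next
        case 3
        then have h: "0 \<le> x" "x \<le> k * y" "y\<^sup>2 - x\<^sup>2 \<le> \<alpha>" by (auto simp: Q3_def)
        then have "x \<le> y" using cone[of y x] by auto
        moreover have "x\<^sup>2 \<le> y\<^sup>2" using h \<open>x \<le> y\<close> by (intro power_mono) auto
        moreover have "2 * y * x \<le> \<beta>" using ineq[OF h(1,2)] h(3) by (rule le_trans_div)
        ultimately show ?thesis using h pos by (auto simp: Q_def mult_ac)
      qed
    next
      assume "(x, y) \<in> Q"
      then have h: "0 \<le> x" "0 \<le> y" "x\<^sup>2 - y\<^sup>2 \<le> \<alpha>" "y\<^sup>2 - x\<^sup>2 \<le> \<alpha>" "2 * x * y \<le> \<beta>" by (auto simp: Q_def)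
      have "y \<le> 1 / k * x" if "\<not> x \<le> k * y" using that k0 by (simp add: field_simps)
      then show "(x, y) \<in> Q1 \<union> Q2 \<union> Q3" using h by (auto simp: Q1_def Q2_def Q3_def Sec_def)
    qed
    then show ?thesis by auto
  qed
  have mQ: "measure lborel Q = \<alpha> / 2 * ln \<kappa> + \<beta> / 2 * ln (1 / k)" "Q \<in> fmeasurable lborel"
  proof -
    have "measure lebesgue Q = measure lebesgue Q1 + measure lebesgue Q2 + measure lebesgue Q3"
    proof (rule measure_Un3_negligible)
      have "Q1 \<inter> Q2 \<subseteq> {(x, y). k * x + (- 1) * y = 0}" by (auto simp: Q1_def Q2_def Sec_def)
      then show "negligible (Q1 \<inter> Q2)" by (rule negligible_subset[rotated]) (intro negligible_line, simp)
      have "Q1 \<inter> Q3 \<subseteq> {(x, y). 1 * x + (- 1) * y = 0}"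
      proof clarsimp
        fix x y assume "(x, y) \<in> Q1" "(x, y) \<in> Q3"
        then have h: "0 \<le> y" "y \<le> k * x" "0 \<le> x" "x \<le> k * y" by (auto simp: Q1_def Q3_def)
        then show "x = y" using cone[of x y] cone[of y x] by linarith
      qed
      then show "negligible (Q1 \<inter> Q3)" by (rule negligible_subset[rotated]) (intro negligible_line, simp)
      have "Q2 \<inter> Q3 \<subseteq> {(x, y). 1 * x + (- k) * y = 0}" 
        using k0 by (auto simp: Q2_def Q3_def Sec_def field_simps)
      then show "negligible (Q2 \<inter> Q3)" by (rule negligible_subset[rotated]) (intro negligible_line, simp)
    qed (use leb mQ1 mQ2 mQ3 Q in auto)
    moreover have "Q1 \<union> Q2 \<union> Q3 \<in> fmeasurable lborel" using mQ1 mQ2 mQ3 by (intro fmeasurable.Un)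
    ultimately show "measure lborel Q = \<alpha> / 2 * ln \<kappa> + \<beta> / 2 * ln (1 / k)" "Q \<in> fmeasurable lborel"
      using leb mQ1 mQ2 mQ3 unfolding Q by auto
  qed
  \<comment> \<open>The four sign patterns reflect the quadrant piece \<open>Q\<close> into the
    whole region; the copies overlap only on the axes.\<close>
  define f where "f e = (\<lambda>(x, y). (fst e * x + 0 * y, 0 * x + snd e * y)) -` Q" for e :: "real \<times> real"
  let ?E = "{-1, 1 :: real} \<times> {-1, 1 :: real}"
  have mf: "f e \<in> fmeasurable lborel" "measure lborel (f e) = measure lborel Q" if "e \<in> ?E" for e
  proof -
    have "\<bar>fst e * snd e\<bar> = 1" using that by auto
    moreover from this have "fst e * snd e \<noteq> 0" by auto
    ultimately show "f e \<in> fmeasurable lborel" "measure lborel (f e) = measure lborel Q"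
      using measure_linear_preimage[of "fst e" "snd e" 0 0 Q] mQ(2) by (auto simp: f_def)
  qed
  have R: "region a b 1 \<i> 1 = \<Union>(f ` ?E)"
  proof -
    have "region a b 1 \<i> 1 = {(x, y). \<bar>x\<^sup>2 - y\<^sup>2\<bar> \<le> \<alpha> \<and> \<bar>2 * x * y\<bar> \<le> \<beta>}"
      using ab by (auto simp: region_def hgt_le_iff lin_def \<alpha>_def \<beta>_def power2_eq_square mult_ac)
    moreover have "(\<exists>e\<in>?E. (x, y) \<in> f e) \<longleftrightarrow> \<bar>x\<^sup>2 - y\<^sup>2\<bar> \<le> \<alpha> \<and> \<bar>2 * x * y\<bar> \<le> \<beta>" for x y
      by (auto simp: f_def Q_def abs_mult)
    ultimately show ?thesis by auto
  qed
  have "measure lebesgue (\<Union>(f ` ?E)) = (\<Sum>e\<in>?E. measure lebesgue (f e))"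
  proof (rule measure_negligible_finite_Union_image)
    show "pairwise (\<lambda>x y. negligible (f x \<inter> f y)) ?E"
    proof (rule pairwiseI)
      fix e e' assume e: "e \<in> ?E" "e' \<in> ?E" "e \<noteq> e'"
      have "f e \<inter> f e' \<subseteq> {(x, y). 1 * x + 0 * y = 0} \<union> {(x, y). 0 * x + 1 * y = 0}"
        using e by (auto simp: f_def Q_def)
      moreover have "negligible ({(x, y). 1 * x + 0 * y = 0} \<union> {(x::real, y::real). 0 * x + 1 * y = 0})"
        by (intro negligible_Un negligible_line) auto
      ultimately show "negligible (f e \<inter> f e')" by (rule negligible_subset[rotated])
    qed
  qed (use mf leb in auto)
  also have "\<dots> = (\<Sum>e\<in>?E. measure lborel Q)"
    using leb mf by (intro sum.cong) auto
  also have "\<dots> = 4 * measure lborel Q" by simp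
  also have "measure lebesgue (\<Union>(f ` ?E)) = measure lborel (region a b 1 \<i> 1)"
    using closed_region[of a b] ab unfolding R[symmetric] by (intro measure_completion) auto
  finally show ?thesis
    unfolding mQ lk l\<kappa> using ab by (simp add: \<alpha>_def \<beta>_def real_sqrt_divide area_const_def)
qed

lemma measure_region:
  assumes ab: "a \<ge> 1" "b \<ge> 1" and D: "Im (cnj \<xi> * \<eta>) \<noteq> 0"
  shows "measure lborel (region a b \<xi> \<eta> 1) = area_const a b / \<bar>Im (cnj \<xi> * \<eta>)\<bar>"
proof -
  have "region a b \<xi> \<eta> 1 = (\<lambda>(x, y). (Re \<xi> * x + Re \<eta> * y, Im \<xi> * x + Im \<eta> * y)) -` region a b 1 \<i> 1"
  proof -
    have "lin \<xi> \<eta> (x, y) = lin 1 \<i> (Re \<xi> * x + Re \<eta> * y, Im \<xi> * x + Im \<eta> * y)" for x y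
      by (simp add: lin_def complex_eq_iff mult.commute)
    then show ?thesis unfolding region_def by auto
  qed
  moreover have det: "Re \<xi> * Im \<eta> - Re \<eta> * Im \<xi> = Im (cnj \<xi> * \<eta>)" by (simp add: mult.commute)
  ultimately have "\<bar>Im (cnj \<xi> * \<eta>)\<bar> * measure lborel (region a b \<xi> \<eta> 1) = measure lborel (region a b 1 \<i> 1)"
    using measure_linear_preimage(2)[of "Re \<xi>" "Im \<eta>" "Re \<eta>" "Im \<xi>" "region a b 1 \<i> 1"]
      region_fmeasurable[OF ab, of 1 \<i> 1] D unfolding det by simp
  then show ?thesis using D measure_unit_region[OF ab] by (simp add: field_simps)
qed

section \<open>Coprime lattice points\<close>

lemma sum_inverse_squares_le:
  assumes "K \<ge> 1" "K \<le> N"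
  shows "(\<Sum>k\<in>{K<..N}. 1 / (real k)\<^sup>2) \<le> 1 / real K - 1 / real N"
  using assms(2)
proof (induction N rule: dec_induct)
  case (step N)
  have N: "N \<ge> 1" using step assms by simp
  have "{K<..Suc N} = insert (Suc N) {K<..N}" using step by auto
  then have "(\<Sum>k\<in>{K<..Suc N}. 1 / (real k)\<^sup>2) = 1 / (real (Suc N))\<^sup>2 + (\<Sum>k\<in>{K<..N}. 1 / (real k)\<^sup>2)"
    by simp
  moreover have "1 / (real (Suc N))\<^sup>2 \<le> 1 / real N - 1 / real (Suc N)"
  proof -
    have "1 / real N - 1 / real (Suc N) = 1 / (real N * real (Suc N))" using N by (simp add: field_simps)
    moreover have "1 / (real (Suc N))\<^sup>2 \<le> 1 / (real N * real (Suc N))"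
      using N unfolding power2_eq_square by (intro divide_left_mono mult_right_mono) auto
    ultimately show ?thesis by simp
  qed
  ultimately show ?case using step.IH by linarith
qed simp

lemma coprime_density_tail:
  assumes "q > 0" "K \<ge> 1"
  shows "\<bar>coprime_density q - (\<Sum>k=1..K. density_term q k)\<bar> \<le> real q / real K"
proof -
  have "coprime_density q = (\<Sum>\<^sub>\<infinity>k\<in>{..K} \<union> {K<..}. density_term q k)"
  proof -
    have "(UNIV :: nat set) = {..K} \<union> {K<..}" by auto
    then show ?thesis by (simp add: coprime_density_def)
  qed
  also have "\<dots> = (\<Sum>k\<le>K. density_term q k) + (\<Sum>\<^sub>\<infinity>k\<in>{K<..}. density_term q k)"
    using density_term_summable[OF assms(1)] by (subst infsum_Un_disjoint) auto
  also have "(\<Sum>k\<le>K. density_term q k) = (\<Sum>k=1..K. density_term q k)"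
    by (rule sum.mono_neutral_right) (auto simp: density_term_def)
  finally have eq: "coprime_density q - (\<Sum>k=1..K. density_term q k) = (\<Sum>\<^sub>\<infinity>k\<in>{K<..}. density_term q k)" by simp
  have s: "(\<lambda>k. real q * (1 / (real k)\<^sup>2)) summable_on {K<..}"
    by (rule summable_on_cmult_right, rule summable_on_subset_banach[OF inverse_squares_summable]) simp
  have "norm (\<Sum>\<^sub>\<infinity>k\<in>{K<..}. density_term q k) \<le> (\<Sum>\<^sub>\<infinity>k\<in>{K<..}. real q * (1 / (real k)\<^sup>2))"
    by (rule norm_infsum_le[OF has_sum_infsum[OF density_term_summable[OF assms(1)]] has_sum_infsum[OF s]])
      (use abs_density_term_le[OF assms(1)] in simp)
  also have "\<dots> \<le> real q / real K"
  proof (rule infsum_le_finite_sums[OF s])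
    fix F assume F: "finite F" "F \<subseteq> {K<..}"
    define N where "N = Max (insert K F)"
    have FN: "F \<subseteq> {K<..N}" using F by (auto simp: N_def)
    have KN: "K \<le> N" using F by (auto simp: N_def)
    have "(\<Sum>k\<in>F. real q * (1 / (real k)\<^sup>2)) = real q * (\<Sum>k\<in>F. 1 / (real k)\<^sup>2)"
      by (rule sum_distrib_left[symmetric])
    also have "\<dots> \<le> real q * (\<Sum>k\<in>{K<..N}. 1 / (real k)\<^sup>2)"
      using FN by (intro mult_left_mono sum_mono2) auto
    also have "\<dots> \<le> real q * (1 / real K - 1 / real N)"
      using sum_inverse_squares_le[OF assms(2) KN] by (intro mult_left_mono) auto
    also have "\<dots> \<le> real q * (1 / real K)" by (intro mult_left_mono) auto
    finally show "(\<Sum>k\<in>F. real q * (1 / (real k)\<^sup>2)) \<le> real q / real K" by simp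
  qed
  finally show ?thesis unfolding eq by simp
qed

lemma sum_inverse_le_ln:
  assumes "K \<ge> 1"
  shows "(\<Sum>k=1..K. 1 / real k) \<le> 1 + ln (real K)"
  using assms
proof (induction K rule: dec_induct)
  case (step n)
  have "ln (real n / real (Suc n)) \<le> real n / real (Suc n) - 1"
    using step by (intro ln_le_minus_one) auto
  also have "\<dots> = - (1 / real (Suc n))" by (simp add: field_simps)
  finally have "1 / real (Suc n) \<le> ln (real (Suc n)) - ln (real n)" using step by (simp add: ln_div)
  then show ?case using step by simp
qed simp

lemma gcd_mult_coprime:
  fixes k c d :: nat
  assumes "coprime c d"
  shows "gcd k (c * d) = gcd k c * gcd k d"
proof (rule dvd_antisym)
  show "gcd k (c * d) dvd gcd k c * gcd k d" 
  proof -
    have "gcd k (c * d) dvd gcd (k * d) (c * d)" by (intro gcd_greatest) auto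
    then have "gcd k (c * d) dvd gcd k c * d"
      using gcd_mult_distrib_nat[of d k c] by (simp add: mult.commute)
    then have "gcd k (c * d) dvd gcd (gcd k c * k) (gcd k c * d)" by (intro gcd_greatest) auto
    then show ?thesis by (simp add: gcd_mult_distrib_nat)
  qed
  have "coprime (gcd k c) (gcd k d)" using assms by (meson coprime_divisors gcd_dvd2)
  then show "gcd k c * gcd k d dvd gcd k (c * d)"
    by (intro gcd_greatest divides_mult mult_dvd_mono) auto
qed

lemma dvd_mult_iff_div_gcd:
  fixes k d :: nat and m :: int
  assumes "k > 0"
  shows "int k dvd int d * m \<longleftrightarrow> int (k div gcd k d) dvd m"
proof -
  define g where "g = gcd k d"
  have g: "g > 0" using assms by (simp add: g_def)
  obtain k' d' where k: "k = g * k'" and d: "d = g * d'" unfolding g_def by (meson gcd_dvd1 gcd_dvd2 dvdE)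
  have "coprime k' d'"
    using g unfolding g_def by (metis g_def k d div_gcd_coprime assms nonzero_mult_div_cancel_left gr_implies_not0)
  then have c: "coprime (int k') (int d')" by simp
  have "int k dvd int d * m \<longleftrightarrow> int g * int k' dvd int g * (int d' * m)" by (simp add: k d mult_ac)
  also have "\<dots> \<longleftrightarrow> int k' dvd int d' * m" using g by simp
  also have "\<dots> \<longleftrightarrow> int k' dvd m" using c by (simp add: coprime_dvd_mult_right_iff)
  finally have "int k dvd int d * m \<longleftrightarrow> int k' dvd m" .
  moreover have "k div g = k'" using g by (simp add: k)
  ultimately show ?thesis by (simp add: g_def)
qed

text \<open>The condition says that k / gcd(k, d1) divides the first coordinate and k / gcd(k, d2)
  the second. Absorbing these factors into the basis vectors leaves a full lattice again.\<close>

lemma card_lattice_points_dvd: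
  fixes d1 d2 k :: nat
  assumes k: "k > 0"
  shows "card {p \<in> lattice_points a b \<xi> \<eta> B. int k dvd int d1 * fst p \<and> int k dvd int d2 * snd p} =
    card (lattice_points a b (of_nat (k div gcd k d1) * \<xi>) (of_nat (k div gcd k d2) * \<eta>) B)"
proof -
  define k1 where "k1 = k div gcd k d1"
  define k2 where "k2 = k div gcd k d2"
  have pos: "k1 > 0" "k2 > 0" using k by (auto simp: k1_def k2_def div_greater_zero_iff dvd_imp_le)
  have "bij_betw (\<lambda>p. (int k1 * fst p, int k2 * snd p)) (lattice_points a b (of_nat k1 * \<xi>) (of_nat k2 * \<eta>) B)
      {p \<in> lattice_points a b \<xi> \<eta> B. int k dvd int d1 * fst p \<and> int k dvd int d2 * snd p}"
  proof (rule bij_betwI[where g = "\<lambda>p. (fst p div int k1, snd p div int k2)"])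
    have l: "lin (of_nat k1 * \<xi>) (of_nat k2 * \<eta>) (ipt p) = lin \<xi> \<eta> (ipt (int k1 * fst p, int k2 * snd p))" for p
      by (simp add: lin_def ipt_def mult_ac)
    show "(\<lambda>p. (int k1 * fst p, int k2 * snd p)) \<in> lattice_points a b (of_nat k1 * \<xi>) (of_nat k2 * \<eta>) B
        \<rightarrow> {p \<in> lattice_points a b \<xi> \<eta> B. int k dvd int d1 * fst p \<and> int k dvd int d2 * snd p}"
      unfolding dvd_mult_iff_div_gcd[OF k] k1_def[symmetric] k2_def[symmetric]
      by (auto simp: lattice_points_def l)
    show "(\<lambda>p. (fst p div int k1, snd p div int k2)) \<in> {p \<in> lattice_points a b \<xi> \<eta> B. int k dvd int d1 * fst p \<and> int k dvd int d2 * snd p}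
        \<rightarrow> lattice_points a b (of_nat k1 * \<xi>) (of_nat k2 * \<eta>) B"
      unfolding dvd_mult_iff_div_gcd[OF k] k1_def[symmetric] k2_def[symmetric]
      by (auto simp: lattice_points_def l)
    fix p assume "p \<in> lattice_points a b (of_nat k1 * \<xi>) (of_nat k2 * \<eta>) B"
    show "(\<lambda>p. (fst p div int k1, snd p div int k2)) ((\<lambda>p. (int k1 * fst p, int k2 * snd p)) p) = p"
      using pos by simp
  next
    fix p assume "p \<in> {p \<in> lattice_points a b \<xi> \<eta> B. int k dvd int d1 * fst p \<and> int k dvd int d2 * snd p}"
    then show "(\<lambda>p. (int k1 * fst p, int k2 * snd p)) ((\<lambda>p. (fst p div int k1, snd p div int k2)) p) = p"
      unfolding dvd_mult_iff_div_gcd[OF k] k1_def[symmetric] k2_def[symmetric] by auto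
  qed
  then show ?thesis unfolding k1_def k2_def by (simp add: bij_betw_same_card)
qed

lemma area_const_nonneg:
  assumes "a \<ge> 1" "b \<ge> 1"
  shows "area_const a b \<ge> 0"
proof -
  have "arsinh (sqrt (b / a)) > 0" "arsinh (sqrt (a / b)) > 0" using assms by simp_all
  then show ?thesis unfolding area_const_def using assms
    by (intro add_nonneg_nonneg mult_nonneg_nonneg) (auto intro: less_imp_le)
qed

text \<open>Moebius inversion over the common divisors k of d1 s and d2 t; each k gives a lattice
  whose basis vectors are enlarged by at most k. The errors add up to sqrt(B) log B times powers of
  q and \<open>\<Delta>\<close>, and the logarithm is absorbed into the exponent 17/32 = 1/2 +
  1/32.\<close>

lemma card_coprime_lattice_points:
  fixes d1 d2 q :: nat
  assumes ab: "a \<ge> 1" "b \<ge> 1" and cop: "coprime d1 d2" and q: "q = d1 * d2" "q > 0"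
    and D: "\<bar>Im (cnj \<xi> * \<eta>)\<bar> \<ge> 1" and \<Delta>: "norm \<xi> \<le> \<Delta>" "norm \<eta> \<le> \<Delta>" "\<Delta> \<ge> 1" and B: "B \<ge> 1"
  defines "M \<equiv> sqrt (a + b)" and "A \<equiv> area_const a b"
  shows "\<bar>real (card {p \<in> lattice_points a b \<xi> \<eta> B. coprime (int d1 * fst p) (int d2 * snd p)})
      - A * B / \<bar>Im (cnj \<xi> * \<eta>)\<bar> * coprime_density q\<bar>
    \<le> (68 * A * M\<^sup>2 + 4 * A * M + M + 2 * A) * ((real q)\<^sup>2 * \<Delta> ^ 3 * B powr (17 / 32))"
proof -
  let ?D = "\<bar>Im (cnj \<xi> * \<eta>)\<bar>"
  let ?L = "lattice_points a b \<xi> \<eta> B"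
  \<comment> \<open>The coordinates of a counted point are at most \<open>\<Delta>\<close> M
    sqrt(B), so \<open>X\<close> bounds every nonzero gcd that occurs and the Moebius sum may stop
    at \<open>K\<close>.\<close>
  define X where "X = real q * M * \<Delta> * sqrt B"
  define K where "K = nat \<lfloor>X\<rfloor>"
  have D0: "Im (cnj \<xi> * \<eta>) \<noteq> 0" using D by auto
  have M1: "M \<ge> 1" using ab by (simp add: M_def)
  have sB: "sqrt B \<ge> 1" using B by simp
  have q1: "real q \<ge> 1" using q(2) by linarith
  have A0: "A \<ge> 0" unfolding A_def by (rule area_const_nonneg[OF ab])
  have d: "d1 > 0" "d2 > 0" using q by (auto intro: gr0I)
  have qM: "real q * M * \<Delta> \<ge> 1"
    using mult_mono[of 1 "real q" 1 M] mult_mono[of 1 "real q * M" 1 \<Delta>] q1 M1 \<Delta> by simp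
  have X1: "X \<ge> 1" using mult_mono[of 1 "real q * M * \<Delta>" 1 "sqrt B"] qM sB by (simp add: X_def)
  have K1: "K \<ge> 1" using X1 by (simp add: K_def le_nat_iff)
  have KX: "real K \<le> X" "real K > X - 1" using X1 unfolding K_def by linarith+
  have KX2: "real K \<ge> X / 2" using KX K1 X1 by linarith
  have fin: "finite ?L" by (rule finite_lattice_points[OF ab D0])
  have zero: "(0, 0) \<in> ?L" using B by (simp add: lattice_points_def ipt_def lin_def hgt_def)
  define G where "G p = nat (gcd (int d1 * fst p) (int d2 * snd p))" for p
  have G: "G p > 0" "G p \<le> K" if p: "p \<in> ?L - {(0, 0)}" for p
  proof -
    have nz: "fst p \<noteq> 0 \<or> snd p \<noteq> 0" using p by (cases p) auto
    then have "gcd (int d1 * fst p) (int d2 * snd p) > 0" using d by (auto simp: gcd_pos_int)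
    then show "G p > 0" by (simp add: G_def)
    have Gi: "int (G p) = gcd (int d1 * fst p) (int d2 * snd p)" by (simp add: G_def)
    have bd: "\<bar>real_of_int (fst p)\<bar> \<le> \<Delta> * (M * sqrt B)" "\<bar>real_of_int (snd p)\<bar> \<le> \<Delta> * (M * sqrt B)"
    proof -
      have pL: "p \<in> ?L" using p by simp
      have "\<bar>real_of_int (fst p)\<bar> * 1 \<le> \<bar>real_of_int (fst p)\<bar> * ?D" using D by (intro mult_left_mono) auto
      also have "\<dots> \<le> norm \<eta> * (M * sqrt B)" unfolding M_def by (rule lattice_point_bound[OF ab D0 pL])
      also have "\<dots> \<le> \<Delta> * (M * sqrt B)" using \<Delta> M1 sB by (intro mult_right_mono) auto
      finally show "\<bar>real_of_int (fst p)\<bar> \<le> \<Delta> * (M * sqrt B)" by simp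
      have "\<bar>real_of_int (snd p)\<bar> * 1 \<le> \<bar>real_of_int (snd p)\<bar> * ?D" using D by (intro mult_left_mono) auto
      also have "\<dots> \<le> norm \<xi> * (M * sqrt B)" unfolding M_def by (rule lattice_point_bound[OF ab D0 pL])
      also have "\<dots> \<le> \<Delta> * (M * sqrt B)" using \<Delta> M1 sB by (intro mult_right_mono) auto
      finally show "\<bar>real_of_int (snd p)\<bar> \<le> \<Delta> * (M * sqrt B)" by simp
    qed
    have dq: "real d1 \<le> real q" "real d2 \<le> real q" using q d by auto
    have "real (G p) \<le> X"
    proof (cases "fst p = 0")
      case False
      then have "int d1 * fst p \<noteq> 0" using d by simp
      then have "int (G p) \<le> \<bar>int d1 * fst p\<bar>" unfolding Gi by (intro zdvd_imp_le) (auto simp: dvd_abs_iff)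
      then have "real (G p) \<le> real_of_int \<bar>int d1 * fst p\<bar>" by linarith
      also have "\<dots> = real d1 * \<bar>real_of_int (fst p)\<bar>" by (simp add: abs_mult)
      also have "\<dots> \<le> real q * (\<Delta> * (M * sqrt B))" using dq bd by (intro mult_mono) auto
      finally show ?thesis by (simp add: X_def mult_ac)
    next
      case True
      then have "int d2 * snd p \<noteq> 0" using d nz by simp
      then have "int (G p) \<le> \<bar>int d2 * snd p\<bar>" unfolding Gi by (intro zdvd_imp_le) (auto simp: dvd_abs_iff)
      then have "real (G p) \<le> real_of_int \<bar>int d2 * snd p\<bar>" by linarith
      also have "\<dots> = real d2 * \<bar>real_of_int (snd p)\<bar>" by (simp add: abs_mult)
      also have "\<dots> \<le> real q * (\<Delta> * (M * sqrt B))" using dq bd by (intro mult_mono) auto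
      finally show ?thesis by (simp add: X_def mult_ac)
    qed
    then show "G p \<le> K" unfolding K_def by (simp add: le_nat_iff le_floor_iff)
  qed
  have Gdvd: "k dvd G p \<longleftrightarrow> int k dvd int d1 * fst p \<and> int k dvd int d2 * snd p" for k p
  proof -
    have "k dvd G p \<longleftrightarrow> int k dvd int (G p)" by simp
    also have "int (G p) = gcd (int d1 * fst p) (int d2 * snd p)" by (simp add: G_def)
    finally show ?thesis by simp
  qed
  define N where "N k = card {p \<in> ?L. int k dvd int d1 * fst p \<and> int k dvd int d2 * snd p}" for k
  let ?P = "{p \<in> ?L. coprime (int d1 * fst p) (int d2 * snd p)}"
  have count: "real (card ?P) = (\<Sum>k=1..K. of_int (moebius k) * (real (N k) - 1))"
  proof -
    \<comment> \<open>The origin is taken out because its gcd is 0, which every k divides; this is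
      the origin of the -1 next to \<open>N k\<close>.\<close>
    have "?P = {p \<in> ?L - {(0, 0)}. G p = 1}"
      by (auto simp: G_def coprime_iff_gcd_eq_1)
    then have "int (card ?P) = (\<Sum>p\<in>?L - {(0, 0)}. if G p = 1 then 1 else 0)"
      using fin by (simp add: sum.If_cases Int_def)
    also have "\<dots> = (\<Sum>p\<in>?L - {(0, 0)}. \<Sum>k=1..K. if k dvd G p then moebius k else 0)"
      using G by (intro sum.cong) (auto simp: moebius_sum_atMost simp del: One_nat_def)
    also have "\<dots> = (\<Sum>k=1..K. \<Sum>p\<in>?L - {(0, 0)}. if k dvd G p then moebius k else 0)"
      by (rule sum.swap)
    also have "\<dots> = (\<Sum>k=1..K. moebius k * (int (N k) - 1))"
    proof (rule sum.cong)
      fix k assume "k \<in> {1..K}"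
      have "{p \<in> ?L - {(0, 0)}. k dvd G p} = {p \<in> ?L. int k dvd int d1 * fst p \<and> int k dvd int d2 * snd p} - {(0, 0)}"
        unfolding Gdvd by auto
      then have "card {p \<in> ?L - {(0, 0)}. k dvd G p} = N k - 1"
        using fin zero by (simp add: N_def card_Diff_singleton)
      moreover have "N k \<ge> 1"
        using fin zero unfolding N_def by (simp add: Suc_le_eq card_gt_0_iff) force
      moreover have "(\<Sum>p\<in>?L - {(0, 0)}. if k dvd G p then moebius k else 0) = moebius k * int (card {p \<in> ?L - {(0, 0)}. k dvd G p})"
        using fin by (simp add: sum.If_cases Int_def)
      ultimately show "(\<Sum>p\<in>?L - {(0, 0)}. if k dvd G p then moebius k else 0) = moebius k * (int (N k) - 1)"
        by (simp add: of_nat_diff)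
    qed simp
    finally have "real_of_int (int (card ?P)) = real_of_int (\<Sum>k=1..K. moebius k * (int (N k) - 1))" by (simp only:)
    then show ?thesis by simp
  qed
  have err: "\<bar>of_int (moebius k) * (real (N k) - 1) - A * B / ?D * density_term q k\<bar>
      \<le> A * real q * (4 * M * sqrt B * \<Delta>) * (1 / real k) + (4 * A * real q * \<Delta>\<^sup>2 + 1)" if k: "k \<in> {1..K}" for k
  proof -
    have k0: "k > 0" using k by simp
    define k1 where "k1 = k div gcd k d1"
    define k2 where "k2 = k div gcd k d2"
    have kg: "k1 * gcd k d1 = k" "k2 * gcd k d2 = k" by (simp_all add: k1_def k2_def)
    have kpos: "k1 > 0" "k2 > 0" using kg k0 by (auto intro!: gr0I)
    have kle: "real k1 \<le> real k" "real k2 \<le> real k" by (simp_all add: k1_def k2_def)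
    have kk: "real k1 * real k2 * real (gcd k q) = (real k)\<^sup>2"
    proof -
      have "k1 * k2 * gcd k q = (k1 * gcd k d1) * (k2 * gcd k d2)"
        unfolding q(1) gcd_mult_coprime[OF cop] by (simp add: mult_ac)
      then have "k1 * k2 * gcd k q = k\<^sup>2" by (simp add: kg power2_eq_square)
      then show ?thesis by (metis of_nat_mult of_nat_power)
    qed
    have inv: "1 / (real k1 * real k2) = real (gcd k q) / (real k)\<^sup>2"
      using kk kpos k0 by (simp add: field_simps)
    have gq: "real (gcd k q) \<le> real q" using q(2) by (simp add: dvd_imp_le)
    define \<xi>' where "\<xi>' = of_nat k1 * \<xi>"
    define \<eta>' where "\<eta>' = of_nat k2 * \<eta>"
    define w where "w = norm \<xi>' + norm \<eta>'"
    have N: "N k = card (lattice_points a b \<xi>' \<eta>' B)"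
      unfolding N_def \<xi>'_def \<eta>'_def k1_def k2_def by (rule card_lattice_points_dvd[OF k0])
    have im: "Im (cnj \<xi>' * \<eta>') = real k1 * real k2 * Im (cnj \<xi> * \<eta>)"
      by (simp add: \<xi>'_def \<eta>'_def algebra_simps)
    have im0: "Im (cnj \<xi>' * \<eta>') \<noteq> 0" unfolding im using kpos D0 by simp
    have mr: "measure lborel (region a b \<xi>' \<eta>' 1) = A / ?D * (real (gcd k q) / (real k)\<^sup>2)"
      unfolding measure_region[OF ab im0] im abs_mult A_def[symmetric] inv[symmetric] using kpos by (simp add: field_simps)
    have w: "w \<le> 2 * real k * \<Delta>" "w \<ge> 0"
    proof -
      have "real k1 * norm \<xi> \<le> real k * \<Delta>" "real k2 * norm \<eta> \<le> real k * \<Delta>"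
        using kle \<Delta> by (auto intro!: mult_mono)
      then show "w \<le> 2 * real k * \<Delta>" by (simp add: w_def \<xi>'_def \<eta>'_def norm_mult)
      show "w \<ge> 0" by (simp add: w_def)
    qed
    have c0: "0 \<le> A / ?D * (real (gcd k q) / (real k)\<^sup>2)" using A0 by simp
    have "\<bar>real (N k) - A / ?D * (real (gcd k q) / (real k)\<^sup>2) * B\<bar> \<le>
        A / ?D * (real (gcd k q) / (real k)\<^sup>2) * (2 * (M * sqrt B) * w + w\<^sup>2)"
      using card_lattice_points[OF ab im0, of B] B unfolding N mr w_def M_def by simp
    also have "\<dots> \<le> (A / 1 * (real q / (real k)\<^sup>2)) * (2 * (M * sqrt B) * (2 * real k * \<Delta>) + (2 * real k * \<Delta>)\<^sup>2)"
    proof (rule mult_mono)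
      show "A / ?D * (real (gcd k q) / (real k)\<^sup>2) \<le> A / 1 * (real q / (real k)\<^sup>2)"
        using A0 D gq by (intro mult_mono divide_left_mono divide_right_mono) auto
      show "2 * (M * sqrt B) * w + w\<^sup>2 \<le> 2 * (M * sqrt B) * (2 * real k * \<Delta>) + (2 * real k * \<Delta>)\<^sup>2"
        using w M1 sB by (intro add_mono mult_left_mono power_mono) auto
    qed (use A0 w M1 sB in auto)
    also have "\<dots> = A * real q * (4 * M * sqrt B * \<Delta>) * (1 / real k) + 4 * A * real q * \<Delta>\<^sup>2"
      using k0 by (simp add: field_simps power2_eq_square)
    finally have main: "\<bar>real (N k) - A / ?D * (real (gcd k q) / (real k)\<^sup>2) * B\<bar>
        \<le> A * real q * (4 * M * sqrt B * \<Delta>) * (1 / real k) + 4 * A * real q * \<Delta>\<^sup>2" .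
    have "of_int (moebius k) * (real (N k) - 1) - A * B / ?D * density_term q k =
        of_int (moebius k) * (real (N k) - A / ?D * (real (gcd k q) / (real k)\<^sup>2) * B - 1)"
      by (simp add: density_term_def algebra_simps)
    also have "\<bar>\<dots>\<bar> \<le> 1 * \<bar>real (N k) - A / ?D * (real (gcd k q) / (real k)\<^sup>2) * B - 1\<bar>"
      unfolding abs_mult using abs_moebius_le_1[of k] by (intro mult_right_mono) linarith+
    also have "\<dots> \<le> \<bar>real (N k) - A / ?D * (real (gcd k q) / (real k)\<^sup>2) * B\<bar> + 1"
      unfolding mult_1 by (rule order_trans[OF abs_triangle_ineq4]) simp
    also have "\<dots> \<le> A * real q * (4 * M * sqrt B * \<Delta>) * (1 / real k) + 4 * A * real q * \<Delta>\<^sup>2 + 1"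
      using main by (rule add_right_mono)
    finally show ?thesis by (simp only: add.assoc)
  qed
  have S1: "\<bar>real (card ?P) - A * B / ?D * (\<Sum>k=1..K. density_term q k)\<bar>
      \<le> A * real q * (4 * M * sqrt B * \<Delta>) * (\<Sum>k=1..K. 1 / real k) + real K * (4 * A * real q * \<Delta>\<^sup>2 + 1)"
  proof -
    have eq: "real (card ?P) - A * B / ?D * (\<Sum>k=1..K. density_term q k) =
      (\<Sum>k=1..K. of_int (moebius k) * (real (N k) - 1) - A * B / ?D * density_term q k)"
      unfolding count by (simp add: sum_subtractf sum_distrib_left)
    have "\<bar>real (card ?P) - A * B / ?D * (\<Sum>k=1..K. density_term q k)\<bar> \<le>
        (\<Sum>k=1..K. A * real q * (4 * M * sqrt B * \<Delta>) * (1 / real k) + (4 * A * real q * \<Delta>\<^sup>2 + 1))"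
      unfolding eq by (rule order_trans[OF sum_abs sum_mono[OF err]])
    also have "\<dots> = A * real q * (4 * M * sqrt B * \<Delta>) * (\<Sum>k=1..K. 1 / real k) + real K * (4 * A * real q * \<Delta>\<^sup>2 + 1)"
    proof -
      have "(\<Sum>k=1..K. u * (1 / real k) + w) = u * (\<Sum>k=1..K. 1 / real k) + real K * w" for u w :: real
        by (simp add: sum.distrib sum_distrib_left)
      then show ?thesis .
    qed
    finally show ?thesis .
  qed
  define Y where "Y = (real q)\<^sup>2 * \<Delta> ^ 3 * B powr (17 / 32)"
  have half: "sqrt B \<le> B powr (17 / 32)"
    unfolding powr_half_sqrt[symmetric, OF order_trans[OF zero_le_one B]] using B by (intro powr_mono) auto
  have Bp: "B powr (17 / 32) \<ge> 1" using half sB by linarith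
  have q2: "real q \<le> (real q)\<^sup>2" "1 \<le> (real q)\<^sup>2" using q1 by (auto simp: self_le_power one_le_power)
  have d3: "\<Delta> \<le> \<Delta> ^ 3" "\<Delta>\<^sup>2 \<le> \<Delta> ^ 3" "1 \<le> \<Delta> ^ 3" using \<Delta>(3) by (auto simp: self_le_power one_le_power power_increasing)
  have harm: "(\<Sum>k=1..K. 1 / real k) \<le> 17 * (real q * M * \<Delta> * B powr (1 / 32))"
  proof -
    \<comment> \<open>Writing ln X as 16 ln(X^(1/16)) costs only B^(1/32), since X contains
      sqrt(B).\<close>
    have "ln X = 16 * ln (X powr (1 / 16))" using X1 by (simp add: ln_powr)
    also have "\<dots> \<le> 16 * (X powr (1 / 16) - 1)" using X1 by (intro mult_left_mono ln_le_minus_one) auto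
    finally have "1 + ln X \<le> 17 * X powr (1 / 16)" using ge_one_powr_ge_zero[OF X1, of "1 / 16"] by simp
    moreover have "ln (real K) \<le> ln X" using KX K1 X1 by simp
    moreover have "X powr (1 / 16) \<le> real q * M * \<Delta> * B powr (1 / 32)"
    proof -
      have "X powr (1 / 16) = (real q * M * \<Delta>) powr (1 / 16) * (B powr (1 / 2)) powr (1 / 16)"
        unfolding X_def using qM B by (simp add: powr_mult powr_half_sqrt)
      also have "\<dots> \<le> (real q * M * \<Delta>) powr 1 * B powr (1 / 32)"
        using qM by (intro mult_mono powr_mono) (auto simp: powr_powr)
      finally show ?thesis using qM by simp
    qed
    ultimately show ?thesis using sum_inverse_le_ln[OF K1] by linarith
  qed
  have T1: "A * real q * (4 * M * sqrt B * \<Delta>) * (\<Sum>k=1..K. 1 / real k) \<le> 68 * A * M\<^sup>2 * Y"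
  proof -
    have "A * real q * (4 * M * sqrt B * \<Delta>) * (\<Sum>k=1..K. 1 / real k) \<le>
        A * real q * (4 * M * sqrt B * \<Delta>) * (17 * (real q * M * \<Delta> * B powr (1 / 32)))"
      using harm A0 M1 sB \<Delta> by (intro mult_left_mono) auto
    also have "\<dots> = 68 * A * M\<^sup>2 * ((real q)\<^sup>2 * \<Delta>\<^sup>2 * (sqrt B * B powr (1 / 32)))"
      by (simp add: power2_eq_square)
    also have "sqrt B * B powr (1 / 32) = B powr (17 / 32)"
      using B by (simp add: powr_half_sqrt[symmetric] powr_add[symmetric])
    also have "68 * A * M\<^sup>2 * ((real q)\<^sup>2 * \<Delta>\<^sup>2 * B powr (17 / 32)) \<le> 68 * A * M\<^sup>2 * Y"
      unfolding Y_def using d3 A0 Bp by (intro mult_left_mono mult_right_mono) auto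
    finally show ?thesis .
  qed
  have XY: "X * \<Delta>\<^sup>2 * real q \<le> M * Y"
  proof -
    have "X * \<Delta>\<^sup>2 * real q = M * ((real q)\<^sup>2 * \<Delta> ^ 3 * sqrt B)"
      by (simp add: X_def power2_eq_square power3_eq_cube)
    also have "\<dots> \<le> M * Y" unfolding Y_def using half M1 \<Delta> by (intro mult_left_mono) auto
    finally show ?thesis .
  qed
  have T2: "real K * (4 * A * real q * \<Delta>\<^sup>2 + 1) \<le> (4 * A * M + M) * Y"
  proof -
    have "real K * (4 * A * real q * \<Delta>\<^sup>2 + 1) \<le> X * (4 * A * real q * \<Delta>\<^sup>2 + 1)"
      using KX A0 by (intro mult_right_mono) auto
    also have "\<dots> = 4 * A * (X * \<Delta>\<^sup>2 * real q) + X * 1" by (simp add: algebra_simps)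
    also have "\<dots> \<le> 4 * A * (M * Y) + M * Y"
    proof (intro add_mono mult_left_mono XY)
      have "1 * 1 \<le> \<Delta>\<^sup>2 * real q" using q1 \<Delta>(3) by (intro mult_mono) (auto simp: one_le_power)
      then have "X * 1 \<le> X * (\<Delta>\<^sup>2 * real q)" using X1 by (intro mult_left_mono) auto
      then show "X * 1 \<le> M * Y" using XY by (simp add: mult.assoc)
    qed (use A0 in auto)
    finally show ?thesis by (simp add: algebra_simps)
  qed
  have T3: "\<bar>A * B / ?D * (\<Sum>k=1..K. density_term q k) - A * B / ?D * coprime_density q\<bar> \<le> 2 * A * Y"
  proof -
    have "\<bar>A * B / ?D * (\<Sum>k=1..K. density_term q k) - A * B / ?D * coprime_density q\<bar> =
        A * B / ?D * \<bar>coprime_density q - (\<Sum>k=1..K. density_term q k)\<bar>"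
    proof -
      have "0 \<le> A * B / ?D" using A0 B by simp
      then show ?thesis by (simp only: right_diff_distrib[symmetric] abs_mult abs_of_nonneg abs_minus_commute)
    qed
    \<comment> \<open>Completing the density series costs at most q / K with K >= X / 2; as X
      contains sqrt(B), this is again O(sqrt(B)).\<close>
    also have "\<dots> \<le> A * B / 1 * (real q / (X / 2))"
    proof (rule mult_mono)
      have "\<bar>coprime_density q - (\<Sum>k=1..K. density_term q k)\<bar> \<le> real q / real K"
        by (rule coprime_density_tail[OF q(2) K1])
      also have "\<dots> \<le> real q / (X / 2)" using KX2 X1 by (intro divide_left_mono) auto
      finally show "\<bar>coprime_density q - (\<Sum>k=1..K. density_term q k)\<bar> \<le> real q / (X / 2)" .
      show "A * B / ?D \<le> A * B / 1" using A0 B D by (intro divide_left_mono) auto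
    qed (use A0 B in auto)
    also have "\<dots> = 2 * A * (sqrt B / (M * \<Delta>))"
    proof -
      have "B = sqrt B * sqrt B" using B by simp
      then show ?thesis using q1 M1 \<Delta> sB unfolding X_def by (simp add: field_simps)
    qed
    also have "\<dots> \<le> 2 * A * Y"
    proof (intro mult_left_mono)
      have "1 * 1 \<le> M * \<Delta>" using M1 \<Delta> by (intro mult_mono) auto
      then have "sqrt B / (M * \<Delta>) \<le> sqrt B / 1" using sB by (intro divide_left_mono) auto
      also have "\<dots> \<le> 1 * 1 * B powr (17 / 32)" using half by simp
      also have "\<dots> \<le> Y" unfolding Y_def using q2 d3 Bp \<Delta>(3) by (intro mult_mono mult_nonneg_nonneg) auto
      finally show "sqrt B / (M * \<Delta>) \<le> Y" .
    qed (use A0 in auto)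
    finally show ?thesis .
  qed
  have "\<bar>real (card ?P) - A * B / ?D * coprime_density q\<bar> \<le> 68 * A * M\<^sup>2 * Y + (4 * A * M + M) * Y + 2 * A * Y"
    using S1 T1 T2 T3 by linarith
  then show ?thesis by (simp add: Y_def algebra_simps)
qed

section \<open>Rational points on conics\<close>

lemma int_sqrt_exists:
  fixes n :: int
  assumes "n \<ge> 0"
  obtains s where "s \<ge> 0" "s\<^sup>2 \<le> n" "n < (s + 1)\<^sup>2"
proof
  define s where "s = \<lfloor>sqrt (of_int n)\<rfloor>"
  show s0: "s \<ge> 0" using assms by (simp add: s_def)
  have "(of_int s)\<^sup>2 \<le> (sqrt (of_int n))\<^sup>2" using s0 by (intro power_mono) (auto simp: s_def)
  then have "of_int (s\<^sup>2) \<le> (of_int n :: real)" using assms by simp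
  then show "s\<^sup>2 \<le> n" by (simp only: of_int_le_iff)
  have "sqrt (of_int n) < of_int (s + 1)" unfolding s_def by linarith
  then have "(sqrt (of_int n))\<^sup>2 < (of_int (s + 1))\<^sup>2" using assms by (intro power_strict_mono) auto
  then have "(of_int n :: real) < of_int ((s + 1)\<^sup>2)" using assms by simp
  then show "n < (s + 1)\<^sup>2" by (simp only: of_int_less_iff)
qed

lemma pigeonhole_congruences:
  fixes a b c r m l X Y U :: int
  assumes pos: "a > 0" "b > 0" "c > 0" and XYU: "X \<ge> 0" "Y \<ge> 0" "U \<ge> 0"
    and big: "a * b * c < (X + 1) * (Y + 1) * (U + 1)"
  obtains x y u where "(x, y, u) \<noteq> (0, 0, 0)" "\<bar>x\<bar> \<le> X" "\<bar>y\<bar> \<le> Y" "\<bar>u\<bar> \<le> U"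
    "c dvd y - r * x" "a dvd y - m * u" "b dvd x - l * u"
proof -
  let ?A = "{0..X} \<times> {0..Y} \<times> {0..U}"
  let ?C = "{0..<c} \<times> {0..<a} \<times> {0..<b}"
  define f where "f = (\<lambda>(x, y, u). ((y - r * x) mod c, (y - m * u) mod a, (x - l * u) mod b))"
  have "f ` ?A \<subseteq> ?C" using pos by (auto simp: f_def)
  then have "card (f ` ?A) \<le> card ?C" by (intro card_mono) auto
  also have "int (card ?C) = a * b * c" using pos by (simp add: card_cartesian_product)
  then have "card ?C < card ?A"
  proof -
    have "int (card ?A) = (X + 1) * (Y + 1) * (U + 1)" using XYU by (simp add: card_cartesian_product)
    then show ?thesis using big \<open>int (card ?C) = a * b * c\<close> by linarith
  qed
  finally have "\<not> inj_on f ?A" by (rule pigeonhole)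
  then obtain p q where "p \<in> ?A" "q \<in> ?A" "p \<noteq> q" "f p = f q" unfolding inj_on_def by blast
  then obtain x y u x' y' u' where h: "x \<in> {0..X}" "y \<in> {0..Y}" "u \<in> {0..U}"
    "x' \<in> {0..X}" "y' \<in> {0..Y}" "u' \<in> {0..U}" "(x, y, u) \<noteq> (x', y', u')" "f (x, y, u) = f (x', y', u')"
    by (cases p, cases q) auto
  have "c dvd (y - r * x) - (y' - r * x')" "a dvd (y - m * u) - (y' - m * u')" "b dvd (x - l * u) - (x' - l * u')"
    using h(8) by (auto simp: f_def mod_eq_dvd_iff)
  then have "c dvd (y - y') - r * (x - x')" "a dvd (y - y') - m * (u - u')" "b dvd (x - x') - l * (u - u')"
    by (simp_all add: algebra_simps)
  then show ?thesis using h by (intro that[of "x - x'" "y - y'" "u - u'"]) auto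
qed

text \<open>For a small nonzero triple satisfying the three congruences, E = a x^2 + b y^2 - c u^2
  is a multiple k a b c with -1 <= k <= 2. For k = 0 it is a solution, for k = 1 composition with
  u^2 + a b produces one of size at most 2 a b, and the extreme values -1 and 2 force equality in
  the size bounds, hence very special coefficients.\<close>

lemma conic_point_exists:
  fixes a b c r m l :: int
  assumes pos: "a > 0" "b > 0" "c > 0" and cop: "coprime a b" "coprime a c" "coprime b c" and odd: "odd c"
    and r: "c dvd a + b * r\<^sup>2" and m: "a dvd b * m\<^sup>2 - c" and l: "b dvd a * l\<^sup>2 - c"
  obtains x y u where "u > 0" "u \<le> 2 * a * b" "a * x\<^sup>2 + b * y\<^sup>2 = c * u\<^sup>2" "c dvd y - r * x"
proof -
  obtain X where X: "X \<ge> 0" "X\<^sup>2 \<le> b * c" "b * c < (X + 1)\<^sup>2" using int_sqrt_exists[of "b * c"] pos by auto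
  obtain Y where Y: "Y \<ge> 0" "Y\<^sup>2 \<le> a * c" "a * c < (Y + 1)\<^sup>2" using int_sqrt_exists[of "a * c"] pos by auto
  \<comment> \<open>For a b = 1 the choice U = 0 already leaves enough triples, and it is imposed in
    order to exclude k = -1 later.\<close>
  obtain U where U: "U \<ge> 0" "U\<^sup>2 \<le> a * b" "a * b * c < (X + 1) * (Y + 1) * (U + 1)" "a * b = 1 \<Longrightarrow> U = 0"
  proof (cases "a * b = 1")
    case True
    then have ab: "a = 1" "b = 1" using pos by (auto simp: zmult_eq_1_iff)
    have "c\<^sup>2 < ((X + 1) * (Y + 1))\<^sup>2"
      using mult_strict_mono[of c "(X + 1)\<^sup>2" c "(Y + 1)\<^sup>2"] X Y ab pos
      by (simp add: power_mult_distrib power2_eq_square[of c])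
    then have "c < (X + 1) * (Y + 1)" by (rule power2_less_imp_less) (use X Y in simp)
    then show ?thesis using that[of 0] ab by simp
  next
    case False
    obtain U where U: "U \<ge> 0" "U\<^sup>2 \<le> a * b" "a * b < (U + 1)\<^sup>2" using int_sqrt_exists[of "a * b"] pos by auto
    have "(b * c) * (a * c) * (a * b) < (X + 1)\<^sup>2 * (Y + 1)\<^sup>2 * (U + 1)\<^sup>2"
      using X Y U pos by (intro mult_strict_mono) auto
    then have "(a * b * c)\<^sup>2 < ((X + 1) * (Y + 1) * (U + 1))\<^sup>2"
      by (simp add: power_mult_distrib power2_eq_square[of a] power2_eq_square[of b] power2_eq_square[of c] mult_ac)
    then have "a * b * c < (X + 1) * (Y + 1) * (U + 1)" by (rule power2_less_imp_less) (use X Y U in simp)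
    then show ?thesis using that[of U] U False by blast
  qed
  obtain x y u where xyu: "(x, y, u) \<noteq> (0, 0, 0)" "\<bar>x\<bar> \<le> X" "\<bar>y\<bar> \<le> Y" "\<bar>u\<bar> \<le> U"
    and dv: "c dvd y - r * x" "a dvd y - m * u" "b dvd x - l * u"
    using pigeonhole_congruences[OF pos X(1) Y(1) U(1,3)] by blast
  have sq: "x\<^sup>2 \<le> b * c" "y\<^sup>2 \<le> a * c" "u\<^sup>2 \<le> a * b"
    using xyu(2-4) X(2) Y(2) U(2) power_mono[of "\<bar>x\<bar>" X 2] power_mono[of "\<bar>y\<bar>" Y 2] power_mono[of "\<bar>u\<bar>" U 2] by simp_all
  have sq': "a * x\<^sup>2 \<le> a * b * c" "b * y\<^sup>2 \<le> a * b * c" "c * u\<^sup>2 \<le> a * b * c"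
    using mult_left_mono[OF sq(1), of a] mult_left_mono[OF sq(2), of b] mult_left_mono[OF sq(3), of c] pos
    by (simp_all add: mult_ac)
  define E where "E = a * x\<^sup>2 + b * y\<^sup>2 - c * u\<^sup>2"
  have "c dvd E"
  proof -
    have "E = (a + b * r\<^sup>2) * x\<^sup>2 + b * (y + r * x) * (y - r * x) - c * u\<^sup>2"
      by (simp add: E_def power2_eq_square algebra_simps)
    then show ?thesis using r dv(1) by (simp add: dvd_diff dvd_add)
  qed
  moreover have "a dvd E"
  proof -
    have "E = a * x\<^sup>2 + b * (y + m * u) * (y - m * u) + (b * m\<^sup>2 - c) * u\<^sup>2"
      by (simp add: E_def power2_eq_square algebra_simps)
    then show ?thesis using m dv(2) by (simp add: dvd_diff dvd_add)
  qed
  moreover have "b dvd E"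
  proof -
    have "E = b * y\<^sup>2 + a * (x + l * u) * (x - l * u) + (a * l\<^sup>2 - c) * u\<^sup>2"
      by (simp add: E_def power2_eq_square algebra_simps)
    then show ?thesis using l dv(3) by (simp add: dvd_diff dvd_add)
  qed
  ultimately have "a * b * c dvd E" using cop by (intro divides_mult) auto
  then obtain k where k: "E = a * b * c * k" by blast
  have N: "a * b * c > 0" using pos by simp
  have "E \<le> a * b * c * 2" "E \<ge> a * b * c * (- 1)"
  proof -
    have "a * x\<^sup>2 \<ge> 0" "b * y\<^sup>2 \<ge> 0" "c * u\<^sup>2 \<ge> 0" using pos by simp_all
    then show "E \<le> a * b * c * 2" "E \<ge> a * b * c * (- 1)" using sq' unfolding E_def by linarith+
  qed
  then have "k \<le> 2" "k \<ge> - 1" using N unfolding k by (simp_all only: mult_le_cancel_left_pos)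
  then consider "k = -1" | "k = 0" | "k = 1" | "k = 2" by linarith
  then show ?thesis
  proof cases
    case 1
    \<comment> \<open>Equality in the bounds gives x = y = 0 and u^2 = a b. As m and l are
      invertible modulo a and b, the product a b divides u, which leaves a b = 1; then U = 0 makes
      the triple zero.\<close>
    have "E = - (a * b * c)" using 1 k by simp
    moreover have "a * x\<^sup>2 \<ge> 0" "b * y\<^sup>2 \<ge> 0" using pos by simp_all
    ultimately have "a * x\<^sup>2 = 0" "b * y\<^sup>2 = 0" "c * u\<^sup>2 = a * b * c" using sq'(3) unfolding E_def by linarith+
    then have z: "x = 0" "y = 0" "u\<^sup>2 = a * b" using pos by auto
    have "coprime a m"
    proof (rule coprimeI)
      fix d assume d: "d dvd a" "d dvd m"
      then have "d dvd b * m\<^sup>2 - c" "d dvd b * m\<^sup>2" using m by (auto simp: power2_eq_square intro: dvd_trans)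
      then have "d dvd c" by (metis dvd_diff_right_iff)
      then show "is_unit d" using d cop(2) coprime_common_divisor by blast
    qed
    then have "a dvd u" using dv(2) z by (simp add: coprime_dvd_mult_right_iff)
    have "coprime b l"
    proof (rule coprimeI)
      fix d assume d: "d dvd b" "d dvd l"
      then have "d dvd a * l\<^sup>2 - c" "d dvd a * l\<^sup>2" using l by (auto simp: power2_eq_square intro: dvd_trans)
      then have "d dvd c" by (metis dvd_diff_right_iff)
      then show "is_unit d" using d cop(3) coprime_common_divisor by blast
    qed
    then have "b dvd u" using dv(3) z by (simp add: coprime_dvd_mult_right_iff)
    with \<open>a dvd u\<close> have "a * b dvd u" using cop by (intro divides_mult) auto
    then have "(a * b)\<^sup>2 dvd u\<^sup>2" by simp
    then have "a * b * (a * b) dvd a * b * 1" by (simp only: z(3) power2_eq_square[of "a * b"] mult_1_right)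
    then have "a * b dvd 1" using pos by (simp only: dvd_mult_cancel_left) auto
    then have ab1: "a * b = 1" using pos by (metis zdvd1_eq abs_of_pos mult_pos_pos)
    then have "u = 0" using U(4) xyu(4) by simp
    then show ?thesis using xyu(1) z by simp
  next
    case 2
    then have e: "a * x\<^sup>2 + b * y\<^sup>2 = c * u\<^sup>2" using k by (simp add: E_def)
    have "u \<noteq> 0"
    proof
      assume "u = 0"
      then have "a * x\<^sup>2 + b * y\<^sup>2 = 0" using e by simp
      moreover have "a * x\<^sup>2 \<ge> 0" "b * y\<^sup>2 \<ge> 0" using pos by simp_all
      ultimately have "a * x\<^sup>2 = 0" "b * y\<^sup>2 = 0" by linarith+
      then show False using pos xyu(1) \<open>u = 0\<close> by simp
    qed
    moreover have "\<bar>u\<bar> \<le> \<bar>u\<bar>\<^sup>2" using \<open>u \<noteq> 0\<close> by (intro self_le_power) auto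
    moreover have "a * b > 0" using pos by simp
    ultimately show ?thesis using that[of "\<bar>u\<bar>" x y] e dv(1) sq(3) by (simp add: mult.assoc)
  next
    case 3
    then have e: "a * x\<^sup>2 + b * y\<^sup>2 = c * (u\<^sup>2 + a * b)" using k by (simp add: E_def algebra_simps)
    \<comment> \<open>Multiplication by the norm u^2 + a b of u + sqrt(-a b) preserves the form,
      turning the value c (u^2 + a b) into c times a square, and it respects the congruence modulo
      c.\<close>
    have "a * (x * u - b * y)\<^sup>2 + b * (y * u + a * x)\<^sup>2 = (a * x\<^sup>2 + b * y\<^sup>2) * (u\<^sup>2 + a * b)"
      by (simp add: power2_eq_square algebra_simps)
    then have "a * (x * u - b * y)\<^sup>2 + b * (y * u + a * x)\<^sup>2 = c * (u\<^sup>2 + a * b)\<^sup>2"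
      unfolding e by (simp add: power2_eq_square)
    moreover have "c dvd (y * u + a * x) - r * (x * u - b * y)"
    proof -
      have "(y * u + a * x) - r * (x * u - b * y) = (u + b * r) * (y - r * x) + (a + b * r\<^sup>2) * x"
        by (simp add: power2_eq_square algebra_simps)
      then show ?thesis using dv(1) r by simp
    qed
    moreover have "u\<^sup>2 + a * b > 0" using pos by (simp add: add_nonneg_pos)
    moreover have "u\<^sup>2 + a * b \<le> 2 * a * b" using sq(3) by simp
    ultimately show ?thesis using that by blast
  next
    case 4
    \<comment> \<open>Now u = 0, x^2 = b c and y^2 = a c, so the congruences force a = b = 1, c =
      x^2 and y = e x with e = +-1. As x divides both 1 + r^2 and e - r, it divides 2; since c is
      odd, c = 1, and (1, 0, 1) is a solution.\<close>
    have "E = 2 * (a * b * c)" using 4 k by simp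
    moreover have "c * u\<^sup>2 \<ge> 0" using pos by simp
    ultimately have "a * x\<^sup>2 = a * b * c" "b * y\<^sup>2 = a * b * c" "c * u\<^sup>2 = 0" using sq' unfolding E_def by linarith+
    then have z: "x\<^sup>2 = b * c" "y\<^sup>2 = a * c" "u = 0" using pos by auto
    have "b * b dvd b * c" using dv(3) z mult_dvd_mono[of b x b x] by (simp add: power2_eq_square)
    then have "b dvd c" using pos by simp
    then have b1: "b = 1" using cop(3) pos by (metis coprime_common_divisor dvd_refl zdvd1_eq abs_of_pos)
    have "a * a dvd a * c" using dv(2) z mult_dvd_mono[of a y a y] by (simp add: power2_eq_square)
    then have "a dvd c" using pos by simp
    then have a1: "a = 1" using cop(2) pos by (metis coprime_common_divisor dvd_refl zdvd1_eq abs_of_pos)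
    have c: "c = x * x" "y * y = x * x" using z a1 b1 by (simp_all add: power2_eq_square)
    then have "y = x \<or> y = - x" by (simp add: square_eq_iff)
    then obtain e where e: "y = e * x" "e * e = (1::int)" by (metis mult_1 mult_minus1 square_eq_1_iff minus_mult_minus)
    have x0: "x \<noteq> 0" using c pos by auto
    have "x * x dvd x * (e - r)" using dv(1) c e by (simp add: algebra_simps)
    then have "x dvd e - r" using x0 by simp
    moreover have "x dvd 1 + r\<^sup>2" using r a1 b1 c dvd_mult_left by auto
    moreover have "(1 + r\<^sup>2) + (e - r) * (e + r) = 2" using e by (simp add: power2_eq_square algebra_simps)
    ultimately have "x dvd 2" by (metis dvd_add dvd_mult2)
    moreover have "odd x" using odd c by simp
    then have "coprime x 2" by (simp add: coprime_right_2_iff_odd)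
    ultimately have "is_unit x" using coprime_common_divisor[of x 2 x] by simp
    then have "x = 1 \<or> x = - 1" by (simp add: zdvd1_eq) linarith
    then have "c = 1" using c by auto
    then show ?thesis using that[of 1 1 0] a1 b1 by simp
  qed
qed

section \<open>Values of binary quadratic forms\<close>

lemma coprime_iff_no_common_prime:
  fixes m n :: int
  assumes "m \<noteq> 0 \<or> n \<noteq> 0"
  shows "coprime m n \<longleftrightarrow> (\<forall>p. prime p \<longrightarrow> p dvd m \<longrightarrow> \<not> p dvd n)"
proof
  assume "coprime m n"
  then show "\<forall>p. prime p \<longrightarrow> p dvd m \<longrightarrow> \<not> p dvd n"
    using coprime_common_divisor not_prime_unit by blast
next
  assume h: "\<forall>p. prime p \<longrightarrow> p dvd m \<longrightarrow> \<not> p dvd n"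
  show "coprime m n"
  proof (rule ccontr)
    assume "\<not> coprime m n"
    then have "gcd m n \<noteq> 1" by (simp add: coprime_iff_gcd_eq_1)
    moreover have "gcd m n \<noteq> 0" using assms by simp
    ultimately have "\<not> is_unit (gcd m n)" by (metis gcd_ge_0_int zdvd1_eq abs_of_nonneg)
    then obtain p where "prime p" "p dvd gcd m n" using prime_divisor_exists[of "gcd m n"] \<open>gcd m n \<noteq> 0\<close> by blast
    then show False using h by auto
  qed
qed

lemma sum_of_squares_mod_4:
  fixes m k D :: int
  assumes "4 dvd m\<^sup>2 + D * k\<^sup>2" "D mod 4 = 1"
  shows "even k"
proof (rule ccontr)
  assume "odd k"
  have sq: "n\<^sup>2 mod 4 = (if even n then 0 else 1)" for n :: int
  proof (cases "even n")
    case True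
    then show ?thesis by (auto elim!: evenE)
  next
    case False
    then obtain j where "n = 2 * j + 1" by (auto elim!: oddE)
    then have "n\<^sup>2 = 4 * (j\<^sup>2 + j) + 1" by (simp add: power2_eq_square algebra_simps)
    then show ?thesis using False by presburger
  qed
  have "(m\<^sup>2 + D * k\<^sup>2) mod 4 = (m\<^sup>2 mod 4 + (D mod 4) * (k\<^sup>2 mod 4) mod 4) mod 4"
    by (simp add: mod_simps)
  also have "\<dots> \<noteq> 0" using sq[of m] sq[of k] \<open>odd k\<close> assms(2) by auto
  finally show False using assms(1) by (simp add: dvd_eq_mod_eq_0)
qed

lemma squarefree_dvd_square_imp:
  fixes p D k :: int
  assumes "prime p" "squarefree D" "p\<^sup>2 dvd D * k\<^sup>2"
  shows "p dvd k"
proof (rule ccontr)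
  assume "\<not> p dvd k"
  then have "coprime (p\<^sup>2) (k\<^sup>2)" using assms(1) by (simp add: prime_imp_coprime)
  then have "p\<^sup>2 dvd D" using assms(3) by (simp add: coprime_dvd_mult_left_iff)
  then have "is_unit p" using assms(2) squarefreeD by blast
  then show False using assms(1) not_prime_unit by blast
qed

text \<open>Completing the square in either variable writes u^2 times an outer coefficient as m^2 +
  D k^2 or m^2 + D x^2. A prime of u dividing 2 D would then divide both k and x: by squarefreeness
  if it divides D, and by residues modulo 4 if it is 2.\<close>

lemma square_value_coprime:
  fixes \<alpha> \<beta> \<gamma> x k u D :: int
  assumes det: "\<alpha> * \<gamma> - \<beta>\<^sup>2 = D" and D: "squarefree D" "D mod 4 = 1"
    and eq: "\<alpha> * x\<^sup>2 + 2 * \<beta> * x * k + \<gamma> * k\<^sup>2 = u\<^sup>2" and cop: "coprime x k"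
  shows "coprime u (2 * D)"
proof -
  have e1: "\<alpha> * u\<^sup>2 = (\<alpha> * x + \<beta> * k)\<^sup>2 + D * k\<^sup>2" and e2: "\<gamma> * u\<^sup>2 = (\<beta> * x + \<gamma> * k)\<^sup>2 + D * x\<^sup>2"
    unfolding eq[symmetric] det[symmetric] by (simp_all add: power2_eq_square algebra_simps)
  have D0: "D \<noteq> 0" using D by auto
  have "\<not> p dvd 2 * D" if p: "prime p" "p dvd u" for p
  proof
    assume "p dvd 2 * D"
    then have "p dvd 2 \<or> p dvd D" using p prime_dvd_mult_iff by blast
    have p2: "p\<^sup>2 dvd u\<^sup>2" using p by simp
    have "p dvd k \<and> p dvd x"
    proof (cases "p dvd D")
      case True
      have aux: "p dvd w" if "s * u\<^sup>2 = m\<^sup>2 + D * w\<^sup>2" for s m w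
      proof -
        have "p dvd s * u\<^sup>2" "p dvd D * w\<^sup>2" using p True by (auto simp: power2_eq_square)
        then have "p dvd m\<^sup>2" using that by (metis dvd_add_left_iff)
        then have "p dvd m" using p prime_dvd_power by blast
        then have "p\<^sup>2 dvd m\<^sup>2" by simp
        moreover have "p\<^sup>2 dvd s * u\<^sup>2" using p2 by simp
        ultimately have "p\<^sup>2 dvd D * w\<^sup>2" using that by (metis dvd_add_right_iff)
        then show ?thesis using squarefree_dvd_square_imp p(1) D(1) by blast
      qed
      show ?thesis using aux[OF e1] aux[OF e2] by blast
    next
      case False
      then have "p dvd 2" using \<open>p dvd 2 \<or> p dvd D\<close> by blast
      then have "p = 2" using p(1) using primes_dvd_imp_eq[of p 2] by simp
      then have "4 dvd u\<^sup>2" using p2 by simp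
      then have "4 dvd \<alpha> * u\<^sup>2" "4 dvd \<gamma> * u\<^sup>2" by auto
      then show ?thesis using sum_of_squares_mod_4 D(2) \<open>p = 2\<close> unfolding e1 e2 by blast
    qed
    then show False using cop p(1) coprime_common_divisor not_prime_unit by blast
  qed
  then show ?thesis using D0 by (subst coprime_iff_no_common_prime) auto
qed

text \<open>Bezout gives one completion. Adding j times the first vector to the second changes the
  mixed value by j n, which reaches any residue modulo m, as n is invertible there, and then the
  range from 0 to n m.\<close>

lemma unimodular_completion:
  fixes x k \<alpha> \<beta> \<gamma> m :: int
  assumes "coprime x k" "m > 0" "\<alpha> * x\<^sup>2 + 2 * \<beta> * x * k + \<gamma> * k\<^sup>2 = n" "n > 0" "coprime n m"
  obtains p q where "x * q - k * p = 1"
    "0 \<le> \<alpha> * x * p + \<beta> * (x * q + k * p) + \<gamma> * k * q" "\<alpha> * x * p + \<beta> * (x * q + k * p) + \<gamma> * k * q < n * m"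
    "[\<alpha> * x * p + \<beta> * (x * q + k * p) + \<gamma> * k * q = e] (mod m)"
proof -
  obtain s t where st: "s * x + t * k = 1" using bezout_int[of x k] assms(1) by (auto simp: coprime_iff_gcd_eq_1)
  define B0 where "B0 = \<alpha> * x * (- t) + \<beta> * (x * s + k * (- t)) + \<gamma> * k * s"
  obtain i where i: "[n * i = 1] (mod m)" using cong_solve_coprime_int[OF assms(5)] by blast
  define j0 where "j0 = i * (e - B0)"
  define j where "j = j0 - m * ((B0 + j0 * n) div (n * m))"
  have "x * (s + j * k) - k * (- t + j * x) = 1" using st by (simp add: algebra_simps)
  moreover have B: "\<alpha> * x * (- t + j * x) + \<beta> * (x * (s + j * k) + k * (- t + j * x)) + \<gamma> * k * (s + j * k) = B0 + j * n"
    unfolding B0_def assms(3)[symmetric] by (simp add: power2_eq_square algebra_simps)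
  have Bm: "B0 + j * n = (B0 + j0 * n) mod (n * m)"
    unfolding j_def minus_div_mult_eq_mod[symmetric] by (simp add: algebra_simps)
  moreover have "[B0 + j * n = e] (mod m)"
  proof -
    have "[B0 + j * n = B0 + j0 * n] (mod m)"
      unfolding j_def by (simp add: cong_iff_dvd_diff algebra_simps)
    also have "B0 + j0 * n = B0 + (n * i) * (e - B0)" by (simp add: j0_def)
    also have "[\<dots> = B0 + 1 * (e - B0)] (mod m)" by (intro cong_add cong_mult i) auto
    finally show ?thesis by simp
  qed
  ultimately show ?thesis
    using assms(2,4) by (intro that[of "s + j * k" "- t + j * x"]) (simp_all only: B Bm pos_mod_sign pos_mod_bound mult_pos_pos)
qed

text \<open>The identity u^2 (s^2 - C t^2) = (u s + B t)(u s - B t) - D t^2 shows that a common odd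
  prime divides D t^2, and such a prime cannot divide t because s and t are coprime.\<close>

lemma gcd_square_forms_prime:
  fixes s t u B C D p :: int
  assumes p: "prime p" and st: "coprime s t" and det: "u\<^sup>2 * C - B\<^sup>2 = D"
    and d: "p dvd s\<^sup>2 - C * t\<^sup>2" "p dvd 2 * t * (u * s + B * t)"
  shows "p dvd 2 * D"
proof -
  have pt: "\<not> p dvd t"
  proof
    assume "p dvd t"
    then have "p dvd C * t\<^sup>2" by (simp add: power2_eq_square)
    then have "p dvd s\<^sup>2" using d(1) by (metis dvd_diff_left_iff)
    then have "p dvd s" using p prime_dvd_power by blast
    then show False using \<open>p dvd t\<close> st p coprime_common_divisor not_prime_unit by blast
  qed
  show ?thesis
  proof (cases "p dvd 2")
    case False
    then have l: "p dvd u * s + B * t" using d(2) p pt by (simp add: prime_dvd_mult_iff)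
    have "u\<^sup>2 * (s\<^sup>2 - C * t\<^sup>2) = (u * s + B * t) * (u * s - B * t) - D * t\<^sup>2"
      unfolding det[symmetric] by (simp add: power2_eq_square algebra_simps)
    then have "D * t\<^sup>2 = (u * s + B * t) * (u * s - B * t) - u\<^sup>2 * (s\<^sup>2 - C * t\<^sup>2)" by simp
    then have "p dvd D * t\<^sup>2" using l d(1) by simp
    then have "p dvd D" using p pt by (simp add: prime_dvd_mult_iff prime_dvd_power_iff)
    then show ?thesis by simp
  qed simp
qed

text \<open>Once the common factor is removed, the root of the square is prime to 2 D and still at
  most 2 D. To make it prime to v as well, the point is replaced by another one on the same conic,
  the member with parameters (1, t) of the family parametrised from the first point.\<close>

lemma primitive_square_value:
  fixes \<alpha> \<beta> \<gamma> x k u D v :: int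
  assumes det: "\<alpha> * \<gamma> - \<beta>\<^sup>2 = D" and D: "squarefree D" "D mod 4 = 1" "D > 0"
    and eq: "\<alpha> * x\<^sup>2 + 2 * \<beta> * x * k + \<gamma> * k\<^sup>2 = u\<^sup>2" and u: "u > 0" "u \<le> 2 * D"
    and v: "v > 0" "squarefree v" "coprime v (2 * D)"
  obtains x' k' u' where "coprime x' k'" "\<alpha> * x'\<^sup>2 + 2 * \<beta> * x' * k' + \<gamma> * k'\<^sup>2 = u'\<^sup>2"
    "u' > 0" "u' \<le> 58 * D ^ 5 * v\<^sup>2" "coprime u' (2 * D * v)"
proof -
  define g where "g = gcd x k"
  have "x \<noteq> 0 \<or> k \<noteq> 0" using eq u by auto
  then have g: "g > 0" by (simp add: g_def gcd_pos_int)
  obtain x0 k0 where xk: "x = g * x0" "k = g * k0" unfolding g_def by (meson gcd_dvd1 gcd_dvd2 dvdE)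
  have cop0: "coprime x0 k0"
    using g xk unfolding g_def by (metis g_def gcd_mult_distrib_int mult_cancel_left1 coprime_iff_gcd_eq_1 abs_of_pos less_irrefl)
  have "g\<^sup>2 * (\<alpha> * x0\<^sup>2 + 2 * \<beta> * x0 * k0 + \<gamma> * k0\<^sup>2) = u\<^sup>2"
    unfolding eq[symmetric] xk by (simp add: power2_eq_square algebra_simps)
  then have "g\<^sup>2 dvd u\<^sup>2" by (metis dvd_triv_left)
  then have "g dvd u" by simp
  then obtain u0 where u0: "u = g * u0" by blast
  have u0p: "u0 > 0" using u g u0 by (simp add: zero_less_mult_iff)
  have "u0 \<le> g * u0" using g u0p by (simp add: mult_le_cancel_right1)
  then have u0le: "u0 \<le> 2 * D" using u u0 by simp
  have eq0: "\<alpha> * x0\<^sup>2 + 2 * \<beta> * x0 * k0 + \<gamma> * k0\<^sup>2 = u0\<^sup>2"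
  proof -
    have "g\<^sup>2 * (\<alpha> * x0\<^sup>2 + 2 * \<beta> * x0 * k0 + \<gamma> * k0\<^sup>2) = g\<^sup>2 * u0\<^sup>2"
      using \<open>g\<^sup>2 * _ = u\<^sup>2\<close> unfolding u0 by (simp add: power_mult_distrib)
    then show ?thesis using g by simp
  qed
  have copD: "coprime u0 (2 * D)" by (rule square_value_coprime[OF det D(1,2) eq0 cop0])
  obtain p q where pq: "x0 * q - k0 * p = 1" and B0: "0 \<le> \<alpha> * x0 * p + \<beta> * (x0 * q + k0 * p) + \<gamma> * k0 * q"
      "\<alpha> * x0 * p + \<beta> * (x0 * q + k0 * p) + \<gamma> * k0 * q < u0\<^sup>2 * 1"
    using unimodular_completion[OF cop0, of 1 \<alpha> \<beta> \<gamma> "u0\<^sup>2"] eq0 u0p by (metis zero_less_one zero_less_power coprime_1_right)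
  define B where "B = \<alpha> * x0 * p + \<beta> * (x0 * q + k0 * p) + \<gamma> * k0 * q"
  define C where "C = \<alpha> * p\<^sup>2 + 2 * \<beta> * p * q + \<gamma> * q\<^sup>2"
  have det0: "u0\<^sup>2 * C - B\<^sup>2 = D"
  proof -
    have "(\<alpha> * x0\<^sup>2 + 2 * \<beta> * x0 * k0 + \<gamma> * k0\<^sup>2) * C - B\<^sup>2 = (\<alpha> * \<gamma> - \<beta>\<^sup>2) * (x0 * q - k0 * p)\<^sup>2"
      unfolding B_def C_def by (simp add: power2_eq_square algebra_simps)
    then show ?thesis by (simp add: eq0 pq det)
  qed
  have form: "\<alpha> * (X * x0 + Y * p)\<^sup>2 + 2 * \<beta> * (X * x0 + Y * p) * (X * k0 + Y * q) + \<gamma> * (X * k0 + Y * q)\<^sup>2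
      = u0\<^sup>2 * X\<^sup>2 + 2 * B * X * Y + C * Y\<^sup>2" for X Y
    unfolding eq0[symmetric] B_def C_def by (simp add: power2_eq_square algebra_simps)
  \<comment> \<open>For a prime r of 2 D v, either r divides t, and then \<open>u1\<close> is
    congruent to \<open>u0\<close>, which r does not divide because v is squarefree; or r divides
    both v and \<open>u0\<close>, and then \<open>u1\<close> is congruent to 2 B t, where r does not
    divide B since u0^2 C - B^2 = D. Removing gcd(v, u0) from v separates the two cases.\<close>
  define t where "t = 2 * D * (v div gcd v u0)"
  define X where "X = 1 - C * t\<^sup>2"
  define Y where "Y = 2 * t * (u0 * 1 + B * t)"
  define u1 where "u1 = u0 + 2 * B * t + u0 * C * t\<^sup>2"
  have gv: "gcd v u0 > 0" using v by simp
  have vdiv: "v = gcd v u0 * (v div gcd v u0)" by simp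
  have vd: "0 < v div gcd v u0" "v div gcd v u0 \<le> v"
  proof -
    define w where "w = v div gcd v u0"
    have vw: "v = gcd v u0 * w" using vdiv by (simp add: w_def)
    have "0 < gcd v u0 * w" using v(1) vw by metis
    then have "0 < w" using gv by (simp add: zero_less_mult_iff)
    moreover have "w dvd v" using vw by (metis dvd_triv_right)
    then have "w \<le> v" using v(1) by (rule zdvd_imp_le)
    ultimately show "0 < v div gcd v u0" "v div gcd v u0 \<le> v" by (simp_all add: w_def)
  qed
  have t: "t > 0" "t \<le> 2 * D * v" using vd D by (auto simp: t_def)
  have C: "C > 0" "C \<le> D + u0\<^sup>2"
  proof -
    have "u0\<^sup>2 * C > 0" using det0 D(3) zero_le_power2[of B] by linarith
    then show "C > 0" by (simp add: zero_less_mult_iff)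
    have "B\<^sup>2 \<le> (u0\<^sup>2)\<^sup>2" using B0 unfolding B_def[symmetric] by (intro power_mono) auto
    then have "u0\<^sup>2 * C \<le> D + u0\<^sup>2 * u0\<^sup>2" using det0 by (simp add: power2_eq_square)
    also have "\<dots> \<le> u0\<^sup>2 * D + u0\<^sup>2 * u0\<^sup>2" using D(3) u0p by (simp add: mult_le_cancel_right1)
    finally have "u0\<^sup>2 * C \<le> u0\<^sup>2 * (D + u0\<^sup>2)" by (simp add: algebra_simps)
    then show "C \<le> D + u0\<^sup>2" using u0p by simp
  qed
  have B: "0 \<le> B" "B \<le> u0\<^sup>2" using B0 by (auto simp: B_def)
  have u1p: "u1 > 0" unfolding u1_def using u0p B t C by (simp add: add_pos_nonneg)
  have val: "u0\<^sup>2 * X\<^sup>2 + 2 * B * X * Y + C * Y\<^sup>2 = u1\<^sup>2"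
    unfolding X_def Y_def u1_def by (simp add: power2_eq_square algebra_simps)
  have copu: "coprime u1 (2 * D * v)"
  proof -
    have "\<not> r dvd 2 * D * v" if r: "prime r" "r dvd u1" for r
    proof
      assume "r dvd 2 * D * v"
      then have "r dvd 2 * D \<or> r dvd v" using r(1) prime_dvd_mult_iff by blast
      show False
      proof (cases "r dvd t")
        case True
        then have "r dvd 2 * B * t + u0 * C * t\<^sup>2" by (simp add: power2_eq_square)
        then have ru: "r dvd u0" using r(2) unfolding u1_def by (metis add.assoc dvd_add_left_iff)
        then have "\<not> r dvd 2 * D" using copD r(1) coprime_common_divisor not_prime_unit by blast
        then have "r dvd v div gcd v u0" "r dvd v"
          using True r(1) \<open>r dvd 2 * D \<or> r dvd v\<close> unfolding t_def by (auto simp: prime_dvd_mult_iff)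
        moreover have "r dvd gcd v u0" using ru \<open>r dvd v\<close> by simp
        ultimately have "r * r dvd v" using vdiv by (metis mult_dvd_mono)
        then have "is_unit r" using v(2) squarefreeD by (metis power2_eq_square)
        then show False using r(1) not_prime_unit by blast
      next
        case False
        then have "\<not> r dvd 2 * D" "\<not> r dvd v div gcd v u0" unfolding t_def by auto
        then have "r dvd v" using \<open>r dvd 2 * D \<or> r dvd v\<close> by blast
        then have "r dvd gcd v u0" using vdiv \<open>\<not> r dvd v div gcd v u0\<close> r(1) by (metis prime_dvd_mult_iff)
        then have ru: "r dvd u0" by simp
        then have "r dvd u0 + u0 * C * t\<^sup>2" by simp
        then have "r dvd 2 * B * t" using r(2) unfolding u1_def by (metis add.assoc add.commute dvd_add_right_iff)
        then have "r dvd B" using r(1) False \<open>\<not> r dvd 2 * D\<close> by (auto simp: prime_dvd_mult_iff)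
        then have "r dvd u0\<^sup>2 * C - B\<^sup>2" using ru by (simp add: power2_eq_square)
        then show False using det0 \<open>\<not> r dvd 2 * D\<close> by simp
      qed
    qed
    then show ?thesis using u1p by (subst coprime_iff_no_common_prime) auto
  qed
  have copXY: "coprime X Y"
  proof -
    have nz: "X \<noteq> 0 \<or> Y \<noteq> 0" using val u1p by auto
    have "\<not> r dvd Y" if r: "prime r" "r dvd X" for r
    proof
      assume "r dvd Y"
      have "r dvd 2 * D"
        using gcd_square_forms_prime[OF r(1), of 1 t u0 C B D] r(2) \<open>r dvd Y\<close> det0 by (simp add: X_def Y_def)
      then have "r dvd t" unfolding t_def by (rule dvd_mult2)
      then have "r dvd C * t\<^sup>2" by (simp add: power2_eq_square)
      then have "r dvd 1" using r(2) unfolding X_def by (metis dvd_diff_left_iff)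
      then show False using r(1) not_prime_unit by blast
    qed
    then show ?thesis using nz by (subst coprime_iff_no_common_prime) auto
  qed
  have "coprime (X * x0 + Y * p) (X * k0 + Y * q)"
  proof (rule coprimeI)
    fix d assume d: "d dvd X * x0 + Y * p" "d dvd X * k0 + Y * q"
    have "X = (X * x0 + Y * p) * q - (X * k0 + Y * q) * p" "Y = (X * k0 + Y * q) * x0 - (X * x0 + Y * p) * k0"
    proof -
      have "(X * x0 + Y * p) * q - (X * k0 + Y * q) * p = X * (x0 * q - k0 * p)" by (simp add: algebra_simps)
      then show "X = (X * x0 + Y * p) * q - (X * k0 + Y * q) * p" by (simp add: pq)
      have "(X * k0 + Y * q) * x0 - (X * x0 + Y * p) * k0 = Y * (x0 * q - k0 * p)" by (simp add: algebra_simps)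
      then show "Y = (X * k0 + Y * q) * x0 - (X * x0 + Y * p) * k0" by (simp add: pq)
    qed
    then have "d dvd X" "d dvd Y" using d by (metis dvd_diff dvd_mult2)+
    then show "is_unit d" using copXY coprime_common_divisor by blast
  qed
  \<comment> \<open>The three summands of \<open>u1\<close> contribute 2, 16 and 40.\<close>
  moreover have "u1 \<le> 58 * D ^ 5 * v\<^sup>2"
  proof -
    have u2: "u0\<^sup>2 \<le> (2 * D)\<^sup>2" using u0le u0p by (intro power_mono) auto
    then have B2: "B \<le> 4 * D\<^sup>2" using B by (simp add: power_mult_distrib)
    have C2: "C \<le> D + 4 * D\<^sup>2" using C u2 by (simp add: power_mult_distrib)
    have DV: "D \<ge> 1" "v \<ge> 1" using D v by auto
    have D5: "D \<le> D ^ 5" "D ^ 3 \<le> D ^ 5" "D ^ 4 \<le> D ^ 5" "D ^ 5 \<ge> 0"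
      using DV by (auto intro: self_le_power power_increasing)
    have t2: "t\<^sup>2 \<le> 4 * D\<^sup>2 * v\<^sup>2" using power_mono[OF t(2), of 2] t(1) by (simp add: power_mult_distrib)
    have v2: "1 \<le> v\<^sup>2" "v \<le> v\<^sup>2" using DV by (auto simp: one_le_power self_le_power)
    have a1: "u0 \<le> 2 * (D ^ 5 * v\<^sup>2)"
    proof -
      have "D * 1 \<le> D ^ 5 * v\<^sup>2" using D5 v2 by (intro mult_mono) auto
      then show ?thesis using u0le by linarith
    qed
    have a2: "2 * B * t \<le> 16 * (D ^ 5 * v\<^sup>2)"
    proof -
      have "B * t \<le> (4 * D\<^sup>2) * (2 * D * v)" using B2 B t by (intro mult_mono) auto
      also have "\<dots> = 8 * (D ^ 3 * v)" by (simp add: power2_eq_square power3_eq_cube)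
      also have "\<dots> \<le> 8 * (D ^ 5 * v\<^sup>2)" using D5 v2 DV by (intro mult_left_mono mult_mono) auto
      finally show ?thesis by linarith
    qed
    have a3: "u0 * C * t\<^sup>2 \<le> 40 * (D ^ 5 * v\<^sup>2)"
    proof -
      have "u0 * C * t\<^sup>2 \<le> (2 * D) * (D + 4 * D\<^sup>2) * (4 * D\<^sup>2 * v\<^sup>2)"
        using u0le C2 t2 u0p C DV by (intro mult_mono mult_nonneg_nonneg) auto
      also have "\<dots> = (8 * D ^ 4 + 32 * D ^ 5) * v\<^sup>2"
        by (simp add: algebra_simps power_def numeral_eq_Suc)
      also have "\<dots> \<le> (40 * D ^ 5) * v\<^sup>2" using D5 by (intro mult_right_mono) auto
      finally show ?thesis by simp
    qed
    show ?thesis using a1 a2 a3 unfolding u1_def by linarith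
  qed
  ultimately show ?thesis using that[of "X * x0 + Y * p" "X * k0 + Y * q" u1] form val u1p copu by simp
qed

section \<open>Adapted bases\<close>

text \<open>On the lattice y = r x + v^3 k the form is v^3 times an integral form in (x, k) of
  determinant D. The first basis vector represents a square; the second is free up to multiples of
  the first, and this freedom buys two congruences. That v divides x2 makes v divide C and controls
  primitivity at v; that B = D modulo 2 D controls the common divisors of the parametrised
  coordinates.\<close>

lemma adapted_basis_exists:
  fixes a b v r m l :: int
  defines "D \<equiv> a * b" and "c \<equiv> v ^ 3"
  assumes pos: "a > 0" "b > 0" "v > 0" and D: "squarefree D" "D mod 4 = 1" and v: "squarefree v" "coprime v (2 * D)"
    and r: "c dvd a + b * r\<^sup>2" and m: "a dvd b * m\<^sup>2 - c" and l: "b dvd a * l\<^sup>2 - c"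
  obtains x1 y1 x2 y2 u B C where
    "x1 * y2 - x2 * y1 = c" "a * x1\<^sup>2 + b * y1\<^sup>2 = c * u\<^sup>2"
    "a * x1 * x2 + b * y1 * y2 = c * B" "a * x2\<^sup>2 + b * y2\<^sup>2 = c * C"
    "c dvd y1 - r * x1" "c dvd y2 - r * x2" "v dvd x2" "v dvd C" "coprime x1 v"
    "u > 0" "u \<le> 58 * D ^ 5 * v\<^sup>2" "coprime u (2 * D * v)"
    "[B = D] (mod (2 * D))" "0 \<le> B" "B < u\<^sup>2 * (2 * D * v)" "u\<^sup>2 * C - B\<^sup>2 = D"
proof -
  have D0: "D > 0" using pos by (simp add: D_def)
  have c0: "c > 0" using pos by (simp add: c_def)
  have cv: "coprime c a" "coprime c b" "odd c"
    using v(2) unfolding c_def D_def by (auto simp: coprime_power_left_iff coprime_mult_right_iff)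
  have "coprime a b"
  proof (rule coprimeI)
    fix d assume "d dvd a" "d dvd b"
    then have "d\<^sup>2 dvd D" by (simp add: D_def power2_eq_square mult_dvd_mono)
    then show "is_unit d" using D(1) squarefreeD by blast
  qed
  obtain x y u where xyu: "u > 0" "u \<le> 2 * a * b" "a * x\<^sup>2 + b * y\<^sup>2 = c * u\<^sup>2" "c dvd y - r * x"
    using conic_point_exists[OF pos(1,2) c0 \<open>coprime a b\<close> _ _ cv(3) r m l] cv(1,2) by (metis coprime_commute)
  obtain \<alpha> where \<alpha>: "a + b * r\<^sup>2 = c * \<alpha>" using r by blast
  define \<beta> where "\<beta> = b * r"
  define \<gamma> where "\<gamma> = b * c"
  have form: "a * x\<^sup>2 + b * (r * x + c * k)\<^sup>2 = c * (\<alpha> * x\<^sup>2 + 2 * \<beta> * x * k + \<gamma> * k\<^sup>2)" for x k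
  proof -
    have "a * x\<^sup>2 + b * (r * x + c * k)\<^sup>2 = (a + b * r\<^sup>2) * x\<^sup>2 + c * (2 * (b * r) * x * k + b * c * k\<^sup>2)"
      by (simp add: power2_eq_square algebra_simps)
    then show ?thesis unfolding \<alpha> \<beta>_def \<gamma>_def by (simp add: algebra_simps)
  qed
  have bil: "a * x * x' + b * (r * x + c * k) * (r * x' + c * k') = c * (\<alpha> * x * x' + \<beta> * (x * k' + k * x') + \<gamma> * k * k')" for x k x' k'
  proof -
    have "a * x * x' + b * (r * x + c * k) * (r * x' + c * k') = (a + b * r\<^sup>2) * (x * x') + c * ((b * r) * (x * k' + k * x') + b * c * k * k')"
      by (simp add: power2_eq_square algebra_simps)
    then show ?thesis unfolding \<alpha> \<beta>_def \<gamma>_def by (simp add: algebra_simps)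
  qed
  have det: "\<alpha> * \<gamma> - \<beta>\<^sup>2 = D"
  proof -
    have "\<alpha> * \<gamma> - \<beta>\<^sup>2 = (c * \<alpha>) * b - b\<^sup>2 * r\<^sup>2" by (simp add: \<beta>_def \<gamma>_def power_mult_distrib)
    also have "\<dots> = D" unfolding \<alpha>[symmetric] D_def by (simp add: power2_eq_square algebra_simps)
    finally show ?thesis .
  qed
  obtain k where k: "y = r * x + c * k" using xyu(4) by (metis dvdE diff_add_cancel add.commute)
  have "c * (\<alpha> * x\<^sup>2 + 2 * \<beta> * x * k + \<gamma> * k\<^sup>2) = c * u\<^sup>2" using xyu(3) form[of x k] k by simp
  then have "\<alpha> * x\<^sup>2 + 2 * \<beta> * x * k + \<gamma> * k\<^sup>2 = u\<^sup>2" using c0 by simp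
  moreover have "u \<le> 2 * D" using xyu(2) by (simp add: D_def)
  ultimately obtain x1 k1 u1 where 1: "coprime x1 k1" "\<alpha> * x1\<^sup>2 + 2 * \<beta> * x1 * k1 + \<gamma> * k1\<^sup>2 = u1\<^sup>2"
    "u1 > 0" "u1 \<le> 58 * D ^ 5 * v\<^sup>2" "coprime u1 (2 * D * v)"
    using primitive_square_value[OF det D D0 _ xyu(1) _ pos(3) v] by blast
  have vc: "v dvd c" by (simp add: c_def)
  have cx1: "coprime x1 v"
  proof (rule coprimeI)
    fix d assume d: "d dvd x1" "d dvd v"
    then have "d dvd c" using vc dvd_trans by blast
    then have "d dvd u1\<^sup>2" unfolding 1(2)[symmetric] \<gamma>_def using d(1) by (simp add: power2_eq_square)
    moreover have "coprime (u1\<^sup>2) v" using 1(5) by (simp add: coprime_mult_right_iff)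
    ultimately show "is_unit d" using d(2) coprime_common_divisor by blast
  qed
  obtain p q where pq: "x1 * q - k1 * p = 1"
    using unimodular_completion[OF 1(1), of 1 \<alpha> \<beta> \<gamma> "u1\<^sup>2"] 1(2,3) by (metis zero_less_one zero_less_power coprime_1_right)
  define B0 where "B0 = \<alpha> * x1 * p + \<beta> * (x1 * q + k1 * p) + \<gamma> * k1 * q"
  obtain i1 where i1: "[x1 * i1 = 1] (mod v)" using cong_solve_coprime_int[OF cx1] by blast
  have "coprime (u1\<^sup>2) (2 * D)" using 1(5) by (simp add: coprime_mult_right_iff)
  then obtain i2 where i2: "[u1\<^sup>2 * i2 = 1] (mod (2 * D))" using cong_solve_coprime_int by blast
  obtain j0 where j0: "[j0 = i1 * (- p)] (mod v)" "[j0 = i2 * (D - B0)] (mod (2 * D))"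
    using binary_chinese_remainder_int[OF v(2)] by blast
  define M where "M = 2 * D * v"
  have M0: "M > 0" using D0 pos by (simp add: M_def)
  \<comment> \<open>Subtracting multiples of \<open>M\<close> preserves both congruences and reduces
    B modulo u1^2 M. This keeps B, and with it C, polynomial in v.\<close>
  define j where "j = j0 - M * ((B0 + j0 * u1\<^sup>2) div (u1\<^sup>2 * M))"
  have jv: "[j = i1 * (- p)] (mod v)"
    by (rule cong_trans[OF _ j0(1)]) (simp add: j_def M_def cong_iff_dvd_diff)
  have jD: "[j = i2 * (D - B0)] (mod (2 * D))"
    by (rule cong_trans[OF _ j0(2)]) (simp add: j_def M_def cong_iff_dvd_diff mult.assoc)
  define x2 where "x2 = p + j * x1"
  define k2 where "k2 = q + j * k1"
  define B where "B = \<alpha> * x1 * x2 + \<beta> * (x1 * k2 + k1 * x2) + \<gamma> * k1 * k2"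
  define C where "C = \<alpha> * x2\<^sup>2 + 2 * \<beta> * x2 * k2 + \<gamma> * k2\<^sup>2"
  have Bj: "B = B0 + j * u1\<^sup>2"
    unfolding B_def B0_def x2_def k2_def 1(2)[symmetric] by (simp add: power2_eq_square algebra_simps)
  have Bm: "B = (B0 + j0 * u1\<^sup>2) mod (u1\<^sup>2 * M)"
    unfolding Bj j_def minus_div_mult_eq_mod[symmetric] by (simp add: algebra_simps)
  have uM: "u1\<^sup>2 * M > 0" using 1(3) M0 by simp
  have det12: "x1 * k2 - k1 * x2 = 1" using pq by (simp add: x2_def k2_def algebra_simps)
  have detB: "u1\<^sup>2 * C - B\<^sup>2 = D"
  proof -
    have "(\<alpha> * x1\<^sup>2 + 2 * \<beta> * x1 * k1 + \<gamma> * k1\<^sup>2) * C - B\<^sup>2 = (\<alpha> * \<gamma> - \<beta>\<^sup>2) * (x1 * k2 - k1 * x2)\<^sup>2"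
      unfolding B_def C_def by (simp add: power2_eq_square algebra_simps)
    then show ?thesis by (simp add: 1(2) det12 det)
  qed
  have vx2: "v dvd x2"
  proof -
    have "[x2 = p + i1 * (- p) * x1] (mod v)" unfolding x2_def by (intro cong_add cong_mult jv) auto
    also have "p + i1 * (- p) * x1 = p + (x1 * i1) * (- p)" by simp
    also have "[\<dots> = p + 1 * (- p)] (mod v)" by (intro cong_add cong_mult i1) auto
    finally show ?thesis by (simp add: cong_0_iff)
  qed
  have BD: "[B = D] (mod (2 * D))"
  proof -
    have "[B = B0 + i2 * (D - B0) * u1\<^sup>2] (mod (2 * D))" unfolding Bj by (intro cong_add cong_mult jD) auto
    also have "B0 + i2 * (D - B0) * u1\<^sup>2 = B0 + (u1\<^sup>2 * i2) * (D - B0)" by simp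
    also have "[\<dots> = B0 + 1 * (D - B0)] (mod (2 * D))" by (intro cong_add cong_mult i2) auto
    finally show ?thesis by simp
  qed
  have vC: "v dvd C"
  proof -
    have "v dvd \<gamma>" using vc by (simp add: \<gamma>_def)
    then show ?thesis using vx2 by (simp add: C_def power2_eq_square)
  qed
  show ?thesis
  proof (rule that[of x1 "r * x2 + c * k2" x2 "r * x1 + c * k1" u1 B C])
    show "x1 * (r * x2 + c * k2) - x2 * (r * x1 + c * k1) = c"
    proof -
      have "x1 * (r * x2 + c * k2) - x2 * (r * x1 + c * k1) = c * (x1 * k2 - k1 * x2)" by (simp add: algebra_simps)
      then show ?thesis by (simp add: det12)
    qed
    show "a * x1\<^sup>2 + b * (r * x1 + c * k1)\<^sup>2 = c * u1\<^sup>2" by (simp add: form 1(2))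
    show "a * x2\<^sup>2 + b * (r * x2 + c * k2)\<^sup>2 = c * C" by (simp add: form C_def)
    show "a * x1 * x2 + b * (r * x1 + c * k1) * (r * x2 + c * k2) = c * B" by (simp add: bil B_def)
    show "0 \<le> B" "B < u1\<^sup>2 * (2 * D * v)" using Bm uM by (simp_all add: M_def)
  qed (use 1 vx2 vC cx1 BD detB in auto)
qed

text \<open>The congruence on B makes D divide B and C, and C = 2 modulo 4. A prime therefore
  divides both forms exactly when it divides s and 2 D. Its square never does: for p | D it would
  divide u^2 C - B^2 = D, and for p = 2 one would have 4 | C. Two positive squarefree integers with
  the same primes are equal.\<close>

lemma gcd_square_forms:
  fixes s t u B C D :: int
  assumes st: "coprime s t" and det: "u\<^sup>2 * C - B\<^sup>2 = D" and D: "squarefree D" "D mod 4 = 1"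
    and u: "coprime u (2 * D)" and B: "[B = D] (mod (2 * D))"
  shows "gcd (s\<^sup>2 - C * t\<^sup>2) (2 * t * (u * s + B * t)) = gcd s (2 * D)"
proof -
  define P where "P = s\<^sup>2 - C * t\<^sup>2"
  define R where "R = 2 * t * (u * s + B * t)"
  have D0: "D \<noteq> 0" using D by auto
  have oddD: "odd D" using D(2) by presburger
  have DB: "D dvd B"
  proof -
    have "2 * D dvd B - D" using B by (simp add: cong_iff_dvd_diff)
    then have "D dvd B - D" using dvd_mult_right by blast
    then show ?thesis by (simp add: dvd_diff_left_iff)
  qed
  have oddB: "odd B"
  proof -
    have "2 * D dvd B - D" using B by (simp add: cong_iff_dvd_diff)
    then have "2 dvd B - D" using dvd_mult_left by blast
    then show ?thesis using oddD by presburger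
  qed
  have DC: "D dvd C"
  proof -
    have "D dvd u\<^sup>2 * C" using DB det by (metis dvd_add dvd_refl diff_eq_eq dvd_mult power2_eq_square)
    moreover have "coprime D (u\<^sup>2)" using u by (simp add: coprime_mult_right_iff coprime_commute)
    ultimately show ?thesis by (simp add: coprime_dvd_mult_right_iff)
  qed
  have m4: "n\<^sup>2 mod 4 = 1" if on: "odd n" for n :: int
  proof -
    obtain j where "n = 2 * j + 1" using on by (auto elim!: oddE)
    then have "n\<^sup>2 = 4 * (j\<^sup>2 + j) + 1" by (simp add: power2_eq_square algebra_simps)
    then show ?thesis by presburger
  qed
  have C4: "C mod 4 = 2"
  proof -
    have "odd u" using u by (simp add: coprime_mult_right_iff)
    have "u\<^sup>2 * C = B\<^sup>2 + D" using det by simp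
    then have "(u\<^sup>2 * C) mod 4 = 2" using m4[OF oddB] D(2) by presburger
    moreover have "(u\<^sup>2 * C) mod 4 = C mod 4" using m4[OF \<open>odd u\<close>] by (metis mod_mult_left_eq mult_1)
    ultimately show ?thesis by simp
  qed
  have main: "p dvd gcd P R \<longleftrightarrow> p dvd gcd s (2 * D)" if p: "prime p" for p
  proof
    assume h: "p dvd gcd P R"
    then have p2D: "p dvd 2 * D" using gcd_square_forms_prime[OF p st det] by (simp add: P_def R_def)
    have "p dvd C"
    proof (cases "p dvd D")
      case True
      then show ?thesis using DC dvd_trans by blast
    next
      case False
      then have "p dvd 2" using p2D p by (simp add: prime_dvd_mult_iff)
      moreover have "2 dvd C" using C4 by presburger
      ultimately show ?thesis using dvd_trans by blast
    qed
    then have "p dvd C * t\<^sup>2" by simp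
    moreover have "p dvd s\<^sup>2 - C * t\<^sup>2" using h by (simp add: P_def)
    ultimately have "p dvd s\<^sup>2" by (metis dvd_diff_left_iff)
    then have "p dvd s" using p prime_dvd_power by blast
    then show "p dvd gcd s (2 * D)" using p2D by simp
  next
    assume h: "p dvd gcd s (2 * D)"
    then have ps: "p dvd s" and p2D: "p dvd 2 * D" by auto
    have "p dvd C \<and> p dvd 2 * B"
    proof (cases "p dvd D")
      case True
      then show ?thesis using DC DB dvd_trans by (metis dvd_mult)
    next
      case False
      then have "p dvd 2" using p2D p by (simp add: prime_dvd_mult_iff)
      moreover have "2 dvd C" using C4 by presburger
      ultimately show ?thesis using dvd_trans by (metis dvd_mult2)
    qed
    moreover have "R = 2 * B * t\<^sup>2 + 2 * t * u * s" by (simp add: R_def power2_eq_square algebra_simps)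
    ultimately show "p dvd gcd P R" using ps by (simp add: P_def power2_eq_square)
  qed
  have sqf1: "\<not> p\<^sup>2 dvd gcd P R" if p: "prime p" for p
  proof
    assume h: "p\<^sup>2 dvd gcd P R"
    then have "p dvd gcd P R" by (metis dvd_trans power2_eq_square dvd_triv_left)
    then have ps: "p dvd s" "p dvd 2 * D" using main[OF p] by auto
    then have pt: "\<not> p dvd t" using st p coprime_common_divisor not_prime_unit by blast
    have "p\<^sup>2 dvd s\<^sup>2 - C * t\<^sup>2" using h by (simp add: P_def)
    moreover have "p\<^sup>2 dvd s\<^sup>2" using ps by simp
    ultimately have "p\<^sup>2 dvd C * t\<^sup>2" by (metis dvd_diff_right_iff)
    moreover have "coprime (p\<^sup>2) (t\<^sup>2)" using pt p by (simp add: prime_imp_coprime)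
    ultimately have pC: "p\<^sup>2 dvd C" by (simp add: coprime_dvd_mult_left_iff)
    show False
    proof (cases "p dvd D")
      case True
      then have "p\<^sup>2 dvd B\<^sup>2" using DB dvd_trans by (metis dvd_power_same)
      then have "p\<^sup>2 dvd u\<^sup>2 * C - B\<^sup>2" using pC by simp
      then have "p\<^sup>2 dvd D" by (simp add: det)
      then have "is_unit p" using D(1) squarefreeD by blast
      then show False using p not_prime_unit by blast
    next
      case False
      then have "p dvd 2" using ps p by (simp add: prime_dvd_mult_iff)
      then have "p = 2" using primes_dvd_imp_eq[of p 2] p by simp
      then have "4 dvd C" using pC by simp
      then show False using C4 by presburger
    qed
  qed
  have g0: "gcd s (2 * D) \<noteq> 0" "gcd P R \<noteq> 0"
  proof -
    show "gcd s (2 * D) \<noteq> 0" using D0 by simp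
    show "gcd P R \<noteq> 0" using sqf1[of 2] by auto
  qed
  have sqfD: "squarefree (gcd s (2 * D))"
  proof -
    have "squarefree (2 * D)"
      using D(1) oddD by (intro squarefree_mult_coprime) (auto intro: squarefree_prime)
    then show ?thesis using squarefree_mono[OF gcd_dvd2] by blast
  qed
  have sqfP: "squarefree (gcd P R)"
    using sqf1 g0(2) by (simp add: squarefree_factorial_semiring)
  have "gcd P R = gcd s (2 * D)"
  proof (rule zdvd_antisym_nonneg)
    have *: "x dvd y" if "squarefree x" "x \<noteq> 0" "\<And>p. prime p \<Longrightarrow> p dvd x \<Longrightarrow> p dvd y" "y \<noteq> 0" for x y :: int
    proof (rule multiplicity_le_imp_dvd[OF that(2)])
      fix p :: int assume p: "prime p"
      show "multiplicity p x \<le> multiplicity p y"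
      proof (cases "p dvd x")
        case True
        have "multiplicity p x \<le> 1" using that(1,2) p by (simp add: squarefree_factorial_semiring'')
        moreover have "multiplicity p y \<ge> 1"
          using that(3)[OF p True]
          by (simp only: One_nat_def Suc_le_eq prime_multiplicity_gt_zero_iff[OF prime_imp_prime_elem[OF p] that(4)])
        ultimately show ?thesis by simp
      qed (simp add: not_dvd_imp_multiplicity_0)
    qed
    show "gcd P R dvd gcd s (2 * D)" using * sqfP g0 main by blast
    show "gcd s (2 * D) dvd gcd P R" using * sqfD g0 main by blast
  qed auto
  then show ?thesis by (simp only: P_def R_def)
qed

section \<open>Parametrisation of the points of the conic\<close>

text \<open>Since both multipliers are positive, the common factor is the gcd itself and not its
  negative; the sign of the primitive vector is thus preserved.\<close>

lemma coprime_proportional: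
  fixes P R X Y N M :: int
  assumes "N * P = M * X" "N * R = M * Y" "N > 0" "M > 0" "coprime X Y"
  shows "P = gcd P R * X" "R = gcd P R * Y"
proof -
  have "N * gcd P R = gcd (N * P) (N * R)" using gcd_mult_distrib_int[of N P R] assms(3) by (simp only: abs_of_pos)
  also have "\<dots> = M * gcd X Y" unfolding assms(1,2) using gcd_mult_distrib_int[of M X Y] assms(4) by (simp only: abs_of_pos)
  also have "\<dots> = M" using assms(5) by (simp add: coprime_iff_gcd_eq_1)
  finally have M: "N * gcd P R = M" .
  have "N * P = N * (gcd P R * X)" "N * R = N * (gcd P R * Y)" using assms(1,2) M by (simp_all flip: mult.assoc)
  then show "P = gcd P R * X" "R = gcd P R * Y" using assms(3) by simp_all
qed

text \<open>The algebraic part of the data from \<open>adapted_basis_exists\<close>. The size bounds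
  are kept apart, because the parametrisation is pure algebra and they enter only in the
  count.\<close>

locale adapted_basis =
  fixes a b v r x1 y1 x2 y2 u B C :: int
  assumes pos: "a > 0" "b > 0" "v > 0"
    and D: "squarefree (a * b)" "(a * b) mod 4 = 1" and v: "coprime v (2 * (a * b))"
    and det: "x1 * y2 - x2 * y1 = v ^ 3" and form1: "a * x1\<^sup>2 + b * y1\<^sup>2 = v ^ 3 * u\<^sup>2"
    and form12: "a * x1 * x2 + b * y1 * y2 = v ^ 3 * B" and form2: "a * x2\<^sup>2 + b * y2\<^sup>2 = v ^ 3 * C"
    and lat: "v ^ 3 dvd y1 - r * x1" "v ^ 3 dvd y2 - r * x2" and vx2: "v dvd x2" and vC: "v dvd C"
    and x1v: "coprime x1 v" and u: "u > 0" "coprime u (2 * (a * b))" 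
    and B: "[B = a * b] (mod (2 * (a * b)))" and detB: "u\<^sup>2 * C - B\<^sup>2 = a * b"
begin

text \<open>On the conic u^2 X^2 + 2 B X Y + C Y^2 = w^2, the lines u X + w : Y = s : t through the
  known point (1, 0, -u) meet it again in X = \<open>Xc s t\<close>, Y = \<open>Yc s t\<close>, w =
  \<open>f s t\<close>.\<close>

definition Xc :: "int \<Rightarrow> int \<Rightarrow> int" where "Xc s t = s\<^sup>2 - C * t\<^sup>2"
definition Yc :: "int \<Rightarrow> int \<Rightarrow> int" where "Yc s t = 2 * t * (u * s + B * t)"
definition px :: "int \<Rightarrow> int \<Rightarrow> int" where "px s t = Xc s t * x1 + Yc s t * x2"
definition py :: "int \<Rightarrow> int \<Rightarrow> int" where "py s t = Xc s t * y1 + Yc s t * y2"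
definition f :: "int \<Rightarrow> int \<Rightarrow> int" where "f s t = u * s\<^sup>2 + 2 * B * s * t + u * C * t\<^sup>2"
definition g :: "int \<Rightarrow> int" where "g s = gcd s (2 * (a * b))"
definition zz :: "int \<Rightarrow> int \<Rightarrow> complex" where "zz x y = Complex (sqrt (of_int a) * of_int x) (sqrt (of_int b) * of_int y)"
text \<open>A square root of the complex number attached to the first basis vector, divided by u;
  the lattice spanned by \<open>\<xi>\<close> and \<open>\<eta>\<close> is built so that squaring
  its elements gives the parametrised points (\<open>lin_sq\<close>).\<close>

definition \<zeta> :: complex where "\<zeta> = csqrt (zz x1 y1) / of_int u"
definition \<xi> :: complex where "\<xi> = \<zeta> * of_int u"
definition \<eta> :: complex where "\<eta> = \<zeta> * Complex (of_int B) (sqrt (of_int (a * b)))"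

lemma c0: "v ^ 3 > 0" using pos by simp

lemma form: "a * (X * x1 + Y * x2)\<^sup>2 + b * (X * y1 + Y * y2)\<^sup>2 = v ^ 3 * (u\<^sup>2 * X\<^sup>2 + 2 * B * X * Y + C * Y\<^sup>2)"
  for X Y :: int
proof -
  have "a * (X * x1 + Y * x2)\<^sup>2 + b * (X * y1 + Y * y2)\<^sup>2 =
    (a * x1\<^sup>2 + b * y1\<^sup>2) * X\<^sup>2 + 2 * (a * x1 * x2 + b * y1 * y2) * X * Y + (a * x2\<^sup>2 + b * y2\<^sup>2) * Y\<^sup>2"
    by (simp add: power2_eq_square algebra_simps)
  then show ?thesis unfolding form1 form12 form2 by (simp add: algebra_simps)
qed

lemma square_XY: "u\<^sup>2 * (Xc s t)\<^sup>2 + 2 * B * Xc s t * Yc s t + C * (Yc s t)\<^sup>2 = (f s t)\<^sup>2"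
  unfolding Xc_def Yc_def f_def by (simp add: power2_eq_square algebra_simps)

lemma gcd_XY: "coprime s t \<Longrightarrow> gcd (Xc s t) (Yc s t) = g s"
  unfolding Xc_def Yc_def g_def by (rule gcd_square_forms[OF _ detB D u(2) B])

lemma g_pos: "g s > 0"
  using pos by (simp add: g_def gcd_pos_int)

lemma g_coprime_v: "coprime (g s) v"
proof -
  have "g s dvd 2 * (a * b)" by (simp add: g_def)
  then show ?thesis using v coprime_divisors[of "g s" "2 * (a * b)" v v] by (simp add: coprime_commute)
qed

lemma XY_coprime:
  assumes "coprime s t"
  obtains X' Y' where "Xc s t = g s * X'" "Yc s t = g s * Y'" "coprime X' Y'"
proof -
  have gp: "gcd (Xc s t) (Yc s t) = g s" "g s > 0" using gcd_XY[OF assms] g_pos by auto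
  obtain X' Y' where XY: "Xc s t = g s * X'" "Yc s t = g s * Y'" by (metis gp(1) gcd_dvd1 gcd_dvd2 dvdE)
  have "g s * gcd X' Y' = g s * 1"
    using gcd_mult_distrib_int[of "g s" X' Y'] gp unfolding XY by (simp only: abs_of_pos mult_1_right)
  then have "gcd X' Y' = 1" using gp(2) by (metis mult_cancel_left less_irrefl)
  then show ?thesis using that[OF XY] by (simp add: coprime_iff_gcd_eq_1)
qed

lemma lattice_dvd:
  assumes "v ^ 3 dvd y - r * x" "v ^ 3 dvd y' - r * x'"
  shows "v ^ 3 dvd x * y' - x' * y"
proof -
  have "x * y' - x' * y = x * (y' - r * x') - x' * (y - r * x)" by (simp add: algebra_simps)
  then show ?thesis using assms by simp
qed

text \<open>Cramer's rule: the determinant of any two vectors of the lattice is divisible by v^3,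
  the determinant of the basis, so the coefficients are integers.\<close>

lemma lattice_span:
  assumes "v ^ 3 dvd y - r * x"
  obtains X Y where "x = X * x1 + Y * x2" "y = X * y1 + Y * y2"
proof -
  obtain X where X: "x * y2 - x2 * y = v ^ 3 * X" using lattice_dvd[OF assms lat(2)] by blast
  obtain Y where Y: "x1 * y - x * y1 = v ^ 3 * Y" using lattice_dvd[OF lat(1) assms] by blast
  have "v ^ 3 * x = (x1 * y2 - x2 * y1) * x" "v ^ 3 * y = (x1 * y2 - x2 * y1) * y" by (simp_all add: det)
  then have "v ^ 3 * x = (x * y2 - x2 * y) * x1 + (x1 * y - x * y1) * x2" "v ^ 3 * y = (x * y2 - x2 * y) * y1 + (x1 * y - x * y1) * y2"
    by (simp_all add: algebra_simps)
  then have "v ^ 3 * x = v ^ 3 * (X * x1 + Y * x2)" "v ^ 3 * y = v ^ 3 * (X * y1 + Y * y2)"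
    unfolding X Y by (simp_all add: algebra_simps)
  then show ?thesis using that c0 by (metis mult_cancel_left less_irrefl)
qed

lemma lattice_span':
  fixes X Y :: int
  shows "v ^ 3 dvd (X * y1 + Y * y2) - r * (X * x1 + Y * x2)"
proof -
  have "(X * y1 + Y * y2) - r * (X * x1 + Y * x2) = X * (y1 - r * x1) + Y * (y2 - r * x2)" by (simp add: algebra_simps)
  then show ?thesis using lat by simp
qed

text \<open>The change of basis has determinant v^3, so outside the primes of v primitivity is
  unchanged. At a prime p of v, x2 vanishes and x1 is invertible, hence p divides x exactly when it
  divides X, and then y, congruent to r x, is divisible as well.\<close>

lemma coprime_coordinates:
  fixes X Y :: int
  shows "coprime (X * x1 + Y * x2) (X * y1 + Y * y2) \<longleftrightarrow> coprime X Y \<and> coprime X v"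
    (is "coprime ?x ?y \<longleftrightarrow> _")
proof
  assume h: "coprime ?x ?y"
  show "coprime X Y \<and> coprime X v"
  proof
    show "coprime X Y"
    proof (rule coprimeI)
      fix d assume "d dvd X" "d dvd Y"
      then have "d dvd ?x" "d dvd ?y" by simp_all
      then show "is_unit d" using h coprime_common_divisor by blast
    qed
    show "coprime X v"
    proof (rule coprimeI)
      fix d assume d: "d dvd X" "d dvd v"
      then have dx: "d dvd ?x" using vx2 dvd_trans by (metis dvd_add dvd_mult dvd_mult2)
      have "d dvd v ^ 3" using d(2) by (simp add: dvd_power_le[of d v 1 3, simplified] numeral_3_eq_3)
      then have "d dvd ?y - r * ?x" using lattice_span' dvd_trans by blast
      then have "d dvd ?y" using dx by (metis dvd_diff_left_iff dvd_mult)
      then show "is_unit d" using h dx coprime_common_divisor by blast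
    qed
  qed
next
  assume h: "coprime X Y \<and> coprime X v"
  show "coprime ?x ?y"
  proof -
    have e: "?x * y2 - x2 * ?y = v ^ 3 * X" "x1 * ?y - ?x * y1 = v ^ 3 * Y"
      unfolding det[symmetric] by (simp_all add: algebra_simps)
    have "\<not> p dvd ?y" if p: "prime p" "p dvd ?x" for p
    proof
      assume "p dvd ?y"
      then have pc: "p dvd v ^ 3 * X" "p dvd v ^ 3 * Y" using p(2) unfolding e[symmetric] by simp_all
      show False
      proof (cases "p dvd v")
        case True
        then have "p dvd Y * x2" using vx2 dvd_trans by (metis dvd_mult)
        then have "p dvd X * x1" using p(2) by (metis dvd_add_left_iff)
        moreover have "\<not> p dvd x1" using True x1v p(1) coprime_common_divisor not_prime_unit by blast
        ultimately have "p dvd X" using p(1) prime_dvd_mult_iff by blast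
        then show False using True h p(1) coprime_common_divisor not_prime_unit by blast
      next
        case False
        then have "\<not> p dvd v ^ 3" using p(1) prime_dvd_power by blast
        then have "p dvd X" "p dvd Y" using pc p(1) prime_dvd_mult_iff by blast+
        then show False using h p(1) coprime_common_divisor not_prime_unit by blast
      qed
    qed
    moreover have "?x \<noteq> 0 \<or> ?y \<noteq> 0"
    proof (rule ccontr)
      assume "\<not> (?x \<noteq> 0 \<or> ?y \<noteq> 0)"
      then have "v ^ 3 * X = 0" "v ^ 3 * Y = 0" using e by auto
      then show False using h c0 by auto
    qed
    ultimately show ?thesis by (subst coprime_iff_no_common_prime) auto
  qed
qed

text \<open>As v divides C, \<open>Xc s t\<close> is congruent to s^2 modulo v, and the removed
  factor \<open>g s\<close> is prime to v.\<close>

lemma coprime_X_v: "coprime s t \<Longrightarrow> Xc s t = g s * X' \<Longrightarrow> coprime X' v \<longleftrightarrow> coprime s v"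
proof -
  assume st: "coprime s t" and X': "Xc s t = g s * X'"
  have "coprime X' v \<longleftrightarrow> coprime (Xc s t) v" using g_coprime_v[of s] by (simp add: X' coprime_mult_left_iff)
  also have "\<dots> \<longleftrightarrow> coprime (s\<^sup>2) v"
  proof -
    have "[Xc s t = s\<^sup>2] (mod v)" unfolding Xc_def cong_iff_dvd_diff using vC by simp
    then show ?thesis by (metis cong_imp_coprime cong_sym coprime_commute)
  qed
  finally show "coprime X' v \<longleftrightarrow> coprime s v" by simp
qed

lemma sqrt_ab: "sqrt (of_int (a * b)) = sqrt (of_int a) * sqrt (of_int b)"
  by (simp add: real_sqrt_mult)

lemma zeta_sq: "\<zeta>\<^sup>2 * of_int (u\<^sup>2) = zz x1 y1"
  using u by (simp add: \<zeta>_def power_divide)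

text \<open>The coordinate form of \<open>zz2\<close>, by which the second basis vector is (B + i
  sqrt(a b)) / u^2 times the first.\<close>

lemma basis_relations: "u\<^sup>2 * x2 = B * x1 - b * y1" "u\<^sup>2 * y2 = B * y1 + a * x1"
proof -
  have "v ^ 3 * (u\<^sup>2 * x2) = (a * x1\<^sup>2 + b * y1\<^sup>2) * x2" by (simp add: form1)
  also have "\<dots> = (a * x1 * x2 + b * y1 * y2) * x1 - b * y1 * (x1 * y2 - x2 * y1)"
    by (simp add: power2_eq_square algebra_simps)
  also have "\<dots> = v ^ 3 * (B * x1 - b * y1)" unfolding form12 det by (simp add: algebra_simps)
  finally show "u\<^sup>2 * x2 = B * x1 - b * y1" using c0 by simp
  have "v ^ 3 * (u\<^sup>2 * y2) = (a * x1\<^sup>2 + b * y1\<^sup>2) * y2" by (simp add: form1)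
  also have "\<dots> = (a * x1 * x2 + b * y1 * y2) * y1 + a * x1 * (x1 * y2 - x2 * y1)"
    by (simp add: power2_eq_square algebra_simps)
  also have "\<dots> = v ^ 3 * (B * y1 + a * x1)" unfolding form12 det by (simp add: algebra_simps)
  finally show "u\<^sup>2 * y2 = B * y1 + a * x1" using c0 by simp
qed

lemma zz2: "of_int (u\<^sup>2) * zz x2 y2 = zz x1 y1 * Complex (of_int B) (sqrt (of_int (a * b)))"
proof -
  have g1: "p * (B * x - (q * q) * y) = p * x * B - q * y * (p * q)" for p B x q y :: real
    by (simp add: algebra_simps)
  have g2: "q * (B * y + (p * p) * x) = p * x * (p * q) + q * y * B" for p B x q y :: real
    by (simp add: algebra_simps)
  have r1: "real_of_int (u\<^sup>2) * of_int x2 = of_int B * of_int x1 - of_int b * of_int y1"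
    "real_of_int (u\<^sup>2) * of_int y2 = of_int B * of_int y1 + of_int a * of_int x1"
    using basis_relations by (metis of_int_mult of_int_diff, metis of_int_mult of_int_add)
  have "sqrt (of_int a) * (real_of_int (u\<^sup>2) * of_int x2) = sqrt (of_int a) * of_int x1 * of_int B - sqrt (of_int b) * of_int y1 * sqrt (of_int (a * b))"
    unfolding r1 sqrt_ab using g1[of "sqrt (of_int a)" "of_int B" "of_int x1" "sqrt (of_int b)" "of_int y1"] pos by simp
  moreover have "sqrt (of_int b) * (real_of_int (u\<^sup>2) * of_int y2) = sqrt (of_int a) * of_int x1 * sqrt (of_int (a * b)) + sqrt (of_int b) * of_int y1 * of_int B"
    unfolding r1 sqrt_ab using g2[of "sqrt (of_int b)" "of_int B" "of_int y1" "sqrt (of_int a)" "of_int x1"] pos by simp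
  ultimately show ?thesis by (simp add: zz_def complex_eq_iff mult_ac)
qed

lemma zz_add: "zz (X * x1 + Y * x2) (X * y1 + Y * y2) = of_int X * zz x1 y1 + of_int Y * zz x2 y2"
  by (simp add: zz_def complex_eq_iff algebra_simps)

text \<open>The number w = B + i sqrt(a b) satisfies w^2 = 2 B w - u^2 C, so (s u + t w)^2 = u^2
  \<open>Xc s t\<close> + \<open>Yc s t\<close> w, and multiplication by w / u^2 leads from the
  first basis vector to the second. The parametrisation is thus squaring.\<close>

lemma lin_sq: "(of_int s * \<xi> + of_int t * \<eta>)\<^sup>2 = zz (px s t) (py s t)"
proof -
  let ?w = "Complex (of_int B) (sqrt (of_int (a * b)))"
  have w2: "?w * ?w = 2 * of_int B * ?w - of_int (u\<^sup>2 * C)"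
  proof -
    have "u\<^sup>2 * C = B\<^sup>2 + a * b" using detB by simp
    then show ?thesis using pos by (simp add: complex_eq_iff power2_eq_square)
  qed
  have "of_int (u\<^sup>2) * (of_int s * \<xi> + of_int t * \<eta>)\<^sup>2 = (\<zeta>\<^sup>2 * of_int (u\<^sup>2)) * (of_int s * of_int u + of_int t * ?w)\<^sup>2"
    unfolding \<xi>_def \<eta>_def by (simp add: power2_eq_square algebra_simps)
  also have "(of_int s * of_int u + of_int t * ?w)\<^sup>2 = of_int (u\<^sup>2 * s\<^sup>2) + 2 * of_int (u * s * t) * ?w + of_int (t\<^sup>2) * (?w * ?w)"
    by (simp add: power2_eq_square algebra_simps)
  also have "\<dots> = of_int (u\<^sup>2 * Xc s t) + of_int (Yc s t) * ?w"
    unfolding w2 Xc_def Yc_def by (simp add: power2_eq_square algebra_simps)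
  also have "\<zeta>\<^sup>2 * of_int (u\<^sup>2) = zz x1 y1" by (rule zeta_sq)
  also have "zz x1 y1 * (of_int (u\<^sup>2 * Xc s t) + of_int (Yc s t) * ?w) = of_int (u\<^sup>2) * of_int (Xc s t) * zz x1 y1 + of_int (Yc s t) * (zz x1 y1 * ?w)"
    by (simp add: algebra_simps)
  also have "\<dots> = of_int (u\<^sup>2) * zz (px s t) (py s t)"
    unfolding zz2[symmetric] px_def py_def zz_add by (simp add: algebra_simps)
  finally show ?thesis using u by simp
qed

lemma norm_zz: "norm (zz x1 y1) = sqrt (of_int (v ^ 3)) * of_int u"
proof -
  have "norm (zz x1 y1) = sqrt (of_int a * (of_int x1)\<^sup>2 + of_int b * (of_int y1)\<^sup>2)"
    using pos by (simp add: zz_def cmod_def power_mult_distrib)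
  also have "of_int a * (of_int x1)\<^sup>2 + of_int b * (of_int y1)\<^sup>2 = real_of_int (a * x1\<^sup>2 + b * y1\<^sup>2)" by simp
  also have "\<dots> = real_of_int (v ^ 3) * (of_int u)\<^sup>2" unfolding form1 by simp
  finally show ?thesis using u by (simp add: real_sqrt_mult)
qed

lemma norm_zeta: "(norm \<zeta>)\<^sup>2 * of_int u = sqrt (of_int (v ^ 3))"
proof -
  have "(norm \<zeta>)\<^sup>2 * (of_int u)\<^sup>2 = norm (\<zeta>\<^sup>2 * of_int (u\<^sup>2))" by (simp add: norm_mult norm_power)
  also have "\<dots> = sqrt (of_int (v ^ 3)) * of_int u" unfolding zeta_sq norm_zz ..
  finally have "((norm \<zeta>)\<^sup>2 * of_int u) * of_int u = sqrt (of_int (v ^ 3)) * of_int u" by (simp add: power2_eq_square mult.assoc)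
  then show ?thesis using u by simp
qed

text \<open>Nothing depends on u, B or C, so all roots r will have the same main term; the power
  v^(3/2) in the denominator of the series originates here.\<close>

lemma covolume: "Im (cnj \<xi> * \<eta>) = sqrt (of_int (v ^ 3)) * sqrt (of_int (a * b))"
proof -
  have "cnj \<xi> * \<eta> = (cnj \<zeta> * \<zeta>) * (of_int u * Complex (of_int B) (sqrt (of_int (a * b))))"
    by (simp add: \<xi>_def \<eta>_def mult_ac)
  also have "cnj \<zeta> * \<zeta> = of_real ((norm \<zeta>)\<^sup>2)" by (metis complex_norm_square mult.commute of_real_power)
  finally have "Im (cnj \<xi> * \<eta>) = (norm \<zeta>)\<^sup>2 * (of_int u * sqrt (of_int (a * b)))" by simp
  then show ?thesis using norm_zeta by (simp add: mult.assoc[symmetric])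
qed

lemma norm_xi: "(norm \<xi>)\<^sup>2 = sqrt (of_int (v ^ 3)) * of_int u"
proof -
  have "(norm \<xi>)\<^sup>2 = ((norm \<zeta>)\<^sup>2 * of_int u) * of_int u"
    using u by (simp add: \<xi>_def norm_mult power_mult_distrib power2_eq_square)
  then show ?thesis unfolding norm_zeta .
qed

lemma norm_eta: "(norm \<eta>)\<^sup>2 = sqrt (of_int (v ^ 3)) * of_int u * of_int C"
proof -
  have "(norm (Complex (of_int B) (sqrt (of_int (a * b)))))\<^sup>2 = of_int (B\<^sup>2 + a * b)"
    using pos by (simp add: cmod_power2)
  also have "B\<^sup>2 + a * b = u\<^sup>2 * C" using detB by simp
  finally have "(norm \<eta>)\<^sup>2 = ((norm \<zeta>)\<^sup>2 * of_int u) * of_int u * of_int C"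
    by (simp add: \<eta>_def norm_mult power_mult_distrib power2_eq_square)
  then show ?thesis unfolding norm_zeta .
qed

end

section \<open>The two-to-one correspondence between parameters and points\<close>

context adapted_basis
begin

definition conic_points :: "real \<Rightarrow> (int \<times> int) set" where
  "conic_points T = {(x, y). coprime x y \<and> v ^ 3 dvd y - r * x \<and> (\<exists>w. a * x\<^sup>2 + b * y\<^sup>2 = v ^ 3 * w\<^sup>2) \<and>
     \<bar>real_of_int x\<bar> \<le> T \<and> \<bar>real_of_int y\<bar> \<le> T}"

text \<open>The factor \<open>g s\<close> in the height bound compensates for the common factor of
  the coordinates, because the squared lattice vector encodes the point before division by
  it.\<close>

definition parameters :: "real \<Rightarrow> (int \<times> int) set" where
  "parameters T = {(s, t). coprime s t \<and> coprime s v \<and>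
     hgt (of_int a) (of_int b) (lin \<xi> \<eta> (ipt (s, t))) \<le> of_int (g s) * T}"

definition point :: "int \<times> int \<Rightarrow> int \<times> int" where
  "point p = (px (fst p) (snd p) div g (fst p), py (fst p) (snd p) div g (fst p))"

lemma lin_ipt: "lin \<xi> \<eta> (ipt (s, t)) = of_int s * \<xi> + of_int t * \<eta>"
  by (simp add: lin_def ipt_def)

lemma point_eqs:
  assumes "coprime s t"
  obtains X' Y' where "Xc s t = g s * X'" "Yc s t = g s * Y'" "coprime X' Y'"
    "point (s, t) = (X' * x1 + Y' * x2, X' * y1 + Y' * y2)"
    "px s t = g s * (X' * x1 + Y' * x2)" "py s t = g s * (X' * y1 + Y' * y2)"
proof -
  obtain X' Y' where XY: "Xc s t = g s * X'" "Yc s t = g s * Y'" "coprime X' Y'" using XY_coprime[OF assms] .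
  have p: "px s t = g s * (X' * x1 + Y' * x2)" "py s t = g s * (X' * y1 + Y' * y2)"
    unfolding px_def py_def XY by (simp_all add: algebra_simps)
  then have "point (s, t) = (X' * x1 + Y' * x2, X' * y1 + Y' * y2)"
    using g_pos[of s] by (simp add: point_def)
  then show ?thesis using that XY p by blast
qed

lemma hgt_point:
  assumes "px s t = g s * x" "py s t = g s * y"
  shows "hgt (of_int a) (of_int b) (lin \<xi> \<eta> (ipt (s, t))) \<le> of_int (g s) * T \<longleftrightarrow> \<bar>real_of_int x\<bar> \<le> T \<and> \<bar>real_of_int y\<bar> \<le> T"
proof -
  have gp: "real_of_int (g s) > 0" using g_pos by simp
  have ab: "real_of_int a > 0" "real_of_int b > 0" "sqrt (of_int a) > (0::real)" "sqrt (of_int b) > (0::real)" using pos by simp_all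
  have "\<bar>Re ((lin \<xi> \<eta> (ipt (s, t)))\<^sup>2)\<bar> = (of_int (g s) * sqrt (of_int a)) * \<bar>real_of_int x\<bar>"
    unfolding lin_ipt lin_sq assms zz_def using gp ab by (simp add: abs_mult mult_ac)
  moreover have "\<bar>Im ((lin \<xi> \<eta> (ipt (s, t)))\<^sup>2)\<bar> = (of_int (g s) * sqrt (of_int b)) * \<bar>real_of_int y\<bar>"
    unfolding lin_ipt lin_sq assms zz_def using gp ab by (simp add: abs_mult mult_ac)
  moreover have "(of_int (g s) * sqrt (of_int a)) * z \<le> of_int (g s) * T * sqrt (of_int a) \<longleftrightarrow> z \<le> T" for z :: real
  proof -
    have "of_int (g s) * T * sqrt (of_int a) = (of_int (g s) * sqrt (of_int a)) * T" by simp
    then show ?thesis using gp ab by (simp only: mult_le_cancel_left_pos mult_pos_pos)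
  qed
  moreover have "(of_int (g s) * sqrt (of_int b)) * z \<le> of_int (g s) * T * sqrt (of_int b) \<longleftrightarrow> z \<le> T" for z :: real
  proof -
    have "of_int (g s) * T * sqrt (of_int b) = (of_int (g s) * sqrt (of_int b)) * T" by simp
    then show ?thesis using gp ab by (simp only: mult_le_cancel_left_pos mult_pos_pos)
  qed
  ultimately show ?thesis unfolding hgt_le_iff[OF ab(1,2)] by simp
qed

lemma point_mem:
  assumes "(s, t) \<in> parameters T"
  shows "point (s, t) \<in> conic_points T"
proof -
  have st: "coprime s t" "coprime s v" "hgt (of_int a) (of_int b) (lin \<xi> \<eta> (ipt (s, t))) \<le> of_int (g s) * T"
    using assms by (auto simp: parameters_def)
  obtain X' Y' where p: "Xc s t = g s * X'" "Yc s t = g s * Y'" "coprime X' Y'"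
    "point (s, t) = (X' * x1 + Y' * x2, X' * y1 + Y' * y2)"
    "px s t = g s * (X' * x1 + Y' * x2)" "py s t = g s * (X' * y1 + Y' * y2)"
    using point_eqs[OF st(1)] .
  have "coprime X' v" using coprime_X_v[OF st(1) p(1)] st(2) by simp
  then have cop: "coprime (X' * x1 + Y' * x2) (X' * y1 + Y' * y2)" using coprime_coordinates p(3) by blast
  have e: "(g s)\<^sup>2 * (u\<^sup>2 * X'\<^sup>2 + 2 * B * X' * Y' + C * Y'\<^sup>2) = (f s t)\<^sup>2"
    unfolding square_XY[symmetric] p(1,2) by (simp add: power2_eq_square algebra_simps)
  then have "(g s)\<^sup>2 dvd (f s t)\<^sup>2" by (metis dvd_triv_left)
  then have "g s dvd f s t" by simp
  then obtain w where w: "f s t = g s * w" by blast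
  have "(g s)\<^sup>2 * (u\<^sup>2 * X'\<^sup>2 + 2 * B * X' * Y' + C * Y'\<^sup>2) = (g s)\<^sup>2 * w\<^sup>2"
    unfolding e w by (simp add: power_mult_distrib)
  then have "u\<^sup>2 * X'\<^sup>2 + 2 * B * X' * Y' + C * Y'\<^sup>2 = w\<^sup>2" using g_pos[of s] by simp
  then have "a * (X' * x1 + Y' * x2)\<^sup>2 + b * (X' * y1 + Y' * y2)\<^sup>2 = v ^ 3 * w\<^sup>2" by (simp add: form)
  then show ?thesis unfolding p(4) conic_points_def
    using cop lattice_span'[of X' Y'] hgt_point[OF p(5,6), of T] st(3) by auto
qed

text \<open>The parameter is the direction (u X + w) : Y of the line through (1, 0, -u). The root w
  is taken positive: then the proportionality factor is positive, so that (x, y) itself is reached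
  and not its negative.\<close>

lemma conic_point_parameter:
  assumes "(x, y) \<in> conic_points T"
  obtains s t where "(s, t) \<in> parameters T" "point (s, t) = (x, y)"
proof -
  have xy: "coprime x y" "v ^ 3 dvd y - r * x" "\<bar>real_of_int x\<bar> \<le> T" "\<bar>real_of_int y\<bar> \<le> T"
    using assms by (auto simp: conic_points_def)
  obtain w0 where w0: "a * x\<^sup>2 + b * y\<^sup>2 = v ^ 3 * w0\<^sup>2" using assms by (auto simp: conic_points_def)
  define w where "w = \<bar>w0\<bar>"
  obtain X Y where XY: "x = X * x1 + Y * x2" "y = X * y1 + Y * y2" using lattice_span[OF xy(2)] .
  have cXY: "coprime X Y" "coprime X v" using xy(1) coprime_coordinates unfolding XY by blast+
  have Q: "u\<^sup>2 * X\<^sup>2 + 2 * B * X * Y + C * Y\<^sup>2 = w\<^sup>2"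
    using w0 form[of X Y] c0 unfolding XY w_def by simp
  have D0: "a * b > 0" using pos by simp
  have sq: "(u\<^sup>2 * X + B * Y)\<^sup>2 + (a * b) * Y\<^sup>2 = u\<^sup>2 * w\<^sup>2"
    unfolding Q[symmetric] detB[symmetric] by (simp add: power2_eq_square algebra_simps)
  have "w \<noteq> 0"
  proof
    assume "w = 0"
    then have "w0 = 0" by (simp add: w_def)
    then have "a * x\<^sup>2 + b * y\<^sup>2 = 0" using w0 by simp
    moreover have "a * x\<^sup>2 \<ge> 0" "b * y\<^sup>2 \<ge> 0" using pos by simp_all
    ultimately have "a * x\<^sup>2 = 0" "b * y\<^sup>2 = 0" by linarith+
    then show False using pos xy(1) by simp
  qed
  then have w: "w > 0" by (simp add: w_def)
  have "\<exists>s t m n. coprime s t \<and> m > 0 \<and> n > 0 \<and> m * Xc s t = n * X \<and> m * Yc s t = n * Y"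
  proof (cases "u * X + w = 0 \<and> Y = 0")
    \<comment> \<open>This is the centre of the pencil, up to sign, where X = -1 and the direction
      is undefined. The tangent there has direction (-B, u) and represents it.\<close>
    case True
    have "\<bar>X\<bar> = 1" using cXY(1) True by (simp add: zdvd1_eq)
    moreover have "u * X < 0" using True w by linarith
    then have "X < 0" using u(1) by (simp add: mult_less_0_iff)
    ultimately have X: "X = - 1" by linarith
    have "coprime (- B) u"
    proof (rule coprimeI)
      fix d assume d: "d dvd - B" "d dvd u"
      then have "d dvd u\<^sup>2 * C - B\<^sup>2" by (simp add: power2_eq_square)
      then have "d dvd a * b" by (simp only: detB)
      moreover have "coprime u (a * b)" using u(2) by (simp add: coprime_mult_right_iff)
      ultimately show "is_unit d" using d(2) coprime_common_divisor by blast
    qed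
    moreover have "1 * Xc (- B) u = (a * b) * X" unfolding X Xc_def detB[symmetric] by (simp add: algebra_simps)
    moreover have "1 * Yc (- B) u = (a * b) * Y" using True by (simp add: Yc_def)
    ultimately show ?thesis using D0 by (metis zero_less_one)
  next
    case False
    define s0 where "s0 = u * X + w"
    define h where "h = gcd s0 Y"
    have h: "h > 0" using False by (auto simp: h_def s0_def gcd_pos_int)
    obtain s t where st: "s0 = h * s" "Y = h * t" unfolding h_def by (meson gcd_dvd1 gcd_dvd2 dvdE)
    have "h * gcd s t = h * 1"
      using gcd_mult_distrib_int[of h s t] h unfolding st[symmetric] h_def[symmetric] by simp
    then have "coprime s t" using h by (simp add: coprime_iff_gcd_eq_1)
    define n where "n = 2 * (u * s0 + B * Y)"
    have "s0\<^sup>2 - C * Y\<^sup>2 = n * X"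
    proof -
      have "s0\<^sup>2 - C * Y\<^sup>2 = n * X + (w\<^sup>2 - (u\<^sup>2 * X\<^sup>2 + 2 * B * X * Y + C * Y\<^sup>2))"
        unfolding s0_def n_def by (simp add: power2_eq_square algebra_simps)
      then show ?thesis using Q by simp
    qed
    then have "h\<^sup>2 * Xc s t = n * X" unfolding Xc_def st by (simp add: power2_eq_square algebra_simps)
    moreover have "h\<^sup>2 * Yc s t = n * Y"
      unfolding Yc_def n_def st by (simp add: power2_eq_square algebra_simps)
    \<comment> \<open>Here n = 2 (W + u w) with W^2 + a b Y^2 = (u w)^2. Hence W >= -u w, and
      equality would force Y = 0 and u X + w = 0, the case already treated.\<close>
    moreover have "n > 0"
    proof -
      define W where "W = u\<^sup>2 * X + B * Y"
      have W2: "W\<^sup>2 + (a * b) * Y\<^sup>2 = (u * w)\<^sup>2" using sq by (simp add: W_def power_mult_distrib)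
      have uw: "u * w > 0" using u w by simp
      have "n = 2 * (W + u * w)" by (simp add: n_def s0_def W_def power2_eq_square algebra_simps)
      moreover have "W + u * w > 0"
      proof (rule ccontr)
        assume "\<not> W + u * w > 0"
        then have "u * w \<le> - W" by simp
        then have "(u * w)\<^sup>2 \<le> (- W)\<^sup>2" using uw by (intro power_mono) auto
        then have "(a * b) * Y\<^sup>2 \<le> 0" using W2 by simp
        have Y0: "Y = 0"
        proof (rule ccontr)
          assume "Y \<noteq> 0"
          then have "Y\<^sup>2 > 0" by simp
          then have "(a * b) * Y\<^sup>2 > 0" by (rule mult_pos_pos[OF D0])
          then show False using \<open>(a * b) * Y\<^sup>2 \<le> 0\<close> by linarith
        qed
        then have "W\<^sup>2 = (u * w)\<^sup>2" using W2 by simp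
        then have "W = u * w \<or> W = - (u * w)" by (simp add: power2_eq_iff)
        then have "W = - (u * w)" using \<open>u * w \<le> - W\<close> uw by linarith
        then have "u * (u * X + w) = 0" using Y0 by (simp add: W_def power2_eq_square algebra_simps)
        then show False using False Y0 u(1) by simp
      qed
      ultimately show ?thesis by simp
    qed
    moreover have "h\<^sup>2 > 0" using h by simp
    ultimately show ?thesis using \<open>coprime s t\<close> by blast
  qed
  then obtain s t m n where st: "coprime s t" "m > 0" "n > 0" "m * Xc s t = n * X" "m * Yc s t = n * Y" by blast
  have e: "Xc s t = g s * X" "Yc s t = g s * Y"
    using coprime_proportional[OF st(4,5,2,3) cXY(1)] gcd_XY[OF st(1)] by simp_all
  have p: "px s t = g s * x" "py s t = g s * y"
    unfolding px_def py_def e XY by (simp_all add: algebra_simps)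
  have "coprime s v" using coprime_X_v[OF st(1) e(1)] cXY(2) by simp
  then have "(s, t) \<in> parameters T"
    using st(1) hgt_point[OF p, of T] xy by (simp add: parameters_def)
  moreover have "point (s, t) = (x, y)" using p g_pos[of s] by (simp add: point_def)
  ultimately show ?thesis using that by blast
qed

lemma covolume_pos: "Im (cnj \<xi> * \<eta>) > 0"
  unfolding covolume using pos by simp

text \<open>Both squared lattice vectors are positive multiples of the same complex number, so the
  product of one vector with the conjugate of the other has a nonnegative real square and is itself
  real. Its imaginary part is s t' - s' t times the covolume; the two primitive pairs are therefore
  proportional.\<close>

lemma point_eq_imp:
  assumes "(s, t) \<in> parameters T" "(s', t') \<in> parameters T" "point (s, t) = point (s', t')"
  shows "(s', t') = (s, t) \<or> (s', t') = (- s, - t)"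
proof -
  have st: "coprime s t" "coprime s' t'" using assms by (auto simp: parameters_def)
  obtain x y where xy: "point (s, t) = (x, y)" by (cases "point (s, t)")
  have p: "px s t = g s * x" "py s t = g s * y" using point_eqs[OF st(1)] xy by (metis fst_conv snd_conv)+
  have p': "px s' t' = g s' * x" "py s' t' = g s' * y" using point_eqs[OF st(2)] xy assms(3) by (metis fst_conv snd_conv)+
  define \<gamma> where "\<gamma> = of_int s * \<xi> + of_int t * \<eta>"
  define \<gamma>' where "\<gamma>' = of_int s' * \<xi> + of_int t' * \<eta>"
  have zs: "zz (k * x) (k * y) = of_int k * zz x y" for k by (simp add: zz_def complex_eq_iff)
  have sq: "\<gamma>\<^sup>2 = of_int (g s) * zz x y" "\<gamma>'\<^sup>2 = of_int (g s') * zz x y"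
    unfolding \<gamma>_def \<gamma>'_def lin_sq p p' zs by simp_all
  have "(cnj \<gamma> * \<gamma>')\<^sup>2 = cnj (\<gamma>\<^sup>2) * \<gamma>'\<^sup>2" by (simp add: power_mult_distrib)
  also have "\<dots> = of_int (g s) * of_int (g s') * (zz x y * cnj (zz x y))" unfolding sq by simp
  also have "\<dots> = of_real (of_int (g s) * of_int (g s') * (norm (zz x y))\<^sup>2)"
    unfolding complex_norm_square[symmetric] by simp
  finally have sq2: "(cnj \<gamma> * \<gamma>')\<^sup>2 = of_real (of_int (g s) * of_int (g s') * (norm (zz x y))\<^sup>2)" .
  define z where "z = cnj \<gamma> * \<gamma>'"
  have nn: "0 \<le> real_of_int (g s) * of_int (g s') * (norm (zz x y))\<^sup>2"
    using g_pos[of s] g_pos[of s'] by simp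
  have "Im (z\<^sup>2) = 0" "Re (z\<^sup>2) \<ge> 0" using sq2 nn unfolding z_def[symmetric] by simp_all
  then have "Re z * Im z = 0" "(Im z)\<^sup>2 \<le> (Re z)\<^sup>2" by (auto simp: power2_eq_square)
  then have "Im z = 0" by auto
  moreover have "Im z = of_int (s * t' - s' * t) * Im (cnj \<xi> * \<eta>)"
    unfolding z_def \<gamma>_def \<gamma>'_def by (simp add: algebra_simps)
  ultimately have "real_of_int (s * t' - s' * t) = 0" using covolume_pos by simp
  then have par: "s * t' = s' * t" by (simp only: of_int_eq_0_iff right_minus_eq)
  have "s dvd s' * t" "s' dvd s * t'" using par by (metis dvd_triv_left)+
  then have "s dvd s'" "s' dvd s" using st by (simp_all add: coprime_dvd_mult_left_iff)
  then have "\<bar>s\<bar> = \<bar>s'\<bar>" by (rule zdvd_antisym_abs)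
  have "t dvd t' * s" "t' dvd t * s'" using par by (metis dvd_triv_right mult.commute)+
  then have "t dvd t'" "t' dvd t" using st by (simp_all add: coprime_dvd_mult_left_iff coprime_commute)
  then have "\<bar>t\<bar> = \<bar>t'\<bar>" by (rule zdvd_antisym_abs)
  show ?thesis
  proof (cases "s = 0 \<or> t = 0")
    case True
    then show ?thesis using \<open>\<bar>s\<bar> = \<bar>s'\<bar>\<close> \<open>\<bar>t\<bar> = \<bar>t'\<bar>\<close> by (auto simp: abs_eq_iff)
  next
    case False
    consider "s' = s" | "s' = - s" using \<open>\<bar>s\<bar> = \<bar>s'\<bar>\<close> by (auto simp: abs_eq_iff)
    then show ?thesis
    proof cases
      case 1
      then show ?thesis using par False by simp
    next
      case 2
      then have "s * t' = s * (- t)" using par by simp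
      then have "t' = - t" using False by (metis mult_cancel_left)
      then show ?thesis using 2 False by simp
    qed
  qed
qed

lemma point_uminus: "point (- s, - t) = point (s, t)"
proof -
  have "Xc (- s) (- t) = Xc s t" "Yc (- s) (- t) = Yc s t" "g (- s) = g s"
    by (simp_all add: Xc_def Yc_def g_def algebra_simps)
  then show ?thesis by (simp add: point_def px_def py_def)
qed

lemma parameters_uminus: "(s, t) \<in> parameters T \<Longrightarrow> (- s, - t) \<in> parameters T"
proof -
  have "(lin \<xi> \<eta> (ipt (- s, - t)))\<^sup>2 = (lin \<xi> \<eta> (ipt (s, t)))\<^sup>2"
    by (simp add: lin_ipt power2_eq_square algebra_simps)
  then have "hgt (of_int a) (of_int b) (lin \<xi> \<eta> (ipt (- s, - t))) = hgt (of_int a) (of_int b) (lin \<xi> \<eta> (ipt (s, t)))"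
    by (simp add: hgt_def)
  moreover have "g (- s) = g s" by (simp add: g_def)
  ultimately show "(s, t) \<in> parameters T \<Longrightarrow> (- s, - t) \<in> parameters T"
    by (simp add: parameters_def)
qed

lemma finite_conic_points: "finite (conic_points T)"
proof (rule finite_subset)
  show "conic_points T \<subseteq> {-\<lfloor>T\<rfloor>..\<lfloor>T\<rfloor>} \<times> {-\<lfloor>T\<rfloor>..\<lfloor>T\<rfloor>}"
  proof (clarsimp simp: conic_points_def)
    fix x y :: int
    assume "\<bar>real_of_int x\<bar> \<le> T" "\<bar>real_of_int y\<bar> \<le> T"
    then have "\<bar>x\<bar> \<le> \<lfloor>T\<rfloor>" "\<bar>y\<bar> \<le> \<lfloor>T\<rfloor>" by (simp_all add: le_floor_iff)
    then show "- \<lfloor>T\<rfloor> \<le> x \<and> x \<le> \<lfloor>T\<rfloor> \<and> - \<lfloor>T\<rfloor> \<le> y \<and> y \<le> \<lfloor>T\<rfloor>" by linarith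
  qed
qed auto

lemma card_parameters: "finite (parameters T)" "card (parameters T) = 2 * card (conic_points T)"
proof -
  define F where "F q = {p \<in> parameters T. point p = q}" for q
  have F2: "card (F q) = 2 \<and> finite (F q)" if q: "q \<in> conic_points T" for q
  proof -
    obtain s t where st: "(s, t) \<in> parameters T" "point (s, t) = q"
      using conic_point_parameter[of "fst q" "snd q" T] q by auto
    have "F q = {(s, t), (- s, - t)}"
    proof (intro equalityI subsetI)
      fix p assume p: "p \<in> F q"
      obtain s' t' where p': "p = (s', t')" by (cases p)
      have "(s', t') \<in> parameters T" "point (s, t) = point (s', t')" using p st(2) unfolding F_def p' by simp_all
      from point_eq_imp[OF st(1) this] show "p \<in> {(s, t), (- s, - t)}" unfolding p' by simp
    next
      fix p assume "p \<in> {(s, t), (- s, - t)}"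
      then show "p \<in> F q"
        using st parameters_uminus[OF st(1)] point_uminus[of s t] unfolding F_def by fastforce
    qed
    \<comment> \<open>Coprimality excludes (0, 0), so the fibre has exactly two elements.\<close>
    moreover have "(s, t) \<noteq> (- s, - t)" using st(1) by (auto simp: parameters_def)
    ultimately show ?thesis by simp
  qed
  have U: "parameters T = (\<Union>q\<in>conic_points T. F q)"
    using point_mem by (auto simp: F_def)
  then show "finite (parameters T)" using F2 finite_conic_points[of T] by auto
  have "card (parameters T) = card (\<Union>q\<in>conic_points T. F q)" using U by simp
  also have "\<dots> = (\<Sum>q\<in>conic_points T. card (F q))"
    using F2 by (intro card_UN_disjoint finite_conic_points) (auto simp: F_def)
  also have "\<dots> = (\<Sum>q\<in>conic_points T. 2)" using F2 by (intro sum.cong) auto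
  finally show "card (parameters T) = 2 * card (conic_points T)" by simp
qed

end

section \<open>Points attached to a root\<close>

text \<open>Collects the coefficients of two bounds: u <= 58 D^5 v^2, and u C <= 4 D^2 v^2 u^3 + D
  after this bound for u has been inserted.\<close>

definition norm_const :: "int \<Rightarrow> real" where
  "norm_const D = of_int (58 ^ 3 * 4 * D ^ 17 + 58 * D ^ 5 + D)"

text \<open>The outer factor 2 D bounds the number of divisors of 2 D, and the innermost one bounds
  d^(17/32) for such a divisor d. The square and the cube come from q = 2 D v and from
  \<open>\<Delta>\<close> in \<open>card_coprime_lattice_points\<close>, with the powers of v taken
  out.\<close>

definition count_error :: "int \<Rightarrow> int \<Rightarrow> real" where
  "count_error a b = (let A = area_const (of_int a) (of_int b); M = sqrt (of_int a + of_int b); D = of_int (a * b) in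
     2 * D * ((68 * A * M\<^sup>2 + 4 * A * M + M + 2 * A) * ((2 * D)\<^sup>2 * (2 * D * norm_const (a * b)) ^ 3 * (2 * D))))"

lemma squarefree_int_iff: "squarefree (int n) \<longleftrightarrow> squarefree n"
proof
  assume h: "squarefree (int n)"
  show "squarefree n"
  proof (rule squarefreeI)
    fix x assume "x\<^sup>2 dvd n"
    then have "(int x)\<^sup>2 dvd int n" by (metis int_dvd_int_iff of_nat_power)
    then have "is_unit (int x)" by (rule squarefreeD[OF h])
    then show "is_unit x" by simp
  qed
next
  assume h: "squarefree n"
  show "squarefree (int n)"
  proof (rule squarefreeI)
    fix x :: int assume "x\<^sup>2 dvd int n"
    moreover have "x\<^sup>2 = int ((nat \<bar>x\<bar>)\<^sup>2)" by simp
    ultimately have "(nat \<bar>x\<bar>)\<^sup>2 dvd n" by (metis int_dvd_int_iff)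
    then have "is_unit (nat \<bar>x\<bar>)" by (rule squarefreeD[OF h])
    then show "is_unit x" by (simp add: zdvd1_eq)
  qed
qed

section \<open>Counting the points of one root uniformly in v\<close>

context adapted_basis
begin

lemma norm_const_ge_1: "norm_const (a * b) \<ge> 1"
proof -
  have "a * b > 0" using pos by simp
  then have "1 \<le> 58 ^ 3 * 4 * (a * b) ^ 17 + 58 * (a * b) ^ 5 + a * b" 
  proof -
    have "0 \<le> (a * b) ^ 17" "0 \<le> (a * b) ^ 5" using \<open>a * b > 0\<close> by (auto intro: zero_le_power less_imp_le)
    moreover have "1 \<le> 58 ^ 3 * 4 * x + 58 * y + z" if "0 \<le> x" "0 \<le> y" "0 < z" for x y z :: int
      using that by (simp; linarith)
    ultimately show ?thesis using \<open>a * b > 0\<close> by blast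
  qed
  then show ?thesis unfolding norm_const_def by (metis of_int_1 of_int_le_iff)
qed

text \<open>The squared norms are v^(3/2) u and v^(3/2) u C. With u = O(v^2), the equation u^2 C =
  B^2 + D and the range of B give u C = O(v^8), so both squares are O(v^10) once v^(3/2) is
  estimated by v^2.\<close>

lemma norm_bounds:
  assumes ub: "u \<le> 58 * (a * b) ^ 5 * v\<^sup>2" and Bb: "0 \<le> B" "B \<le> u\<^sup>2 * (2 * (a * b) * v)"
  shows "norm \<xi> \<le> norm_const (a * b) * of_int v ^ 5" "norm \<eta> \<le> norm_const (a * b) * of_int v ^ 5"
proof -
  define D where "D = a * b"
  have D1: "D \<ge> 1" using pos by (simp add: D_def int_one_le_iff_zero_less)
  have v1: "v \<ge> 1" using pos by simp
  let ?K = "norm_const D"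
  have K1: "?K \<ge> 1" using norm_const_ge_1 by (simp add: D_def)
  have sv: "sqrt (of_int (v ^ 3)) \<le> of_int v ^ 2" "sqrt (of_int (v ^ 3)) \<ge> 0"
  proof -
    have "real_of_int (v ^ 3) \<le> (of_int v ^ 2)\<^sup>2" using v1 by (simp add: power_increasing flip: power_mult)
    then show "sqrt (of_int (v ^ 3)) \<le> of_int v ^ 2" by (intro real_le_lsqrt) auto
    show "sqrt (of_int (v ^ 3)) \<ge> 0" using v1 by simp
  qed
  have KK: "?K * of_int v ^ 10 \<le> (?K * of_int v ^ 5)\<^sup>2"
  proof -
    have "?K * of_int v ^ 10 \<le> ?K\<^sup>2 * of_int v ^ 10" using K1 v1 by (intro mult_right_mono self_le_power) auto
    then show ?thesis by (simp add: power_mult_distrib flip: power_mult)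
  qed
  have uK: "of_int u \<le> ?K * of_int v ^ 2"
  proof -
    have "u \<le> (58 ^ 3 * 4 * D ^ 17 + 58 * D ^ 5 + D) * v\<^sup>2"
    proof -
      have "58 * D ^ 5 * v\<^sup>2 \<le> (58 ^ 3 * 4 * D ^ 17 + 58 * D ^ 5 + D) * v\<^sup>2" using D1 by (intro mult_right_mono) auto
      then show ?thesis using ub unfolding D_def[symmetric] by linarith
    qed
    then have "real_of_int u \<le> of_int ((58 ^ 3 * 4 * D ^ 17 + 58 * D ^ 5 + D) * v\<^sup>2)" by (simp only: of_int_le_iff)
    then show ?thesis by (simp add: norm_const_def)
  qed
  have uCK: "of_int (u * C) \<le> ?K * of_int v ^ 8"
  proof -
    have "u * (u * C) = B\<^sup>2 + D" using detB by (simp add: D_def power2_eq_square)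
    also have "\<dots> \<le> (u\<^sup>2 * (2 * D * v))\<^sup>2 + u * D"
      using Bb u(1) D1 unfolding D_def[symmetric] by (intro add_mono power_mono) (auto simp: mult_le_cancel_right1)
    also have "\<dots> = u * (u ^ 3 * (4 * D\<^sup>2 * v\<^sup>2) + D)" by (simp add: power2_eq_square power3_eq_cube algebra_simps)
    finally have "u * C \<le> u ^ 3 * (4 * D\<^sup>2 * v\<^sup>2) + D" using u(1) by simp
    also have "\<dots> \<le> (58 * D ^ 5 * v\<^sup>2) ^ 3 * (4 * D\<^sup>2 * v\<^sup>2) + D * v ^ 8"
      using ub u(1) v1 D1 unfolding D_def[symmetric]
      by (intro add_mono mult_right_mono power_mono) (auto simp: mult_le_cancel_left1 one_le_power)
    also have "(58 * D ^ 5 * v\<^sup>2) ^ 3 * (4 * D\<^sup>2 * v\<^sup>2) = 58 ^ 3 * 4 * D ^ 17 * v ^ 8"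
    proof -
      have "(58 * D ^ 5 * v\<^sup>2) ^ 3 = 58 ^ 3 * D ^ 15 * v ^ 6" by (simp add: power_mult_distrib flip: power_mult)
      moreover have "D ^ 17 = D ^ 15 * D\<^sup>2" "v ^ 8 = v ^ 6 * v\<^sup>2" by (simp_all flip: power_add)
      ultimately show ?thesis by (simp only: mult_ac)
    qed
    also have "58 ^ 3 * 4 * D ^ 17 * v ^ 8 + D * v ^ 8 \<le> (58 ^ 3 * 4 * D ^ 17 + 58 * D ^ 5 + D) * v ^ 8"
      using D1 v1 by (simp add: algebra_simps)
    finally have "u * C \<le> (58 ^ 3 * 4 * D ^ 17 + 58 * D ^ 5 + D) * v ^ 8" .
    then have "real_of_int (u * C) \<le> of_int ((58 ^ 3 * 4 * D ^ 17 + 58 * D ^ 5 + D) * v ^ 8)" by (simp only: of_int_le_iff)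
    then show ?thesis by (simp add: norm_const_def)
  qed
  have "(norm \<xi>)\<^sup>2 \<le> of_int v ^ 2 * (?K * of_int v ^ 2)"
    unfolding norm_xi using sv uK u(1) by (intro mult_mono) auto
  also have "\<dots> = ?K * of_int v ^ 4" by (simp add: power_def numeral_eq_Suc)
  also have "\<dots> \<le> ?K * of_int v ^ 10" using K1 v1 by (intro mult_left_mono power_increasing) auto
  also note KK
  finally show "norm \<xi> \<le> norm_const (a * b) * of_int v ^ 5"
    unfolding D_def[symmetric] using K1 v1 by (rule_tac power2_le_imp_le) auto
  have "(norm \<eta>)\<^sup>2 = sqrt (of_int (v ^ 3)) * of_int (u * C)" unfolding norm_eta by simp
  also have "\<dots> \<le> of_int v ^ 2 * (?K * of_int v ^ 8)"
  proof (rule mult_mono[OF sv(1) uCK])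
    have "u * (u * C) = B\<^sup>2 + a * b" using detB by (simp add: power2_eq_square)
    moreover have "0 \<le> B\<^sup>2" "0 < a * b" using pos by simp_all
    ultimately have "0 < u * (u * C)" by linarith
    then have "0 < u * C" using u(1) by (metis zero_less_mult_pos)
    then show "0 \<le> real_of_int (u * C)" by (simp only: of_int_0_le_iff less_imp_le)
  qed simp
  also have "\<dots> = ?K * of_int v ^ 10" by (simp flip: power_add)
  also note KK
  finally show "norm \<eta> \<le> norm_const (a * b) * of_int v ^ 5"
    unfolding D_def[symmetric] using K1 v1 by (rule_tac power2_le_imp_le) auto
qed

lemma squarefree_2ab: "squarefree (2 * (a * b))"
proof -
  have "odd n" if "n mod 4 = 1" for n :: int using that by presburger
  then have "odd (a * b)" using D(2) by blast
  then have "coprime 2 (a * b)" using coprime_left_2_iff_odd[of "a * b"] by blast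
  moreover have "squarefree (2 :: int)" by (rule squarefree_prime) simp
  ultimately show ?thesis by (rule squarefree_mult_coprime[OF _ _ D(1)])
qed

lemma coprime_divisor_complement:
  assumes "2 * (a * b) = d * e" "d > 0"
  shows "coprime d e"
proof (rule coprimeI)
  fix c assume "c dvd d" "c dvd e"
  then have "c\<^sup>2 dvd 2 * (a * b)" unfolding assms(1) power2_eq_square by (rule mult_dvd_mono)
  then show "is_unit c" using squarefree_2ab squarefreeD by blast
qed

text \<open>With s = d m the gcd equals d exactly when m is prime to the complementary divisor e. As
  d and e are coprime, this condition, coprimality to v and coprimality of the pair merge into the
  single one that d m is prime to e v n.\<close>

lemma card_parameters_divisor:
  fixes d e :: nat
  assumes de: "2 * (a * b) = int d * int e" and d0: "d > 0"
  shows "card {p \<in> parameters T. g (fst p) = int d} =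
    card {p \<in> lattice_points (of_int a) (of_int b) (of_nat d * \<xi>) \<eta> (real d * T).
       coprime (int d * fst p) (int (e * nat v) * snd p)}"
proof -
  have cde: "coprime (int d) (int e)" using coprime_divisor_complement[OF de] d0 by simp
  have iv: "int (nat v) = v" using pos by simp
  have key: "(int d * m, n) \<in> parameters T \<and> g (int d * m) = int d \<longleftrightarrow>
      (m, n) \<in> lattice_points (of_int a) (of_int b) (of_nat d * \<xi>) \<eta> (real d * T) \<and>
      coprime (int d * m) (int (e * nat v) * n)" for m n
  proof -
    have "gcd (int d * m) (int d * int e) = int d * gcd m (int e)"
      using gcd_mult_distrib_int[of "int d" m "int e"] by simp
    then have g: "g (int d * m) = int d \<longleftrightarrow> coprime m (int e)"
      using d0 unfolding g_def de by (simp add: coprime_iff_gcd_eq_1)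
    have l: "lin (of_nat d * \<xi>) \<eta> (ipt (m, n)) = lin \<xi> \<eta> (ipt (int d * m, n))"
      by (simp add: lin_def ipt_def)
    have "coprime (int d * m) (int (e * nat v) * n) \<longleftrightarrow>
        coprime (int d * m) (int e) \<and> coprime (int d * m) v \<and> coprime (int d * m) n"
      by (simp only: of_nat_mult iv coprime_mult_right_iff) blast
    also have "coprime (int d * m) (int e) \<longleftrightarrow> coprime m (int e)"
      using cde by (simp add: coprime_mult_left_iff)
    finally show ?thesis unfolding g parameters_def lattice_points_def
      using g by (auto simp: l)
  qed
  have "bij_betw (\<lambda>p. (int d * fst p, snd p))
     {p \<in> lattice_points (of_int a) (of_int b) (of_nat d * \<xi>) \<eta> (real d * T). coprime (int d * fst p) (int (e * nat v) * snd p)}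
     {p \<in> parameters T. g (fst p) = int d}"
  proof (rule bij_betwI[where g = "\<lambda>p. (fst p div int d, snd p)"])
    show "(\<lambda>p. (int d * fst p, snd p)) \<in> {p \<in> lattice_points (of_int a) (of_int b) (of_nat d * \<xi>) \<eta> (real d * T). coprime (int d * fst p) (int (e * nat v) * snd p)}
       \<rightarrow> {p \<in> parameters T. g (fst p) = int d}"
      using key by fastforce
    show "(\<lambda>p. (fst p div int d, snd p)) \<in> {p \<in> parameters T. g (fst p) = int d} \<rightarrow>
      {p \<in> lattice_points (of_int a) (of_int b) (of_nat d * \<xi>) \<eta> (real d * T). coprime (int d * fst p) (int (e * nat v) * snd p)}"
    proof
      fix p assume p: "p \<in> {p \<in> parameters T. g (fst p) = int d}"
      then have "int d dvd fst p" unfolding g_def by (metis (mono_tags, lifting) mem_Collect_eq gcd_dvd1)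
      then have eq: "int d * (fst p div int d) = fst p" by simp
      show "(fst p div int d, snd p) \<in> {p \<in> lattice_points (of_int a) (of_int b) (of_nat d * \<xi>) \<eta> (real d * T). coprime (int d * fst p) (int (e * nat v) * snd p)}"
      proof -
        have "(int d * (fst p div int d), snd p) \<in> parameters T \<and> g (int d * (fst p div int d)) = int d"
          unfolding eq using p by simp
        then show ?thesis unfolding key by (simp only: mem_Collect_eq fst_conv snd_conv)
      qed
    qed
    fix p :: "int \<times> int"
    show "(fst (int d * fst p, snd p) div int d, snd (int d * fst p, snd p)) = p" using d0 by simp
  next
    fix p assume p: "p \<in> {p \<in> parameters T. g (fst p) = int d}"
    then have "int d dvd fst p" unfolding g_def by (metis (mono_tags, lifting) mem_Collect_eq gcd_dvd1)
    then show "(int d * fst (fst p div int d, snd p), snd (fst p div int d, snd p)) = p" by simp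
  qed
  then show ?thesis by (simp add: bij_betw_same_card)
qed

text \<open>For each divisor d the basis vector \<open>\<xi>\<close> is stretched by d, which
  multiplies the covolume by d, but the height bound is multiplied by d as well; q does not depend
  on d either. All main terms agree, and only the number of divisors enters. The power v^17 is v^2
  from q^2 times v^15 from the cube of the basis size.\<close>

lemma card_conic_points:
  assumes ub: "u \<le> 58 * (a * b) ^ 5 * v\<^sup>2" and Bb: "0 \<le> B" "B \<le> u\<^sup>2 * (2 * (a * b) * v)" and T: "T \<ge> 1"
  shows "\<bar>2 * real (card (conic_points T)) - 2 ^ card (prime_factors (nat (2 * (a * b)))) *
      (area_const (of_int a) (of_int b) * T / (sqrt (of_int (v ^ 3)) * sqrt (of_int (a * b))) * coprime_density (nat (2 * (a * b) * v)))\<bar>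
    \<le> count_error a b * (of_int v ^ 17 * T powr (17 / 32))"
proof -
  define D where "D = a * b"
  have D1: "D \<ge> 1" using pos by (simp add: D_def int_one_le_iff_zero_less)
  have v1: "v \<ge> 1" using pos by simp
  define A where "A = area_const (of_int a) (of_int b)"
  define M where "M = sqrt (of_int a + of_int b :: real)"
  define q where "q = nat (2 * D * v)"
  define E where "E = 68 * A * M\<^sup>2 + 4 * A * M + M + 2 * A"
  define W where "W = sqrt (of_int (v ^ 3)) * sqrt (of_int D)"
  define \<Delta> where "\<Delta> = 2 * of_int D * (norm_const D * of_int v ^ 5)"
  let ?Dv = "{d. d dvd nat (2 * D)}"
  have ab1: "real_of_int a \<ge> 1" "real_of_int b \<ge> 1" using pos by simp_all
  have A0: "A \<ge> 0" unfolding A_def by (rule area_const_nonneg[OF ab1])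
  have E0: "E \<ge> 0" unfolding E_def using A0 ab1 by (simp add: M_def)
  have nD: "nat (2 * D) > 0" using D1 by simp
  have finD: "finite ?Dv" using nD by simp
  have K1: "norm_const D \<ge> 1" using norm_const_ge_1 by (simp add: D_def)
  have W1: "W \<ge> 1"
  proof -
    have "1 * 1 \<le> sqrt (of_int (v ^ 3)) * sqrt (of_int D :: real)"
      using v1 D1 by (intro mult_mono) (simp_all add: one_le_power)
    then show ?thesis by (simp add: W_def)
  qed
  have Im: "Im (cnj \<xi> * \<eta>) = W" unfolding covolume W_def D_def ..
  have fin: "finite (parameters T)" by (rule card_parameters)
  have split: "card (parameters T) = (\<Sum>d\<in>?Dv. card {p \<in> parameters T. g (fst p) = int d})"
  proof -
    have "parameters T = (\<Union>d\<in>?Dv. {p \<in> parameters T. g (fst p) = int d})"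
    proof (intro equalityI subsetI)
      fix p assume p: "p \<in> parameters T"
      have "g (fst p) dvd 2 * D" by (simp add: g_def D_def)
      then have "nat (g (fst p)) dvd nat (2 * D)" using g_pos[of "fst p"] D1 by (simp add: nat_dvd_iff)
      moreover have "g (fst p) = int (nat (g (fst p)))" using g_pos[of "fst p"] by simp
      ultimately show "p \<in> (\<Union>d\<in>?Dv. {p \<in> parameters T. g (fst p) = int d})" using p by blast
    qed auto
    then have "card (parameters T) = card (\<Union>d\<in>?Dv. {p \<in> parameters T. g (fst p) = int d})" by simp
    also have "\<dots> = (\<Sum>d\<in>?Dv. card {p \<in> parameters T. g (fst p) = int d})"
      using fin by (intro card_UN_disjoint finD) auto
    finally show ?thesis .
  qed
  let ?main = "A * T / W * coprime_density q"
  let ?err = "E * ((2 * of_int D)\<^sup>2 * (2 * of_int D * norm_const D) ^ 3 * (2 * of_int D)) * (of_int v ^ 17 * T powr (17 / 32))"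
  have each: "\<bar>real (card {p \<in> parameters T. g (fst p) = int d}) - ?main\<bar> \<le> ?err" if dD: "d \<in> ?Dv" for d
  proof -
    have d0: "d > 0" using dvd_pos_nat[OF nD] dD by simp
    obtain e where e: "nat (2 * D) = d * e" using dD by blast
    have de: "2 * (a * b) = int d * int e"
      using e D1 unfolding D_def by (metis int_nat_eq mult.commute of_nat_mult zero_le_mult_iff zero_le_numeral less_imp_le pos(1,2))
    have dle: "real d \<le> 2 * of_int D"
    proof -
      have "d \<le> nat (2 * D)" using dD nD by (auto intro: dvd_imp_le)
      then have "int d \<le> 2 * D" using D1 by linarith
      then have "real_of_int (int d) \<le> of_int (2 * D)" by (simp only: of_int_le_iff)
      then show ?thesis by simp
    qed
    have d1: "real d \<ge> 1" using d0 by simp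
    have vdD: "coprime (int d) v"
      using v de coprime_divisors[of "int d" "2 * (a * b)" v v] by (simp add: coprime_commute)
    have "coprime (int d) (int e * v)"
      using coprime_divisor_complement[OF de] d0 vdD by (simp add: coprime_mult_right_iff)
    then have cop: "coprime d (e * nat v)"
      using v1 by (metis coprime_int_iff of_nat_mult int_nat_eq zero_le_one order_trans)
    have qd: "q = d * (e * nat v)"
      using e v1 D1 unfolding q_def by (simp add: nat_mult_distrib mult.assoc)
    have q0: "q > 0" using v1 D1 by (simp add: q_def)
    have im: "Im (cnj (of_nat d * \<xi>) * \<eta>) = real d * W"
      using Im by (simp add: algebra_simps)
    have im1: "\<bar>Im (cnj (of_nat d * \<xi>) * \<eta>)\<bar> = real d * W" "real d * W \<ge> 1"
      using W1 d1 mult_mono[of 1 "real d" 1 W] unfolding im by simp_all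
    have nb: "norm (of_nat d * \<xi>) \<le> \<Delta>" "norm \<eta> \<le> \<Delta>"
    proof -
      note n = norm_bounds[OF ub Bb, folded D_def]
      show "norm (of_nat d * \<xi>) \<le> \<Delta>" unfolding \<Delta>_def norm_mult norm_of_nat
        using n dle K1 v1 by (intro mult_mono) auto
      have "1 * norm \<eta> \<le> \<Delta>" unfolding \<Delta>_def using n D1 K1 v1 by (intro mult_mono) auto
      then show "norm \<eta> \<le> \<Delta>" by simp
    qed
    have \<Delta>1: "\<Delta> \<ge> 1"
    proof -
      have "1 * (1 * 1) \<le> \<Delta>" unfolding \<Delta>_def using D1 K1 v1 by (intro mult_mono) (auto simp: one_le_power)
      then show ?thesis by simp
    qed
    have dT: "real d * T \<ge> 1" using mult_mono[of 1 "real d" 1 T] d1 T by simp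
    note S = card_coprime_lattice_points[OF ab1 cop qd q0 _ nb \<Delta>1 dT, folded A_def M_def, folded E_def, unfolded im1(1), OF im1(2)]
    have "\<bar>real (card {p \<in> parameters T. g (fst p) = int d}) - A * (real d * T) / (real d * W) * coprime_density q\<bar>
        \<le> E * ((real q)\<^sup>2 * \<Delta> ^ 3 * (real d * T) powr (17 / 32))"
      using S unfolding card_parameters_divisor[OF de d0] by simp
    also have "A * (real d * T) / (real d * W) = A * T / W" using d0 by simp
    also have "E * ((real q)\<^sup>2 * \<Delta> ^ 3 * (real d * T) powr (17 / 32)) \<le> E * ((real q)\<^sup>2 * \<Delta> ^ 3 * (2 * of_int D * T powr (17 / 32)))"
    proof (intro mult_left_mono)
      have "(real d * T) powr (17 / 32) = real d powr (17 / 32) * T powr (17 / 32)" using d1 T by (simp add: powr_mult)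
      also have "\<dots> \<le> real d powr 1 * T powr (17 / 32)" using d1 by (intro mult_right_mono powr_mono) auto
      also have "\<dots> \<le> 2 * of_int D * T powr (17 / 32)" using dle d1 by (intro mult_right_mono) auto
      finally show "(real d * T) powr (17 / 32) \<le> 2 * of_int D * T powr (17 / 32)" .
    qed (use E0 \<Delta>1 in auto)
    also have "\<dots> = ?err"
    proof -
      have "real q = 2 * of_int D * of_int v" using v1 D1 by (simp add: q_def)
      moreover have "(real_of_int v)\<^sup>2 * (of_int v ^ 5) ^ 3 = of_int v ^ 17" by (simp flip: power_mult power_add)
      ultimately show ?thesis unfolding \<Delta>_def by (simp add: power_mult_distrib mult_ac)
    qed
    finally show ?thesis .
  qed
  have cardD: "card ?Dv = 2 ^ card (prime_factors (nat (2 * D)))"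
  proof (rule card_divisors_squarefree)
    have "squarefree (int (nat (2 * D)))" using squarefree_2ab D1 by (simp add: D_def)
    then show "squarefree (nat (2 * D))" by (simp only: squarefree_int_iff)
  qed
  have "\<bar>real (card (parameters T)) - (\<Sum>d\<in>?Dv. ?main)\<bar> = \<bar>\<Sum>d\<in>?Dv. (real (card {p \<in> parameters T. g (fst p) = int d}) - ?main)\<bar>"
    unfolding split by (simp add: sum_subtractf)
  also have "\<dots> \<le> (\<Sum>d\<in>?Dv. ?err)" by (rule order_trans[OF sum_abs sum_mono[OF each]])
  also have "\<dots> = real (card ?Dv) * ?err" by simp
  also have "\<dots> \<le> (2 * of_int D) * ?err"
  proof (intro mult_right_mono)
    have "card ?Dv \<le> card {1..nat (2 * D)}" using dvd_pos_nat[OF nD] dvd_imp_le[OF _ nD] by (intro card_mono) (auto simp: Suc_le_eq)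
    then show "real (card ?Dv) \<le> 2 * of_int D" using D1 by simp
    show "0 \<le> ?err" using E0 D1 K1 v1 by simp
  qed
  also have "\<dots> = count_error a b * (of_int v ^ 17 * T powr (17 / 32))"
    unfolding count_error_def Let_def A_def[symmetric] M_def[symmetric] E_def[symmetric] D_def[symmetric] by simp
  finally show ?thesis
    unfolding card_parameters(2) A_def[symmetric] D_def[symmetric] W_def[symmetric] q_def[symmetric] by (simp add: cardD)
qed

end

section \<open>Roots of the congruence\<close>

definition roots :: "int \<Rightarrow> int \<Rightarrow> int \<Rightarrow> int set" where
  "roots a b n = {r \<in> {0..<n}. n dvd a + b * r\<^sup>2}"

lemma finite_roots [simp]: "finite (roots a b n)"
  by (rule finite_subset[of _ "{0..<n}"]) (auto simp: roots_def)

lemma root_mod_iff: "n dvd a + b * (r mod n)\<^sup>2 \<longleftrightarrow> n dvd a + b * (r :: int)\<^sup>2"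
proof -
  have "[a + b * (r mod n)\<^sup>2 = a + b * r\<^sup>2] (mod n)" by (intro cong_add cong_mult cong_pow) (auto simp: cong_def)
  then show ?thesis by (rule cong_dvd_iff)
qed

lemma root_cong: "[r = s] (mod n) \<Longrightarrow> n dvd a + b * r\<^sup>2 \<longleftrightarrow> n dvd a + b * (s :: int)\<^sup>2"
  using root_mod_iff[of n a b r] root_mod_iff[of n a b s] by (simp add: cong_def)

lemma root_coprime:
  fixes a b n r :: int
  assumes "coprime n (2 * (a * b))" "n dvd a + b * r\<^sup>2"
  shows "coprime n (2 * b * r)"
proof -
  have "coprime n r"
  proof (rule coprimeI)
    fix d assume d: "d dvd n" "d dvd r"
    then have "d dvd a + b * r\<^sup>2" using assms(2) dvd_trans by blast
    moreover have "d dvd b * r\<^sup>2" using d by (simp add: power2_eq_square)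
    ultimately have "d dvd a" by (metis dvd_add_left_iff)
    moreover have "coprime n a" using assms(1) by (simp add: coprime_mult_right_iff)
    ultimately show "is_unit d" using d coprime_common_divisor by blast
  qed
  then show ?thesis using assms(1) by (simp add: coprime_mult_right_iff)
qed

text \<open>Hensel lifting: the derivative 2 b r is invertible at every root, so each root modulo n
  has exactly one lift modulo n n'. It will be used from v to v^2 and from v^2 to v^3.\<close>

lemma card_roots_lift:
  fixes a b n n' :: int
  assumes n: "n > 0" "n' > 0" "n' dvd n" and cop: "coprime n (2 * (a * b))"
  shows "card (roots a b (n * n')) = card (roots a b n)"
proof (rule bij_betw_same_card)
  show "bij_betw (\<lambda>r. r mod n) (roots a b (n * n')) (roots a b n)"
  proof (rule bij_betw_imageI)
    show "inj_on (\<lambda>r. r mod n) (roots a b (n * n'))"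
    proof (rule inj_onI)
      fix r s assume rs: "r \<in> roots a b (n * n')" "s \<in> roots a b (n * n')" "r mod n = s mod n"
      have rn: "n dvd a + b * r\<^sup>2" using rs(1) dvd_mult_left by (auto simp: roots_def)
      have c: "coprime n (2 * b * r)" by (rule root_coprime[OF cop rn])
      have "coprime n (b * (r + s))"
      proof -
        have "[b * (r + s) = b * (r + r)] (mod n)"
          using rs(3) by (intro cong_mult cong_add) (auto simp: cong_def)
        moreover have "b * (r + r) = 2 * b * r" by simp
        ultimately show ?thesis using c by (metis cong_imp_coprime cong_sym coprime_commute)
      qed
      moreover from this have "coprime n' (b * (r + s))" by (rule coprime_divisors[OF n(3) dvd_refl])
      ultimately have "coprime (n * n') (b * (r + s))" by simp
      moreover have "n * n' dvd b * (r + s) * (r - s)"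
      proof -
        have "b * (r + s) * (r - s) = (a + b * r\<^sup>2) - (a + b * s\<^sup>2)" by (simp add: power2_eq_square algebra_simps)
        moreover have "n * n' dvd a + b * r\<^sup>2" "n * n' dvd a + b * s\<^sup>2" using rs by (simp_all add: roots_def)
        ultimately show ?thesis by (simp only: dvd_diff)
      qed
      ultimately have "n * n' dvd r - s" by (simp add: coprime_dvd_mult_right_iff)
      then have "r mod (n * n') = s mod (n * n')" by (simp add: mod_eq_dvd_iff)
      then show "r = s" using rs by (simp add: roots_def)
    qed
    show "(\<lambda>r. r mod n) ` roots a b (n * n') = roots a b n"
    proof (intro equalityI subsetI)
      fix s assume "s \<in> (\<lambda>r. r mod n) ` roots a b (n * n')"
      then obtain r where r: "r \<in> roots a b (n * n')" "s = r mod n" by blast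
      then have "n dvd a + b * r\<^sup>2" using dvd_mult_left by (auto simp: roots_def)
      then show "s \<in> roots a b n" using n r by (simp add: roots_def root_mod_iff)
    next
      fix s assume s: "s \<in> roots a b n"
      then obtain e where e: "a + b * s\<^sup>2 = n * e" by (auto simp: roots_def)
      have "coprime n (2 * b * s)" using s by (intro root_coprime[OF cop]) (simp add: roots_def)
      then have "coprime n' (2 * b * s)" by (rule coprime_divisors[OF n(3) dvd_refl])
      then have "coprime (2 * b * s) n'" by (simp only: coprime_commute)
      then obtain i where i: "[(2 * b * s) * i = 1] (mod n')" using cong_solve_coprime_int by blast
      \<comment> \<open>This solves e + 2 b s k = 0 modulo n'; the quadratic term of the expansion
        carries the factor n and vanishes modulo n'.\<close>
      define k where "k = - e * i"
      have "[e + 2 * b * s * k + b * k\<^sup>2 * n = e + (2 * b * s * i) * (- e) + 0] (mod n')"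
      proof (intro cong_add)
        show "[b * k\<^sup>2 * n = 0] (mod n')" using n(3) by (simp add: cong_0_iff)
      qed (simp_all add: k_def mult_ac)
      also have "[e + (2 * b * s * i) * (- e) + 0 = e + 1 * (- e) + 0] (mod n')"
        by (intro cong_add cong_mult i) auto
      finally have "n' dvd e + 2 * b * s * k + b * k\<^sup>2 * n" by (simp add: cong_0_iff)
      then have "n * n' dvd n * (e + 2 * b * s * k + b * k\<^sup>2 * n)" by simp
      also have "n * (e + 2 * b * s * k + b * k\<^sup>2 * n) = a + b * (s + k * n)\<^sup>2"
      proof -
        have "a + b * (s + k * n)\<^sup>2 = (a + b * s\<^sup>2) + n * (2 * b * s * k + b * k\<^sup>2 * n)"
          by (simp add: power2_eq_square algebra_simps)
        then show ?thesis unfolding e by (simp add: algebra_simps)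
      qed
      finally have R: "n * n' dvd a + b * (s + k * n)\<^sup>2" .
      define r where "r = (s + k * n) mod (n * n')"
      have "r \<in> roots a b (n * n')" using R n by (simp add: roots_def r_def root_mod_iff)
      moreover have "r mod n = s"
      proof -
        have "r mod n = (s + k * n) mod n" unfolding r_def by (simp add: mod_mod_cancel)
        then show ?thesis using s by (simp add: roots_def)
      qed
      ultimately show "s \<in> (\<lambda>r. r mod n) ` roots a b (n * n')" by force
    qed
  qed
qed

lemma card_roots_cube:
  assumes "v > 0" "coprime v (2 * (a * b))"
  shows "card (roots a b (v ^ 3)) = card (roots a b v)"
proof -
  have "card (roots a b (v * v * v)) = card (roots a b (v * v))"
    using assms by (intro card_roots_lift) auto
  also have "\<dots> = card (roots a b v)" using assms by (intro card_roots_lift) auto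
  finally show ?thesis by (simp add: power3_eq_cube)
qed

lemma card_roots_mult:
  fixes m n :: int
  assumes "m > 0" "n > 0" "coprime m n"
  shows "card (roots a b (m * n)) = card (roots a b m) * card (roots a b n)"
proof -
  have "bij_betw (\<lambda>r. (r mod m, r mod n)) (roots a b (m * n)) (roots a b m \<times> roots a b n)"
  proof (rule bij_betw_imageI)
    show "inj_on (\<lambda>r. (r mod m, r mod n)) (roots a b (m * n))"
    proof (rule inj_onI)
      fix r s assume rs: "r \<in> roots a b (m * n)" "s \<in> roots a b (m * n)" "(r mod m, r mod n) = (s mod m, s mod n)"
      then have "m dvd r - s" "n dvd r - s" by (simp_all add: mod_eq_dvd_iff)
      then have "m * n dvd r - s" using assms by (intro divides_mult)
      then have "r mod (m * n) = s mod (m * n)" by (simp add: mod_eq_dvd_iff)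
      then show "r = s" using rs by (simp add: roots_def)
    qed
    show "(\<lambda>r. (r mod m, r mod n)) ` roots a b (m * n) = roots a b m \<times> roots a b n"
    proof (intro equalityI subsetI)
      fix q assume "q \<in> (\<lambda>r. (r mod m, r mod n)) ` roots a b (m * n)"
      then obtain r where r: "r \<in> roots a b (m * n)" "q = (r mod m, r mod n)" by blast
      then have "m dvd a + b * r\<^sup>2" "n dvd a + b * r\<^sup>2" using dvd_mult_left dvd_mult_right by (auto simp: roots_def)
      then show "q \<in> roots a b m \<times> roots a b n" using assms r by (simp add: roots_def root_mod_iff)
    next
      fix q assume "q \<in> roots a b m \<times> roots a b n"
      then obtain s t where st: "q = (s, t)" "s \<in> roots a b m" "t \<in> roots a b n" by blast
      obtain x where x: "[x = s] (mod m)" "[x = t] (mod n)" using binary_chinese_remainder_int[OF assms(3)] by blast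
      define r where "r = x mod (m * n)"
      have rm: "r mod m = s" "r mod n = t"
        using x st by (auto simp: r_def mod_mod_cancel roots_def cong_def)
      have "m dvd a + b * x\<^sup>2" "n dvd a + b * x\<^sup>2" using x st root_cong by (auto simp: roots_def)
      then have "m * n dvd a + b * x\<^sup>2" using assms(3) by (intro divides_mult)
      then have "r \<in> roots a b (m * n)" using assms by (simp add: roots_def r_def root_mod_iff)
      then show "q \<in> (\<lambda>r. (r mod m, r mod n)) ` roots a b (m * n)" using rm st(1) by force
    qed
  qed
  then show ?thesis by (simp add: bij_betw_same_card card_cartesian_product)
qed

text \<open>As b is invertible, the congruence is equivalent to (b r)^2 = -a b modulo p, which has
  two solutions or none, p being odd and prime to a b.\<close>

lemma card_roots_prime:
  fixes p :: nat and a b :: int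
  assumes p: "prime p" and cop: "coprime (int p) (2 * (a * b))"
  shows "int (card (roots a b (int p))) = 1 + Legendre (- (a * b)) (int p)"
proof -
  have pi: "prime (int p)" using p by simp
  have nd: "\<not> int p dvd 2" "\<not> int p dvd a" "\<not> int p dvd b"
  proof -
    have *: "\<not> int p dvd x" if "coprime (int p) x" for x
      using coprime_common_divisor[of "int p" x "int p"] that pi not_prime_unit by auto
    show "\<not> int p dvd 2" "\<not> int p dvd a" "\<not> int p dvd b"
      by (rule *, use cop in \<open>simp only: coprime_mult_right_iff\<close>)+
  qed
  have p0: "int p > 0" using p prime_gt_0_nat by simp
  have ab: "\<not> [- (a * b) = 0] (mod int p)" using nd pi by (simp add: cong_0_iff prime_dvd_mult_iff)
  have cb: "coprime b (int p)" using cop by (simp add: coprime_mult_right_iff coprime_commute)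
  obtain i where i: "[b * i = 1] (mod int p)" using cong_solve_coprime_int[OF cb] by blast
  have equiv: "int p dvd a + b * r\<^sup>2 \<longleftrightarrow> [(b * r)\<^sup>2 = - (a * b)] (mod int p)" for r
  proof -
    have "[(b * r)\<^sup>2 = - (a * b)] (mod int p) \<longleftrightarrow> int p dvd b * (a + b * r\<^sup>2)"
      by (simp add: cong_iff_dvd_diff power2_eq_square algebra_simps)
    also have "\<dots> \<longleftrightarrow> int p dvd a + b * r\<^sup>2" using nd pi by (simp add: prime_dvd_mult_iff)
    finally show ?thesis by simp
  qed
  show ?thesis
  proof (cases "QuadRes (int p) (- (a * b))")
    case False
    then have "roots a b (int p) = {}" unfolding roots_def using equiv by (auto simp: QuadRes_def)
    then show ?thesis using False ab by (simp add: Legendre_def)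
  next
    case True
    then obtain y where y: "[y\<^sup>2 = - (a * b)] (mod int p)" by (auto simp: QuadRes_def)
    define s where "s = (i * y) mod int p"
    define t where "t = (- (i * y)) mod int p"
    have bs: "[b * (i * y) = y] (mod int p)"
      using cong_mult[OF i cong_refl[of y]] by (simp add: mult.assoc)
    have root: "int p dvd a + b * (i * y)\<^sup>2"
      unfolding equiv using cong_trans[OF cong_pow[OF bs, of 2] y] .
    have ydvd: "\<not> int p dvd y"
    proof
      assume "int p dvd y"
      then have "[y\<^sup>2 = 0] (mod int p)" by (simp add: cong_0_iff power2_eq_square)
      then show False using ab y by (metis cong_sym cong_trans)
    qed
    have iy: "\<not> int p dvd i * y"
    proof
      assume "int p dvd i * y"
      then have "[b * (i * y) = 0] (mod int p)" by (simp add: cong_0_iff)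
      then have "[y = 0] (mod int p)" using bs by (metis cong_sym cong_trans)
      then show False using ydvd by (simp add: cong_0_iff)
    qed
    have st: "s \<noteq> t"
    proof
      assume "s = t"
      then have "int p dvd i * y - (- (i * y))" unfolding s_def t_def by (simp only: mod_eq_dvd_iff)
      then have "int p dvd 2 * (i * y)" by simp
      then show False using nd iy pi by (simp add: prime_dvd_mult_iff)
    qed
    have "roots a b (int p) = {s, t}"
    proof (intro equalityI subsetI)
      fix r assume r: "r \<in> roots a b (int p)"
      then have "int p dvd a + b * r\<^sup>2" by (simp add: roots_def)
      then have "int p dvd (a + b * r\<^sup>2) - (a + b * (i * y)\<^sup>2)" using root by (rule dvd_diff)
      moreover have "(a + b * r\<^sup>2) - (a + b * (i * y)\<^sup>2) = b * ((r - i * y) * (r - (- (i * y))))"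
        by (simp add: power2_eq_square algebra_simps)
      ultimately have "int p dvd r - i * y \<or> int p dvd r - (- (i * y))"
        using pi nd by (simp only: prime_dvd_mult_iff) blast
      then have "r mod int p = s \<or> r mod int p = t" unfolding s_def t_def mod_eq_dvd_iff .
      then show "r \<in> {s, t}" using r by (simp add: roots_def)
    next
      fix r assume "r \<in> {s, t}"
      moreover have "int p dvd a + b * (- (i * y))\<^sup>2" using root by simp
      ultimately show "r \<in> roots a b (int p)"
        using root p0 unfolding roots_def s_def t_def by (auto simp: root_mod_iff simp del: power2_minus)
    qed
    then show ?thesis using True ab st by (simp add: Legendre_def)
  qed
qed

lemma odd_prime_factors_odd:
  assumes "odd n"
  shows "odd_prime_factors n = prime_factors n"
proof -
  have "p > 2" if "p \<in> prime_factors n" for p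
  proof -
    have "prime p" "p dvd n" using that by auto
    then have "p \<noteq> 2" using assms by auto
    then show ?thesis using prime_ge_2_nat[OF \<open>prime p\<close>] by simp
  qed
  then show ?thesis by (auto simp: odd_prime_factors_def)
qed

lemma card_roots_squarefree:
  fixes v :: nat and a b :: int
  assumes "squarefree v" "coprime (int v) (2 * (a * b))"
  shows "int (card (roots a b (int v))) = (\<Prod>p\<in>prime_factors v. 1 + Legendre (- (a * b)) (int p))"
  using assms
proof (induction v rule: squarefree_nat_induct)
  case one
  have "roots a b 1 = {0}" by (auto simp: roots_def)
  then show ?case by simp
next
  case (mult p q)
  have q0: "q > 0" using mult by (auto intro: gr0I)
  have p0: "p > 0" using mult prime_gt_0_nat by blast
  have c: "coprime (int p) (2 * (a * b))" "coprime (int q) (2 * (a * b))"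
    using mult.prems by simp_all
  have "coprime p q" using mult by (simp add: prime_imp_coprime)
  then have "card (roots a b (int p * int q)) = card (roots a b (int p)) * card (roots a b (int q))"
    using p0 q0 by (intro card_roots_mult) auto
  then show ?case
    using mult.IH[OF c(2)] card_roots_prime[OF mult.hyps(1) c(1)] mult.hyps
    by (simp add: prime_factors_prime_mult)
qed

lemma square_root_squarefree_modulus:
  fixes n :: nat and b c :: int
  assumes "squarefree n" "\<And>p. prime p \<Longrightarrow> p dvd n \<Longrightarrow> \<exists>m. int p dvd b * m\<^sup>2 - c"
  shows "\<exists>m. int n dvd b * m\<^sup>2 - c"
  using assms
proof (induction n rule: squarefree_nat_induct)
  case (mult p q)
  obtain m1 where m1: "int p dvd b * m1\<^sup>2 - c" using mult.prems[OF mult.hyps(1)] by auto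
  obtain m2 where m2: "int q dvd b * m2\<^sup>2 - c" using mult.IH mult.prems by auto
  have cop: "coprime (int p) (int q)" using mult.hyps by (simp add: prime_imp_coprime)
  obtain m where m: "[m = m1] (mod int p)" "[m = m2] (mod int q)" using binary_chinese_remainder_int[OF cop] by blast
  have "[b * m\<^sup>2 - c = b * m1\<^sup>2 - c] (mod int p)" "[b * m\<^sup>2 - c = b * m2\<^sup>2 - c] (mod int q)"
    using m by (auto intro!: cong_diff cong_mult cong_pow)
  then have "int p dvd b * m\<^sup>2 - c" "int q dvd b * m\<^sup>2 - c" using m1 m2 cong_dvd_iff by blast+
  then have "int p * int q dvd b * m\<^sup>2 - c" using cop by (intro divides_mult)
  then show ?case by auto
qed auto

section \<open>Representations by a diagonal form\<close>

text \<open>A prime p >= 2^(1/\<open>\<epsilon>\<close>) satisfies 2 <= p^\<open>\<epsilon>\<close>,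
  so its factor 2 is paid for by n^\<open>\<epsilon>\<close>; the smaller primes, at most N in
  number, make up the constant.\<close>

lemma two_pow_card_prime_factors_bound:
  fixes \<epsilon> :: real
  assumes "\<epsilon> > 0"
  obtains C where "C \<ge> 1" "\<And>n::nat. n > 0 \<Longrightarrow> 2 ^ card (prime_factors n) \<le> C * real n powr \<epsilon>"
proof
  define N where "N = nat \<lceil>2 powr (1 / \<epsilon>)\<rceil>"
  show "(1::real) \<le> 2 ^ N" by simp
  fix n :: nat assume n: "n > 0"
  let ?P = "prime_factors n"
  define h where "h p = (if p < N then 2 else (1::real))" for p
  have step: "2 \<le> h p * real p powr \<epsilon>" if "p \<in> ?P" for p
  proof (cases "p < N")
    case True
    have "p > 0" using that by (auto intro: prime_gt_0_nat)
    then have "1 \<le> real p powr \<epsilon>" using assms by (intro ge_one_powr_ge_zero) auto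
    then show ?thesis using True by (simp add: h_def)
  next
    case False
    have "2 powr (1 / \<epsilon>) \<le> real N" unfolding N_def by linarith
    also have "\<dots> \<le> real p" using False by simp
    finally have "(2 powr (1 / \<epsilon>)) powr \<epsilon> \<le> real p powr \<epsilon>" using assms by (intro powr_mono2) auto
    then show ?thesis using assms False by (simp add: powr_powr h_def)
  qed
  have "(2::real) ^ card ?P = (\<Prod>p\<in>?P. 2)" by simp
  also have "\<dots> \<le> (\<Prod>p\<in>?P. h p * real p powr \<epsilon>)" by (rule prod_mono) (use step in auto)
  also have "\<dots> = (\<Prod>p\<in>?P. h p) * (\<Prod>p\<in>?P. real p powr \<epsilon>)" by (rule prod.distrib)
  also have "(\<Prod>p\<in>?P. h p) = 2 ^ card {p \<in> ?P. p < N}"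
    unfolding h_def by (subst prod.inter_filter [symmetric]) simp_all
  also have "(\<Prod>p\<in>?P. real p powr \<epsilon>) = real (\<Prod>?P) powr \<epsilon>" by (simp add: prod_powr_distrib)
  also have "2 ^ card {p \<in> ?P. p < N} * real (\<Prod>?P) powr \<epsilon> \<le> 2 ^ N * real n powr \<epsilon>"
  proof (intro mult_mono)
    have "card {p \<in> ?P. p < N} \<le> card {..<N}" by (rule card_mono) auto
    then show "(2::real) ^ card {p \<in> ?P. p < N} \<le> 2 ^ N" by (intro power_increasing) auto
    have "\<Prod>?P dvd (\<Prod>p\<in>?P. p ^ multiplicity p n)"
      by (rule prod_dvd_prod) (auto simp: prime_factors_multiplicity)
    also have "\<dots> = n" using n by (simp add: prime_factorization_nat [symmetric])
    finally have "\<Prod>?P \<le> n" using n by (rule dvd_imp_le)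
    then show "real (\<Prod>?P) powr \<epsilon> \<le> real n powr \<epsilon>"
      using assms by (intro powr_mono2) (simp_all del: of_nat_prod)
  qed auto
  finally show "2 ^ card ?P \<le> 2 ^ N * real n powr \<epsilon>" .
qed

text \<open>Two such divisors with the same primes divide each other, so k is determined by a subset
  of the primes of n.\<close>

lemma card_unitary_divisors_le:
  fixes n :: nat
  assumes "n > 0"
  shows "card {k. k dvd n \<and> coprime k (n div k)} \<le> 2 ^ card (prime_factors n)"
proof -
  let ?U = "{k. k dvd n \<and> coprime k (n div k)}"
  have dvd: "k dvd l" if "k \<in> ?U" "l \<in> ?U" "prime_factors k = prime_factors l" for k l
  proof -
    have n: "l * (n div l) = n" using that by simp
    have l0: "l > 0" "k > 0" using that assms by (auto intro: dvd_pos_nat)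
    have "coprime k (n div l)"
    proof (rule ccontr)
      assume "\<not> coprime k (n div l)"
      then have "gcd k (n div l) \<noteq> 1" using coprime_iff_gcd_eq_1[of k "n div l"] by blast
      then obtain p where "prime p" "p dvd gcd k (n div l)" using prime_factor_nat by blast
      then have p: "prime p" "p dvd k" "p dvd n div l" by auto
      then have "p \<in> prime_factors k" using l0 by (simp add: prime_factors_dvd)
      then have "p dvd l" using that(3) by auto
      then have "\<not> coprime l (n div l)" using p coprime_common_divisor not_prime_unit by blast
      then show False using that by simp
    qed
    moreover have "k dvd l * (n div l)" using that n by simp
    ultimately show ?thesis by (simp add: coprime_dvd_mult_left_iff)
  qed
  have "card ?U \<le> card (Pow (prime_factors n))"
  proof (rule card_inj_on_le)
    show "inj_on prime_factors ?U" by (intro inj_onI dvd_antisym dvd) auto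
    show "prime_factors ` ?U \<subseteq> Pow (prime_factors n)" using assms by (auto intro: dvd_prime_factors[THEN subsetD])
  qed auto
  then show ?thesis by (simp add: card_Pow)
qed

lemma card_fibres_le:
  assumes "finite R" "\<And>x. x \<in> R \<Longrightarrow> card {y \<in> R. h y = h x} \<le> m"
  shows "card R \<le> m * card (h ` R)"
proof -
  have "R = (\<Union>k\<in>h ` R. {y \<in> R. h y = k})" by auto
  then have "card R \<le> (\<Sum>k\<in>h ` R. card {y \<in> R. h y = k})"
    using card_UN_le[of "h ` R" "\<lambda>k. {y \<in> R. h y = k}"] assms(1) by simp
  also have "\<dots> \<le> (\<Sum>k\<in>h ` R. m)" using assms(2) by (intro sum_mono) auto
  finally show ?thesis by (simp add: mult.commute)
qed

text \<open>Fix one representation (x0, y0). For any other (x, y), n divides the product of x y0 -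
  x0 y and x y0 + x0 y, and no prime of n divides both factors, so gcd(n, x y0 - x0 y) is a unitary
  divisor of n. There are at most 2^omega(n) of these, and representations with the same divisor
  differ only by one of nine possibilities.\<close>

lemma card_representations_le:
  fixes a b n :: int
  assumes pos: "a > 0" "b > 0" "n > 0" and cop: "coprime n (2 * (a * b))"
  shows "finite {(x, y). coprime x y \<and> a * x\<^sup>2 + b * y\<^sup>2 = n}"
    and "card {(x, y). coprime x y \<and> a * x\<^sup>2 + b * y\<^sup>2 = n} \<le> 9 * 2 ^ card (prime_factors (nat n))"
proof -
  let ?R = "{(x, y). coprime x y \<and> a * x\<^sup>2 + b * y\<^sup>2 = n}"
  have sq_le: "\<bar>x\<bar> \<le> n" if "c > 0" "d > 0" "c * x\<^sup>2 + d * y\<^sup>2 = n" for c d x y :: int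
  proof -
    have "\<bar>x\<bar> \<le> x\<^sup>2" by (cases "x = 0") (auto simp: abs_le_square_iff intro: self_le_power[of "\<bar>x\<bar>" 2, simplified])
    also have "\<dots> \<le> c * x\<^sup>2" using that by (simp add: mult_le_cancel_right1)
    also have "\<dots> \<le> n" using that zero_le_power2[of y] mult_nonneg_nonneg[of d "y\<^sup>2"] by linarith
    finally show ?thesis .
  qed
  have "?R \<subseteq> {-n..n} \<times> {-n..n}"
  proof
    fix p assume "p \<in> ?R"
    then obtain x y where p: "p = (x, y)" and h: "a * x\<^sup>2 + b * y\<^sup>2 = n" by auto
    have "\<bar>x\<bar> \<le> n" "\<bar>y\<bar> \<le> n" using sq_le[OF pos(1,2) h] sq_le[of b a y x] h pos by (simp_all add: add.commute)
    then show "p \<in> {-n..n} \<times> {-n..n}" unfolding p by auto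
  qed
  then show fin: "finite ?R" by (rule finite_subset) simp
  have nab: "coprime n a" "coprime n b" "coprime n 2" using cop by (simp_all only: coprime_mult_right_iff)
  have cn: "coprime n x" "coprime n y" if "(x, y) \<in> ?R" for x y
  proof -
    have xy: "coprime x y" "a * x\<^sup>2 + b * y\<^sup>2 = n" using that by auto
    show "coprime n x"
    proof (rule ccontr)
      assume "\<not> coprime n x"
      then obtain p where p: "prime p" "p dvd n" "p dvd x" using coprime_iff_no_common_prime[of n x] pos(3) by auto
      then have "p dvd b * y\<^sup>2" using xy(2) by (metis dvd_add_right_iff dvd_mult dvd_mult2 power2_eq_square)
      moreover have "\<not> p dvd b" using p nab(2) coprime_common_divisor not_prime_unit by blast
      ultimately have "p dvd y" using p(1) by (simp add: prime_dvd_mult_iff prime_dvd_power_iff)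
      then show False using p xy(1) coprime_common_divisor not_prime_unit by blast
    qed
    show "coprime n y"
    proof (rule ccontr)
      assume "\<not> coprime n y"
      then obtain p where p: "prime p" "p dvd n" "p dvd y" using coprime_iff_no_common_prime[of n y] pos(3) by auto
      then have "p dvd a * x\<^sup>2" using xy(2) by (metis dvd_add_left_iff dvd_mult dvd_mult2 power2_eq_square)
      moreover have "\<not> p dvd a" using p nab(1) coprime_common_divisor not_prime_unit by blast
      ultimately have "p dvd x" using p(1) by (simp add: prime_dvd_mult_iff prime_dvd_power_iff)
      then show False using p xy(1) coprime_common_divisor not_prime_unit by blast
    qed
  qed
  show "card ?R \<le> 9 * 2 ^ card (prime_factors (nat n))"
  proof (cases "?R = {}")
    case False
    then obtain x0 y0 where R0: "(x0, y0) \<in> ?R" by auto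
    define h where "h = (\<lambda>(x, y). nat (gcd n (x * y0 - x0 * y)))"
    have hp: "h (x, y) > 0" "int (h (x, y)) = gcd n (x * y0 - x0 * y)" for x y
      using pos(3) by (auto simp: h_def gcd_pos_int)
    have props: "h (x, y) dvd nat n \<and> coprime (h (x, y)) (nat n div h (x, y)) \<and>
        int (h (x, y)) dvd x * y0 - x0 * y \<and> n div int (h (x, y)) dvd x * y0 + x0 * y" if R: "(x, y) \<in> ?R" for x y
    proof -
      define k where "k = int (h (x, y))"
      have k: "k = gcd n (x * y0 - x0 * y)" "k > 0"
        using hp(2)[of x y] hp(1)[of x y] by (simp_all only: k_def of_nat_0_less_iff)
      obtain l where l: "n = k * l" using k(1) by (metis gcd_dvd1 dvdE)
      obtain e where e: "x * y0 - x0 * y = k * e" using k(1) by (metis gcd_dvd2 dvdE)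
      have "k * gcd l e = k * 1"
        using gcd_mult_distrib_int[of k l e] k unfolding l[symmetric] e[symmetric] by simp
      then have le: "coprime l e" using k(2) by (simp add: coprime_iff_gcd_eq_1)
      \<comment> \<open>Eliminating a between the two representations gives a multiple of n; as b is
        prime to n, n divides the product of the two determinants.\<close>
      have "b * ((x * y0 - x0 * y) * (x * y0 + x0 * y)) = n * (x\<^sup>2 - x0\<^sup>2)"
      proof -
        have "a * x0\<^sup>2 + b * y0\<^sup>2 = n" "a * x\<^sup>2 + b * y\<^sup>2 = n" using R R0 by auto
        then have "n * (x\<^sup>2 - x0\<^sup>2) = (a * x0\<^sup>2 + b * y0\<^sup>2) * x\<^sup>2 - (a * x\<^sup>2 + b * y\<^sup>2) * x0\<^sup>2"
          by (simp add: algebra_simps)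
        then show ?thesis by (simp add: power2_eq_square algebra_simps)
      qed
      then have "n dvd b * ((x * y0 - x0 * y) * (x * y0 + x0 * y))" by simp
      then have "n dvd (x * y0 - x0 * y) * (x * y0 + x0 * y)" using nab(2) by (simp add: coprime_dvd_mult_right_iff)
      then have "k * l dvd k * (e * (x * y0 + x0 * y))" unfolding e l by (simp add: mult.assoc)
      then have "l dvd e * (x * y0 + x0 * y)" using k(2) by simp
      then have l2: "l dvd x * y0 + x0 * y" using le by (simp add: coprime_dvd_mult_right_iff)
      have kl: "coprime k l"
      proof (rule ccontr)
        assume "\<not> coprime k l"
        then obtain p where p: "prime p" "p dvd k" "p dvd l" using coprime_iff_no_common_prime[of k l] k(2) by auto
        have "p dvd x * y0 - x0 * y" "p dvd x * y0 + x0 * y" using p e l2 dvd_trans by auto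
        then have "p dvd (x * y0 - x0 * y) + (x * y0 + x0 * y)" by (rule dvd_add)
        then have "p dvd 2 * (x * y0)" by simp
        moreover have "p dvd n" using p l by simp
        then have "\<not> p dvd 2" "\<not> p dvd x" "\<not> p dvd y0"
          using nab(3) cn[OF R] cn[OF R0] p(1) coprime_common_divisor not_prime_unit by blast+
        ultimately show False using p(1) by (simp add: prime_dvd_mult_iff)
      qed
      have lp: "l > 0" using l pos(3) k(2) by (simp add: zero_less_mult_iff)
      have nl: "nat n = h (x, y) * nat l" using l lp k(2) by (simp add: k_def nat_mult_distrib)
      have "coprime (h (x, y)) (nat l)"
        using kl lp unfolding k_def by (metis coprime_int_iff int_nat_eq less_imp_le)
      then have "coprime (h (x, y)) (nat n div h (x, y))" using hp(1)[of x y] by (simp add: nl)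
      moreover have "n div int (h (x, y)) = l" using l k(2) by (simp add: k_def)
      ultimately show ?thesis using nl l2 e k_def by simp
    qed
    have fibre: "card {q \<in> ?R. h q = h p} \<le> 9" if p: "p \<in> ?R" for p
    proof -
      obtain x y where xy: "p = (x, y)" by (cases p)
      have R: "(x, y) \<in> ?R" using p xy by simp
      \<comment> \<open>The real part and the coefficient of sqrt(a b) in the product of one point
        with the conjugate of the other. Their norm identity e^2 + a b d^2 = n^2, together with n |
        d from the common gcd, leaves only 0 and +-n for each of them.\<close>
      define \<phi> where "\<phi> = (\<lambda>(x', y'). (a * x * x' + b * y * y', x * y' - x' * y))"
      have val: "a * x\<^sup>2 + b * y\<^sup>2 = n" using R by auto
      have "card {q \<in> ?R. h q = h p} \<le> card ({- n, 0, n} \<times> {- n, 0, n})"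
      proof (rule card_inj_on_le)
        show "inj_on \<phi> {q \<in> ?R. h q = h p}"
        proof (rule inj_onI)
          fix q q' assume "\<phi> q = \<phi> q'"
          moreover have inv: "n * fst q = x * fst (\<phi> q) - b * y * snd (\<phi> q)" "n * snd q = y * fst (\<phi> q) + a * x * snd (\<phi> q)" for q
            unfolding val[symmetric] \<phi>_def by (cases q; simp add: power2_eq_square algebra_simps)+
          ultimately have "n * fst q = n * fst q'" "n * snd q = n * snd q'" by metis+
          then show "q = q'" using pos(3) by (simp add: prod_eq_iff)
        qed
        show "\<phi> ` {q \<in> ?R. h q = h p} \<subseteq> {- n, 0, n} \<times> {- n, 0, n}"
        proof
          fix z assume "z \<in> \<phi> ` {q \<in> ?R. h q = h p}"
          then obtain x' y' where q: "(x', y') \<in> ?R" "h (x', y') = h (x, y)" "z = \<phi> (x', y')" using xy by auto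
          define k where "k = int (h (x, y))"
          define l where "l = n div k"
          have k0: "k > 0" using hp(1)[of x y] by (simp only: k_def of_nat_0_less_iff)
          have kn: "k dvd n" using hp(2)[of x y] by (simp add: k_def)
          have n: "n = k * l" using kn by (simp add: l_def)
          have P: "k dvd x * y0 - x0 * y" "l dvd x * y0 + x0 * y" using props[OF R] by (simp_all add: k_def l_def)
          have P': "k dvd x' * y0 - x0 * y'" "l dvd x' * y0 + x0 * y'" using props[OF q(1)] q(2) by (simp_all add: k_def l_def)
          have kl: "coprime k l"
          proof -
            have "coprime (h (x, y)) (nat n div h (x, y))" using props[OF R] by simp
            then have "coprime (int (h (x, y))) (int (nat n div h (x, y)))" by (simp only: coprime_int_iff)
            then show ?thesis using pos(3) by (simp add: k_def l_def zdiv_int)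
          qed
          define d where "d = x * y' - x' * y"
          have "y0 * d = y' * (x * y0 - x0 * y) - y * (x' * y0 - x0 * y')" by (simp add: d_def algebra_simps)
          then have "k dvd y0 * d" using P P' by simp
          moreover have "coprime k y0" using cn(2)[OF R0] kn coprime_divisors[OF kn dvd_refl] by blast
          ultimately have kd: "k dvd d" by (simp add: coprime_dvd_mult_right_iff)
          have "y0 * d = y' * (x * y0 + x0 * y) - y * (x' * y0 + x0 * y')" by (simp add: d_def algebra_simps)
          then have "l dvd y0 * d" using P P' by simp
          moreover have "l dvd n" using n by simp
          then have "coprime l y0" using cn(2)[OF R0] coprime_divisors[OF _ dvd_refl] by blast
          ultimately have "l dvd d" by (simp add: coprime_dvd_mult_right_iff)
          then have "n dvd d" unfolding n using kd kl by (intro divides_mult)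
          then obtain j where j: "d = n * j" by blast
          define e where "e = a * x * x' + b * y * y'"
          have val': "a * x'\<^sup>2 + b * y'\<^sup>2 = n" using q by auto
          have id: "e\<^sup>2 + a * b * d\<^sup>2 = n\<^sup>2"
          proof -
            have "e\<^sup>2 + a * b * d\<^sup>2 = (a * x\<^sup>2 + b * y\<^sup>2) * (a * x'\<^sup>2 + b * y'\<^sup>2)"
              unfolding e_def d_def by (simp add: power2_eq_square algebra_simps)
            then show ?thesis unfolding val val' by (simp add: power2_eq_square)
          qed
          have ab1: "a * b \<ge> 1" using pos by (simp add: int_one_le_iff_zero_less)
          have "j\<^sup>2 \<le> 1"
          proof -
            have "d\<^sup>2 \<le> a * b * d\<^sup>2" using ab1 by (simp add: mult_le_cancel_right1)
            then have "d\<^sup>2 \<le> n\<^sup>2" using id zero_le_power2[of e] by linarith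
            then have "n\<^sup>2 * j\<^sup>2 \<le> n\<^sup>2 * 1" by (simp add: j power_mult_distrib)
            then show ?thesis using pos(3) by simp
          qed
          then have j': "j \<in> {-1, 0, 1}" by (auto simp: abs_square_le_1)
          have "d \<in> {- n, 0, n}" using j' j by auto
          moreover have "e \<in> {- n, 0, n}"
          proof (cases "j = 0")
            case True
            then have "e\<^sup>2 = n\<^sup>2" using id j by simp
            then show ?thesis by (auto simp: power2_eq_iff)
          next
            case False
            then have "d\<^sup>2 = n\<^sup>2" using j' j by auto
            then have "e\<^sup>2 = (1 - a * b) * n\<^sup>2" using id by (simp add: algebra_simps)
            also have "\<dots> \<le> 0" using ab1 by (simp add: mult_nonpos_nonneg)
            finally have "e = 0" by simp
            then show ?thesis by simp
          qed
          moreover have "z = (e, d)" by (simp add: q(3) \<phi>_def d_def e_def)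
          ultimately show "z \<in> {- n, 0, n} \<times> {- n, 0, n}" by (simp only: mem_Sigma_iff)
        qed
      qed simp
      also have "\<dots> \<le> 9"
      proof -
        have "card {- n, 0, n} \<le> 3" using card_length[of "[- n, 0, n]"] by simp
        then have "card {- n, 0, n} * card {- n, 0, n} \<le> 3 * 3" by (intro mult_le_mono)
        then show ?thesis unfolding card_cartesian_product by simp
      qed
      finally show ?thesis .
    qed
    have "card ?R \<le> 9 * card (h ` ?R)" by (rule card_fibres_le[OF fin fibre])
    also have "card (h ` ?R) \<le> card {k. k dvd nat n \<and> coprime k (nat n div k)}"
      using props pos(3) by (intro card_mono) auto
    also have "\<dots> \<le> 2 ^ card (prime_factors (nat n))" using pos(3) by (intro card_unitary_divisors_le) simp
    finally show ?thesis by simp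
  next
    case True
    show ?thesis unfolding True by simp
  qed
qed

section \<open>Squareful values with a fixed cubic part\<close>

definition fixed_v_points :: "nat \<Rightarrow> nat \<Rightarrow> nat \<Rightarrow> real \<Rightarrow> (int \<times> int) set" where
  "fixed_v_points a b v T = {(x, y). coprime x y \<and> \<bar>real_of_int x\<bar> \<le> T \<and> \<bar>real_of_int y\<bar> \<le> T \<and>
     (\<exists>w. int a * x\<^sup>2 + int b * y\<^sup>2 = int v ^ 3 * w\<^sup>2)}"

lemma finite_fixed_v_points: "finite (fixed_v_points a b v T)"
proof (rule finite_subset)
  show "fixed_v_points a b v T \<subseteq> {-\<lfloor>T\<rfloor>..\<lfloor>T\<rfloor>} \<times> {-\<lfloor>T\<rfloor>..\<lfloor>T\<rfloor>}"
  proof (clarsimp simp: fixed_v_points_def)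
    fix x y :: int
    assume "\<bar>real_of_int x\<bar> \<le> T" "\<bar>real_of_int y\<bar> \<le> T"
    then have "\<bar>x\<bar> \<le> \<lfloor>T\<rfloor>" "\<bar>y\<bar> \<le> \<lfloor>T\<rfloor>" by (simp_all add: le_floor_iff)
    then show "- \<lfloor>T\<rfloor> \<le> x \<and> x \<le> \<lfloor>T\<rfloor> \<and> - \<lfloor>T\<rfloor> \<le> y \<and> y \<le> \<lfloor>T\<rfloor>" by linarith
  qed
qed auto

text \<open>Agrees with \<open>conic_points\<close> of the locale, but refers to no basis, so it can
  be summed over the roots before bases are chosen.\<close>

definition root_points :: "nat \<Rightarrow> nat \<Rightarrow> nat \<Rightarrow> real \<Rightarrow> int \<Rightarrow> (int \<times> int) set" where
  "root_points a b v T r = {(x, y). coprime x y \<and> int v ^ 3 dvd y - r * x \<and>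
     (\<exists>w. int a * x\<^sup>2 + int b * y\<^sup>2 = int v ^ 3 * w\<^sup>2) \<and> \<bar>real_of_int x\<bar> \<le> T \<and> \<bar>real_of_int y\<bar> \<le> T}"

lemma coprime_x_modulus:
  fixes x y b c n :: int
  assumes "coprime x y" "c dvd a * x\<^sup>2 + b * y\<^sup>2" "coprime c b" "c \<noteq> 0"
  shows "coprime x c"
proof (rule ccontr)
  assume "\<not> coprime x c"
  then obtain p where p: "prime p" "p dvd x" "p dvd c" using coprime_iff_no_common_prime[of x c] assms(4) by auto
  then have "p dvd a * x\<^sup>2 + b * y\<^sup>2" using assms(2) dvd_trans by blast
  moreover have "p dvd a * x\<^sup>2" using p(2) by (simp add: power2_eq_square)
  ultimately have "p dvd b * y\<^sup>2" by (metis dvd_add_right_iff)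
  moreover have "\<not> p dvd b" using p assms(3) coprime_common_divisor not_prime_unit by blast
  ultimately have "p dvd y" using p(1) by (simp add: prime_dvd_mult_iff prime_dvd_power_iff)
  then show False using p assms(1) coprime_common_divisor not_prime_unit by blast
qed

text \<open>Since x is invertible modulo v^3, the quotient r = y / x is a well-defined residue; the
  equation makes it a root, and it sorts the points into disjoint classes.\<close>

lemma card_fixed_v_points:
  assumes v: "v > 0" and cop: "coprime (int v) (2 * (int a * int b))"
  shows "card (fixed_v_points a b v T) = (\<Sum>r\<in>roots (int a) (int b) (int v ^ 3). card (root_points a b v T r))"
proof -
  let ?c = "int v ^ 3"
  have c0: "?c > 0" using v by simp
  have cb: "coprime ?c (int b)" using cop by (simp only: coprime_mult_right_iff coprime_power_left_iff) simp
  have cx: "coprime x ?c" if "coprime x y" "int a * x\<^sup>2 + int b * y\<^sup>2 = ?c * w\<^sup>2" for x y w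
    using that c0 cb by (intro coprime_x_modulus[of x y ?c "int a" "int b"]) auto
  have "fixed_v_points a b v T = (\<Union>r\<in>roots (int a) (int b) ?c. root_points a b v T r)"
  proof (intro equalityI subsetI)
    fix p assume "p \<in> fixed_v_points a b v T"
    then obtain x y w where p: "p = (x, y)" "coprime x y" "\<bar>real_of_int x\<bar> \<le> T" "\<bar>real_of_int y\<bar> \<le> T"
      "int a * x\<^sup>2 + int b * y\<^sup>2 = ?c * w\<^sup>2" by (auto simp: fixed_v_points_def)
    have c: "coprime x ?c" using cx p by blast
    obtain i where i: "[x * i = 1] (mod ?c)" using cong_solve_coprime_int[OF c] by blast
    define r where "r = (y * i) mod ?c"
    have "[r * x = y * i * x] (mod ?c)" unfolding r_def by (intro cong_mult) (auto simp: cong_def)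
    also have "y * i * x = y * (x * i)" by simp
    also have "[y * (x * i) = y * 1] (mod ?c)" by (intro cong_mult i) auto
    finally have rx: "[r * x = y] (mod ?c)" by simp
    have "[x\<^sup>2 * (int a + int b * r\<^sup>2) = int a * x\<^sup>2 + int b * y\<^sup>2] (mod ?c)"
    proof -
      have "x\<^sup>2 * (int a + int b * r\<^sup>2) = int a * x\<^sup>2 + int b * (r * x)\<^sup>2" by (simp add: power_mult_distrib algebra_simps)
      also have "[\<dots> = int a * x\<^sup>2 + int b * y\<^sup>2] (mod ?c)" by (intro cong_add cong_mult cong_pow rx) auto
      finally show ?thesis .
    qed
    then have "?c dvd x\<^sup>2 * (int a + int b * r\<^sup>2)" using p(5) cong_dvd_iff by (metis dvd_triv_left)
    moreover have "coprime ?c (x\<^sup>2)" using c by (simp only: coprime_power_right_iff coprime_commute) simp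
    ultimately have "?c dvd int a + int b * r\<^sup>2" by (simp add: coprime_dvd_mult_right_iff)
    then have "r \<in> roots (int a) (int b) ?c" using c0 by (simp add: roots_def r_def)
    moreover have "?c dvd y - r * x" using rx by (metis cong_iff_dvd_diff cong_sym)
    ultimately show "p \<in> (\<Union>r\<in>roots (int a) (int b) ?c. root_points a b v T r)"
      using p by (auto simp: root_points_def)
  next
    fix p assume "p \<in> (\<Union>r\<in>roots (int a) (int b) ?c. root_points a b v T r)"
    then show "p \<in> fixed_v_points a b v T" by (auto simp: root_points_def fixed_v_points_def)
  qed
  then have "card (fixed_v_points a b v T) = card (\<Union>r\<in>roots (int a) (int b) ?c. root_points a b v T r)" by simp
  also have "\<dots> = (\<Sum>r\<in>roots (int a) (int b) ?c. card (root_points a b v T r))"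
  proof (rule card_UN_disjoint)
    have "root_points a b v T r \<subseteq> fixed_v_points a b v T" for r
      by (auto simp: root_points_def fixed_v_points_def)
    then have "finite (root_points a b v T r)" for r
      by (rule finite_subset) (rule finite_fixed_v_points)
    then show "\<forall>r\<in>roots (int a) (int b) ?c. finite (root_points a b v T r)" by blast
    show "\<forall>r\<in>roots (int a) (int b) ?c. \<forall>s\<in>roots (int a) (int b) ?c. r \<noteq> s \<longrightarrow> root_points a b v T r \<inter> root_points a b v T s = {}"
    proof (intro ballI impI)
      fix r s assume rs: "r \<in> roots (int a) (int b) ?c" "s \<in> roots (int a) (int b) ?c" "r \<noteq> s"
      show "root_points a b v T r \<inter> root_points a b v T s = {}"
      proof (rule ccontr)
        assume "root_points a b v T r \<inter> root_points a b v T s \<noteq> {}"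
        then obtain x y w where xy: "coprime x y" "?c dvd y - r * x" "?c dvd y - s * x" "int a * x\<^sup>2 + int b * y\<^sup>2 = ?c * w\<^sup>2"
          by (auto simp: root_points_def)
        have "?c dvd (y - s * x) - (y - r * x)" by (rule dvd_diff[OF xy(3,2)])
        then have "?c dvd (r - s) * x" by (simp add: algebra_simps)
        moreover have "coprime ?c x" using cx[OF xy(1,4)] by (simp only: coprime_commute)
        ultimately have "?c dvd r - s" by (simp add: coprime_dvd_mult_left_iff)
        then have "r mod ?c = s mod ?c" by (simp add: mod_eq_dvd_iff)
        then show False using rs by (simp add: roots_def)
      qed
    qed
  qed simp
  finally show ?thesis .
qed

section \<open>Local conditions at the primes of a and b\<close>

lemma QuadRes_imp_root:
  fixes p :: nat and b v :: int
  assumes p: "prime p" and b: "\<not> int p dvd b" and Q: "QuadRes (int p) (b * v)"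
  shows "\<exists>m. int p dvd b * m\<^sup>2 - v ^ 3"
proof -
  obtain z where z: "[z\<^sup>2 = b * v] (mod int p)" using Q by (auto simp: QuadRes_def)
  have "prime (int p)" using p by simp
  then have "coprime (int p) b" using b by (rule prime_imp_coprime)
  then have "coprime b (int p)" by (simp only: coprime_commute)
  then obtain i where i: "[b * i = 1] (mod int p)" using cong_solve_coprime_int by blast
  \<comment> \<open>The witness is z v / b with i the inverse of b: from z^2 = b v one gets b (z v /
    b)^2 = z^2 v^2 / b = v^3.\<close>
  have "b * (z * v * i)\<^sup>2 = z\<^sup>2 * (v\<^sup>2 * (b * i) * i)" by (simp add: power2_eq_square algebra_simps)
  also have "[z\<^sup>2 * (v\<^sup>2 * (b * i) * i) = (b * v) * (v\<^sup>2 * 1 * i)] (mod int p)"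
    by (intro cong_mult z i) auto
  also have "(b * v) * (v\<^sup>2 * 1 * i) = v ^ 3 * (b * i)" by (simp add: power2_eq_square power3_eq_cube)
  also have "[v ^ 3 * (b * i) = v ^ 3 * 1] (mod int p)" by (intro cong_mult i) auto
  finally show ?thesis by (auto simp: cong_iff_dvd_diff)
qed

text \<open>Modulo p the equation reads b y^2 = v^3 w^2, so b v is the square of b y / (v w). The
  division is possible: if p divided w, it would divide y, and then x as well because a is
  squarefree.\<close>

lemma conic_point_imp_QuadRes:
  fixes p a b v :: nat and x y w :: int
  assumes p: "prime p" "p dvd a" "squarefree a" "\<not> p dvd b" "\<not> p dvd v"
    and xy: "coprime x y" "int a * x\<^sup>2 + int b * y\<^sup>2 = int v ^ 3 * w\<^sup>2"
  shows "QuadRes (int p) (int (b * v))"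
proof -
  have pi: "prime (int p)" using p by simp
  have pw: "\<not> int p dvd w"
  proof
    assume pw: "int p dvd w"
    have "int p dvd int a * x\<^sup>2" using p(2) by simp
    moreover have "int p dvd int v ^ 3 * w\<^sup>2" using pw by (simp add: power2_eq_square)
    ultimately have "int p dvd int b * y\<^sup>2" using xy(2) by (metis dvd_add_right_iff)
    moreover have "\<not> int p dvd int b" using p(4) by simp
    ultimately have py: "int p dvd y" using pi by (simp only: prime_dvd_mult_iff prime_dvd_power_iff) (simp add: prime_dvd_power_iff)
    have "(int p)\<^sup>2 dvd int v ^ 3 * w\<^sup>2" using pw by (intro dvd_mult dvd_power_same)
    moreover have "(int p)\<^sup>2 dvd int b * y\<^sup>2" using py by (intro dvd_mult dvd_power_same)
    ultimately have "(int p)\<^sup>2 dvd int a * x\<^sup>2" using xy(2) by (metis dvd_add_left_iff)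
    then have "int p dvd x"
      using squarefree_dvd_square_imp[of "int p" "int a" x] pi p(3) by (simp add: squarefree_int_iff)
    then show False using py xy(1) pi coprime_common_divisor not_prime_unit by blast
  qed
  have "\<not> int p dvd int v * w" using pi pw p(5) by (simp add: prime_dvd_mult_iff)
  then have "coprime (int p) (int v * w)" by (rule prime_imp_coprime[OF pi])
  then have "coprime (int v * w) (int p)" by (simp only: coprime_commute)
  then obtain i where i: "[(int v * w) * i = 1] (mod int p)" using cong_solve_coprime_int by blast
  have e: "[int b * y\<^sup>2 = int v ^ 3 * w\<^sup>2] (mod int p)"
  proof -
    have "int v ^ 3 * w\<^sup>2 - int b * y\<^sup>2 = int a * x\<^sup>2" using xy(2) by simp
    then have "int p dvd int v ^ 3 * w\<^sup>2 - int b * y\<^sup>2" using p(2) by simp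
    then show ?thesis by (metis cong_iff_dvd_diff cong_sym)
  qed
  have "(int b * y * i)\<^sup>2 = int b * (int b * y\<^sup>2) * i\<^sup>2" by (simp add: power2_eq_square)
  also have "[int b * (int b * y\<^sup>2) * i\<^sup>2 = int b * (int v ^ 3 * w\<^sup>2) * i\<^sup>2] (mod int p)"
    by (intro cong_mult e) auto
  also have "int b * (int v ^ 3 * w\<^sup>2) * i\<^sup>2 = int (b * v) * ((int v * w) * i)\<^sup>2"
    by (simp add: power2_eq_square power3_eq_cube)
  also have "[int (b * v) * ((int v * w) * i)\<^sup>2 = int (b * v) * 1\<^sup>2] (mod int p)"
    by (intro cong_mult cong_pow i) auto
  finally show ?thesis unfolding QuadRes_def by auto
qed

lemma count_error_nonneg:
  assumes "a > 0" "b > 0"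
  shows "count_error a b \<ge> 0"
proof -
  have ab: "real_of_int a \<ge> 1" "real_of_int b \<ge> 1" using assms by simp_all
  have A: "area_const (of_int a) (of_int b) \<ge> 0" by (rule area_const_nonneg[OF ab])
  have "a * b > 0" using assms by simp
  then have n: "norm_const (a * b) \<ge> 0" "real_of_int (a * b) \<ge> 0" unfolding norm_const_def by (simp_all only: of_int_0_le_iff) auto
  show ?thesis unfolding count_error_def Let_def
    using A n ab by (intro mult_nonneg_nonneg add_nonneg_nonneg zero_le_power) auto
qed

lemma squarefree_mult_imp_coprime:
  fixes m n :: nat
  assumes "squarefree (m * n)"
  shows "coprime m n"
proof (rule coprimeI)
  fix d assume "d dvd m" "d dvd n"
  then have "d\<^sup>2 dvd m * n" by (simp add: power2_eq_square mult_dvd_mono)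
  then show "is_unit d" using assms squarefreeD by blast
qed

lemma cong_1_mod_4_odd: "[n = 1] (mod 4) \<Longrightarrow> odd (n :: nat)"
  unfolding cong_def by presburger

lemma card_root_points:
  fixes a b v :: nat and m l r :: int
  assumes pos: "a > 0" "b > 0" "v > 0" and D: "squarefree (a * b)" "(a * b) mod 4 = 1"
    and v: "squarefree v" "coprime (int v) (2 * (int a * int b))" and T: "T \<ge> 1"
    and r: "int v ^ 3 dvd int a + int b * r\<^sup>2"
    and m: "int a dvd int b * m\<^sup>2 - int v ^ 3" and l: "int b dvd int a * l\<^sup>2 - int v ^ 3"
  shows "\<bar>2 * real (card (root_points a b v T r)) - 2 ^ card (prime_factors (2 * (a * b))) *
      (area_const (real a) (real b) * T / (sqrt (real v ^ 3) * sqrt (real a * real b)) * coprime_density (2 * (a * b) * v))\<bar>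
    \<le> count_error (int a) (int b) * (real v ^ 17 * T powr (17 / 32))"
proof -
  have sq: "squarefree (int a * int b)" "squarefree (int v)"
    using D(1) v(1) squarefree_int_iff[of "a * b"] by (simp_all add: squarefree_int_iff)
  have m4: "(int a * int b) mod 4 = 1" using D(2) by (metis of_nat_mult of_nat_1 of_nat_numeral zmod_int)
  have p: "int a > 0" "int b > 0" "int v > 0" using pos by simp_all
  obtain x1 y1 x2 y2 u B C where h:
    "x1 * y2 - x2 * y1 = int v ^ 3" "int a * x1\<^sup>2 + int b * y1\<^sup>2 = int v ^ 3 * u\<^sup>2"
    "int a * x1 * x2 + int b * y1 * y2 = int v ^ 3 * B" "int a * x2\<^sup>2 + int b * y2\<^sup>2 = int v ^ 3 * C"
    "int v ^ 3 dvd y1 - r * x1" "int v ^ 3 dvd y2 - r * x2" "int v dvd x2" "int v dvd C" "coprime x1 (int v)"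
    "u > 0" "u \<le> 58 * (int a * int b) ^ 5 * (int v)\<^sup>2" "coprime u (2 * (int a * int b) * int v)"
    "[B = int a * int b] (mod (2 * (int a * int b)))" "0 \<le> B" "B < u\<^sup>2 * (2 * (int a * int b) * int v)"
    "u\<^sup>2 * C - B\<^sup>2 = int a * int b"
    using adapted_basis_exists[OF p sq(1) m4 sq(2) v(2) r m l] .
  have cu: "coprime u (2 * (int a * int b))" using h(12) by (simp only: coprime_mult_right_iff)
  interpret adapted_basis "int a" "int b" "int v" r x1 y1 x2 y2 u B C
    by (unfold_locales; (rule p sq m4 v(2) h cu)?)
  have "root_points a b v T r = conic_points T"
    by (simp add: root_points_def conic_points_def)
  moreover have "nat (2 * (int a * int b)) = 2 * (a * b)" "nat (2 * (int a * int b) * int v) = 2 * (a * b) * v"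
    by (simp_all add: nat_mult_distrib)
  ultimately show ?thesis
    using card_conic_points[OF h(11,14) less_imp_le[OF h(15)] T] by simp
qed

lemma card_prime_factors_mult_coprime:
  fixes m n :: nat
  assumes "coprime m n" "m > 0" "n > 0"
  shows "prime_factors (m * n) = prime_factors m \<union> prime_factors n" "prime_factors m \<inter> prime_factors n = {}"
proof -
  show "prime_factors (m * n) = prime_factors m \<union> prime_factors n"
    using assms by (simp add: prime_factors_product)
  show "prime_factors m \<inter> prime_factors n = {}"
  proof -
    have False if "p \<in> prime_factors m" "p \<in> prime_factors n" for p
    proof -
      have "prime p" "p dvd m" "p dvd n" using that by auto
      then show False using coprime_common_divisor[OF assms(1), of p] not_prime_unit by blast
    qed
    then show ?thesis by blast
  qed
qed

lemma area_const_sigma: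
  assumes "a > 0" "b > 0"
  shows "area_const (real a) (real b) = sigma_infty a b * sqrt (real a * real b)"
proof -
  have "sqrt (real a) > 0" "sqrt (real b) > 0" using assms by simp_all
  then show ?thesis
    by (simp add: area_const_def sigma_infty_def real_sqrt_mult divide_simps)
qed

lemma sqrt_cube: "v > 0 \<Longrightarrow> sqrt (real v ^ 3) = real v powr (3 / 2)"
proof -
  assume v: "v > 0"
  have "sqrt (real v ^ 3) = (real v ^ 3) powr (1 / 2)" using v by (simp add: powr_half_sqrt)
  also have "real v ^ 3 = real v powr 3" using v by simp
  also have "(real v powr 3) powr (1 / 2) = real v powr (3 * (1 / 2))" by (rule powr_powr)
  finally show ?thesis by simp
qed

text \<open>The prime 2, which \<open>gamma_fn\<close> leaves out, turns 6 / pi^2 into 4 / pi^2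
  through its factor 1 / (1 + 1/2).\<close>

lemma coprime_density_gamma:
  assumes "squarefree (a * b * v)" "odd (a * b * v)"
  shows "coprime_density (2 * (a * b) * v) = 4 / pi\<^sup>2 * gamma_fn (a * b * v)"
proof -
  have n0: "a * b * v > 0" using assms(2) by (auto intro!: gr0I)
  have c2: "coprime 2 (a * b * v)" using assms(2) coprime_left_2_iff_odd by blast
  have "squarefree (2 * (a * b * v))"
    using squarefree_mult_coprime[OF c2 squarefree_prime[OF two_is_prime_nat] assms(1)] .
  then have "coprime_density (2 * (a * b * v)) = 6 / pi\<^sup>2 * (\<Prod>p\<in>prime_factors (2 * (a * b * v)). inverse (1 + 1 / real p))"
    by (rule coprime_density_squarefree)
  also have "prime_factors (2 * (a * b * v)) = insert 2 (prime_factors (a * b * v))" "2 \<notin> prime_factors (a * b * v)"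
    using prime_factors_prime_mult[OF two_is_prime_nat] assms(2) by simp_all
  then have "(\<Prod>p\<in>prime_factors (2 * (a * b * v)). inverse (1 + 1 / real p)) = inverse (1 + 1 / 2) * (\<Prod>p\<in>prime_factors (a * b * v). inverse (1 + 1 / real p))"
    by simp
  also have "(\<Prod>p\<in>prime_factors (a * b * v). inverse (1 + 1 / real p)) = gamma_fn (a * b * v)"
    unfolding gamma_fn_def odd_prime_factors_odd[OF assms(2)] ..
  finally show ?thesis by (simp add: mult.assoc)
qed

text \<open>If a prime of a or b fails its quadratic condition, both \<open>rho\<close> and the set
  of points vanish. Otherwise the congruences for Legendre's argument are solvable, every root
  modulo v^3 contributes the same main term, and the number of roots, at most v, raises the error
  from v^17 to v^18.\<close>

lemma fixed_v_asymptotic: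
  assumes pos: "a > 0" "b > 0" and sqf: "squarefree (a * b * v)"
    and m4: "[a = 1] (mod 4)" "[b = 1] (mod 4)" "[v = 1] (mod 4)" and T: "T \<ge> 1"
  shows "\<bar>real (card (fixed_v_points a b v T)) / 2 - 2 * sigma_infty a b / pi\<^sup>2 * leading_term a b v * T\<bar>
    \<le> count_error (int a) (int b) * (real v ^ 18 * T powr (17 / 32))"
proof -
  let ?ce = "count_error (int a) (int b)"
  have ce: "?ce \<ge> 0" using pos by (intro count_error_nonneg) auto
  have odd: "odd a" "odd b" "odd v" using m4 cong_1_mod_4_odd by auto
  have v0: "v > 0" using odd(3) by (auto intro!: gr0I)
  have sq: "squarefree (a * b)" "squarefree v" using sqf squarefree_multD by blast+
  have sqab: "squarefree a" "squarefree b" using sq(1) squarefree_multD by blast+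
  have cop: "coprime (a * b) v" "coprime a b" using squarefree_mult_imp_coprime sqf sq(1) by blast+
  have copv: "coprime a v" "coprime b v" using cop(1) by (simp_all add: coprime_mult_left_iff)
  have oddv: "coprime v 2" using odd(3) coprime_right_2_iff_odd by blast
  have cv: "coprime (int v) (2 * (int a * int b))"
  proof -
    have "coprime v a" "coprime v b" using copv by (simp_all only: coprime_commute)
    then have "coprime v (2 * (a * b))" using oddv by (simp only: coprime_mult_right_iff)
    then have "coprime (int v) (int (2 * (a * b)))" by (simp only: coprime_int_iff)
    then show ?thesis by simp
  qed
  have ab4: "(a * b) mod 4 = 1" using cong_mult[OF m4(1,2)] by (simp add: cong_def)
  define n where "n = card (roots (int a) (int b) (int v ^ 3))"
  have nv: "n = card (roots (int a) (int b) (int v))"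
    unfolding n_def using v0 cv by (intro card_roots_cube) auto
  have nprod: "int n = (\<Prod>p\<in>prime_factors v. 1 + Legendre (- (int a * int b)) (int p))"
    unfolding nv by (rule card_roots_squarefree[OF sq(2) cv])
  have nle: "real n \<le> real v"
  proof -
    have "n \<le> card {0..<int v}" unfolding nv by (intro card_mono) (auto simp: roots_def)
    then show ?thesis by simp
  qed
  have rho: "rho a b v = (\<Prod>p\<in>prime_factors a. 1 + Legendre (int (b * v)) (int p)) *
     (\<Prod>p\<in>prime_factors b. 1 + Legendre (int (a * v)) (int p)) * int n"
    unfolding rho_def nprod odd_prime_factors_odd[OF odd(1)] odd_prime_factors_odd[OF odd(2)] odd_prime_factors_odd[OF odd(3)]
    by simp
  have nondvd: "\<not> p dvd c * v" if "p \<in> prime_factors d" "coprime d c" "coprime d v" for p c d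
  proof
    assume "p dvd c * v"
    have p: "prime p" "p dvd d" using that by auto
    then have "p dvd c \<or> p dvd v" using \<open>p dvd c * v\<close> prime_dvd_mult_iff by blast
    then show False using p that(2,3) coprime_common_divisor not_prime_unit by blast
  qed
  have nz: "\<not> [int (c * v) = 0] (mod int p)" if "p \<in> prime_factors d" "coprime d c" "coprime d v" for p c d
  proof -
    have "\<not> int p dvd int (c * v)" using nondvd[OF that] by (simp only: int_dvd_int_iff) simp
    then show ?thesis by (simp only: cong_0_iff) simp
  qed
  have cba: "coprime b a" using cop(2) by (simp only: coprime_commute)
  show ?thesis
  proof (cases "(\<forall>p\<in>prime_factors a. QuadRes (int p) (int (b * v))) \<and> (\<forall>p\<in>prime_factors b. QuadRes (int p) (int (a * v)))")
    case False
    have "rho a b v = 0"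
    proof -
      have z: "(\<Prod>p\<in>prime_factors d. 1 + Legendre (int (c * v)) (int p)) = 0"
        if "p \<in> prime_factors d" "\<not> QuadRes (int p) (int (c * v))" "coprime d c" "coprime d v" for p c d
      proof -
        have "Legendre (int (c * v)) (int p) = - 1" using nz[OF that(1,3,4)] that(2) by (simp add: Legendre_def)
        then have "1 + Legendre (int (c * v)) (int p) = 0" by simp
        then show ?thesis using that(1) by (intro prod_zero) auto
      qed
      show ?thesis using False z[of _ a b] z[of _ b a] cop(2) cba copv unfolding rho by auto
    qed
    moreover have "fixed_v_points a b v T = {}"
    proof (rule ccontr)
      assume "fixed_v_points a b v T \<noteq> {}"
      then obtain x y w where xy: "coprime x y" "int a * x\<^sup>2 + int b * y\<^sup>2 = int v ^ 3 * w\<^sup>2"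
        by (auto simp: fixed_v_points_def)
      have nd: "\<not> p dvd c" "\<not> p dvd v" "prime p" "p dvd d" if "p \<in> prime_factors d" "coprime d c" "coprime d v" for p c d :: nat
        using nondvd[OF that] that(1) by auto
      have "QuadRes (int p) (int (b * v))" if "p \<in> prime_factors a" for p
        using conic_point_imp_QuadRes[OF nd(3,4)[OF that cop(2) copv(1)] sqab(1) nd(1,2)[OF that cop(2) copv(1)] xy] .
      moreover have "QuadRes (int p) (int (a * v))" if "p \<in> prime_factors b" for p
      proof (rule conic_point_imp_QuadRes[OF nd(3,4)[OF that cba copv(2)] sqab(2) nd(1,2)[OF that cba copv(2)]])
        show "coprime y x" using xy(1) by (simp only: coprime_commute)
        show "int b * y\<^sup>2 + int a * x\<^sup>2 = int v ^ 3 * w\<^sup>2" using xy(2) by simp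
      qed
      ultimately show False using False by blast
    qed
    ultimately show ?thesis using ce by (simp add: leading_term_def)
  next
    case True
    have prod2: "(\<Prod>p\<in>prime_factors d. 1 + Legendre (int (c * v)) (int p)) = 2 ^ card (prime_factors d)"
      if "\<forall>p\<in>prime_factors d. QuadRes (int p) (int (c * v))" "coprime d c" "coprime d v" for c d
    proof -
      have "(\<Prod>p\<in>prime_factors d. 1 + Legendre (int (c * v)) (int p)) = (\<Prod>p\<in>prime_factors d. 2)"
      proof (rule prod.cong)
        fix p assume p: "p \<in> prime_factors d"
        have "Legendre (int (c * v)) (int p) = 1" using nz[OF p that(2,3)] that(1) p by (simp add: Legendre_def)
        then show "1 + Legendre (int (c * v)) (int p) = 2" by simp
      qed simp
      then show ?thesis by simp
    qed
    have rho': "rho a b v = 2 ^ card (prime_factors a) * 2 ^ card (prime_factors b) * int n"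
      unfolding rho using prod2[of a b] prod2[of b a] True cop(2) cba copv by simp
    have ml: "\<exists>m. int d dvd int c * m\<^sup>2 - int v ^ 3"
      if "squarefree d" "\<forall>p\<in>prime_factors d. QuadRes (int p) (int (c * v))" "coprime d c" "d > 0" for c d
    proof (rule square_root_squarefree_modulus[OF that(1)])
      fix p assume p: "prime p" "p dvd d"
      then have pf: "p \<in> prime_factors d" using that(4) by (simp add: prime_factors_dvd)
      have "\<not> p dvd c" using p that(3) coprime_common_divisor not_prime_unit by blast
      then show "\<exists>m. int p dvd int c * m\<^sup>2 - int v ^ 3"
        using QuadRes_imp_root[OF p(1), of "int c" "int v"] that(2) pf by simp
    qed
    obtain m where m: "int a dvd int b * m\<^sup>2 - int v ^ 3" using ml[OF sqab(1)] True cop(2) pos(1) by blast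
    obtain l where l: "int b dvd int a * l\<^sup>2 - int v ^ 3" using ml[OF sqab(2)] True cba pos(2) by blast
    define E where "E = ?ce * (real v ^ 17 * T powr (17 / 32))"
    define M where "M = 2 ^ card (prime_factors (2 * (a * b))) *
      (area_const (real a) (real b) * T / (sqrt (real v ^ 3) * sqrt (real a * real b)) * coprime_density (2 * (a * b) * v))"
    let ?R = "roots (int a) (int b) (int v ^ 3)"
    have each: "\<bar>2 * real (card (root_points a b v T r)) - M\<bar> \<le> E" if "r \<in> ?R" for r
    proof -
      have r: "int v ^ 3 dvd int a + int b * r\<^sup>2" using that by (simp add: roots_def)
      show ?thesis unfolding M_def E_def
        by (rule card_root_points[OF pos v0 sq(1) ab4 sq(2) cv T r m l])
    qed
    have "2 * real (card (fixed_v_points a b v T)) - real n * M = (\<Sum>r\<in>?R. 2 * real (card (root_points a b v T r)) - M)"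
      unfolding card_fixed_v_points[OF v0 cv] n_def by (simp add: sum_subtractf sum_distrib_left)
    then have "\<bar>2 * real (card (fixed_v_points a b v T)) - real n * M\<bar> \<le> (\<Sum>r\<in>?R. E)"
      using order_trans[OF sum_abs sum_mono[OF each]] by simp
    also have "\<dots> = real n * E" by (simp add: n_def)
    also have "\<dots> \<le> real v * E" using nle ce by (intro mult_right_mono) (simp_all add: E_def)
    also have "\<dots> = ?ce * (real v ^ 18 * T powr (17 / 32))"
      by (simp add: E_def power_Suc[of "real v" 17, symmetric, simplified] mult_ac power_def numeral_eq_Suc)
    finally have main: "\<bar>2 * real (card (fixed_v_points a b v T)) - real n * M\<bar> \<le> ?ce * (real v ^ 18 * T powr (17 / 32))" .
    \<comment> \<open>In \<open>M\<close>, the divisor count of 2 a b gives 2 times the part of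
      \<open>rho\<close> at a and b, and the density gives 4 / pi^2, together 8 / pi^2. The factor 4
      accounts for the two-to-one parametrisation and for the halving of the count.\<close>
    have eqM: "real n * M = 4 * (2 * sigma_infty a b / pi\<^sup>2 * leading_term a b v * T)"
    proof -
      have ab0: "sqrt (real a * real b) > 0" using pos by simp
      have oddn: "odd (a * b * v)" using odd by simp
      have mu: "real_of_int ((moebius (a * b * v))\<^sup>2) = 1" using sqf by (simp add: moebius_def flip: power_mult)
      have "card (prime_factors (2 * (a * b))) = Suc (card (prime_factors (a * b)))"
        using prime_factors_prime_mult[OF two_is_prime_nat, of "a * b"] odd by simp
      also have "card (prime_factors (a * b)) = card (prime_factors a) + card (prime_factors b)"
        using card_prime_factors_mult_coprime[OF cop(2) pos] by (simp add: card_Un_disjoint)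
      finally have two: "(2::real) ^ card (prime_factors (2 * (a * b))) = 2 * (2 ^ card (prime_factors a) * 2 ^ card (prime_factors b))"
        by (simp add: power_add)
      have "M = 2 * (2 ^ card (prime_factors a) * 2 ^ card (prime_factors b)) *
          (sigma_infty a b * T / real v powr (3 / 2) * (4 / pi\<^sup>2 * gamma_fn (a * b * v)))"
        unfolding M_def two coprime_density_gamma[OF sqf oddn] area_const_sigma[OF pos] sqrt_cube[OF v0] using ab0 pos by simp
      then have "real n * M = 4 * (2 * sigma_infty a b / pi\<^sup>2 * (gamma_fn (a * b * v) * (2 ^ card (prime_factors a) * 2 ^ card (prime_factors b) * real n) / real v powr (3 / 2)) * T)"
        by (simp add: mult_ac)
      also have "2 ^ card (prime_factors a) * 2 ^ card (prime_factors b) * real n = real_of_int (rho a b v)" unfolding rho' by simp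
      finally show ?thesis unfolding leading_term_def mu by simp
    qed
    have abs4: "\<bar>p / 2 - X\<bar> = \<bar>2 * p - 4 * X\<bar> / 4" for p X :: real
    proof -
      have "2 * p - 4 * X = 4 * (p / 2 - X)" by simp
      then show ?thesis by (simp only: abs_mult abs_numeral nonzero_mult_div_cancel_left zero_neq_numeral not_False_eq_True)
    qed
    have "\<bar>real (card (fixed_v_points a b v T)) / 2 - 2 * sigma_infty a b / pi\<^sup>2 * leading_term a b v * T\<bar>
        = \<bar>2 * real (card (fixed_v_points a b v T)) - real n * M\<bar> / 4"
      unfolding eqM by (rule abs4)
    also have "\<dots> \<le> \<bar>2 * real (card (fixed_v_points a b v T)) - real n * M\<bar>" by simp
    also note main
    finally show ?thesis .
  qed
qed

section \<open>Shape of the squareful values\<close>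

lemma odd_square_mod_4:
  fixes x :: int
  shows "x\<^sup>2 mod 4 = (if even x then 0 else 1)"
proof (cases "even x")
  case True
  then show ?thesis by (auto elim!: evenE)
next
  case False
  then obtain j where "x = 2 * j + 1" by (auto elim!: oddE)
  then have "x\<^sup>2 = 4 * (j\<^sup>2 + j) + 1" by (simp add: power2_eq_square algebra_simps)
  then show ?thesis using False by presburger
qed

lemma odd_of_mod_4: "n mod 4 = 1 \<Longrightarrow> odd (n :: int)"
  by presburger

lemma even_of_mod_4: "n mod 4 = 2 \<Longrightarrow> even (n :: int)"
  by presburger

lemma cong_1_mod_4_int: "[n = 1] (mod 4) \<longleftrightarrow> int n mod 4 = 1"
proof -
  have "int n mod 4 = int (n mod 4)" by (simp add: zmod_int)
  then have "int n mod 4 = 1 \<longleftrightarrow> n mod 4 = 1" by linarith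
  moreover have "[n = 1] (mod 4) \<longleftrightarrow> n mod 4 = 1" by (simp add: cong_def)
  ultimately show ?thesis by blast
qed

text \<open>Two odd coordinates would give a value congruent to 2 modulo 4, which is not squareful.
  If a prime p of a divides the value, it divides y, so p^2 divides a x^2 and, a being squarefree, p
  divides x, against coprimality; likewise for b.\<close>

lemma squareful_value:
  fixes a b :: nat and x y :: int
  assumes pos: "a > 0" "b > 0" and sq: "squarefree (a * b)" and m4: "[a = 1] (mod 4)" "[b = 1] (mod 4)"
    and cop: "coprime x y" and sf: "squareful (int a * x\<^sup>2 + int b * y\<^sup>2)"
  shows "coprime (int a * x\<^sup>2 + int b * y\<^sup>2) (2 * (int a * int b))" "(int a * x\<^sup>2 + int b * y\<^sup>2) mod 4 = 1"
    "int a * x\<^sup>2 + int b * y\<^sup>2 > 0"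
proof -
  let ?n = "int a * x\<^sup>2 + int b * y\<^sup>2"
  have n0: "?n \<noteq> 0" using sf by (simp add: squareful_def)
  show npos: "?n > 0"
  proof -
    have "?n \<ge> 0" by simp
    then show ?thesis using n0 by linarith
  qed
  have sqi: "squarefree (int a)" "squarefree (int b)" using sq squarefree_multD squarefree_int_iff by blast+
  have ci: "coprime (int a) (int b)" using squarefree_mult_imp_coprime[OF sq] by simp
  have am: "int a mod 4 = 1" "int b mod 4 = 1" using m4 by (simp_all only: cong_1_mod_4_int)
  have mod4: "?n mod 4 = ((if even x then 0 else 1) + (if even y then 0 else 1)) mod 4"
  proof -
    have "?n mod 4 = ((int a * x\<^sup>2) mod 4 + (int b * y\<^sup>2) mod 4) mod 4" by (rule mod_add_eq[symmetric])
    moreover have "(int a * x\<^sup>2) mod 4 = ((int a mod 4) * (x\<^sup>2 mod 4)) mod 4" "(int b * y\<^sup>2) mod 4 = ((int b mod 4) * (y\<^sup>2 mod 4)) mod 4"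
      by (rule mod_mult_eq[symmetric])+
    ultimately show ?thesis unfolding am odd_square_mod_4 by simp
  qed
  have "\<not> (even x \<and> even y)" using cop by (meson coprime_common_divisor odd_one)
  moreover have "\<not> (odd x \<and> odd y)"
  proof
    assume "odd x \<and> odd y"
    then have m2: "?n mod 4 = 2" using mod4 by simp
    then have "2 dvd ?n" by (rule even_of_mod_4)
    moreover have "prime (2 :: int)" by simp
    ultimately have "2\<^sup>2 dvd ?n" using sf unfolding squareful_def by blast
    then show False using m2 by simp
  qed
  ultimately show n4: "?n mod 4 = 1" using mod4 by auto
  have key: False if p: "prime p" "p dvd ?n" "p dvd c" "squarefree c" "coprime c d" "?n = c * X\<^sup>2 + d * Y\<^sup>2" "coprime X Y" for p c d X Y
  proof -
    have p2: "p\<^sup>2 dvd ?n" using sf p(1,2) by (simp add: squareful_def)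
    have "p dvd c * X\<^sup>2" using p(3) by simp
    then have "p dvd d * Y\<^sup>2" using p(2,6) by (metis dvd_add_right_iff)
    moreover have "\<not> p dvd d" using p coprime_common_divisor not_prime_unit by blast
    ultimately have pY: "p dvd Y" using p(1) by (simp add: prime_dvd_mult_iff prime_dvd_power_iff)
    then have "p\<^sup>2 dvd d * Y\<^sup>2" by (intro dvd_mult dvd_power_same)
    then have "p\<^sup>2 dvd c * X\<^sup>2" using p2 p(6) by (metis dvd_add_left_iff)
    then have "p dvd X" by (rule squarefree_dvd_square_imp[OF p(1,4)])
    then show False using pY p(1,7) coprime_common_divisor not_prime_unit by blast
  qed
  show "coprime ?n (2 * (int a * int b))"
  proof (rule ccontr)
    assume "\<not> coprime ?n (2 * (int a * int b))"
    then obtain p where p: "prime p" "p dvd ?n" "p dvd 2 * (int a * int b)"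
      using coprime_iff_no_common_prime[of ?n "2 * (int a * int b)"] n0 by blast
    then consider "p dvd 2" | "p dvd int a" | "p dvd int b" using prime_dvd_mult_iff by metis
    then show False
    proof cases
      case 1
      then have "p = 2" using primes_dvd_imp_eq[of p 2] p(1) by simp
      then show False using p(2) odd_of_mod_4[OF n4] by simp
    next
      case 2
      show False by (rule key[OF p(1,2) 2 sqi(1) ci refl cop])
    next
      case 3
      show False
      proof (rule key[OF p(1,2) 3 sqi(2)])
        show "coprime (int b) (int a)" "coprime y x" using ci cop by (simp_all only: coprime_commute)
        show "?n = int b * y\<^sup>2 + int a * x\<^sup>2" by simp
      qed
    qed
  qed
qed

text \<open>Write n = v s^2 with v squarefree. A prime of v has odd exponent in n, hence exponent at
  least 3 as n is squareful, so it also divides s; therefore s = v w.\<close>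

lemma squareful_decomposition:
  fixes n :: int
  assumes "squareful n" "n > 0"
  obtains v w :: nat where "squarefree v" "v > 0" "w > 0" "n = int v ^ 3 * (int w)\<^sup>2"
proof -
  define N where "N = nat n"
  define v where "v = squarefree_part N"
  define s where "s = square_part N"
  have N: "N = v * s\<^sup>2" unfolding v_def s_def by (rule squarefree_decompose)
  have v: "squarefree v" unfolding v_def by (rule squarefree_squarefree_part)
  have N0: "N > 0" using assms(2) by (simp add: N_def)
  have vs0: "v > 0" "s > 0" using N N0 by (auto intro!: gr0I)
  have "v dvd s"
  proof (rule multiplicity_le_imp_dvd)
    fix p :: nat assume p: "prime p"
    show "multiplicity p v \<le> multiplicity p s"
    proof (cases "p dvd v")
      case True
      have "int p dvd n" using True N assms(2) unfolding N_def by (metis dvd_mult2 int_dvd_int_iff int_nat_eq less_imp_le)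
      then have "(int p)\<^sup>2 dvd n" using assms(1) p by (simp add: squareful_def)
      then have p2: "p\<^sup>2 dvd N" using assms(2) unfolding N_def by (metis int_dvd_int_iff int_nat_eq less_imp_le of_nat_power)
      have "p dvd s"
      proof (rule ccontr)
        assume "\<not> p dvd s"
        then have "coprime (p\<^sup>2) (s\<^sup>2)" using p by (simp add: prime_imp_coprime)
        then have "p\<^sup>2 dvd v" using p2 N by (simp add: coprime_dvd_mult_left_iff)
        then have "is_unit p" using v squarefreeD by blast
        then show False using p not_prime_unit by blast
      qed
      then have "multiplicity p s \<ge> 1" using p vs0
        by (simp only: One_nat_def Suc_le_eq prime_multiplicity_gt_zero_iff[OF prime_imp_prime_elem[OF p]])
      moreover have "multiplicity p v \<le> 1" using v vs0 p by (simp add: squarefree_factorial_semiring'')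
      ultimately show ?thesis by simp
    qed (simp add: not_dvd_imp_multiplicity_0)
  qed (use vs0 in simp)
  then obtain w where w: "s = v * w" by blast
  have "w > 0" using vs0 w by (auto intro!: gr0I)
  moreover have "N = v ^ 3 * w\<^sup>2" unfolding N w by (simp add: power2_eq_square power3_eq_cube)
  then have "n = int v ^ 3 * (int w)\<^sup>2" using assms(2) unfolding N_def by (metis int_nat_eq less_imp_le of_nat_mult of_nat_power)
  ultimately show ?thesis using that v vs0 by blast
qed

text \<open>The primes of v are recovered as those with odd exponent in v^3 w^2.\<close>

lemma squareful_decomposition_unique:
  fixes v v' :: nat and w w' :: int
  assumes "squarefree v" "squarefree v'" "int v ^ 3 * w\<^sup>2 = int v' ^ 3 * w'\<^sup>2" "w \<noteq> 0" "w' \<noteq> 0"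
  shows "v = v'"
proof -
  have par: "prime p \<Longrightarrow> p dvd u \<longleftrightarrow> odd (multiplicity p (u ^ 3 * z\<^sup>2))" if "squarefree u" "z > 0" for p u z :: nat
  proof -
    assume p: "prime p"
    have u0: "u \<noteq> 0" using that(1) not_squarefree_0 by metis
    have "multiplicity p (u ^ 3 * z\<^sup>2) = 3 * multiplicity p u + 2 * multiplicity p z"
      using p u0 that(2) by (simp add: prime_elem_multiplicity_mult_distrib prime_elem_multiplicity_power_distrib)
    moreover have "multiplicity p u \<le> 1" using that(1) u0 p by (simp add: squarefree_factorial_semiring'')
    moreover have "multiplicity p u > 0 \<longleftrightarrow> p dvd u" by (rule prime_multiplicity_gt_zero_iff[OF prime_imp_prime_elem[OF p] u0])
    ultimately show "p dvd u \<longleftrightarrow> odd (multiplicity p (u ^ 3 * z\<^sup>2))" by (cases "multiplicity p u = 0") auto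
  qed
  have e: "v ^ 3 * (nat \<bar>w\<bar>)\<^sup>2 = v' ^ 3 * (nat \<bar>w'\<bar>)\<^sup>2"
  proof -
    have "int (v ^ 3 * (nat \<bar>w\<bar>)\<^sup>2) = int (v' ^ 3 * (nat \<bar>w'\<bar>)\<^sup>2)" using assms(3) by simp
    then show ?thesis by (simp only: of_nat_eq_iff)
  qed
  have iff: "p dvd v \<longleftrightarrow> p dvd v'" if "prime p" for p
    using par[OF assms(1), of "nat \<bar>w\<bar>" p] par[OF assms(2), of "nat \<bar>w'\<bar>" p] e assms(4,5) that by simp
  have d: "u dvd u'" if "squarefree u" "squarefree u'" "\<And>p. prime p \<Longrightarrow> p dvd u \<Longrightarrow> p dvd u'" for u u' :: nat
  proof (rule multiplicity_le_imp_dvd)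
    show "u \<noteq> 0" using that(1) not_squarefree_0 by metis
    fix p :: nat assume p: "prime p"
    show "multiplicity p u \<le> multiplicity p u'"
    proof (cases "p dvd u")
      case True
      have u0: "u' \<noteq> 0" "u \<noteq> 0" using that(1,2) not_squarefree_0 by metis+
      have "multiplicity p u \<le> 1" using that(1) u0 p by (simp add: squarefree_factorial_semiring'')
      moreover have "multiplicity p u' \<ge> 1" using that(3)[OF p True] u0
        by (simp only: One_nat_def Suc_le_eq prime_multiplicity_gt_zero_iff[OF prime_imp_prime_elem[OF p] u0(1)])
      ultimately show ?thesis by simp
    qed (simp add: not_dvd_imp_multiplicity_0)
  qed
  have "v dvd v'" by (rule d[OF assms(1,2)]) (use iff in blast)
  moreover have "v' dvd v" by (rule d[OF assms(2,1)]) (use iff in blast)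
  ultimately show ?thesis by (rule dvd_antisym)
qed

definition admissible :: "nat \<Rightarrow> nat \<Rightarrow> nat set" where
  "admissible a b = {v. v \<ge> 1 \<and> [v = 1] (mod 4) \<and> squarefree (a * b * v)}"

lemma fixed_v_points_squareful:
  assumes "a > 0" "b > 0" "v > 0" "(x, y) \<in> fixed_v_points a b v T"
  obtains w where "w \<noteq> 0" "int a * x\<^sup>2 + int b * y\<^sup>2 = int v ^ 3 * w\<^sup>2" "squareful (int a * x\<^sup>2 + int b * y\<^sup>2)"
proof -
  obtain w where w: "int a * x\<^sup>2 + int b * y\<^sup>2 = int v ^ 3 * w\<^sup>2" "coprime x y" using assms(4) by (auto simp: fixed_v_points_def)
  have w0: "w \<noteq> 0"
  proof
    assume "w = 0"
    then have "int a * x\<^sup>2 + int b * y\<^sup>2 = 0" using w by simp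
    moreover have "int a * x\<^sup>2 \<ge> 0" "int b * y\<^sup>2 \<ge> 0" by simp_all
    ultimately have "int a * x\<^sup>2 = 0" "int b * y\<^sup>2 = 0" by linarith+
    then show False using assms(1,2) w(2) by simp
  qed
  have "squareful (int v ^ 3 * w\<^sup>2)" unfolding squareful_def
  proof (intro conjI allI impI)
    show "int v ^ 3 * w\<^sup>2 \<noteq> 0" using w0 assms(3) by simp
    fix p :: int assume p: "prime p" "p dvd int v ^ 3 * w\<^sup>2"
    then have "p dvd int v \<or> p dvd w" using prime_dvd_mult_iff prime_dvd_power by blast
    then show "p\<^sup>2 dvd int v ^ 3 * w\<^sup>2"
    proof
      assume "p dvd int v"
      then have "p\<^sup>2 dvd (int v)\<^sup>2" by simp
      then have "p\<^sup>2 dvd (int v)\<^sup>2 * (int v * w\<^sup>2)" by (rule dvd_mult2)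
      then show ?thesis by (simp add: power2_eq_square power3_eq_cube mult_ac)
    next
      assume "p dvd w"
      then have "p\<^sup>2 dvd w\<^sup>2" by simp
      then show ?thesis by (rule dvd_mult)
    qed
  qed
  then show ?thesis using that w0 w(1) by simp
qed

lemma squareful_points_decomposition:
  assumes pos: "a > 0" "b > 0" and sq: "squarefree (a * b)" and m4: "[a = 1] (mod 4)" "[b = 1] (mod 4)"
  shows "squareful_points a b B = (\<Union>v\<in>admissible a b. fixed_v_points a b v B)"
proof (intro equalityI subsetI)
  fix p assume "p \<in> squareful_points a b B"
  then obtain x y where p: "p = (x, y)" "coprime x y" "\<bar>real_of_int x\<bar> \<le> B" "\<bar>real_of_int y\<bar> \<le> B"
    "squareful (int a * x\<^sup>2 + int b * y\<^sup>2)" by (auto simp: squareful_points_def coprime_iff_gcd_eq_1)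
  let ?n = "int a * x\<^sup>2 + int b * y\<^sup>2"
  note val = squareful_value[OF pos sq m4 p(2,5)]
  obtain v w :: nat where vw: "squarefree v" "v > 0" "w > 0" "?n = int v ^ 3 * (int w)\<^sup>2"
    using squareful_decomposition[OF p(5) val(3)] .
  have "odd ?n" using val(2) by (rule odd_of_mod_4)
  then have odd: "odd (int v)" "odd (int w)" unfolding vw(4) by simp_all
  have "int v mod 4 = 1"
  proof -
    \<comment> \<open>The value is v times the odd square (v w)^2, so v has the same residue modulo
      4 as the value.\<close>
    have "?n = (int v)\<^sup>2 * (int w)\<^sup>2 * int v" unfolding vw(4) by (simp add: power2_eq_square power3_eq_cube)
    then have "?n mod 4 = (((int v)\<^sup>2 * (int w)\<^sup>2) mod 4 * (int v mod 4)) mod 4" by (simp only: mod_mult_eq)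
    also have "((int v)\<^sup>2 * (int w)\<^sup>2) mod 4 = ((int v)\<^sup>2 mod 4 * ((int w)\<^sup>2 mod 4)) mod 4" by (rule mod_mult_eq[symmetric])
    finally show ?thesis using val(2) odd unfolding odd_square_mod_4 by simp
  qed
  then have "[v = 1] (mod 4)" by (simp only: cong_1_mod_4_int)
  moreover have "squarefree (a * b * v)"
  proof -
    have "int v dvd ?n" unfolding vw(4) by (simp add: power3_eq_cube)
    then have "coprime (int v) (2 * (int a * int b))" by (rule coprime_divisors[OF _ dvd_refl val(1)])
    then have "coprime (int v) (int (a * b))" by (simp add: coprime_mult_right_iff)
    then have "coprime (a * b) v" by (simp only: coprime_int_iff coprime_commute)
    then show ?thesis by (rule squarefree_mult_coprime[OF _ sq vw(1)])
  qed
  ultimately have "v \<in> admissible a b" using vw(2) by (simp add: admissible_def)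
  moreover have "p \<in> fixed_v_points a b v B" using p vw(4) by (auto simp: fixed_v_points_def)
  ultimately show "p \<in> (\<Union>v\<in>admissible a b. fixed_v_points a b v B)" by blast
next
  fix p assume "p \<in> (\<Union>v\<in>admissible a b. fixed_v_points a b v B)"
  then obtain v where v: "v \<in> admissible a b" "p \<in> fixed_v_points a b v B" by blast
  obtain x y where xy: "p = (x, y)" by (cases p)
  have p: "p = (x, y)" "v \<in> admissible a b" "(x, y) \<in> fixed_v_points a b v B" using v xy by auto
  have "v > 0" using p(2) by (simp add: admissible_def)
  then have "squareful (int a * x\<^sup>2 + int b * y\<^sup>2)"
    by (rule fixed_v_points_squareful[OF pos _ p(3)])
  then show "p \<in> squareful_points a b B"
    using p by (auto simp: squareful_points_def fixed_v_points_def coprime_iff_gcd_eq_1)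
qed

lemma fixed_v_points_bound:
  assumes pos: "a > 0" "b > 0" "v > 0" and p: "(x, y) \<in> fixed_v_points a b v B"
    and w: "int a * x\<^sup>2 + int b * y\<^sup>2 = int v ^ 3 * w\<^sup>2"
  shows "real v ^ 3 * (of_int w)\<^sup>2 \<le> (real a + real b) * B\<^sup>2"
proof -
  have xy: "\<bar>real_of_int x\<bar> \<le> B" "\<bar>real_of_int y\<bar> \<le> B" using p by (auto simp: fixed_v_points_def)
  have "(real_of_int x)\<^sup>2 \<le> B\<^sup>2" "(real_of_int y)\<^sup>2 \<le> B\<^sup>2"
    using power_mono[OF xy(1), of 2] power_mono[OF xy(2), of 2] by simp_all
  then have "real a * (real_of_int x)\<^sup>2 + real b * (real_of_int y)\<^sup>2 \<le> real a * B\<^sup>2 + real b * B\<^sup>2"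
    by (intro add_mono mult_left_mono) auto
  moreover have "real a * (real_of_int x)\<^sup>2 + real b * (real_of_int y)\<^sup>2 = real v ^ 3 * (of_int w)\<^sup>2"
    using arg_cong[OF w, of real_of_int] by simp
  ultimately show ?thesis by (simp add: algebra_simps)
qed

section \<open>Summation over the cubic part\<close>

text \<open>As v^3 w^2 <= (a + b) B^2, there are at most sqrt(a + b) B v^(-3/2) choices for w, and
  each resulting value has O(B^(2 e)) primitive representations. No lattice is involved, so the
  bound does not deteriorate for large v.\<close>

lemma card_fixed_v_points_le:
  fixes e :: real
  assumes pos: "a > 0" "b > 0" and sq: "squarefree (a * b)" and m4: "[a = 1] (mod 4)" "[b = 1] (mod 4)"
    and e: "e > 0"
  shows "\<exists>K\<ge>0. \<forall>v B. v \<ge> 1 \<longrightarrow> B \<ge> 1 \<longrightarrow>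
    real (card (fixed_v_points a b v B)) \<le> K * B powr (1 + 2 * e) * real v powr - (3 / 2)"
proof -
  have "\<exists>C\<ge>1. \<forall>n::nat. n > 0 \<longrightarrow> 2 ^ card (prime_factors n) \<le> C * real n powr e"
    by (rule two_pow_card_prime_factors_bound[OF e]) blast
  then obtain C where C: "C \<ge> 1" "\<And>n::nat. n > 0 \<Longrightarrow> 2 ^ card (prime_factors n) \<le> C * real n powr e"
    by blast
  define s where "s = real a + real b"
  have s0: "s > 0" using pos by (simp add: s_def)
  define K where "K = 9 * C * s powr e * sqrt s"
  show ?thesis
  proof (intro exI[of _ K] conjI allI impI)
    show "K \<ge> 0" using C(1) s0 by (simp add: K_def)
    fix v :: nat and B :: real
    assume v: "v \<ge> 1" and B: "B \<ge> 1"
    let ?S = "fixed_v_points a b v B"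
    define W where "W = nat \<lfloor>sqrt s * B * real v powr - (3 / 2)\<rfloor>"
    define R where "R w = {p \<in> ?S. int a * (fst p)\<^sup>2 + int b * (snd p)\<^sup>2 = int v ^ 3 * (int w)\<^sup>2}" for w
    let ?b = "9 * (C * (s * B\<^sup>2) powr e)"
    have v0: "v > 0" using v by simp
    have cover: "?S \<subseteq> (\<Union>w\<in>{1..W}. R w)"
    proof
      fix p assume p: "p \<in> ?S"
      obtain x y where xy: "p = (x, y)" by (cases p)
      have pS: "(x, y) \<in> ?S" using p xy by simp
      obtain w where w: "w \<noteq> 0" "int a * x\<^sup>2 + int b * y\<^sup>2 = int v ^ 3 * w\<^sup>2"
        using fixed_v_points_squareful[OF pos v0 pS] by metis
      define w' where "w' = nat \<bar>w\<bar>"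
      have ww: "(int w')\<^sup>2 = w\<^sup>2" by (simp add: w'_def)
      have "real v ^ 3 * (of_int w)\<^sup>2 \<le> s * B\<^sup>2"
        unfolding s_def by (rule fixed_v_points_bound[OF pos v0 pS w(2)])
      then have "(of_int w)\<^sup>2 \<le> s * B\<^sup>2 / real v ^ 3" using v0 by (simp add: field_simps)
      then have "sqrt ((of_int w)\<^sup>2) \<le> sqrt (s * B\<^sup>2 / real v ^ 3)" by (rule real_sqrt_le_mono)
      then have "\<bar>real_of_int w\<bar> \<le> sqrt s * B / real v powr (3 / 2)"
        using B by (simp add: real_sqrt_mult real_sqrt_divide sqrt_cube[OF v0])
      moreover have "real w' = \<bar>real_of_int w\<bar>" by (simp add: w'_def)
      ultimately have "real w' \<le> sqrt s * B * real v powr - (3 / 2)" by (simp only: powr_minus divide_inverse)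
      then have "w' \<le> W" by (simp add: W_def le_nat_iff le_floor_iff)
      moreover have "w' \<ge> 1" using w(1) by (simp add: w'_def)
      moreover have "p \<in> R w'" using p w(2) ww by (simp add: R_def xy)
      ultimately show "p \<in> (\<Union>w\<in>{1..W}. R w)" by auto
    qed
    have Rle: "real (card (R w)) \<le> ?b" for w
    proof (cases "R w = {}")
      case True
      then show ?thesis using C(1) s0 by simp
    next
      case False
      then obtain x y where xy: "(x, y) \<in> R w" by auto
      let ?n = "int v ^ 3 * (int w)\<^sup>2"
      have xyS: "(x, y) \<in> ?S" "int a * x\<^sup>2 + int b * y\<^sup>2 = ?n" using xy by (auto simp: R_def)
      have cxy: "coprime x y" using xyS(1) by (auto simp: fixed_v_points_def)
      have sf: "squareful (int a * x\<^sup>2 + int b * y\<^sup>2)" by (rule fixed_v_points_squareful[OF pos v0 xyS(1)])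
      have n: "coprime ?n (2 * (int a * int b))" "?n > 0"
        using squareful_value[OF pos sq m4 cxy sf] xyS(2) by simp_all
      have ab: "int a > 0" "int b > 0" using pos by simp_all
      note rep = card_representations_le[OF ab n(2,1)]
      have "card (R w) \<le> card {(x, y). coprime x y \<and> int a * x\<^sup>2 + int b * y\<^sup>2 = ?n}"
        by (intro card_mono rep(1)) (auto simp: R_def fixed_v_points_def)
      also have "\<dots> \<le> 9 * 2 ^ card (prime_factors (nat ?n))" by (rule rep(2))
      finally have "real (card (R w)) \<le> real (9 * 2 ^ card (prime_factors (nat ?n)))" by (simp only: of_nat_le_iff)
      also have "\<dots> = 9 * 2 ^ card (prime_factors (nat ?n))" by simp
      also have "\<dots> \<le> 9 * (C * real (nat ?n) powr e)" using n(2) by (intro mult_left_mono C(2)) auto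
      also have "\<dots> \<le> ?b"
      proof -
        have "real (nat ?n) = real v ^ 3 * (of_int (int w))\<^sup>2" using n(2) by simp
        also have "\<dots> \<le> s * B\<^sup>2" unfolding s_def by (rule fixed_v_points_bound[OF pos v0 xyS])
        finally have "real (nat ?n) powr e \<le> (s * B\<^sup>2) powr e" using e by (intro powr_mono2) auto
        then show ?thesis using C(1) by (intro mult_left_mono) auto
      qed
      finally show ?thesis .
    qed
    have fin: "finite (R w)" for w
      using finite_fixed_v_points[of a b v B] unfolding R_def by (rule finite_subset[rotated]) blast
    have "card ?S \<le> card (\<Union>w\<in>{1..W}. R w)" using fin by (intro card_mono cover) auto
    also have "\<dots> \<le> (\<Sum>w\<in>{1..W}. card (R w))" by (rule card_UN_le) simp
    finally have "real (card ?S) \<le> real (\<Sum>w\<in>{1..W}. card (R w))" by (simp only: of_nat_le_iff)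
    also have "\<dots> = (\<Sum>w\<in>{1..W}. real (card (R w)))" by simp
    also have "\<dots> \<le> (\<Sum>w\<in>{1..W}. ?b)" by (intro sum_mono Rle)
    also have "\<dots> = real W * ?b" by simp
    also have "\<dots> \<le> (sqrt s * B * real v powr - (3 / 2)) * ?b"
    proof (intro mult_right_mono)
      have "0 \<le> sqrt s * B * real v powr - (3 / 2)" using s0 B by simp
      then show "real W \<le> sqrt s * B * real v powr - (3 / 2)" unfolding W_def by linarith
      show "0 \<le> ?b" using C(1) by simp
    qed
    also have "(s * B\<^sup>2) powr e = s powr e * B powr (2 * e)"
    proof -
      have "B\<^sup>2 = B powr 2" using B by simp
      then have "(B\<^sup>2) powr e = B powr (2 * e)" by (simp only: powr_powr)
      then show ?thesis using s0 by (simp add: powr_mult)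
    qed
    also have "(sqrt s * B * real v powr - (3 / 2)) * (9 * (C * (s powr e * B powr (2 * e)))) =
        K * (B powr 1 * B powr (2 * e)) * real v powr - (3 / 2)"
      using B by (simp add: K_def mult_ac)
    also have "B powr 1 * B powr (2 * e) = B powr (1 + 2 * e)" by (rule powr_add[symmetric])
    finally show "real (card ?S) \<le> K * B powr (1 + 2 * e) * real v powr - (3 / 2)" .
  qed
qed

text \<open>For summability the cruder exponent -5/4 was enough; a tail of size about V^(-1/2) needs
  the exponent -3/2 up to an arbitrarily small e.\<close>

lemma abs_leading_term_le:
  fixes e :: real
  assumes e: "e > 0"
  shows "\<exists>K\<ge>0. \<forall>v. v \<ge> 1 \<longrightarrow> \<bar>leading_term a b v\<bar> \<le> K * real v powr (- (3 / 2) + e)"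
proof -
  have "\<exists>C\<ge>1. \<forall>n::nat. n > 0 \<longrightarrow> 2 ^ card (prime_factors n) \<le> C * real n powr e"
    by (rule two_pow_card_prime_factors_bound[OF e]) blast
  then obtain C where C: "C \<ge> 1" "\<And>n::nat. n > 0 \<Longrightarrow> 2 ^ card (prime_factors n) \<le> C * real n powr e"
    by blast
  define L where "L = (2::real) ^ card (odd_prime_factors a) * 2 ^ card (odd_prime_factors b)"
  show ?thesis
  proof (intro exI[of _ "L * C"] conjI allI impI)
    show "L * C \<ge> 0" using C(1) by (simp add: L_def)
    fix v :: nat assume v: "v \<ge> 1"
    have mu: "\<bar>real_of_int ((moebius (a * b * v))\<^sup>2)\<bar> \<le> 1" by (auto simp: moebius_def power_mult [symmetric])
    have "0 \<le> gamma_fn (a * b * v)" "gamma_fn (a * b * v) \<le> 1"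
      unfolding gamma_fn_def
      by (auto intro!: prod_nonneg prod_le_1 inverse_le_1_iff [THEN iffD2] simp: add_nonneg_nonneg)
    then have ga: "\<bar>gamma_fn (a * b * v)\<bar> \<le> 1" by simp
    have "\<bar>rho a b v\<bar> \<le> 2 ^ card (odd_prime_factors a) * 2 ^ card (odd_prime_factors b) * 2 ^ card (odd_prime_factors v)"
      unfolding rho_def abs_mult by (intro mult_mono abs_prod_Legendre_le) auto
    then have "real_of_int \<bar>rho a b v\<bar> \<le> real_of_int (2 ^ card (odd_prime_factors a) *
        2 ^ card (odd_prime_factors b) * 2 ^ card (odd_prime_factors v))"
      by (simp only: of_int_le_iff)
    also have "\<dots> = L * 2 ^ card (odd_prime_factors v)" by (simp add: L_def)
    also have "\<dots> \<le> L * (C * real v powr e)"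
    proof (intro mult_left_mono)
      have "card (odd_prime_factors v) \<le> card (prime_factors v)"
        by (intro card_mono) (auto simp: odd_prime_factors_def)
      then have "(2::real) ^ card (odd_prime_factors v) \<le> 2 ^ card (prime_factors v)" by (intro power_increasing) auto
      also have "\<dots> \<le> C * real v powr e" using v by (intro C(2)) auto
      finally show "(2::real) ^ card (odd_prime_factors v) \<le> C * real v powr e" .
    qed (simp add: L_def)
    finally have rho: "\<bar>real_of_int (rho a b v)\<bar> \<le> L * C * real v powr e" by (simp add: mult.assoc)
    have "\<bar>real_of_int ((moebius (a * b * v))\<^sup>2)\<bar> * \<bar>gamma_fn (a * b * v)\<bar> * \<bar>real_of_int (rho a b v)\<bar>
        \<le> 1 * 1 * (L * C * real v powr e)"
      by (intro mult_mono mu ga rho) auto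
    then have "\<bar>leading_term a b v\<bar> \<le> L * C * real v powr e / real v powr (3 / 2)"
      unfolding leading_term_def abs_divide abs_mult by (simp add: divide_right_mono)
    also have "\<dots> = L * C * real v powr (- (3 / 2) + e)"
      by (simp only: powr_add powr_minus divide_inverse mult_ac)
    finally show "\<bar>leading_term a b v\<bar> \<le> L * C * real v powr (- (3 / 2) + e)" .
  qed
qed

text \<open>The exponent is split as (-1/2 + 2 e) + (-1 - e). The first power does not increase, as
  e <= 1/4, and is bounded by its value at V; the second is summable over all v.\<close>

lemma powr_tail_sum_le:
  fixes e V :: real
  assumes e: "0 < e" "e \<le> 1 / 4" and V: "V \<ge> 1" and F: "finite F" "\<And>v. v \<in> F \<Longrightarrow> real v > V"
  shows "(\<Sum>v\<in>F. real v powr (- (3 / 2) + e)) \<le> V powr (- (1 / 2) + 2 * e) * (\<Sum>v. real v powr - (1 + e))"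
proof -
  have summ: "summable (\<lambda>v. real v powr - (1 + e))" using e by (simp add: summable_real_powr_iff)
  have "(\<Sum>v\<in>F. real v powr (- (3 / 2) + e)) \<le> (\<Sum>v\<in>F. V powr (- (1 / 2) + 2 * e) * real v powr - (1 + e))"
  proof (rule sum_mono)
    fix v assume v: "v \<in> F"
    have "real v powr (- (3 / 2) + e) = real v powr (- (1 / 2) + 2 * e) * real v powr - (1 + e)"
      by (simp add: powr_add[symmetric])
    also have "\<dots> \<le> V powr (- (1 / 2) + 2 * e) * real v powr - (1 + e)"
      using F(2)[OF v] V e by (intro mult_right_mono powr_mono2') auto
    finally show "real v powr (- (3 / 2) + e) \<le> V powr (- (1 / 2) + 2 * e) * real v powr - (1 + e)" .
  qed
  also have "\<dots> = V powr (- (1 / 2) + 2 * e) * (\<Sum>v\<in>F. real v powr - (1 + e))" by (rule sum_distrib_left[symmetric])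
  also have "\<dots> \<le> V powr (- (1 / 2) + 2 * e) * (\<Sum>v. real v powr - (1 + e))"
    using summ F(1) by (intro mult_left_mono sum_le_suminf) auto
  finally show ?thesis .
qed

lemma sigma_infty_nonneg: "a > 0 \<Longrightarrow> b > 0 \<Longrightarrow> sigma_infty a b \<ge> 0"
proof -
  assume ab: "a > 0" "b > 0"
  then have ar: "arsinh (sqrt (real a / real b)) > 0" "arsinh (sqrt (real b / real a)) > 0" by simp_all
  show ?thesis unfolding sigma_infty_def
    by (intro mult_nonneg_nonneg add_nonneg_nonneg divide_nonneg_nonneg less_imp_le[OF ar(1)] less_imp_le[OF ar(2)]) auto
qed

theorem theorem1p4:
  fixes a b :: nat and \<epsilon> :: real
  assumes "a > 0" and "b > 0"
    and "(moebius (a * b))\<^sup>2 = 1"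
    and "[a = 1] (mod 4)" and "[b = 1] (mod 4)"
    and "\<epsilon> > 0"
  shows "\<exists>C. \<forall>B\<ge>1. \<bar>squareful_count a b B - leading_constant a b * B\<bar>
                   \<le> C * B powr (85 / 86 + \<epsilon>)"
proof -
  have pos: "a > 0" "b > 0" and m4: "[a = 1] (mod 4)" "[b = 1] (mod 4)" using assms by auto
  have sq: "squarefree (a * b)"
  proof (rule ccontr)
    assume "\<not> squarefree (a * b)"
    then have "moebius (a * b) = 0" by (simp add: moebius_def)
    then show False using assms(3) by simp
  qed
  \<comment> \<open>The large v lose 2 e in the exponent from the representation bound and 2 e / 43
    from the tail sum, together at most 3 e <= \<open>\<epsilon>\<close>. The minimum also keeps e
    within the range of \<open>powr_tail_sum_le\<close>.\<close>
  define e where "e = min \<epsilon> (1 / 3) / 3"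
  have e: "e > 0" "e \<le> 1 / 9" "3 * e \<le> \<epsilon>" using assms(6) by (auto simp: e_def)
  obtain K1 where K1: "K1 \<ge> 0" "\<And>v B. v \<ge> 1 \<Longrightarrow> B \<ge> 1 \<Longrightarrow> real (card (fixed_v_points a b v B)) \<le> K1 * B powr (1 + 2 * e) * real v powr - (3 / 2)"
    using card_fixed_v_points_le[OF pos sq m4 e(1)] by blast
  obtain K2 where K2: "K2 \<ge> 0" "\<And>v. v \<ge> 1 \<Longrightarrow> \<bar>leading_term a b v\<bar> \<le> K2 * real v powr (- (3 / 2) + e)"
    using abs_leading_term_le[OF e(1)] by blast
  define Z where "Z = (\<Sum>v. real v powr - (1 + e))"
  have Z0: "Z \<ge> 0"
    unfolding Z_def using e by (intro suminf_nonneg) (auto simp: summable_real_powr_iff)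
  define ce where "ce = count_error (int a) (int b)"
  have ce0: "ce \<ge> 0" unfolding ce_def using pos by (intro count_error_nonneg) auto
  define c0 where "c0 = 2 * sigma_infty a b / pi\<^sup>2"
  have c00: "c0 \<ge> 0" unfolding c0_def using sigma_infty_nonneg[OF pos] by simp
  define A where "A = {v::nat. v \<ge> 1 \<and> [v = 1] (mod 4)}"
  have lc: "leading_constant a b = c0 * (\<Sum>\<^sub>\<infinity>v\<in>A. leading_term a b v)" by (simp add: leading_constant_def c0_def A_def)
  have bound: "\<bar>squareful_count a b B - leading_constant a b * B\<bar> \<le> (ce + K1 * Z + c0 * K2 * Z) * B powr (85 / 86 + \<epsilon>)"
    if B: "B \<ge> 1" for B
  proof -
    define V where "V = B powr (1 / 43)"
    have V1: "V \<ge> 1" unfolding V_def using B by (intro ge_one_powr_ge_zero) auto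
    \<comment> \<open>From v <= v^3 w^2 <= N, no point has v above \<open>N\<close>; this makes the
      set \<open>G\<close> of relevant large v finite.\<close>
    define N where "N = (real a + real b) * B\<^sup>2"
    define F where "F = {v \<in> admissible a b. real v \<le> V}"
    define G where "G = {v \<in> admissible a b. V < real v \<and> real v \<le> N}"
    have finF: "finite F" by (rule finite_subset[of _ "{..nat \<lfloor>V\<rfloor>}"]) (auto simp: F_def le_nat_iff le_floor_iff)
    have finG: "finite G" by (rule finite_subset[of _ "{..nat \<lfloor>N\<rfloor>}"]) (auto simp: G_def le_nat_iff le_floor_iff)
    have FG: "F \<inter> G = {}" by (auto simp: F_def G_def)
    have vpos: "v \<ge> 1" "v > 0" if "v \<in> admissible a b" for v using that by (auto simp: admissible_def)
    have empty: "v \<in> F \<union> G" if v: "v \<in> admissible a b" "(x, y) \<in> fixed_v_points a b v B" for v x y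
    proof -
      obtain w where w: "w \<noteq> 0" "int a * x\<^sup>2 + int b * y\<^sup>2 = int v ^ 3 * w\<^sup>2"
        using fixed_v_points_squareful[OF pos vpos(2)[OF v(1)] v(2)] by metis
      have "real v ^ 3 * (of_int w)\<^sup>2 \<le> N"
        unfolding N_def by (rule fixed_v_points_bound[OF pos vpos(2)[OF v(1)] v(2) w(2)])
      moreover have "real v * 1 \<le> real v ^ 3 * (of_int w)\<^sup>2"
      proof (rule mult_mono)
        show "real v \<le> real v ^ 3" using vpos(1)[OF v(1)] by (intro self_le_power) auto
        have "1 \<le> w\<^sup>2" using w(1) by (simp add: int_one_le_iff_zero_less)
        then have "real_of_int 1 \<le> of_int (w\<^sup>2)" by (simp only: of_int_le_iff)
        then show "1 \<le> (real_of_int w)\<^sup>2" by simp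
      qed auto
      ultimately have "real v \<le> N" by linarith
      then show ?thesis using v(1) by (auto simp: F_def G_def)
    qed
    have "squareful_points a b B = (\<Union>v\<in>F \<union> G. fixed_v_points a b v B)"
    proof -
      have "(\<Union>v\<in>admissible a b. fixed_v_points a b v B) = (\<Union>v\<in>F \<union> G. fixed_v_points a b v B)"
      proof (intro equalityI subsetI)
        fix p assume "p \<in> (\<Union>v\<in>admissible a b. fixed_v_points a b v B)"
        then obtain v where v: "v \<in> admissible a b" "p \<in> fixed_v_points a b v B" by blast
        obtain x y where "p = (x, y)" by (cases p)
        then have "v \<in> F \<union> G" using empty[of v x y] v by simp
        then show "p \<in> (\<Union>v\<in>F \<union> G. fixed_v_points a b v B)" using v by blast
      next
        fix p assume "p \<in> (\<Union>v\<in>F \<union> G. fixed_v_points a b v B)"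
        then show "p \<in> (\<Union>v\<in>admissible a b. fixed_v_points a b v B)" by (auto simp: F_def G_def)
      qed
      then show ?thesis using squareful_points_decomposition[OF pos sq m4] by simp
    qed
    then have "card (squareful_points a b B) = card (\<Union>v\<in>F \<union> G. fixed_v_points a b v B)" by simp
    also have "\<dots> = (\<Sum>v\<in>F \<union> G. card (fixed_v_points a b v B))"
    proof (rule card_UN_disjoint)
      show "finite (F \<union> G)" using finF finG by simp
      show "\<forall>v\<in>F \<union> G. finite (fixed_v_points a b v B)" using finite_fixed_v_points by blast
      show "\<forall>v\<in>F \<union> G. \<forall>v'\<in>F \<union> G. v \<noteq> v' \<longrightarrow> fixed_v_points a b v B \<inter> fixed_v_points a b v' B = {}"
      proof (intro ballI impI)
        fix v v' assume v: "v \<in> F \<union> G" "v' \<in> F \<union> G" "v \<noteq> v'"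
        then have adm: "v \<in> admissible a b" "v' \<in> admissible a b" by (auto simp: F_def G_def)
        then have sqf: "squarefree v" "squarefree v'" unfolding admissible_def using squarefree_multD(2) by blast+
        show "fixed_v_points a b v B \<inter> fixed_v_points a b v' B = {}"
        proof (rule ccontr)
          assume "fixed_v_points a b v B \<inter> fixed_v_points a b v' B \<noteq> {}"
          then obtain p where "p \<in> fixed_v_points a b v B" "p \<in> fixed_v_points a b v' B" by blast
          then obtain x y where xy: "(x, y) \<in> fixed_v_points a b v B" "(x, y) \<in> fixed_v_points a b v' B" by (cases p) auto
          obtain w where w: "w \<noteq> 0" "int a * x\<^sup>2 + int b * y\<^sup>2 = int v ^ 3 * w\<^sup>2"
            using fixed_v_points_squareful[OF pos vpos(2)[OF adm(1)] xy(1)] by metis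
          obtain w' where w': "w' \<noteq> 0" "int a * x\<^sup>2 + int b * y\<^sup>2 = int v' ^ 3 * w'\<^sup>2"
            using fixed_v_points_squareful[OF pos vpos(2)[OF adm(2)] xy(2)] by metis
          have "int v ^ 3 * w\<^sup>2 = int v' ^ 3 * w'\<^sup>2" using w(2) w'(2) by simp
          then show False using squareful_decomposition_unique[OF sqf _ w(1) w'(1)] v(3) by blast
        qed
      qed
    qed
    also have "\<dots> = (\<Sum>v\<in>F. card (fixed_v_points a b v B)) + (\<Sum>v\<in>G. card (fixed_v_points a b v B))"
      by (rule sum.union_disjoint[OF finF finG FG])
    finally have count: "squareful_count a b B =
        (\<Sum>v\<in>F. real (card (fixed_v_points a b v B)) / 2) + (\<Sum>v\<in>G. real (card (fixed_v_points a b v B))) / 2"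
      unfolding squareful_count_def by (simp add: add_divide_distrib sum_divide_distrib)
    have X1: "\<bar>(\<Sum>v\<in>F. real (card (fixed_v_points a b v B)) / 2) - c0 * (\<Sum>v\<in>F. leading_term a b v) * B\<bar>
        \<le> ce * B powr (85 / 86)"
    proof -
      have each: "\<bar>real (card (fixed_v_points a b v B)) / 2 - c0 * leading_term a b v * B\<bar> \<le> ce * (V ^ 18 * B powr (17 / 32))"
        if v: "v \<in> F" for v
      proof -
        have "\<bar>real (card (fixed_v_points a b v B)) / 2 - c0 * leading_term a b v * B\<bar> \<le> ce * (real v ^ 18 * B powr (17 / 32))"
          unfolding c0_def ce_def using v
          by (intro fixed_v_asymptotic[OF pos _ m4 _ B]) (auto simp: F_def admissible_def)
        also have "\<dots> \<le> ce * (V ^ 18 * B powr (17 / 32))"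
          using v ce0 by (intro mult_left_mono mult_right_mono power_mono) (auto simp: F_def)
        finally show ?thesis .
      qed
      have "(\<Sum>v\<in>F. real (card (fixed_v_points a b v B)) / 2) - c0 * (\<Sum>v\<in>F. leading_term a b v) * B =
          (\<Sum>v\<in>F. real (card (fixed_v_points a b v B)) / 2 - c0 * leading_term a b v * B)"
        by (simp add: sum_subtractf sum_distrib_left sum_distrib_right)
      then have "\<bar>(\<Sum>v\<in>F. real (card (fixed_v_points a b v B)) / 2) - c0 * (\<Sum>v\<in>F. leading_term a b v) * B\<bar>
          \<le> (\<Sum>v\<in>F. ce * (V ^ 18 * B powr (17 / 32)))"
        using order_trans[OF sum_abs sum_mono[OF each]] by simp
      also have "\<dots> = real (card F) * (ce * (V ^ 18 * B powr (17 / 32)))" by simp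
      also have "\<dots> \<le> V * (ce * (V ^ 18 * B powr (17 / 32)))"
      proof (intro mult_right_mono)
        have "F \<subseteq> {1..nat \<lfloor>V\<rfloor>}" using vpos by (auto simp: F_def le_nat_iff le_floor_iff)
        then have "card F \<le> card {1..nat \<lfloor>V\<rfloor>}" by (intro card_mono) auto
        then show "real (card F) \<le> V" using V1 by (simp add: le_nat_iff le_floor_iff)
        show "0 \<le> ce * (V ^ 18 * B powr (17 / 32))" using ce0 V1 by simp
      qed
      also have "\<dots> = ce * (V powr 19 * B powr (17 / 32))"
      proof -
        have "V powr 19 = V * V ^ 18" using V1 by (simp add: powr_numeral flip: power_Suc)
        then show ?thesis by simp
      qed
      \<comment> \<open>19/43 + 17/32 = 1339/1376, which lies below 85/86 = 1360/1376.\<close>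
      also have "V powr 19 * B powr (17 / 32) = B powr (1339 / 1376)"
        unfolding V_def powr_powr powr_add[symmetric] by simp
      also have "ce * B powr (1339 / 1376) \<le> ce * B powr (85 / 86)"
        using B ce0 by (intro mult_left_mono powr_mono) auto
      finally show ?thesis .
    qed
    have Vexp: "V powr (- (1 / 2) + 2 * e) = B powr (- (1 / 86) + 2 * e / 43)"
      unfolding V_def powr_powr by (simp add: field_simps)
    have e4: "e \<le> 1 / 4" using e(2) by simp
    have X2: "0 \<le> (\<Sum>v\<in>G. real (card (fixed_v_points a b v B)))" "(\<Sum>v\<in>G. real (card (fixed_v_points a b v B))) \<le> K1 * Z * B powr (85 / 86 + \<epsilon>)"
    proof -
      show "0 \<le> (\<Sum>v\<in>G. real (card (fixed_v_points a b v B)))" by (intro sum_nonneg) auto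
      have "(\<Sum>v\<in>G. real (card (fixed_v_points a b v B))) \<le> (\<Sum>v\<in>G. K1 * B powr (1 + 2 * e) * real v powr (- (3 / 2) + e))"
      proof (rule sum_mono)
        fix v assume "v \<in> G"
        then have v: "v \<ge> 1" using vpos by (auto simp: G_def)
        have "real (card (fixed_v_points a b v B)) \<le> K1 * B powr (1 + 2 * e) * real v powr - (3 / 2)" by (rule K1(2)[OF v B])
        also have "\<dots> \<le> K1 * B powr (1 + 2 * e) * real v powr (- (3 / 2) + e)"
          using v e K1(1) by (intro mult_left_mono powr_mono) auto
        finally show "real (card (fixed_v_points a b v B)) \<le> K1 * B powr (1 + 2 * e) * real v powr (- (3 / 2) + e)" .
      qed
      also have "\<dots> = K1 * B powr (1 + 2 * e) * (\<Sum>v\<in>G. real v powr (- (3 / 2) + e))" by (rule sum_distrib_left[symmetric])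
      also have "\<dots> \<le> K1 * B powr (1 + 2 * e) * (V powr (- (1 / 2) + 2 * e) * Z)"
        unfolding Z_def using K1(1) by (intro mult_left_mono powr_tail_sum_le[OF e(1) e4 V1 finG]) (auto simp: G_def)
      also have "\<dots> = K1 * Z * B powr ((1 + 2 * e) + (- (1 / 86) + 2 * e / 43))"
        unfolding Vexp by (subst powr_add) (simp add: mult_ac)
      also have "\<dots> \<le> K1 * Z * B powr (85 / 86 + \<epsilon>)"
        using B e K1(1) Z0 by (intro mult_left_mono powr_mono) auto
      finally show "(\<Sum>v\<in>G. real (card (fixed_v_points a b v B))) \<le> K1 * Z * B powr (85 / 86 + \<epsilon>)" .
    qed
    have X3: "\<bar>(\<Sum>\<^sub>\<infinity>v\<in>A. leading_term a b v) - (\<Sum>v\<in>F. leading_term a b v)\<bar> \<le> K2 * (V powr (- (1 / 2) + 2 * e) * Z)"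
    proof -
      define H where "H = {v \<in> A. real v > V}"
      define F' where "F' = {v \<in> A. real v \<le> V}"
      have finF': "finite F'" by (rule finite_subset[of _ "{..nat \<lfloor>V\<rfloor>}"]) (auto simp: F'_def le_nat_iff le_floor_iff)
      have summ: "leading_term a b summable_on A" unfolding A_def by (rule leading_term_summable)
      have AH: "A = F' \<union> H" "F' \<inter> H = {}" by (auto simp: F'_def H_def)
      have sH: "leading_term a b summable_on H" using summable_on_subset_banach[OF summ] AH by blast
      have "(\<Sum>\<^sub>\<infinity>v\<in>A. leading_term a b v) = (\<Sum>v\<in>F'. leading_term a b v) + (\<Sum>\<^sub>\<infinity>v\<in>H. leading_term a b v)"
        unfolding AH(1) using finF' sH AH(2) by (subst infsum_Un_disjoint) auto
      \<comment> \<open>The elements of \<open>F'\<close> outside \<open>F\<close> are not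
        admissible, so the Moebius factor makes their terms 0.\<close>
      also have "(\<Sum>v\<in>F'. leading_term a b v) = (\<Sum>v\<in>F. leading_term a b v)"
        by (rule sum.mono_neutral_right[OF finF']) (auto simp: F_def F'_def A_def admissible_def leading_term_def moebius_def)
      finally have eq: "(\<Sum>\<^sub>\<infinity>v\<in>A. leading_term a b v) - (\<Sum>v\<in>F. leading_term a b v) = (\<Sum>\<^sub>\<infinity>v\<in>H. leading_term a b v)" by simp
      have nH: "(\<lambda>v. norm (leading_term a b v)) summable_on H"
        using sH unfolding summable_on_iff_abs_summable_on_real[of "leading_term a b" H] .
      have "norm (\<Sum>\<^sub>\<infinity>v\<in>H. leading_term a b v) \<le> (\<Sum>\<^sub>\<infinity>v\<in>H. norm (leading_term a b v))"
        by (rule norm_infsum_bound[OF nH])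
      also have "\<dots> \<le> K2 * (V powr (- (1 / 2) + 2 * e) * Z)"
      proof (rule infsum_le_finite_sums[OF nH])
        fix S assume S: "finite S" "S \<subseteq> H"
        have "(\<Sum>v\<in>S. norm (leading_term a b v)) \<le> (\<Sum>v\<in>S. K2 * real v powr (- (3 / 2) + e))"
          using S K2(2) by (intro sum_mono) (auto simp: H_def A_def)
        also have "\<dots> = K2 * (\<Sum>v\<in>S. real v powr (- (3 / 2) + e))" by (rule sum_distrib_left[symmetric])
        also have "\<dots> \<le> K2 * (V powr (- (1 / 2) + 2 * e) * Z)"
          unfolding Z_def using K2(1) S by (intro mult_left_mono powr_tail_sum_le[OF e(1) e4 V1 S(1)]) (auto simp: H_def)
        finally show "(\<Sum>v\<in>S. norm (leading_term a b v)) \<le> K2 * (V powr (- (1 / 2) + 2 * e) * Z)" .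
      qed
      finally show ?thesis unfolding eq by simp
    qed
    have X4: "\<bar>c0 * (\<Sum>v\<in>F. leading_term a b v) * B - leading_constant a b * B\<bar> \<le> c0 * K2 * Z * B powr (85 / 86 + \<epsilon>)"
    proof -
      have "c0 * (\<Sum>v\<in>F. leading_term a b v) * B - leading_constant a b * B =
          - (c0 * B * ((\<Sum>\<^sub>\<infinity>v\<in>A. leading_term a b v) - (\<Sum>v\<in>F. leading_term a b v)))"
        unfolding lc by (simp add: algebra_simps)
      then have "\<bar>c0 * (\<Sum>v\<in>F. leading_term a b v) * B - leading_constant a b * B\<bar> =
          c0 * B * \<bar>(\<Sum>\<^sub>\<infinity>v\<in>A. leading_term a b v) - (\<Sum>v\<in>F. leading_term a b v)\<bar>"
        using c00 B by (simp only: abs_minus_cancel abs_mult)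
      also have "\<dots> \<le> c0 * B * (K2 * (V powr (- (1 / 2) + 2 * e) * Z))"
        using X3 c00 B by (intro mult_left_mono) auto
      also have "\<dots> = c0 * K2 * Z * B powr (1 + (- (1 / 86) + 2 * e / 43))"
        unfolding Vexp using B by (subst powr_add) (simp add: mult_ac)
      also have "\<dots> \<le> c0 * K2 * Z * B powr (85 / 86 + \<epsilon>)"
        using B e c00 K2(1) Z0 by (intro mult_left_mono powr_mono) auto
      finally show ?thesis .
    qed
    have X1': "ce * B powr (85 / 86) \<le> ce * B powr (85 / 86 + \<epsilon>)"
      using B ce0 assms(6) by (intro mult_left_mono powr_mono) auto
    have "\<bar>squareful_count a b B - leading_constant a b * B\<bar>
        \<le> ce * B powr (85 / 86 + \<epsilon>) + K1 * Z * B powr (85 / 86 + \<epsilon>) + c0 * K2 * Z * B powr (85 / 86 + \<epsilon>)"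
      using X1 X1' X2 X4 unfolding count by linarith
    then show ?thesis by (simp add: algebra_simps)
  qed
  then show ?thesis by blast
qed

end
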